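(* Let $G$ be a step $r$ graded nilpotent Lie group of dimension $n$, with Lie algebra $\mathfrak{g}=\mathfrak{g}_1\oplus\cdots\oplus\mathfrak{g}_r$, equipped with its left-invariant Carnot manifold structure. Let $(\xi_1,\ldots,\xi_n)$ be a graded basis of $\mathfrak{g}$ and let $X=(X_1,\ldots,X_n)$ be the $H$-frame of left-invariant vector fields on $G$ with $X_j(e)=\xi_j$. Then, in the canonical coordinates on $G$ given by the inverse of the global diffeomorphism $$\exp_X:\mathbb{R}^n\to G,\qquad \exp_X(x)=\exp(x_1X_1+\cdots+x_nX_n),$$ one has $$\varepsilon_a^X(x)=a^{-1}\cdot x=(-a)\cdot x\qquad\text{for all } a,x\in\mathbb{R}^n,$$ where $\cdot$ is the product law of $G^0$ and $\varepsilon_a^X$ is the $\varepsilon$-Carnot coordinate map at $a$ associated with these coordinates and the $H$-frame $X$.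
   Context: A step $r$ graded nilpotent Lie group $G$ (unit $e$) is a connected simply connected nilpotent real Lie group whose Lie algebra has a grading $\mathfrak{g}=\mathfrak{g}_1\oplus\cdots\oplus\mathfrak{g}_r$ with $[\mathfrak{g}_w,\mathfrak{g}_{w'}]\subset\mathfrak{g}_{w+w'}$ if $w+w'\le r$ and $[\mathfrak{g}_w,\mathfrak{g}_{w'}]=0$ otherwise. Its left-invariant Carnot structure is the filtration $H_1\subset\cdots\subset H_r=TG$, where $H_w$ is the left-translate of $\mathfrak{g}_1\oplus\cdots\oplus\mathfrak{g}_w$. Weights: $w_j=\min\{w: j\le\mathrm{rk}\,H_w\}$. A graded basis is a basis with $\xi_j\in\mathfrak{g}_{w_j}$; then $[\xi_i,\xi_j]=\sum_{w_k=w_i+w_j}L_{ij}^k\xi_k$ with constants $L_{ij}^k$. $\exp(X)$ is the time-one flow of $X$ starting at $e$. $G^0$ is $\mathbb{R}^n$ equipped with the Dynkin (Baker-Campbell-Hausdorff) product $x\cdot y=x+y+\frac12[x,y]+\frac1{12}([x,[x,y]]+[y,[y,x]])+\cdots$ (finite sum) for the bracket on $\mathbb{R}^n$ with $[\epsilon_i,\epsilon_j]=\sum_{w_k=w_i+w_j}L_{ij}^k\epsilon_k$ on the canonical basis; $a^{-1}=-a$ is the inverse in $G^0$. The map $\varepsilon_a^X$ in general. Let $M$ be an $n$-manifold with a filtration by subbundles $H_1\subset\cdots\subset H_r=TM$ such that $[H_w,H_{w'}]\subset H_{w+w'}$ for $w+w'\le r$ (a Carnot manifold), with weights $w_j=\min\{w: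 j\le\mathrm{rk}\,H_w\}$, and let $(X_1,\ldots,X_n)$ be an $H$-frame near $a$, i.e. a tangent frame with $X_j$ a section of $H_{w_j}$. For $\alpha\in\mathbb{N}_0^n$: $|\alpha|=\sum\alpha_j$, $\langle\alpha\rangle=\sum w_j\alpha_j$. For $I=(i_1,\ldots,i_k)$, $k\ge0$: $X_I=X_{i_1}\cdots X_{i_k}$, $\langle I\rangle=\sum_l w_{i_l}$. A smooth $f$ has order $N$ at $a$ if $X_If(a)=0$ whenever $\langle I\rangle<N$ and $X_If(a)\neq0$ for some $I$ with $\langle I\rangle=N$. Coordinates centered at $a$ are linearly adapted if $X_j(0)=\partial_j$ for all $j$, and privileged at $a$ if moreover each $x_j$ has order $w_j$ at $a$. With $\delta_t(x)=t\cdot x=(t^{w_1}x_1,\ldots,t^{w_n}x_n)$ and $\delta_t^*(\sum a_j(x)\partial_j)=\sum t^{-w_j}a_j(t\cdot x)\partial_j$, in privileged coordinates $t^{w_j}\delta_t^*X_j$ converges as $t\to0$ ($C^\infty$ on compact sets) to a polynomial vector field $X_j^{(a)}$ on $\mathbb{R}^n$ (model vector field). Given local coordinates near $a$, $T_a$ is the unique affine map such that $x\mapsto T_a(x)$ gives coordinates centered at $a$ and linearly adapted; $\hat\psi_a$ is the unique polynomial map with components $\hat\psi_a(y)_k=y_k+\sum_{\langle\alpha\rangle<w_k,|\alpha|\ge2}a_{k\alpha}y^\alpha$ converting these coordinates into privileged coordinates at $a$ (known to exist); $\psi_a=\hat\psi_a\circ T_a$; $X_j^{(a)}$ are the model vector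 fields in the coordinates given by $\psi_a$; $\exp_{X^{(a)}}(x)$ is the time-one flow of $\sum x_jX_j^{(a)}$ starting at $0$, a diffeomorphism of $\mathbb{R}^n$. Then $\varepsilon_a^X=\exp_{X^{(a)}}^{-1}\circ\psi_a:\mathbb{R}^n\to\mathbb{R}^n$. In the claim, points of $G$ are identified with points of $\mathbb{R}^n$ through the canonical coordinates. *)

theory Defs
  imports "HOL-Analysis.Analysis" "HOL-Library.Function_Algebras"
begin

text \<open>
  The library has neither smooth manifolds nor Lie groups.  Tangent vectors are modelled as
  derivations, i.e. as elements of the function space \<open>('g \<Rightarrow> real) \<Rightarrow> real\<close>; the pointwise
  vector space structure on functions gives access to \<^const>\<open>span\<close>, \<^const>\<open>dim\<close>,
  \<^const>\<open>independent\<close> and \<^const>\<open>representation\<close>.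
\<close>

instantiation "fun" :: (type, real_vector) real_vector
begin

definition "c *\<^sub>R f = (\<lambda>x. c *\<^sub>R f x)"

instance
  by standard (simp_all add: scaleR_fun_def fun_eq_iff scaleR_add_right scaleR_add_left)

end


section \<open>Smooth maps and manifolds\<close>

text \<open>Only meant for open \<open>S\<close>.\<close>

primrec Ck_on :: "nat \<Rightarrow> 'a::euclidean_space set \<Rightarrow> ('a \<Rightarrow> 'b::real_normed_vector) \<Rightarrow> bool" where
  "Ck_on 0 S f \<longleftrightarrow> continuous_on S f"
| "Ck_on (Suc k) S f \<longleftrightarrow> (\<forall>x\<in>S. f differentiable (at x)) \<and>
     (\<forall>b\<in>Basis. Ck_on k S (\<lambda>x. frechet_derivative f (at x) b))"

definition smooth_on :: "'a::euclidean_space set \<Rightarrow> ('a \<Rightarrow> 'b::real_normed_vector) \<Rightarrow> bool" where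
  "smooth_on S f \<longleftrightarrow> (\<forall>k. Ck_on k S f)"

text \<open>A chart is a pair \<open>(U, \<phi>)\<close>, where only the values of \<open>\<phi>\<close> on \<open>U\<close> matter.\<close>

type_synonym ('m, 'e) atlas = "('m set \<times> ('m \<Rightarrow> 'e)) set"

definition smooth_atlas :: "('m::topological_space, 'e::euclidean_space) atlas \<Rightarrow> bool" where
  "smooth_atlas A \<longleftrightarrow>
     (\<Union>(U, \<phi>)\<in>A. U) = UNIV \<and>
     (\<forall>(U, \<phi>)\<in>A. open U \<and> open (\<phi> ` U) \<and> homeomorphism U (\<phi> ` U) \<phi> (inv_into U \<phi>)) \<and>
     (\<forall>(U, \<phi>)\<in>A. \<forall>(V, \<psi>)\<in>A. smooth_on (\<phi> ` (U \<inter> V)) (\<psi> \<circ> inv_into U \<phi>))"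

definition euclid_atlas :: "('e::euclidean_space, 'e) atlas" where
  "euclid_atlas = {(UNIV, \<lambda>x. x)}"

definition prod_atlas :: "('m, 'e) atlas \<Rightarrow> ('n, 'f) atlas \<Rightarrow> ('m \<times> 'n, 'e \<times> 'f) atlas" where
  "prod_atlas A B = {(U \<times> V, \<lambda>(p, q). (\<phi> p, \<psi> q)) | U \<phi> V \<psi>. (U, \<phi>) \<in> A \<and> (V, \<psi>) \<in> B}"

definition smooth_map :: "('m::topological_space, 'e::euclidean_space) atlas \<Rightarrow>
    ('n::topological_space, 'f::euclidean_space) atlas \<Rightarrow> ('m \<Rightarrow> 'n) \<Rightarrow> bool" where
  "smooth_map A B F \<longleftrightarrow> continuous_on UNIV F \<and>
     (\<forall>(U, \<phi>)\<in>A. \<forall>(V, \<psi>)\<in>B. smooth_on (\<phi> ` (U \<inter> F -` V)) (\<psi> \<circ> F \<circ> inv_into U \<phi>))"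

definition diffeomorphism :: "('m::topological_space, 'e::euclidean_space) atlas \<Rightarrow>
    ('n::topological_space, 'f::euclidean_space) atlas \<Rightarrow> ('m \<Rightarrow> 'n) \<Rightarrow> bool" where
  "diffeomorphism A B F \<longleftrightarrow> bij F \<and> smooth_map A B F \<and> smooth_map B A (inv F)"

definition smooth_fun :: "('m::topological_space, 'e::euclidean_space) atlas \<Rightarrow> ('m \<Rightarrow> real) \<Rightarrow> bool" where
  "smooth_fun A f \<longleftrightarrow> smooth_map A euclid_atlas f"


section \<open>Tangent vectors and vector fields\<close>

type_synonym 'm tangent = "('m \<Rightarrow> real) \<Rightarrow> real"
type_synonym 'm vfield = "'m \<Rightarrow> 'm tangent"

text \<open>
  Derivations at \<open>p\<close> of the algebra of smooth functions.  The value on non-smooth functions is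
  normalised to \<open>0\<close>, so that a derivation is determined by its values on smooth functions.
\<close>

definition tangent_space :: "('m::topological_space, 'e::euclidean_space) atlas \<Rightarrow> 'm \<Rightarrow> 'm tangent set" where
  "tangent_space A p = {v.
     (\<forall>f. \<not> smooth_fun A f \<longrightarrow> v f = 0) \<and>
     (\<forall>f c. smooth_fun A f \<longrightarrow> v (\<lambda>q. c * f q) = c * v f) \<and>
     (\<forall>f g. smooth_fun A f \<longrightarrow> smooth_fun A g \<longrightarrow>
        v (\<lambda>q. f q + g q) = v f + v g \<and>
        v (\<lambda>q. f q * g q) = v f * g p + f p * v g)}"

definition smooth_vfield :: "('m::topological_space, 'e::euclidean_space) atlas \<Rightarrow> 'm vfield \<Rightarrow> bool" where
  "smooth_vfield A V \<longleftrightarrow> (\<forall>p. V p \<in> tangent_space A p) \<and>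
     (\<forall>f. smooth_fun A f \<longrightarrow> smooth_fun A (\<lambda>p. V p f))"

definition vfield_bracket :: "'m vfield \<Rightarrow> 'm vfield \<Rightarrow> 'm vfield" where
  "vfield_bracket V W p = (\<lambda>f. V p (\<lambda>q. W q f) - W p (\<lambda>q. V q f))"

definition integral_curve :: "('m::topological_space, 'e::euclidean_space) atlas \<Rightarrow> 'm vfield \<Rightarrow> (real \<Rightarrow> 'm) \<Rightarrow> bool" where
  "integral_curve A V \<gamma> \<longleftrightarrow> continuous_on {0..1} \<gamma> \<and>
     (\<forall>t\<in>{0..1}. \<forall>f. smooth_fun A f \<longrightarrow>
        ((\<lambda>s. f (\<gamma> s)) has_real_derivative V (\<gamma> t) f) (at t within {0..1}))"

definition flow_one :: "('m::topological_space, 'e::euclidean_space) atlas \<Rightarrow> 'm vfield \<Rightarrow> 'm \<Rightarrow> 'm" where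
  "flow_one A V p = (THE q. \<exists>\<gamma>. integral_curve A V \<gamma> \<and> \<gamma> 0 = p \<and> \<gamma> 1 = q)"


section \<open>Lie groups\<close>

locale lie_group = group mul e iv
  for mul :: "'g::{t2_space, second_countable_topology} \<Rightarrow> 'g \<Rightarrow> 'g"
    and e :: 'g and iv :: "'g \<Rightarrow> 'g" +
  fixes A :: "('g, 'e::euclidean_space) atlas"
  assumes atlas: "smooth_atlas A"
    and smooth_mul: "smooth_map (prod_atlas A A) A (\<lambda>(p, q). mul p q)"
    and smooth_iv: "smooth_map A A iv"

definition left_translate :: "('g \<Rightarrow> 'g \<Rightarrow> 'g) \<Rightarrow> 'g \<Rightarrow> 'g tangent \<Rightarrow> 'g tangent" where
  "left_translate mul p v = (\<lambda>f. v (\<lambda>q. f (mul p q)))"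

definition left_invariant :: "('g \<Rightarrow> 'g \<Rightarrow> 'g) \<Rightarrow> 'g vfield \<Rightarrow> bool" where
  "left_invariant mul V \<longleftrightarrow> (\<forall>p q. V (mul p q) = left_translate mul p (V q))"

text \<open>
  The Lie algebra is \<open>tangent_space A e\<close>; the bracket of \<open>\<xi>\<close> and \<open>\<eta>\<close> is the value at \<open>e\<close> of the
  bracket of the left-invariant vector fields \<open>p \<mapsto> left_translate mul p \<xi>\<close> and
  \<open>p \<mapsto> left_translate mul p \<eta>\<close>.
\<close>

definition lie_bracket :: "('g \<Rightarrow> 'g \<Rightarrow> 'g) \<Rightarrow> 'g \<Rightarrow> 'g tangent \<Rightarrow> 'g tangent \<Rightarrow> 'g tangent" where
  "lie_bracket mul e \<xi> \<eta> =
     vfield_bracket (\<lambda>p. left_translate mul p \<xi>) (\<lambda>p. left_translate mul p \<eta>) e"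

primrec lower_central :: "('g \<Rightarrow> 'g \<Rightarrow> 'g) \<Rightarrow> 'g::topological_space \<Rightarrow>
    ('g, 'e::euclidean_space) atlas \<Rightarrow> nat \<Rightarrow> 'g tangent set" where
  "lower_central mul e A 0 = tangent_space A e"
| "lower_central mul e A (Suc k) =
     span {lie_bracket mul e \<xi> \<eta> | \<xi> \<eta>. \<xi> \<in> tangent_space A e \<and> \<eta> \<in> lower_central mul e A k}"

definition lie_grading :: "('g \<Rightarrow> 'g \<Rightarrow> 'g) \<Rightarrow> 'g::topological_space \<Rightarrow>
    ('g, 'e::euclidean_space) atlas \<Rightarrow> (nat \<Rightarrow> 'g tangent set) \<Rightarrow> nat \<Rightarrow> bool" where
  "lie_grading mul e A gr r \<longleftrightarrow>
     (\<forall>w\<in>{1..r}. subspace (gr w) \<and> gr w \<subseteq> tangent_space A e) \<and>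
     (\<forall>v\<in>tangent_space A e. \<exists>c. (\<forall>w\<in>{1..r}. c w \<in> gr w) \<and> v = (\<Sum>w\<in>{1..r}. c w)) \<and>
     (\<forall>c. (\<forall>w\<in>{1..r}. c w \<in> gr w) \<and> (\<Sum>w\<in>{1..r}. c w) = 0 \<longrightarrow> (\<forall>w\<in>{1..r}. c w = 0)) \<and>
     (\<forall>w\<in>{1..r}. \<forall>w'\<in>{1..r}. \<forall>\<xi>\<in>gr w. \<forall>\<eta>\<in>gr w'.
        (if w + w' \<le> r then lie_bracket mul e \<xi> \<eta> \<in> gr (w + w') else lie_bracket mul e \<xi> \<eta> = 0))"

definition graded_nilpotent_lie_group :: "('g \<Rightarrow> 'g \<Rightarrow> 'g) \<Rightarrow>
    'g::{t2_space, second_countable_topology} \<Rightarrow> ('g \<Rightarrow> 'g) \<Rightarrow>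
    ('g, 'e::euclidean_space) atlas \<Rightarrow> (nat \<Rightarrow> 'g tangent set) \<Rightarrow> nat \<Rightarrow> bool" where
  "graded_nilpotent_lie_group mul e iv A gr r \<longleftrightarrow>
     lie_group mul e iv A \<and>
     connected (UNIV :: 'g set) \<and> simply_connected (UNIV :: 'g set) \<and>
     (\<exists>k. lower_central mul e A k = {0}) \<and>
     lie_grading mul e A gr r"

definition carnot_filtration :: "('g \<Rightarrow> 'g \<Rightarrow> 'g) \<Rightarrow> (nat \<Rightarrow> 'g tangent set) \<Rightarrow> nat \<Rightarrow> 'g \<Rightarrow> 'g tangent set" where
  "carnot_filtration mul gr w p = left_translate mul p ` span (\<Union>v\<in>{1..w}. gr v)"

text \<open>
  The index type \<open>'n\<close> carries a linear order, and \<open>card {..j}\<close> is the position of \<open>j\<close> in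
  \<open>1, \<dots>, n\<close>; the rank of \<open>H w\<close> is constant and read off at \<open>e\<close>.  The least such \<open>w\<close> is positive
  because \<open>H 0\<close> has rank \<open>0\<close>.
\<close>

definition carnot_weight :: "(nat \<Rightarrow> 'g \<Rightarrow> 'g tangent set) \<Rightarrow> 'g \<Rightarrow> 'n::{finite, linorder} \<Rightarrow> nat" where
  "carnot_weight H e j = (LEAST w. card {..j} \<le> dim (H w e))"

definition graded_basis :: "'g::topological_space \<Rightarrow> ('g, 'e::euclidean_space) atlas \<Rightarrow>
    (nat \<Rightarrow> 'g tangent set) \<Rightarrow> ('n::finite \<Rightarrow> nat) \<Rightarrow> ('n \<Rightarrow> 'g tangent) \<Rightarrow> bool" where
  "graded_basis e A gr w \<xi> \<longleftrightarrow>
     inj \<xi> \<and> independent (range \<xi>) \<and> span (range \<xi>) = tangent_space A e \<and> (\<forall>j. \<xi> j \<in> gr (w j))"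

definition struct_const :: "('g \<Rightarrow> 'g \<Rightarrow> 'g) \<Rightarrow> 'g \<Rightarrow> ('n \<Rightarrow> 'g tangent) \<Rightarrow> 'n \<Rightarrow> 'n \<Rightarrow> 'n \<Rightarrow> real" where
  "struct_const mul e \<xi> i j k = representation (range \<xi>) (lie_bracket mul e (\<xi> i) (\<xi> j)) (\<xi> k)"

definition exp_frame :: "('g::topological_space, 'e::euclidean_space) atlas \<Rightarrow> 'g \<Rightarrow>
    ('n::finite \<Rightarrow> 'g vfield) \<Rightarrow> real^'n \<Rightarrow> 'g" where
  "exp_frame A e X x = flow_one A (\<Sum>j\<in>UNIV. x $ j *\<^sub>R X j) e"

text \<open>The coefficients of a vector field in a global coordinate system \<open>\<kappa>\<close>.\<close>

definition in_coords :: "('m \<Rightarrow> real^'n) \<Rightarrow> 'm vfield \<Rightarrow> real^'n \<Rightarrow> real^'n" where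
  "in_coords \<kappa> V x = (\<chi> k. V (inv \<kappa> x) (\<lambda>p. \<kappa> p $ k))"


section \<open>The Dynkin product\<close>

definition graded_bracket :: "('n::finite \<Rightarrow> nat) \<Rightarrow> ('n \<Rightarrow> 'n \<Rightarrow> 'n \<Rightarrow> real) \<Rightarrow> real^'n \<Rightarrow> real^'n \<Rightarrow> real^'n" where
  "graded_bracket w L x y =
     (\<Sum>i\<in>UNIV. \<Sum>j\<in>UNIV. (x $ i * y $ j) *\<^sub>R (\<Sum>k | w k = w i + w j. L i j k *\<^sub>R axis k 1))"

fun nested_bracket :: "('v \<Rightarrow> 'v \<Rightarrow> 'v) \<Rightarrow> 'v::zero list \<Rightarrow> 'v" where
  "nested_bracket br [] = 0"
| "nested_bracket br [v] = v"
| "nested_bracket br (v # vs) = br v (nested_bracket br vs)"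

text \<open>
  Dynkin's formula: the product is the sum of
  \[ \frac{(-1)^{k-1}}{k} \cdot \frac{[x^{p_1} y^{q_1} \cdots x^{p_k} y^{q_k}]}
       {\sum_l (p_l + q_l) \cdot \prod_l p_l! \, q_l!} \]
  over all $k \geq 1$ and all $p_l, q_l \geq 0$ with $p_l + q_l > 0$, where the bracket of a word is
  nested to the right.  For a bracket of nilpotency step at most \<open>r\<close> the words of length greater
  than \<open>r\<close> do not contribute.
\<close>

definition dynkin_indices :: "nat \<Rightarrow> (nat \<times> nat) list set" where
  "dynkin_indices r = {ps. ps \<noteq> [] \<and> (\<forall>(p, q)\<in>set ps. p + q > 0) \<and> (\<Sum>(p, q)\<leftarrow>ps. p + q) \<le> r}"

definition dynkin_product :: "nat \<Rightarrow> ('v \<Rightarrow> 'v \<Rightarrow> 'v) \<Rightarrow> 'v::real_vector \<Rightarrow> 'v \<Rightarrow> 'v" where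
  "dynkin_product r br x y = (\<Sum>ps\<in>dynkin_indices r.
     ((-1) ^ (length ps - 1) /
       (real (length ps) * real (\<Sum>(p, q)\<leftarrow>ps. p + q) * (\<Prod>(p, q)\<leftarrow>ps. fact p * fact q)))
     *\<^sub>R nested_bracket br (concat (map (\<lambda>(p, q). replicate p x @ replicate q y) ps)))"

lemma finite_dynkin_indices: "finite (dynkin_indices r)"
proof -
  have "length ps \<le> (\<Sum>(p, q)\<leftarrow>ps. p + q)" if "\<forall>(p, q)\<in>set ps. p + q > 0" for ps :: "(nat \<times> nat) list"
    using that by (induction ps) auto
  moreover have "set ps \<subseteq> {..r} \<times> {..r}" if "(\<Sum>(p, q)\<leftarrow>ps. p + q) \<le> r" for ps :: "(nat \<times> nat) list"
    using that by (induction ps) auto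
  ultimately have "dynkin_indices r \<subseteq> {ps. set ps \<subseteq> {..r} \<times> {..r} \<and> length ps \<le> r}"
    unfolding dynkin_indices_def by force
  then show ?thesis
    by (rule finite_subset) (intro finite_lists_length_le finite_cartesian_product finite_atMost)
qed


section \<open>The epsilon-Carnot coordinate map\<close>

text \<open>
  Everything below takes place in given local coordinates: a frame is a family
  \<open>X :: 'n \<Rightarrow> real^'n \<Rightarrow> real^'n\<close> of coefficient functions, and \<open>a\<close> is a point in the range of the
  coordinates.  Only the germ of \<open>X\<close> at \<open>a\<close> is used.  A further coordinate system is a map
  \<open>\<phi> :: real^'n \<Rightarrow> real^'n\<close> from the given coordinates to the new ones.
\<close>

definition vf_apply :: "(real^'n \<Rightarrow> real^'n) \<Rightarrow> (real^'n \<Rightarrow> real) \<Rightarrow> real^'n \<Rightarrow> real" where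
  "vf_apply V f x = frechet_derivative f (at x) (V x)"

definition frame_word :: "('n \<Rightarrow> real^'n \<Rightarrow> real^'n) \<Rightarrow> 'n list \<Rightarrow> (real^'n \<Rightarrow> real) \<Rightarrow> real^'n \<Rightarrow> real" where
  "frame_word X I f = foldr (\<lambda>i. vf_apply (X i)) I f"

definition word_weight :: "('n \<Rightarrow> nat) \<Rightarrow> 'n list \<Rightarrow> nat" where
  "word_weight w I = (\<Sum>i\<leftarrow>I. w i)"

definition has_order :: "('n \<Rightarrow> nat) \<Rightarrow> ('n \<Rightarrow> real^'n \<Rightarrow> real^'n) \<Rightarrow> real^'n \<Rightarrow> (real^'n \<Rightarrow> real) \<Rightarrow> nat \<Rightarrow> bool" where
  "has_order w X a f N \<longleftrightarrow>
     (\<forall>I. word_weight w I < N \<longrightarrow> frame_word X I f a = 0) \<and>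
     (\<exists>I. word_weight w I = N \<and> frame_word X I f a \<noteq> 0)"

text \<open>
  \<open>frechet_derivative \<phi> (at a) (X j a)\<close> is the value at the origin of \<open>X j\<close> in the
  coordinates \<open>\<phi>\<close>.
\<close>

definition linearly_adapted :: "('n::finite \<Rightarrow> real^'n \<Rightarrow> real^'n) \<Rightarrow> real^'n \<Rightarrow> (real^'n \<Rightarrow> real^'n) \<Rightarrow> bool" where
  "linearly_adapted X a \<phi> \<longleftrightarrow> \<phi> a = 0 \<and> (\<forall>j. frechet_derivative \<phi> (at a) (X j a) = axis j 1)"

definition privileged :: "('n::finite \<Rightarrow> nat) \<Rightarrow> ('n \<Rightarrow> real^'n \<Rightarrow> real^'n) \<Rightarrow> real^'n \<Rightarrow> (real^'n \<Rightarrow> real^'n) \<Rightarrow> bool" where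
  "privileged w X a \<phi> \<longleftrightarrow> linearly_adapted X a \<phi> \<and> (\<forall>j. has_order w X a (\<lambda>x. \<phi> x $ j) (w j))"

definition T_map :: "('n::finite \<Rightarrow> real^'n \<Rightarrow> real^'n) \<Rightarrow> real^'n \<Rightarrow> real^'n \<Rightarrow> real^'n" where
  "T_map X a = (THE T. (\<exists>(M :: real^'n^'n) b. T = (\<lambda>x. M *v x + b)) \<and> linearly_adapted X a T)"

definition psi_hat_shape :: "('n::finite \<Rightarrow> nat) \<Rightarrow> (real^'n \<Rightarrow> real^'n) \<Rightarrow> bool" where
  "psi_hat_shape w P \<longleftrightarrow> (\<exists>c :: 'n \<Rightarrow> ('n \<Rightarrow> nat) \<Rightarrow> real. \<forall>y k.
     P y $ k = y $ k +
       (\<Sum>\<alpha> | (\<Sum>j\<in>UNIV. w j * \<alpha> j) < w k \<and> (\<Sum>j\<in>UNIV. \<alpha> j) \<ge> 2. c k \<alpha> * (\<Prod>j\<in>UNIV. y $ j ^ \<alpha> j)))"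

definition psi_hat :: "('n::finite \<Rightarrow> nat) \<Rightarrow> ('n \<Rightarrow> real^'n \<Rightarrow> real^'n) \<Rightarrow> real^'n \<Rightarrow> real^'n \<Rightarrow> real^'n" where
  "psi_hat w X a = (THE P. psi_hat_shape w P \<and> privileged w X a (P \<circ> T_map X a))"

definition psi_map :: "('n::finite \<Rightarrow> nat) \<Rightarrow> ('n \<Rightarrow> real^'n \<Rightarrow> real^'n) \<Rightarrow> real^'n \<Rightarrow> real^'n \<Rightarrow> real^'n" where
  "psi_map w X a = psi_hat w X a \<circ> T_map X a"

definition pushforward :: "(real^'n \<Rightarrow> real^'n) \<Rightarrow> (real^'n \<Rightarrow> real^'n) \<Rightarrow> real^'n \<Rightarrow> real^'n" where
  "pushforward \<phi> V y = frechet_derivative \<phi> (at (inv \<phi> y)) (V (inv \<phi> y))"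

definition dilation :: "('n::finite \<Rightarrow> nat) \<Rightarrow> real \<Rightarrow> real^'n \<Rightarrow> real^'n" where
  "dilation w t x = (\<chi> j. t ^ w j * x $ j)"

definition dilation_pullback :: "('n::finite \<Rightarrow> nat) \<Rightarrow> real \<Rightarrow> (real^'n \<Rightarrow> real^'n) \<Rightarrow> real^'n \<Rightarrow> real^'n" where
  "dilation_pullback w t V x = (\<chi> j. inverse (t ^ w j) * V (dilation w t x) $ j)"

text \<open>The limit is taken pointwise, which suffices to identify the limit vector field.\<close>

definition model_field :: "('n::finite \<Rightarrow> nat) \<Rightarrow> ('n \<Rightarrow> real^'n \<Rightarrow> real^'n) \<Rightarrow> real^'n \<Rightarrow> 'n \<Rightarrow> real^'n \<Rightarrow> real^'n" where
  "model_field w X a j x =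
     Lim (at 0) (\<lambda>t. t ^ w j *\<^sub>R dilation_pullback w t (pushforward (psi_map w X a) (X j)) x)"

definition euclid_flow_one :: "(real^'n \<Rightarrow> real^'n) \<Rightarrow> real^'n \<Rightarrow> real^'n" where
  "euclid_flow_one V p = (THE q. \<exists>\<gamma>. \<gamma> 0 = p \<and> \<gamma> 1 = q \<and>
     (\<forall>t\<in>{0..1::real}. (\<gamma> has_vector_derivative V (\<gamma> t)) (at t within {0..1})))"

definition exp_model :: "('n::finite \<Rightarrow> nat) \<Rightarrow> ('n \<Rightarrow> real^'n \<Rightarrow> real^'n) \<Rightarrow> real^'n \<Rightarrow> real^'n \<Rightarrow> real^'n" where
  "exp_model w X a u = euclid_flow_one (\<lambda>y. \<Sum>j\<in>UNIV. u $ j *\<^sub>R model_field w X a j y) 0"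

definition eps_map :: "('n::finite \<Rightarrow> nat) \<Rightarrow> ('n \<Rightarrow> real^'n \<Rightarrow> real^'n) \<Rightarrow> real^'n \<Rightarrow> real^'n \<Rightarrow> real^'n" where
  "eps_map w X a = inv (exp_model w X a) \<circ> psi_map w X a"

end

theory Submission
  imports Defs
begin

text \<open>
  In the coordinates given by the basis, the logarithmic derivative of a smooth map into \<open>G\<close> is a
  vector-valued function, and the bracket enters only through the Maurer--Cartan equation.  It yields
  the derivative of the exponential map \<open>EE\<close> and hence that \<open>EE (dyn x y) = EE x \<cdot> EE y\<close>: for
  small \<open>t\<close> the logarithm of \<open>EE (t x) \<cdot> EE (t y)\<close> and Dynkin's polynomial \<open>dyn (t x) (t y)\<close> solve the
  same differential equation, and both sides of the consequence
  \<open>exp (ad (dyn (t x) (t y))) = exp (t ad x) exp (t ad y)\<close> are polynomials in \<open>t\<close>.  Connectedness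
  makes \<open>EE\<close> surjective; simple connectedness makes it injective.

  Thus the frame on \<open>\<real>\<^sup>n\<close> is invariant under left translations of \<open>G\<^sup>0\<close> and homogeneous under
  dilations, so that the left translation by \<open>- a\<close> is privileged at \<open>a\<close>.  Composed with the inverse of
  \<open>T\<^sub>a\<close> it has the shape required of the polynomial map converting to privileged coordinates, so it is
  the map \<open>\<psi>\<^sub>a\<close>.  It carries the frame to itself, the model fields are the frame itself, and
  their exponential map is the identity.
\<close>

section \<open>Smooth functions\<close>

text \<open>Three circumstances shape the argument. Tangent vectors act on globally defined smooth
  functions only, so charts enter through functions cut off by bumps, and smoothness of maps into
  \<open>G\<close> is tested on such functions. A logarithm exists at first only near
  \<open>e\<close>; the detour through the adjoint representation is what carries the product
  formula from small to all times, because an equality of polynomial operators can be continued in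
  \<open>t\<close> while an equality of points of \<open>G\<close> cannot. The group laws of
  Dynkin's product must precede the injectivity of \<open>EE\<close>, since the grid argument
  multiplies logarithms; there the dilations make up for injectivity, being automorphisms of the
  product that move any point into the ball on which \<open>EE\<close> is injective. Finally
  \<open>T_map\<close>, \<open>psi_hat\<close> and the flows are definite descriptions, so each
  needs uniqueness besides a witness. The polynomial correction is the hard case: being privileged
  restricts only words of small weight, while the correction mixes monomials of different degrees
  below that weight.\<close>

lemma frechet_derivative_eq:
  "(f has_derivative f') (at x) \<Longrightarrow> frechet_derivative f (at x) = f'"
  by (rule frechet_derivative_at[symmetric])

text \<open>\<open>S\<close> has to be open here: the derivative at a point of \<open>S\<close>
  depends on the values at all nearby points, and agreement is given on \<open>S\<close>
  only.\<close>

lemma Ck_on_cong_imp: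
  assumes "open S" "\<And>x. x \<in> S \<Longrightarrow> f x = g x" "Ck_on k S f"
  shows "Ck_on k S g"
  using assms(2,3)
proof (induction k arbitrary: f g)
  case 0
  then show ?case by (auto cong: continuous_on_cong)
next
  case (Suc k)
  have d: "f differentiable (at x)" if "x \<in> S" for x
    using that Suc.prems by auto
  have "g differentiable (at x)" if "x \<in> S" for x
    using d[OF that] that \<open>open S\<close> Suc.prems(1)
    unfolding differentiable_def by (meson has_derivative_transform_within_open)
  moreover have "frechet_derivative f (at x) b = frechet_derivative g (at x) b" if "x \<in> S" for x b
    using frechet_derivative_transform_within_open[OF d[OF that] \<open>open S\<close> that] Suc.prems(1) by metis
  ultimately show ?case
    using Suc.prems(2) Suc.IH[of "\<lambda>x. frechet_derivative f (at x) _" "\<lambda>x. frechet_derivative g (at x) _"]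
    by auto
qed

lemma Ck_on_cong:
  "open S \<Longrightarrow> (\<And>x. x \<in> S \<Longrightarrow> f x = g x) \<Longrightarrow> Ck_on k S f \<longleftrightarrow> Ck_on k S g"
  using Ck_on_cong_imp[of S f g k] Ck_on_cong_imp[of S g f k] by metis

lemma Ck_on_subset: "Ck_on k S f \<Longrightarrow> T \<subseteq> S \<Longrightarrow> Ck_on k T f"
  by (induction k arbitrary: f) (auto intro: continuous_on_subset)

lemma Ck_on_Suc_imp: "Ck_on (Suc k) S f \<Longrightarrow> Ck_on k S f"
proof (induction k arbitrary: f)
  case 0
  then show ?case
    by (auto intro!: continuous_at_imp_continuous_on differentiable_imp_continuous_within)
next
  case (Suc k)
  then show ?case by (metis Ck_on.simps(2))
qed

lemma Ck_on_local:
  assumes "\<And>x. x \<in> S \<Longrightarrow> \<exists>T. open T \<and> x \<in> T \<and> Ck_on k T f"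
  shows "Ck_on k S f"
  using assms
proof (induction k arbitrary: f)
  case 0
  then show ?case
    by (auto intro!: continuous_at_imp_continuous_on)
      (metis continuous_on_eq_continuous_at)
next
  case (Suc k)
  show ?case
    using Suc.prems by (auto intro!: Suc.IH) blast+
qed

lemma smooth_on_cong:
  "open S \<Longrightarrow> (\<And>x. x \<in> S \<Longrightarrow> f x = g x) \<Longrightarrow> smooth_on S f \<longleftrightarrow> smooth_on S g"
  unfolding smooth_on_def using Ck_on_cong by blast

lemma smooth_on_subset: "smooth_on S f \<Longrightarrow> T \<subseteq> S \<Longrightarrow> smooth_on T f"
  unfolding smooth_on_def using Ck_on_subset by blast

lemma smooth_on_local:
  assumes "\<And>x. x \<in> S \<Longrightarrow> \<exists>T. open T \<and> x \<in> T \<and> smooth_on T f"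
  shows "smooth_on S f"
  unfolding smooth_on_def using assms by (meson Ck_on_local smooth_on_def)

lemma smooth_on_differentiable: "smooth_on S f \<Longrightarrow> x \<in> S \<Longrightarrow> f differentiable (at x)"
  unfolding smooth_on_def by (metis Ck_on.simps(2))

lemma smooth_on_has_derivative:
  "smooth_on S f \<Longrightarrow> x \<in> S \<Longrightarrow> (f has_derivative frechet_derivative f (at x)) (at x)"
  using smooth_on_differentiable frechet_derivative_works by blast

lemma smooth_on_continuous_on: "smooth_on S f \<Longrightarrow> continuous_on S f"
  unfolding smooth_on_def by (metis Ck_on.simps(1))

section \<open>Sums, products and compositions of smooth functions\<close>

lemma Ck_on_const: "Ck_on k S (\<lambda>x. c)"
  by (induction k arbitrary: c) auto

lemma Ck_on_linear:
  assumes "bounded_linear f" shows "Ck_on k S f"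
proof (cases k)
  case 0
  then show ?thesis using assms by (simp add: linear_continuous_on)
next
  case (Suc k')
  have hd: "(f has_derivative f) (at x)" for x
    using assms by (rule bounded_linear_imp_has_derivative)
  have "frechet_derivative f (at x) = f" for x
    by (rule frechet_derivative_eq[OF hd])
  then show ?thesis
    using hd Suc by (auto simp: Ck_on_const differentiable_def)
qed

lemma Ck_on_add:
  assumes "open S" "Ck_on k S f" "Ck_on k S g" shows "Ck_on k S (\<lambda>x. f x + g x)"
  using assms(2,3)
proof (induction k arbitrary: f g)
  case 0
  then show ?case by (auto intro: continuous_intros)
next
  case (Suc k)
  have hd: "((\<lambda>x. f x + g x) has_derivative
      (\<lambda>b. frechet_derivative f (at x) b + frechet_derivative g (at x) b)) (at x)" if "x \<in> S" for x
    using that Suc.prems by (intro has_derivative_add[of f _ _ g]) (auto simp flip: frechet_derivative_works)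
  have eq: "frechet_derivative (\<lambda>x. f x + g x) (at x) b =
      frechet_derivative f (at x) b + frechet_derivative g (at x) b" if "x \<in> S" for x b
    by (simp add: frechet_derivative_eq[OF hd[OF that]])
  have "Ck_on k S (\<lambda>x. frechet_derivative f (at x) b + frechet_derivative g (at x) b)"
    if "b \<in> Basis" for b
    using Suc.prems that by (intro Suc.IH) auto
  then show ?case
    using hd by (auto simp: Ck_on_cong[OF \<open>open S\<close> eq] differentiable_def)
qed

lemma Ck_on_scaleR:
  fixes g :: "'a::euclidean_space \<Rightarrow> 'b::real_normed_vector"
  assumes "open S" "Ck_on k S f" "Ck_on k S g" shows "Ck_on k S (\<lambda>x. f x *\<^sub>R g x)"
  using assms(2,3)
proof (induction k arbitrary: f g)
  case 0
  then show ?case by (auto intro: continuous_intros)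
next
  case (Suc k)
  have hd: "((\<lambda>x. f x *\<^sub>R g x) has_derivative
      (\<lambda>b. f x *\<^sub>R frechet_derivative g (at x) b + frechet_derivative f (at x) b *\<^sub>R g x)) (at x)"
    if "x \<in> S" for x
    using that Suc.prems by (intro has_derivative_scaleR[of f _ _ _ g]) (auto simp flip: frechet_derivative_works)
  have eq: "frechet_derivative (\<lambda>x. f x *\<^sub>R g x) (at x) b =
      f x *\<^sub>R frechet_derivative g (at x) b + frechet_derivative f (at x) b *\<^sub>R g x" if "x \<in> S" for x b
    by (simp add: frechet_derivative_eq[OF hd[OF that]])
  \<comment> \<open>The product rule involves \<open>f\<close> and \<open>g\<close> themselves next
    to their derivatives, so both are also used one class lower.\<close>
  have "Ck_on k S f" "Ck_on k S g"
    using Suc.prems Ck_on_Suc_imp by blast+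
  then have "Ck_on k S (\<lambda>x. f x *\<^sub>R frechet_derivative g (at x) b + frechet_derivative f (at x) b *\<^sub>R g x)"
    if "b \<in> Basis" for b
    using Suc.prems that by (intro Ck_on_add Suc.IH \<open>open S\<close>) auto
  then show ?case
    using hd by (auto simp: Ck_on_cong[OF \<open>open S\<close> eq] differentiable_def)
qed

lemma Ck_on_sum:
  assumes "open S" "\<And>i. i \<in> I \<Longrightarrow> Ck_on k S (f i)" shows "Ck_on k S (\<lambda>x. \<Sum>i\<in>I. f i x)"
  using assms(2) by (induction I rule: infinite_finite_induct) (auto simp: Ck_on_const Ck_on_add \<open>open S\<close>)

lemma frechet_derivative_expand:
  fixes f :: "'a::euclidean_space \<Rightarrow> 'b::real_normed_vector"
  assumes "f differentiable (at x)"
  shows "frechet_derivative f (at x) v = (\<Sum>b\<in>Basis. (v \<bullet> b) *\<^sub>R frechet_derivative f (at x) b)"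
proof -
  interpret linear "frechet_derivative f (at x)"
    using assms linear_frechet_derivative by blast
  show ?thesis
    using arg_cong[OF euclidean_representation[of v, symmetric], of "frechet_derivative f (at x)"]
    by (simp only: sum scale)
qed

lemma Ck_on_linear_compose:
  assumes "open S" "bounded_linear L" "Ck_on k S f" shows "Ck_on k S (\<lambda>x. L (f x))"
  using assms(3)
proof (induction k arbitrary: f)
  case 0
  then show ?case using assms(2) by (simp add: bounded_linear.continuous_on)
next
  case (Suc k)
  have hd: "((\<lambda>x. L (f x)) has_derivative (\<lambda>b. L (frechet_derivative f (at x) b))) (at x)" if "x \<in> S" for x
    using that Suc.prems
    by (intro bounded_linear.has_derivative[OF assms(2), of f]) (auto simp flip: frechet_derivative_works)
  have eq: "frechet_derivative (\<lambda>x. L (f x)) (at x) b = L (frechet_derivative f (at x) b)" if "x \<in> S" for x b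
    by (simp add: frechet_derivative_eq[OF hd[OF that]])
  show ?case
    using Suc hd by (auto simp: Ck_on_cong[OF \<open>open S\<close> eq] differentiable_def)
qed

text \<open>The chain rule evaluates the derivative of \<open>g\<close> in a direction that varies
  with \<open>x\<close>, whereas \<open>Ck_on\<close> controls basis directions only. Expanding the
  direction over the basis gives a sum of products whose factors are covered by the induction
  hypothesis.\<close>

lemma Ck_on_compose:
  fixes g :: "'b::euclidean_space \<Rightarrow> 'c::real_normed_vector" and f :: "'a::euclidean_space \<Rightarrow> 'b"
  assumes "open S" "Ck_on k S f" "Ck_on k T g" "f ` S \<subseteq> T"
  shows "Ck_on k S (\<lambda>x. g (f x))"
  using assms(2-4)
proof (induction k arbitrary: f g)
  case 0
  then show ?case using continuous_on_compose2[of T g S f] by simp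
next
  case (Suc k)
  have hd: "((\<lambda>x. g (f x)) has_derivative
      (\<lambda>b. frechet_derivative g (at (f x)) (frechet_derivative f (at x) b))) (at x)" if "x \<in> S" for x
    using that Suc.prems by (intro has_derivative_compose[of f _ _ _ g])
      (auto simp flip: frechet_derivative_works simp: image_subset_iff)
  have eq: "frechet_derivative (\<lambda>x. g (f x)) (at x) b =
     (\<Sum>i\<in>Basis. (frechet_derivative f (at x) b \<bullet> i) *\<^sub>R frechet_derivative g (at (f x)) i)"
    if "x \<in> S" for x b
  proof -
    have "g differentiable (at (f x))" using that Suc.prems by auto
    from frechet_derivative_expand[OF this, of "frechet_derivative f (at x) b"] show ?thesis
      by (simp add: frechet_derivative_eq[OF hd[OF that]])
  qed
  have "Ck_on k S f" using Suc.prems Ck_on_Suc_imp by blast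
  then have "Ck_on k S (\<lambda>x. \<Sum>i\<in>Basis. (frechet_derivative f (at x) b \<bullet> i) *\<^sub>R frechet_derivative g (at (f x)) i)"
    if "b \<in> Basis" for b
    using Suc.prems that
    by (intro Ck_on_sum Ck_on_scaleR Ck_on_linear_compose[of _ "\<lambda>v. v \<bullet> _"] Suc.IH
        bounded_linear_inner_left \<open>open S\<close>) auto
  then show ?case
    using hd by (auto simp: Ck_on_cong[OF \<open>open S\<close> eq] differentiable_def)
qed

lemma smooth_on_const [simp]: "smooth_on S (\<lambda>x. c)"
  by (simp add: smooth_on_def Ck_on_const)

lemma smooth_on_linear: "bounded_linear f \<Longrightarrow> smooth_on S f"
  by (simp add: smooth_on_def Ck_on_linear)

lemma smooth_on_ident [simp]: "smooth_on S (\<lambda>x. x)"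
  by (simp add: smooth_on_linear)

lemma smooth_on_add: "open S \<Longrightarrow> smooth_on S f \<Longrightarrow> smooth_on S g \<Longrightarrow> smooth_on S (\<lambda>x. f x + g x)"
  by (simp add: smooth_on_def Ck_on_add)

lemma smooth_on_scaleR:
  "open S \<Longrightarrow> smooth_on S f \<Longrightarrow> smooth_on S g \<Longrightarrow> smooth_on S (\<lambda>x. f x *\<^sub>R g x)"
  by (simp add: smooth_on_def Ck_on_scaleR)

lemma smooth_on_mult:
  fixes f g :: "_ \<Rightarrow> real"
  shows "open S \<Longrightarrow> smooth_on S f \<Longrightarrow> smooth_on S g \<Longrightarrow> smooth_on S (\<lambda>x. f x * g x)"
  using smooth_on_scaleR[of S f g] by simp

lemma smooth_on_sum: "open S \<Longrightarrow> (\<And>i. i \<in> I \<Longrightarrow> smooth_on S (f i)) \<Longrightarrow> smooth_on S (\<lambda>x. \<Sum>i\<in>I. f i x)"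
  by (simp add: smooth_on_def Ck_on_sum)

lemma smooth_on_linear_compose:
  "open S \<Longrightarrow> bounded_linear L \<Longrightarrow> smooth_on S f \<Longrightarrow> smooth_on S (\<lambda>x. L (f x))"
  by (simp add: smooth_on_def Ck_on_linear_compose)

lemma smooth_on_compose:
  fixes f :: "'a::euclidean_space \<Rightarrow> 'b::euclidean_space"
  shows "open S \<Longrightarrow> smooth_on S f \<Longrightarrow> smooth_on T g \<Longrightarrow> f ` S \<subseteq> T \<Longrightarrow> smooth_on S (\<lambda>x. g (f x))"
  unfolding smooth_on_def using Ck_on_compose by blast

lemma smooth_on_minus: "open S \<Longrightarrow> smooth_on S f \<Longrightarrow> smooth_on S (\<lambda>x. - f x)"
  using smooth_on_linear_compose[of S uminus f] by (simp add: bounded_linear_minus)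

lemma smooth_on_diff: "open S \<Longrightarrow> smooth_on S f \<Longrightarrow> smooth_on S g \<Longrightarrow> smooth_on S (\<lambda>x. f x - g x)"
  using smooth_on_add[of S f "\<lambda>x. - g x"] smooth_on_minus by fastforce

lemma smooth_on_Pair:
  assumes "open S" "smooth_on S f" "smooth_on S g" shows "smooth_on S (\<lambda>x. (f x, g x))"
proof -
  have "smooth_on S (\<lambda>x. (f x, 0) + (0, g x))"
    using assms by (intro smooth_on_add smooth_on_linear_compose[of S "\<lambda>v. (v, 0)" f]
        smooth_on_linear_compose[of S "\<lambda>v. (0, v)" g]) (auto intro: bounded_linear_intros)
  then show ?thesis by simp
qed

lemma smooth_on_vec:
  fixes f :: "'a::euclidean_space \<Rightarrow> real^'n"
  assumes "open S" "\<And>k. smooth_on S (\<lambda>x. f x $ k)" shows "smooth_on S f"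
proof -
  have eq: "f = (\<lambda>x. \<Sum>k\<in>UNIV. f x $ k *\<^sub>R axis k 1)"
    by (simp add: fun_eq_iff vec_eq_iff axis_def if_distrib cong: if_cong)
  show ?thesis
    by (subst eq) (intro smooth_on_sum smooth_on_scaleR assms smooth_on_const)
qed

lemma smooth_on_vec_nth: "open S \<Longrightarrow> smooth_on S f \<Longrightarrow> smooth_on S (\<lambda>x. f x $ k)"
  by (rule smooth_on_linear_compose[of S "\<lambda>v. v $ k"]) (auto intro: bounded_linear_vec_nth)

lemma smooth_on_frechet_derivative:
  assumes "open S" "smooth_on S f"
  shows "smooth_on S (\<lambda>x. frechet_derivative f (at x) v)"
proof -
  have "smooth_on S (\<lambda>x. frechet_derivative f (at x) b)" if "b \<in> Basis" for b
    using assms(2) that unfolding smooth_on_def by (metis Ck_on.simps(2))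
  then have "smooth_on S (\<lambda>x. \<Sum>b\<in>Basis. (v \<bullet> b) *\<^sub>R frechet_derivative f (at x) b)"
    by (intro smooth_on_sum smooth_on_scaleR \<open>open S\<close>) auto
  then show ?thesis
    by (rule smooth_on_cong[OF \<open>open S\<close>, THEN iffD1, rotated])
      (use assms smooth_on_differentiable frechet_derivative_expand in metis)
qed

text \<open>Regularity bootstrap: each class of \<open>f\<close> is passed on to the derivative and
  so gains one order. It serves reciprocals, solutions of differential equations and logarithms of
  smooth maps.\<close>

lemma smooth_on_bootstrap:
  assumes "open S"
    and d: "\<And>x. x \<in> S \<Longrightarrow> (f has_derivative f' x) (at x)"
    and step: "\<And>k b. Ck_on k S f \<Longrightarrow> b \<in> Basis \<Longrightarrow> Ck_on k S (\<lambda>x. f' x b)"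
  shows "smooth_on S f"
proof -
  have "Ck_on k S f" for k
  proof (induction k)
    case 0
    then show ?case
      using d by (auto intro!: continuous_at_imp_continuous_on has_derivative_continuous)
  next
    case (Suc k)
    have eq: "frechet_derivative f (at x) b = f' x b" if "x \<in> S" for x b
      by (simp add: frechet_derivative_eq[OF d[OF that]])
    show ?case
      using d step[OF Suc] by (auto simp: Ck_on_cong[OF \<open>open S\<close> eq] differentiable_def)
  qed
  then show ?thesis by (simp add: smooth_on_def)
qed

lemma smooth_on_inverse:
  fixes f :: "'a::euclidean_space \<Rightarrow> real"
  assumes "open S" "smooth_on S f" "\<And>x. x \<in> S \<Longrightarrow> f x \<noteq> 0"
  shows "smooth_on S (\<lambda>x. inverse (f x))"
proof (rule smooth_on_bootstrap[OF \<open>open S\<close>])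
  fix x assume "x \<in> S"
  then show "((\<lambda>x. inverse (f x)) has_derivative
      (\<lambda>b. - (inverse (f x) * frechet_derivative f (at x) b * inverse (f x)))) (at x)"
    using assms smooth_on_has_derivative[of S f x] by (intro Deriv.has_derivative_inverse) auto
next
  fix k and b :: 'a
  assume k: "Ck_on k S (\<lambda>x. inverse (f x))"
  have "Ck_on k S (\<lambda>x. frechet_derivative f (at x) b)"
    using smooth_on_frechet_derivative[OF assms(1,2)] by (simp add: smooth_on_def)
  then have "Ck_on k S (\<lambda>x. - (inverse (f x) *\<^sub>R (frechet_derivative f (at x) b *\<^sub>R inverse (f x))))"
    using k by (intro Ck_on_linear_compose[of S uminus] Ck_on_scaleR assms(1) bounded_linear_minus) auto
  then show "Ck_on k S (\<lambda>x. - (inverse (f x) * frechet_derivative f (at x) b * inverse (f x)))"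
    by (simp add: mult.assoc)
qed

lemma smooth_on_real_polynomial:
  fixes f :: "'a::euclidean_space \<Rightarrow> real"
  shows "real_polynomial_function f \<Longrightarrow> open S \<Longrightarrow> smooth_on S f"
  by (induction rule: real_polynomial_function.induct)
    (simp_all add: smooth_on_add smooth_on_mult smooth_on_linear)

section \<open>Symmetry of second derivatives\<close>

lemma has_real_derivative_along_line:
  fixes g :: "'a::euclidean_space \<Rightarrow> real"
  assumes "g differentiable (at (x + s *\<^sub>R u))"
  shows "((\<lambda>s. g (x + s *\<^sub>R u)) has_real_derivative frechet_derivative g (at (x + s *\<^sub>R u)) u) (at s)"
proof -
  have g: "(g has_derivative frechet_derivative g (at (x + s *\<^sub>R u))) (at (x + s *\<^sub>R u))"
    using assms frechet_derivative_works by blast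
  have "((\<lambda>s. x + s *\<^sub>R u) has_derivative (\<lambda>h. h *\<^sub>R u)) (at s)"
    by (auto intro!: derivative_eq_intros)
  from has_derivative_compose[OF this g]
  have "((\<lambda>s. g (x + s *\<^sub>R u)) has_derivative
      (\<lambda>h. frechet_derivative g (at (x + s *\<^sub>R u)) (h *\<^sub>R u))) (at s)" .
  moreover have "frechet_derivative g (at (x + s *\<^sub>R u)) (h *\<^sub>R u) =
      frechet_derivative g (at (x + s *\<^sub>R u)) u * h" for h
    using linear_frechet_derivative[OF assms] by (simp add: linear_scale mult.commute)
  ultimately show ?thesis
    by (simp add: has_field_derivative_def)
qed

text \<open>The mean value theorem is applied twice: along \<open>u\<close> to the difference of
  \<open>g\<close> on two parallel lines, then along \<open>v\<close> to the derivative in direction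
  \<open>u\<close>.\<close>

lemma second_difference_mvt:
  fixes g :: "'a::euclidean_space \<Rightarrow> real"
  assumes "open S" "smooth_on S g" "h > 0"
    and in_S: "\<And>s t. s \<in> {0..h} \<Longrightarrow> t \<in> {0..h} \<Longrightarrow> x + s *\<^sub>R u + t *\<^sub>R v \<in> S"
  obtains s t where "s \<in> {0..h}" "t \<in> {0..h}"
    "g (x + h *\<^sub>R u + h *\<^sub>R v) - g (x + h *\<^sub>R u) - g (x + h *\<^sub>R v) + g x =
     h * h * frechet_derivative (\<lambda>y. frechet_derivative g (at y) u) (at (x + s *\<^sub>R u + t *\<^sub>R v)) v"
proof -
  let ?D = "\<lambda>y. frechet_derivative g (at y) u"
  have line: "x + t *\<^sub>R v + s *\<^sub>R u = x + s *\<^sub>R u + t *\<^sub>R v" for s t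
    by simp
  have "((\<lambda>s. g (x + h *\<^sub>R v + s *\<^sub>R u) - g (x + s *\<^sub>R u)) has_real_derivative
      (?D (x + h *\<^sub>R v + s *\<^sub>R u) - ?D (x + s *\<^sub>R u))) (at s)" if "s \<in> {0..h}" for s
    using in_S[OF that, of h] in_S[OF that, of 0] \<open>h > 0\<close> smooth_on_differentiable[OF assms(2)]
    by (intro DERIV_diff has_real_derivative_along_line) (auto simp: line)
  then obtain s where s: "0 < s" "s < h" and
    1: "(g (x + h *\<^sub>R v + h *\<^sub>R u) - g (x + h *\<^sub>R u)) - (g (x + h *\<^sub>R v + 0 *\<^sub>R u) - g (x + 0 *\<^sub>R u)) =
      (h - 0) * (?D (x + h *\<^sub>R v + s *\<^sub>R u) - ?D (x + s *\<^sub>R u))"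
    using MVT2[OF \<open>h > 0\<close>, of "\<lambda>s. g (x + h *\<^sub>R v + s *\<^sub>R u) - g (x + s *\<^sub>R u)"
        "\<lambda>s. ?D (x + h *\<^sub>R v + s *\<^sub>R u) - ?D (x + s *\<^sub>R u)"] by auto
  have sm: "smooth_on S ?D"
    by (rule smooth_on_frechet_derivative[OF assms(1,2)])
  have "((\<lambda>t. ?D (x + s *\<^sub>R u + t *\<^sub>R v)) has_real_derivative
      frechet_derivative ?D (at (x + s *\<^sub>R u + t *\<^sub>R v)) v) (at t)" if "t \<in> {0..h}" for t
    using in_S[of s t] s that smooth_on_differentiable[OF sm]
    by (intro has_real_derivative_along_line) auto
  then obtain t where t: "0 < t" "t < h" and
    2: "?D (x + s *\<^sub>R u + h *\<^sub>R v) - ?D (x + s *\<^sub>R u + 0 *\<^sub>R v) =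
      (h - 0) * frechet_derivative ?D (at (x + s *\<^sub>R u + t *\<^sub>R v)) v"
    using MVT2[OF \<open>h > 0\<close>, of "\<lambda>t. ?D (x + s *\<^sub>R u + t *\<^sub>R v)"
        "\<lambda>t. frechet_derivative ?D (at (x + s *\<^sub>R u + t *\<^sub>R v)) v"] by auto
  show thesis
    using 1 2 s t by (intro that[of s t]) (auto simp: line algebra_simps)
qed

text \<open>The second difference is symmetric in \<open>u\<close> and \<open>v\<close>, so the two
  mixed derivatives agree at some two points within \<open>h * K\<close> of \<open>x\<close>;
  continuity gives the claim as \<open>h\<close> shrinks.\<close>

lemma frechet_derivative_commute:
  fixes g :: "'a::euclidean_space \<Rightarrow> real"
  assumes "open S" "smooth_on S g" "x \<in> S"
  shows "frechet_derivative (\<lambda>y. frechet_derivative g (at y) u) (at x) v =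
    frechet_derivative (\<lambda>y. frechet_derivative g (at y) v) (at x) u"
proof -
  define D where "D = (\<lambda>u v y. frechet_derivative (\<lambda>y. frechet_derivative g (at y) u) (at y) v)"
  have "smooth_on S (D u v)" for u v
    unfolding D_def by (intro smooth_on_frechet_derivative assms)
  then have isC: "isCont (D u v) x" for u v
    using smooth_on_continuous_on assms(1,3) continuous_on_eq_continuous_at by blast
  obtain \<rho> where \<rho>: "\<rho> > 0" "ball x \<rho> \<subseteq> S"
    using assms(1,3) open_contains_ball by blast
  define K where "K = norm u + norm v + 1"
  have "K > 0" unfolding K_def by (simp add: add_nonneg_pos)
  have small: "dist x (x + s *\<^sub>R u + t *\<^sub>R v) < h * K"
    if "s \<in> {0..h}" "t \<in> {0..h}" "h > 0" for s t h
  proof -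
    have "norm (s *\<^sub>R u + t *\<^sub>R v) \<le> s * norm u + t * norm v"
      using that norm_triangle_ineq[of "s *\<^sub>R u" "t *\<^sub>R v"] by simp
    also have "\<dots> \<le> h * norm u + h * norm v"
      using that by (intro add_mono mult_right_mono) auto
    also have "\<dots> < h * K"
      using that by (simp add: K_def distrib_left)
    finally show ?thesis by (metis add.assoc dist_add_cancel dist_0_norm add.right_neutral)
  qed
  have ex: "\<exists>p q. dist x p < h * K \<and> dist x q < h * K \<and> D u v p = D v u q"
    if h: "h > 0" "h * K \<le> \<rho>" for h
  proof -
    have S: "x + s *\<^sub>R u + t *\<^sub>R v \<in> S" if "s \<in> {0..h}" "t \<in> {0..h}" for s t
      using small[OF that] h \<rho> by (auto simp: subset_iff)
    have S': "x + s *\<^sub>R v + t *\<^sub>R u \<in> S" if "s \<in> {0..h}" "t \<in> {0..h}" for s t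
      using S[OF that(2,1)] by (simp add: algebra_simps)
    obtain s t where 1: "s \<in> {0..h}" "t \<in> {0..h}"
      "g (x + h *\<^sub>R u + h *\<^sub>R v) - g (x + h *\<^sub>R u) - g (x + h *\<^sub>R v) + g x = h * h * D u v (x + s *\<^sub>R u + t *\<^sub>R v)"
      using second_difference_mvt[OF assms(1,2) h(1) S] unfolding D_def by blast
    obtain s' t' where 2: "s' \<in> {0..h}" "t' \<in> {0..h}"
      "g (x + h *\<^sub>R v + h *\<^sub>R u) - g (x + h *\<^sub>R v) - g (x + h *\<^sub>R u) + g x = h * h * D v u (x + s' *\<^sub>R v + t' *\<^sub>R u)"
      using second_difference_mvt[OF assms(1,2) h(1) S'] unfolding D_def by blast
    have eq: "x + h *\<^sub>R v + h *\<^sub>R u = x + h *\<^sub>R u + h *\<^sub>R v" by simp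
    from 1(3) 2(3)[unfolded eq] have "h * h * D u v (x + s *\<^sub>R u + t *\<^sub>R v) = h * h * D v u (x + s' *\<^sub>R v + t' *\<^sub>R u)"
      by linarith
    then have "D u v (x + s *\<^sub>R u + t *\<^sub>R v) = D v u (x + t' *\<^sub>R u + s' *\<^sub>R v)"
      using h by (simp add: add.commute add.left_commute)
    then show ?thesis
      using small[OF 1(1,2) h(1)] small[OF 2(2,1) h(1)] by blast
  qed
  have "D u v x = D v u x"
  proof (rule ccontr)
    assume ne: "D u v x \<noteq> D v u x"
    define \<epsilon> where "\<epsilon> = \<bar>D u v x - D v u x\<bar> / 2"
    have "\<epsilon> > 0" using ne by (simp add: \<epsilon>_def)
    obtain d1 where d1: "d1 > 0" "\<And>p. dist x p < d1 \<Longrightarrow> \<bar>D u v p - D u v x\<bar> < \<epsilon>"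
      using isC[of u v] \<open>\<epsilon> > 0\<close> unfolding continuous_at_eps_delta dist_real_def
      by (metis dist_commute)
    obtain d2 where d2: "d2 > 0" "\<And>p. dist x p < d2 \<Longrightarrow> \<bar>D v u p - D v u x\<bar> < \<epsilon>"
      using isC[of v u] \<open>\<epsilon> > 0\<close> unfolding continuous_at_eps_delta dist_real_def
      by (metis dist_commute)
    \<comment> \<open>The intermediate points then lie within \<open>d1\<close> and
      \<open>d2\<close> of \<open>x\<close>, and \<open>\<rho>\<close> keeps the whole parallelogram
      in \<open>S\<close>.\<close>
    define h where "h = Min {\<rho>, d1, d2} / K"
    have "h > 0" "h * K = Min {\<rho>, d1, d2}"
      using \<rho> d1 d2 \<open>K > 0\<close> by (auto simp: h_def)
    then obtain p q where "dist x p < d1" "dist x q < d2" "D u v p = D v u q"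
      using ex[of h] by fastforce
    then show False
      using d1(2)[of p] d2(2)[of q] unfolding \<epsilon>_def by (smt (verit) field_sum_of_halves)
  qed
  then show ?thesis by (simp add: D_def)
qed

section \<open>Bump functions\<close>

definition flat_poly :: "real poly \<Rightarrow> real \<Rightarrow> real" where
  "flat_poly p x = (if x > 0 then poly p (1 / x) * exp (- (1 / x)) else 0)"

lemma poly_times_exp_minus_tendsto_0: "((\<lambda>u. poly p u * exp (- u)) \<longlongrightarrow> (0::real)) at_top"
proof -
  have "((\<lambda>u. \<Sum>i\<le>degree p. coeff p i * (u ^ i / exp u)) \<longlongrightarrow> (\<Sum>i\<le>degree p. coeff p i * 0)) at_top"
    by (intro tendsto_sum tendsto_mult tendsto_const tendsto_power_div_exp_0)
  moreover have "poly p u * exp (- u) = (\<Sum>i\<le>degree p. coeff p i * (u ^ i / exp u))" for u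
    by (simp add: poly_altdef sum_distrib_right exp_minus divide_inverse mult.assoc)
  ultimately show ?thesis by simp
qed

text \<open>The functions p(1/x) exp(-1/x) are treated for all polynomials together because
  differentiation stays inside this family: it replaces p by X^2 (p - p'). Smoothness is then a
  single induction over all \<open>p\<close>.\<close>

lemma has_real_derivative_flat_poly:
  "(flat_poly p has_real_derivative flat_poly ([:0, 0, 1:] * (p - pderiv p)) x) (at x)"
proof (cases x "0 :: real" rule: linorder_cases)
  case less
  have "((\<lambda>x. 0) has_real_derivative 0) (at x)" by simp
  then have "(flat_poly p has_real_derivative 0) (at x)"
    by (rule has_field_derivative_transform_within_open[of _ _ _ "{..<0}"])
      (use less in \<open>auto simp: flat_poly_def\<close>)
  then show ?thesis using less by (simp add: flat_poly_def)
next
  case greater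
  have "((\<lambda>x. poly p (1 / x) * exp (- (1 / x))) has_real_derivative
      poly ([:0, 0, 1:] * (p - pderiv p)) (1 / x) * exp (- (1 / x))) (at x)"
    using greater
    by (auto intro!: derivative_eq_intros DERIV_chain'[of "\<lambda>x. 1 / x" _ _ _ "poly p"] poly_DERIV
        simp: field_simps power2_eq_square)
  then have "(flat_poly p has_real_derivative
      poly ([:0, 0, 1:] * (p - pderiv p)) (1 / x) * exp (- (1 / x))) (at x)"
    by (rule has_field_derivative_transform_within_open[of _ _ _ "{0<..}"])
      (use greater in \<open>auto simp: flat_poly_def\<close>)
  then show ?thesis using greater by (simp add: flat_poly_def)
next
  case equal
  \<comment> \<open>With u = 1/y the difference quotient at 0 is u p(u) exp(-u), hence the extra
    factor X in \<open>pCons 0 p\<close>.\<close>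
  have "((\<lambda>y. poly (pCons 0 p) (inverse y) * exp (- inverse y)) \<longlongrightarrow> 0) (at_right (0::real))"
    using filterlim_compose[OF poly_times_exp_minus_tendsto_0 filterlim_inverse_at_top_right] .
  moreover have "\<forall>\<^sub>F y in at_right 0. poly (pCons 0 p) (inverse y) * exp (- inverse y) = flat_poly p y / y"
    by (auto simp: eventually_at_right_less flat_poly_def field_simps
        intro!: eventually_mono[OF eventually_at_right_less[of "0::real"]])
  ultimately have r: "((\<lambda>y. flat_poly p y / y) \<longlongrightarrow> 0) (at_right 0)"
    by (rule Lim_transform_eventually)
  have "\<forall>\<^sub>F y in at_left 0. 0 = flat_poly p y / y"
    by (auto simp: flat_poly_def eventually_at_left_field intro!: exI[of _ "-1"])
  then have l: "((\<lambda>y. flat_poly p y / y) \<longlongrightarrow> 0) (at_left 0)"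
    by (rule Lim_transform_eventually[OF tendsto_const])
  have "((\<lambda>y. flat_poly p y / y) \<longlongrightarrow> 0) (at 0)"
    using l r filterlim_at_split by blast
  then show ?thesis
    using equal by (simp add: has_field_derivative_iff flat_poly_def)
qed

lemma smooth_on_flat_poly: "smooth_on UNIV (flat_poly p)"
proof -
  have "Ck_on k UNIV (flat_poly p)" for k
  proof (induction k arbitrary: p)
    case 0
    then show ?case
      using has_real_derivative_flat_poly[of p] by (auto intro!: continuous_at_imp_continuous_on DERIV_isCont)
  next
    case (Suc k)
    have "frechet_derivative (flat_poly p) (at x) 1 = flat_poly ([:0, 0, 1:] * (p - pderiv p)) x" for x
      using frechet_derivative_eq[OF has_real_derivative_flat_poly[of p x, unfolded has_field_derivative_def]]
      by simp
    then show ?case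
      using Suc.IH[of "[:0, 0, 1:] * (p - pderiv p)"] has_real_derivative_flat_poly[of p]
      by (auto simp: real_differentiable_def simp del: mult_pCons_left)
  qed
  then show ?thesis by (simp add: smooth_on_def)
qed

text \<open>A quotient of flat functions of the squared distance, which is smooth also at the
  centre. Since \<open>r < R\<close>, at every point at least one of the two summands in the
  denominator is positive.\<close>

lemma smooth_bump:
  fixes c :: "'a::euclidean_space"
  assumes "0 < r" "r < R"
  obtains \<beta> :: "'a \<Rightarrow> real" where "smooth_on UNIV \<beta>"
    "\<And>y. y \<in> cball c r \<Longrightarrow> \<beta> y = 1" "\<And>y. y \<notin> ball c R \<Longrightarrow> \<beta> y = 0"
proof
  let ?n = "\<lambda>y. (y - c) \<bullet> (y - c)"
  let ?h = "flat_poly 1"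
  let ?p = "\<lambda>y. ?h (R\<^sup>2 - ?n y)" and ?q = "\<lambda>y. ?h (?n y - r\<^sup>2)"
  have pos: "?h x > 0" if "x > 0" for x using that by (simp add: flat_poly_def)
  have nonneg: "?h x \<ge> 0" for x by (simp add: flat_poly_def)
  have zero: "?h x = 0" if "x \<le> 0" for x using that by (simp add: flat_poly_def)
  have n: "?n y = (dist c y)\<^sup>2" for y
    unfolding dist_norm norm_minus_commute[of c y] power2_norm_eq_inner ..
  have "r\<^sup>2 < R\<^sup>2" using assms by (simp add: power_strict_mono)
  have den: "?p y + ?q y \<noteq> 0" for y
  proof (cases "?n y < R\<^sup>2")
    case True
    then show ?thesis using pos[of "R\<^sup>2 - ?n y"] nonneg[of "?n y - r\<^sup>2"] by simp
  next
    case False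
    then show ?thesis using pos[of "?n y - r\<^sup>2"] nonneg[of "R\<^sup>2 - ?n y"] \<open>r\<^sup>2 < R\<^sup>2\<close> by simp
  qed
  have "smooth_on UNIV (\<lambda>y. \<Sum>b\<in>Basis. ((y - c) \<bullet> b) * ((y - c) \<bullet> b))"
    by (intro smooth_on_sum smooth_on_mult smooth_on_linear_compose[of _ "\<lambda>v. v \<bullet> _"]
        smooth_on_diff bounded_linear_inner_left) auto
  then have sn: "smooth_on UNIV ?n"
    by (subst euclidean_inner)
  have "smooth_on UNIV ?p" "smooth_on UNIV ?q"
    by (intro smooth_on_compose[where T = UNIV, OF _ _ smooth_on_flat_poly] smooth_on_diff sn; simp)+
  then show "smooth_on UNIV (\<lambda>y. ?p y * inverse (?p y + ?q y))"
    by (intro smooth_on_mult smooth_on_inverse smooth_on_add den) auto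
  show "?p y * inverse (?p y + ?q y) = 1" if "y \<in> cball c r" for y
  proof -
    have "?n y \<le> r\<^sup>2" using that assms by (simp add: n power_mono)
    then have "?q y = 0" by (intro zero) simp
    with den[of y] show ?thesis by simp
  qed
  show "?p y * inverse (?p y + ?q y) = 0" if "y \<notin> ball c R" for y
  proof -
    have "?n y \<ge> R\<^sup>2" using that assms by (simp add: n power_mono)
    then have "?p y = 0" by (intro zero) simp
    then show ?thesis by simp
  qed
qed

section \<open>Ordinary differential equations\<close>

text \<open>The derivative is bounded on the compact ball, and the ball is convex, so the mean value
  inequality applies.\<close>

lemma smooth_on_imp_lipschitz:
  fixes V :: "'a::euclidean_space \<Rightarrow> 'b::real_normed_vector"
  assumes "open S" "smooth_on S V" "cball c R \<subseteq> S"
  obtains L where "L \<ge> 0" "\<And>x y. x \<in> cball c R \<Longrightarrow> y \<in> cball c R \<Longrightarrow> norm (V x - V y) \<le> L * norm (x - y)"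
proof -
  let ?B = "\<lambda>x. \<Sum>b\<in>Basis. norm (frechet_derivative V (at x) b)"
  have "continuous_on S (\<lambda>x. frechet_derivative V (at x) b)" for b
    using smooth_on_frechet_derivative[OF assms(1,2)] smooth_on_continuous_on by blast
  then have "continuous_on (cball c R) ?B"
    by (intro continuous_intros continuous_on_subset[OF _ assms(3)])
  then have "bounded (?B ` cball c R)"
    using compact_imp_bounded[OF compact_continuous_image] compact_cball by blast
  then obtain M where M: "M > 0" "\<And>x. x \<in> cball c R \<Longrightarrow> ?B x \<le> M"
    unfolding bounded_pos by (metis abs_ge_self image_eqI order_trans real_norm_def)
  have on: "onorm (frechet_derivative V (at x)) \<le> M" if "x \<in> cball c R" for x
  proof (rule onorm_le)
    fix v
    have d: "V differentiable (at x)" using that assms smooth_on_differentiable by blast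
    have "norm (frechet_derivative V (at x) v) \<le> (\<Sum>b\<in>Basis. norm ((v \<bullet> b) *\<^sub>R frechet_derivative V (at x) b))"
      by (subst frechet_derivative_expand[OF d]) (rule norm_sum)
    also have "\<dots> \<le> (\<Sum>b\<in>Basis. norm v * norm (frechet_derivative V (at x) b))"
      by (intro sum_mono) (simp add: Basis_le_norm mult_right_mono)
    also have "\<dots> = norm v * ?B x" by (simp add: sum_distrib_left)
    also have "\<dots> \<le> M * norm v" using mult_left_mono[OF M(2)[OF that] norm_ge_zero[of v]] by (simp add: mult.commute)
    finally show "norm (frechet_derivative V (at x) v) \<le> M * norm v" .
  qed
  show thesis
  proof (rule that[of M])
    fix x y assume xy: "x \<in> cball c R" "y \<in> cball c R"
    show "norm (V x - V y) \<le> M * norm (x - y)"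
    proof (rule differentiable_bound[of "cball c R" V "\<lambda>x. frechet_derivative V (at x)"])
      show "(V has_derivative frechet_derivative V (at x)) (at x within cball c R)" if "x \<in> cball c R" for x
        using that assms smooth_on_has_derivative has_derivative_at_withinI by blast
    qed (use xy on in auto)
  qed (use M in simp)
qed

text \<open>Gronwall's argument: with a Lipschitz constant \<open>L\<close> on a ball containing
  both curves, exp(-2 L t) times the squared distance is nonincreasing, and it starts at 0.\<close>

lemma ode_unique:
  fixes V :: "'a::euclidean_space \<Rightarrow> 'a"
  assumes V: "smooth_on UNIV V"
    and \<gamma>: "\<And>t. t \<in> {0..1} \<Longrightarrow> (\<gamma> has_vector_derivative V (\<gamma> t)) (at t within {0..1})"
    and \<eta>: "\<And>t. t \<in> {0..1} \<Longrightarrow> (\<eta> has_vector_derivative V (\<eta> t)) (at t within {0..1})"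
    and "\<gamma> 0 = \<eta> 0" "t \<in> {0..1}"
  shows "\<gamma> t = \<eta> t"
proof -
  have c: "continuous_on {0..1} \<gamma>" "continuous_on {0..1} \<eta>"
    using \<gamma> \<eta> has_vector_derivative_continuous continuous_on_eq_continuous_within by blast+
  then have "bounded (\<gamma> ` {0..1} \<union> \<eta> ` {0..1})"
    by (intro compact_imp_bounded compact_Un compact_continuous_image) auto
  then obtain R where R: "\<gamma> ` {0..1} \<union> \<eta> ` {0..1} \<subseteq> cball 0 R"
    unfolding bounded_iff by (auto simp: subset_iff)
  obtain L where L: "L \<ge> 0" "\<And>x y. x \<in> cball 0 R \<Longrightarrow> y \<in> cball 0 R \<Longrightarrow> norm (V x - V y) \<le> L * norm (x - y)"
    using smooth_on_imp_lipschitz[OF _ V] by (metis open_UNIV subset_UNIV)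
  let ?\<phi> = "\<lambda>t. (\<gamma> t - \<eta> t) \<bullet> (\<gamma> t - \<eta> t)"
  let ?g = "\<lambda>t. exp (- 2 * L * t) * ?\<phi> t"
  have "?g t \<le> ?g 0"
  proof (cases "t = 0")
    case False
    with assms have "0 < t" by simp
    have der: "\<exists>y. (?g has_real_derivative y) (at s) \<and> y \<le> 0" if s: "0 < s" "s < t" for s
    proof -
      have "s \<in> interior {0..1}" using s assms(5) by simp
      then have at: "at s within {0..1} = at s" by (rule at_within_interior)
      have d: "((\<lambda>t. \<gamma> t - \<eta> t) has_vector_derivative V (\<gamma> s) - V (\<eta> s)) (at s)"
        using \<gamma>[of s] \<eta>[of s] s assms(5) by (intro has_vector_derivative_diff) (auto simp: at)
      have d2: "(?\<phi> has_real_derivative 2 * ((\<gamma> s - \<eta> s) \<bullet> (V (\<gamma> s) - V (\<eta> s)))) (at s)"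
        using has_derivative_inner[OF d[unfolded has_vector_derivative_def] d[unfolded has_vector_derivative_def]]
        unfolding has_field_derivative_def
        by (rule has_derivative_eq_rhs) (auto simp: fun_eq_iff inner_commute algebra_simps)
      have "(?g has_real_derivative
         exp (- 2 * L * s) * (2 * ((\<gamma> s - \<eta> s) \<bullet> (V (\<gamma> s) - V (\<eta> s)))) - 2 * L * exp (- 2 * L * s) * ?\<phi> s) (at s)"
        by (auto intro!: derivative_eq_intros d2 simp del: inner_diff_left inner_diff_right)
      moreover have "(\<gamma> s - \<eta> s) \<bullet> (V (\<gamma> s) - V (\<eta> s)) \<le> L * ?\<phi> s"
      proof -
        have "(\<gamma> s - \<eta> s) \<bullet> (V (\<gamma> s) - V (\<eta> s)) \<le> norm (\<gamma> s - \<eta> s) * norm (V (\<gamma> s) - V (\<eta> s))"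
          by (rule norm_cauchy_schwarz)
        also have "\<dots> \<le> norm (\<gamma> s - \<eta> s) * (L * norm (\<gamma> s - \<eta> s))"
          using R s assms(5) by (intro mult_left_mono L(2)) (auto simp: subset_iff)
        also have "\<dots> = L * ?\<phi> s"
          by (simp add: dot_square_norm power2_eq_square)
        finally show ?thesis .
      qed
      then have "exp (- 2 * L * s) * (2 * ((\<gamma> s - \<eta> s) \<bullet> (V (\<gamma> s) - V (\<eta> s)))) \<le> exp (- 2 * L * s) * (2 * (L * ?\<phi> s))"
        by (intro mult_left_mono) (simp_all del: inner_diff_left inner_diff_right)
      ultimately show ?thesis
        by (intro exI conjI) (assumption, simp add: algebra_simps)
    qed
    show ?thesis
    proof (rule DERIV_nonpos_imp_decreasing_open[of 0 t ?g])
      show "continuous_on {0..t} ?g"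
        using assms(5) by (intro continuous_intros continuous_on_subset[OF c(1)] continuous_on_subset[OF c(2)]) auto
    qed (use \<open>0 < t\<close> der in auto)
  qed simp
  also have "?g 0 = 0" using assms(4) by simp
  finally have "?\<phi> t \<le> 0"
    by (simp add: mult_le_0_iff del: inner_diff_left inner_diff_right)
  then show ?thesis
    by (metis inner_gt_zero_iff linorder_not_less right_minus_eq)
qed

lemma vector_derivative_bound:
  fixes F :: "real \<Rightarrow> 'a::real_normed_vector"
  assumes "\<And>t. t \<in> {a..b} \<Longrightarrow> (F has_vector_derivative g t) (at t within {a..b})"
    and "\<And>t. t \<in> {a..b} \<Longrightarrow> norm (g t) \<le> B" "s \<in> {a..b}" "t \<in> {a..b}"
  shows "norm (F t - F s) \<le> B * \<bar>t - s\<bar>"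
proof -
  have "onorm (\<lambda>h. h *\<^sub>R g t) \<le> B" if "t \<in> {a..b}" for t
    using assms(2)[OF that] by (intro onorm_le) (simp add: mult.commute[of B] mult_left_mono)
  then have "norm (F t - F s) \<le> B * norm (t - s)"
    using assms by (intro differentiable_bound[of "{a..b}" F "\<lambda>t h. h *\<^sub>R g t"])
      (auto simp: has_vector_derivative_def)
  then show ?thesis by simp
qed

text \<open>Picard iteration. The interval is two-sided so that the solution has a full derivative
  also at the initial time.\<close>

lemma ode_exists:
  fixes V :: "'a::euclidean_space \<Rightarrow> 'a"
  assumes "open \<Omega>" "smooth_on \<Omega> V" "y0 \<in> \<Omega>"
  obtains \<epsilon> y where "\<epsilon> > 0" "y 0 = y0"
    "\<And>t::real. t \<in> {-\<epsilon><..<\<epsilon>} \<Longrightarrow> y t \<in> \<Omega> \<and> (y has_vector_derivative V (y t)) (at t)"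
proof -
  obtain R where R: "R > 0" "cball y0 R \<subseteq> \<Omega>"
    using assms open_contains_cball by blast
  obtain L where L: "L \<ge> 0"
    "\<And>x y. x \<in> cball y0 R \<Longrightarrow> y \<in> cball y0 R \<Longrightarrow> norm (V x - V y) \<le> L * norm (x - y)"
    using smooth_on_imp_lipschitz[OF assms(1,2) R(2)] by metis
  have contV: "continuous_on (cball y0 R) V"
    using continuous_on_subset[OF smooth_on_continuous_on[OF assms(2)] R(2)] .
  then have "bounded (V ` cball y0 R)"
    using compact_imp_bounded[OF compact_continuous_image] compact_cball by blast
  then obtain M where M: "M > 0" "\<And>x. x \<in> cball y0 R \<Longrightarrow> norm (V x) \<le> M"
    unfolding bounded_pos by blast
  \<comment> \<open>The first bound keeps the iterates in the ball of radius \<open>R\<close>, the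
    second makes the iteration a contraction with factor 1/2; \<open>L + 1\<close> avoids a division
    by zero.\<close>
  define \<epsilon> where "\<epsilon> = min (R / M) (1 / (2 * (L + 1)))"
  have \<epsilon>: "\<epsilon> > 0" "M * \<epsilon> \<le> R" "L * \<epsilon> \<le> 1 / 2"
  proof -
    show "\<epsilon> > 0" using R M L by (simp add: \<epsilon>_def)
    have "\<epsilon> \<le> R / M" by (simp add: \<epsilon>_def)
    then show "M * \<epsilon> \<le> R" using M(1) by (simp add: field_simps)
    have "L * \<epsilon> \<le> (L + 1) * (1 / (2 * (L + 1)))"
      using L(1) \<open>\<epsilon> > 0\<close> by (intro mult_mono) (auto simp: \<epsilon>_def)
    also have "\<dots> = 1 / 2" using L(1) by simp
    finally show "L * \<epsilon> \<le> 1 / 2" .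
  qed
  define S where "S = PiC (UNIV :: real set) (\<lambda>_. cball y0 R)"
  have S_iff: "f \<in> S \<longleftrightarrow> (\<forall>t. f t \<in> cball y0 R)" for f
    by (simp add: S_def mem_PiC_iff Pi_iff)
  \<comment> \<open>The integral from 0 to \<open>t\<close> for either sign of \<open>t\<close>,
    written as a difference of integrals that start at \<open>-\<epsilon>\<close>.\<close>
  define I where "I = (\<lambda>(f :: real \<Rightarrow>\<^sub>C 'a) t. integral {-\<epsilon>..t} (\<lambda>s. V (f s)) - integral {-\<epsilon>..0} (\<lambda>s. V (f s)))"
  have I0: "I f 0 = 0" for f by (simp add: I_def)
  have cVf: "continuous_on {-\<epsilon>..\<epsilon>} (\<lambda>s. V (f s))" if "f \<in> S" for f
    using that by (intro continuous_on_compose2[OF contV]) (auto simp: S_iff)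
  have dI: "(I f has_vector_derivative V (f t)) (at t within {-\<epsilon>..\<epsilon>})"
    if "f \<in> S" "t \<in> {-\<epsilon>..\<epsilon>}" for f t
    unfolding I_def using integral_has_vector_derivative[OF cVf[OF that(1)] that(2)]
    by (auto intro!: derivative_eq_intros)
  have z: "0 \<in> {-\<epsilon>..\<epsilon>}" using \<epsilon> by simp
  have bI: "norm (I f t) \<le> R" if "f \<in> S" "t \<in> {-\<epsilon>..\<epsilon>}" for f t
  proof -
    have "norm (I f t - I f 0) \<le> M * \<bar>t - 0\<bar>"
      using that M by (intro vector_derivative_bound[OF dI _ z]) (auto simp: S_iff)
    also have "\<dots> \<le> M * \<epsilon>" using that M by (intro mult_left_mono) auto
    finally show ?thesis using \<epsilon> I0 by simp
  qed
  \<comment> \<open>Clamping the time turns curves on the interval into bounded continuous functions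
    on the whole line, the complete space in which Banach's theorem is applied.\<close>
  define cl where "cl = (\<lambda>t::real. max (-\<epsilon>) (min t \<epsilon>))"
  have cl: "cl t \<in> {-\<epsilon>..\<epsilon>}" for t using \<epsilon> by (auto simp: cl_def)
  have cl_id: "cl t = t" if "t \<in> {-\<epsilon>..\<epsilon>}" for t using that by (auto simp: cl_def)
  define T where "T = (\<lambda>f. Bcontfun (\<lambda>t. y0 + I f (cl t)))"
  have T: "apply_bcontfun (T f) t = y0 + I f (cl t)" if "f \<in> S" for f t
  proof -
    have "continuous_on {-\<epsilon>..\<epsilon>} (I f)"
      using dI[OF that] has_vector_derivative_continuous continuous_on_eq_continuous_within by blast
    moreover have "continuous_on UNIV cl"
      unfolding cl_def by (intro continuous_intros)
    ultimately have "continuous_on UNIV (\<lambda>t. I f (cl t))"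
      by (rule continuous_on_compose2) (use cl in blast)
    then have "continuous_on UNIV (\<lambda>t. y0 + I f (cl t))"
      by (intro continuous_on_add continuous_on_const)
    moreover have "norm (y0 + I f (cl t)) \<le> norm y0 + R" for t
      using norm_triangle_ineq[of y0 "I f (cl t)"] bI[OF that cl[of t]] by linarith
    ultimately have "(\<lambda>t. y0 + I f (cl t)) \<in> bcontfun"
      by (rule bcontfun_normI)
    then show ?thesis by (simp add: T_def Bcontfun_inverse)
  qed
  have "\<exists>!f\<in>S. T f = f"
  proof (rule Banach_fix[where c = "1 / 2"])
    show "complete S" unfolding S_def complete_eq_closed by (intro closed_PiC) simp
    have "const_bcontfun y0 \<in> S" using R by (simp add: S_iff)
    then show "S \<noteq> {}" by blast
    show "T ` S \<subseteq> S"
      using bI[OF _ cl] by (auto simp: S_iff[of "T _"] T dist_norm)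
    fix f g assume fg: "f \<in> S" "g \<in> S"
    show "dist (T f) (T g) \<le> 1 / 2 * dist f g"
    proof (rule dist_bound)
      fix t
      have "norm ((I f (cl t) - I g (cl t)) - (I f 0 - I g 0)) \<le> (L * dist f g) * \<bar>cl t - 0\<bar>"
      proof (rule vector_derivative_bound[OF _ _ z cl, of "\<lambda>t. I f t - I g t"])
        fix t assume t: "t \<in> {-\<epsilon>..\<epsilon>}"
        show "((\<lambda>t. I f t - I g t) has_vector_derivative V (f t) - V (g t)) (at t within {-\<epsilon>..\<epsilon>})"
          using fg t dI by (intro has_vector_derivative_diff) auto
        have "norm (V (f t) - V (g t)) \<le> L * norm (f t - g t)"
          using fg L(2) by (auto simp: S_iff)
        also have "\<dots> \<le> L * dist f g"
          using L(1) dist_bounded[of f t g] by (intro mult_left_mono) (auto simp: dist_norm)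
        finally show "norm (V (f t) - V (g t)) \<le> L * dist f g" .
      qed
      also have "\<dots> \<le> (L * dist f g) * \<epsilon>"
        using cl[of t] L by (intro mult_left_mono) auto
      also have "\<dots> = (L * \<epsilon>) * dist f g" by simp
      also have "\<dots> \<le> 1 / 2 * dist f g" using \<epsilon> by (intro mult_right_mono) auto
      finally show "dist (T f t) (T g t) \<le> 1 / 2 * dist f g"
        using fg by (simp add: T dist_norm I0)
    qed
  qed auto
  then obtain f where f: "f \<in> S" "T f = f" by blast
  have ft: "apply_bcontfun f t = y0 + I f t" if "t \<in> {-\<epsilon>..\<epsilon>}" for t
    using T[OF f(1), of t] f(2) cl_id[OF that] by simp
  show thesis
  proof (rule that[of \<epsilon> "apply_bcontfun f"])
    show "\<epsilon> > 0" by fact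
    show "apply_bcontfun f 0 = y0" using ft[OF z] I0 by simp
    fix t assume t: "t \<in> {-\<epsilon><..<\<epsilon>}"
    have "((\<lambda>t. y0 + I f t) has_vector_derivative V (f t)) (at t within {-\<epsilon>..\<epsilon>})"
      using t dI[OF f(1), of t] by (auto intro!: derivative_eq_intros)
    moreover have "at t within {-\<epsilon>..\<epsilon>} = at t"
      using t by (intro at_within_interior) auto
    ultimately have "((\<lambda>t. y0 + I f t) has_vector_derivative V (f t)) (at t)" by simp
    then have "(apply_bcontfun f has_vector_derivative V (f t)) (at t)"
      by (rule has_vector_derivative_transform_within_open[of _ _ _ "{-\<epsilon><..<\<epsilon>}"]) (use t ft in auto)
    then show "apply_bcontfun f t \<in> \<Omega> \<and> (apply_bcontfun f has_vector_derivative V (f t)) (at t)"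
      using f(1) R by (auto simp: S_iff)
  qed
qed

section \<open>Smooth maps of manifolds\<close>

text \<open>The part of \<open>smooth_atlas\<close> that does not mention transition maps. It is the
  part shown for \<open>prod_atlas\<close>, and it lets smoothness of real functions be tested in
  charts.\<close>

definition topological_atlas :: "('m::t2_space, 'e::euclidean_space) atlas \<Rightarrow> bool" where
  "topological_atlas A \<longleftrightarrow> (\<Union>(U, \<phi>)\<in>A. U) = UNIV \<and>
     (\<forall>(U, \<phi>)\<in>A. open U \<and> open (\<phi> ` U) \<and> homeomorphism U (\<phi> ` U) \<phi> (inv_into U \<phi>))"

lemma smooth_atlas_imp_topological: "smooth_atlas A \<Longrightarrow> topological_atlas A"
  by (auto simp: smooth_atlas_def topological_atlas_def)

lemma topological_atlasE:
  assumes "topological_atlas A"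
  obtains U \<phi> where "(U, \<phi>) \<in> A" "p \<in> U"
proof -
  have "p \<in> (\<Union>(U, \<phi>)\<in>A. U)"
    using assms by (simp add: topological_atlas_def)
  then show thesis using that by auto
qed

lemma topological_atlas_chart:
  assumes "topological_atlas A" "(U, \<phi>) \<in> A"
  shows "open U" "open (\<phi> ` U)" "homeomorphism U (\<phi> ` U) \<phi> (inv_into U \<phi>)"
    "inj_on \<phi> U" "continuous_on U \<phi>" "continuous_on (\<phi> ` U) (inv_into U \<phi>)"
proof -
  show *: "open U" "open (\<phi> ` U)" "homeomorphism U (\<phi> ` U) \<phi> (inv_into U \<phi>)"
    using assms unfolding topological_atlas_def by auto
  show "inj_on \<phi> U"
    using *(3) by (metis homeomorphism_def inj_on_inverseI)
  show "continuous_on U \<phi>" "continuous_on (\<phi> ` U) (inv_into U \<phi>)"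
    using *(3) by (auto simp: homeomorphism_def)
qed

lemma chart_image_open:
  assumes "topological_atlas A" "(U, \<phi>) \<in> A" "open W"
  shows "open (\<phi> ` (U \<inter> W))"
proof -
  note c = topological_atlas_chart[OF assms(1,2)]
  have "openin (top_of_set U) (U \<inter> W)"
    using assms(3) by (simp add: openin_open_Int)
  then have "openin (top_of_set (\<phi> ` U)) (\<phi> ` (U \<inter> W))"
    using c(3) homeomorphism_imp_open_map by blast
  then show ?thesis using c(2) openin_open_trans by blast
qed

lemma chart_preimage_open:
  assumes "topological_atlas A" "(U, \<phi>) \<in> A" "open W"
  shows "open (U \<inter> \<phi> -` W)"
  using continuous_open_preimage[OF topological_atlas_chart(5,1)[OF assms(1,2)] assms(3)] .

text \<open>The continuity demanded by \<open>smooth_map\<close> follows from smoothness in the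
  charts, whose open domains cover the manifold.\<close>

lemma smooth_fun_iff:
  assumes "topological_atlas A"
  shows "smooth_fun A f \<longleftrightarrow> (\<forall>(U, \<phi>)\<in>A. smooth_on (\<phi> ` U) (f \<circ> inv_into U \<phi>))"
proof
  assume "smooth_fun A f"
  then show "\<forall>(U, \<phi>)\<in>A. smooth_on (\<phi> ` U) (f \<circ> inv_into U \<phi>)"
    by (auto simp: smooth_fun_def smooth_map_def euclid_atlas_def o_def)
next
  assume R: "\<forall>(U, \<phi>)\<in>A. smooth_on (\<phi> ` U) (f \<circ> inv_into U \<phi>)"
  have "isCont f p" for p
  proof -
    obtain U \<phi> where U: "(U, \<phi>) \<in> A" "p \<in> U"
      using assms by (rule topological_atlasE)
    note c = topological_atlas_chart[OF assms U(1)]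
    have "continuous_on (\<phi> ` U) (f \<circ> inv_into U \<phi>)"
      using R U(1) by (intro smooth_on_continuous_on) auto
    then have "continuous_on U ((f \<circ> inv_into U \<phi>) \<circ> \<phi>)"
      using c(5) by (rule continuous_on_compose[rotated])
    then have "continuous_on U f"
      by (rule continuous_on_eq) (use c(4) in simp)
    then show ?thesis
      using c(1) U(2) continuous_on_eq_continuous_at by blast
  qed
  then have "continuous_on UNIV f"
    by (simp add: continuous_at_imp_continuous_on)
  with R show "smooth_fun A f"
    by (auto simp: smooth_fun_def smooth_map_def euclid_atlas_def o_def)
qed

lemma smooth_fun_continuous: "smooth_fun A f \<Longrightarrow> continuous_on UNIV f"
  by (simp add: smooth_fun_def smooth_map_def)

context
  fixes A :: "('m::t2_space, 'e::euclidean_space) atlas"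
  assumes A: "topological_atlas A"
begin

lemma smooth_fun_const: "smooth_fun A (\<lambda>p. c)"
  by (auto simp: smooth_fun_iff[OF A] o_def)

lemma smooth_fun_add: "smooth_fun A f \<Longrightarrow> smooth_fun A g \<Longrightarrow> smooth_fun A (\<lambda>p. f p + g p)"
  using topological_atlas_chart(2)[OF A]
  by (fastforce simp: smooth_fun_iff[OF A] o_def intro!: smooth_on_add)

lemma smooth_fun_mult: "smooth_fun A f \<Longrightarrow> smooth_fun A g \<Longrightarrow> smooth_fun A (\<lambda>p. f p * g p)"
  using topological_atlas_chart(2)[OF A]
  by (fastforce simp: smooth_fun_iff[OF A] o_def intro!: smooth_on_mult)

lemma smooth_fun_cmul: "smooth_fun A f \<Longrightarrow> smooth_fun A (\<lambda>p. c * f p)"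
  by (intro smooth_fun_mult smooth_fun_const)

lemma smooth_fun_sum: "(\<And>i. i \<in> I \<Longrightarrow> smooth_fun A (f i)) \<Longrightarrow> smooth_fun A (\<lambda>p. \<Sum>i\<in>I. f i p)"
  by (induction I rule: infinite_finite_induct) (auto simp: smooth_fun_const smooth_fun_add)

lemma smooth_fun_compose:
  assumes B: "topological_atlas B" and F: "smooth_map A B F" and f: "smooth_fun B f"
  shows "smooth_fun A (\<lambda>p. f (F p))"
  unfolding smooth_fun_iff[OF A]
proof (clarify, rule smooth_on_local)
  fix U \<phi> y assume U: "(U, \<phi>) \<in> A" "y \<in> \<phi> ` U"
  then obtain p where p: "p \<in> U" "y = \<phi> p" by blast
  obtain V \<psi> where V: "(V, \<psi>) \<in> B" "F p \<in> V"
    using B by (rule topological_atlasE)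
  let ?T = "\<phi> ` (U \<inter> F -` V)"
  note c = topological_atlas_chart[OF A U(1)] and d = topological_atlas_chart[OF B V(1)]
  have "open (F -` V)"
    using F d(1) by (simp add: smooth_map_def continuous_on_open_vimage)
  then have T: "open ?T" using chart_image_open[OF A U(1)] by blast
  have s1: "smooth_on ?T (\<lambda>y. \<psi> (F (inv_into U \<phi> y)))"
    using F U V by (fastforce simp: smooth_map_def o_def)
  have s2: "smooth_on (\<psi> ` V) (\<lambda>z. f (inv_into V \<psi> z))"
    using f V by (fastforce simp: smooth_fun_iff[OF B] o_def)
  have "smooth_on ?T (\<lambda>y. f (inv_into V \<psi> (\<psi> (F (inv_into U \<phi> y)))))"
    by (rule smooth_on_compose[OF T s1 s2]) (use c(4) in auto)
  then have "smooth_on ?T ((\<lambda>p. f (F p)) \<circ> inv_into U \<phi>)"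
    by (rule smooth_on_cong[OF T, THEN iffD1, rotated]) (use c(4) d(4) in \<open>auto simp: o_def\<close>)
  then show "\<exists>T. open T \<and> y \<in> T \<and> smooth_on T ((\<lambda>p. f (F p)) \<circ> inv_into U \<phi>)"
    using T p V by blast
qed

end

section \<open>Product atlases and extension by cut-off functions\<close>

lemma topological_atlas_prod:
  assumes A: "topological_atlas A" and B: "topological_atlas B"
  shows "topological_atlas (prod_atlas A B)"
proof -
  have cover: "\<exists>W \<theta>. (W, \<theta>) \<in> prod_atlas A B \<and> x \<in> W" for x
  proof -
    obtain U \<phi> where "(U, \<phi>) \<in> A" "fst x \<in> U" using A by (rule topological_atlasE)
    moreover obtain V \<psi> where "(V, \<psi>) \<in> B" "snd x \<in> V" using B by (rule topological_atlasE)
    ultimately have "(U \<times> V, \<lambda>(p, q). (\<phi> p, \<psi> q)) \<in> prod_atlas A B" "x \<in> U \<times> V"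
      unfolding prod_atlas_def by (auto simp: mem_Times_iff)
    then show ?thesis by blast
  qed
  have "open W \<and> open (\<theta> ` W) \<and> homeomorphism W (\<theta> ` W) \<theta> (inv_into W \<theta>)"
    if W: "(W, \<theta>) \<in> prod_atlas A B" for W \<theta>
  proof -
    obtain U \<phi> V \<psi> where *: "(U, \<phi>) \<in> A" "(V, \<psi>) \<in> B" "W = U \<times> V" "\<theta> = (\<lambda>(p, q). (\<phi> p, \<psi> q))"
      using W unfolding prod_atlas_def by blast
    note c = topological_atlas_chart[OF A *(1)] and d = topological_atlas_chart[OF B *(2)]
    have im: "\<theta> ` W = \<phi> ` U \<times> \<psi> ` V" using * by force
    have inv: "inv_into W \<theta> z = (inv_into U \<phi> (fst z), inv_into V \<psi> (snd z))" if "z \<in> \<theta> ` W" for z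
    proof -
      from that obtain p q where pq: "p \<in> U" "q \<in> V" "z = (\<phi> p, \<psi> q)" using * by auto
      have "inj_on \<theta> W" using c(4) d(4) * by (auto simp: inj_on_def)
      then have "inv_into W \<theta> (\<theta> (p, q)) = (p, q)" using pq * by (intro inv_into_f_f) auto
      then show ?thesis using pq * c(4) d(4) by simp
    qed
    have "homeomorphism W (\<theta> ` W) \<theta> (inv_into W \<theta>)"
    proof (rule homeomorphismI)
      show "continuous_on W \<theta>"
        unfolding * case_prod_beta using c(5) d(5)
        by (intro continuous_on_Pair continuous_on_compose2[of U \<phi> _ fst] continuous_on_compose2[of V \<psi> _ snd])
          (auto intro: continuous_intros)
      have "continuous_on (\<theta> ` W) (\<lambda>z. (inv_into U \<phi> (fst z), inv_into V \<psi> (snd z)))"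
        unfolding im using c(6) d(6)
        by (intro continuous_on_Pair continuous_on_compose2[of "\<phi> ` U" "inv_into U \<phi>" _ fst]
            continuous_on_compose2[of "\<psi> ` V" "inv_into V \<psi>" _ snd])
          (auto intro: continuous_intros)
      then show "continuous_on (\<theta> ` W) (inv_into W \<theta>)"
        by (rule continuous_on_eq) (simp add: inv)
    qed (use inv c(4) d(4) * in \<open>auto simp: f_inv_into_f inv_into_into\<close>)
    then show ?thesis using c d * im by (simp add: open_Times)
  qed
  then show ?thesis using cover unfolding topological_atlas_def by fast
qed

text \<open>Multiplication by a bump function in the chart. The neighbourhood \<open>N\<close> is
  chosen before \<open>g\<close>, so that one \<open>N\<close> serves all components of the chart at
  once.\<close>

lemma smooth_atlas_extension:
  fixes A :: "('m::t2_space, 'e::euclidean_space) atlas"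
  assumes A: "smooth_atlas A" and U: "(U, \<phi>) \<in> A" and W: "open W" and p: "p \<in> U \<inter> W"
  obtains N where "open N" "p \<in> N" "N \<subseteq> U \<inter> W"
    "\<And>g :: 'e \<Rightarrow> real. smooth_on (\<phi> ` U) g \<Longrightarrow>
       \<exists>f. smooth_fun A f \<and> (\<forall>q\<in>N. f q = g (\<phi> q)) \<and> (\<forall>q. q \<notin> U \<inter> W \<longrightarrow> f q = 0)"
proof -
  have A': "topological_atlas A" using A by (rule smooth_atlas_imp_topological)
  note c = topological_atlas_chart[OF A' U]
  obtain R where R: "R > 0" "cball (\<phi> p) R \<subseteq> \<phi> ` (U \<inter> W)"
    using chart_image_open[OF A' U W] p open_contains_cball by blast
  obtain \<beta> :: "'e \<Rightarrow> real" where \<beta>: "smooth_on UNIV \<beta>"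
    "\<And>y. y \<in> cball (\<phi> p) (R / 3) \<Longrightarrow> \<beta> y = 1" "\<And>y. y \<notin> ball (\<phi> p) (2 * R / 3) \<Longrightarrow> \<beta> y = 0"
    using smooth_bump[of "R / 3" "2 * R / 3"] R(1) by auto
  let ?N = "U \<inter> \<phi> -` ball (\<phi> p) (R / 3)"
  \<comment> \<open>A compact set outside which the extension vanishes. It is closed because the
    manifold is Hausdorff, so its complement is a neighbourhood of every point outside
    \<open>U\<close>.\<close>
  define K where "K = inv_into U \<phi> ` cball (\<phi> p) (2 * R / 3)"
  have sub: "cball (\<phi> p) (2 * R / 3) \<subseteq> \<phi> ` (U \<inter> W)"
    using R by (auto simp: subset_iff)
  then have "continuous_on (cball (\<phi> p) (2 * R / 3)) (inv_into U \<phi>)"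
    by (intro continuous_on_subset[OF c(6)]) blast
  then have "closed K"
    unfolding K_def by (intro compact_imp_closed compact_continuous_image compact_cball)
  have inW: "q \<in> W" if "q \<in> U" "\<phi> q \<in> cball (\<phi> p) (2 * R / 3)" for q
    using sub that c(4) by (smt (verit) Int_iff image_iff inj_onD subsetD)
  show thesis
  proof (rule that[of ?N])
    show "open ?N" by (intro chart_preimage_open[OF A' U] open_ball)
    show "p \<in> ?N" using p R by simp
    show "?N \<subseteq> U \<inter> W" using inW R by (auto simp: subset_iff)
    fix g :: "'e \<Rightarrow> real" assume g: "smooth_on (\<phi> ` U) g"
    define f where "f q = (if q \<in> U then \<beta> (\<phi> q) * g (\<phi> q) else 0)" for q
    have bg: "smooth_on (\<phi> ` U) (\<lambda>y. \<beta> y * g y)"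
      using c(2) g smooth_on_subset[OF \<beta>(1)] by (intro smooth_on_mult) auto
    have "smooth_fun A f"
      unfolding smooth_fun_iff[OF A']
    proof (clarify, rule smooth_on_local)
      fix V \<psi> y assume V: "(V, \<psi>) \<in> A" "y \<in> \<psi> ` V"
      then obtain q where q: "q \<in> V" "y = \<psi> q" by blast
      note d = topological_atlas_chart[OF A' V(1)]
      show "\<exists>T. open T \<and> y \<in> T \<and> smooth_on T (f \<circ> inv_into V \<psi>)"
      proof (cases "q \<in> U")
        case True
        let ?T = "\<psi> ` (V \<inter> U)"
        have T: "open ?T" by (rule chart_image_open[OF A' V(1) c(1)])
        have tr: "smooth_on ?T (\<lambda>y. \<phi> (inv_into V \<psi> y))"
          using A U V unfolding smooth_atlas_def by (fastforce simp: o_def)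
        have "smooth_on ?T (\<lambda>y. \<beta> (\<phi> (inv_into V \<psi> y)) * g (\<phi> (inv_into V \<psi> y)))"
          by (rule smooth_on_compose[OF T tr bg]) (use d(4) in auto)
        then have "smooth_on ?T (f \<circ> inv_into V \<psi>)"
          by (rule smooth_on_cong[OF T, THEN iffD1, rotated]) (use d(4) in \<open>auto simp: f_def\<close>)
        then show ?thesis using T q True by blast
      next
        case False
        let ?T = "\<psi> ` (V \<inter> - K)"
        have T: "open ?T"
          using \<open>closed K\<close> by (intro chart_image_open[OF A' V(1)]) auto
        have zero: "f q' = 0" if "q' \<notin> K" for q'
        proof (cases "q' \<in> U")
          case True
          then have "\<phi> q' \<notin> cball (\<phi> p) (2 * R / 3)"
            using that c(4) unfolding K_def by (metis image_eqI inv_into_f_f)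
          then have "\<beta> (\<phi> q') = 0" by (intro \<beta>(3)) auto
          then show ?thesis by (simp add: f_def)
        qed (simp add: f_def)
        have "smooth_on ?T (f \<circ> inv_into V \<psi>)"
          by (rule smooth_on_cong[OF T, THEN iffD1, rotated, OF smooth_on_const[of _ 0]])
            (use d(4) zero in auto)
        moreover have "q \<notin> K"
        proof
          assume "q \<in> K"
          then obtain z where z: "z \<in> cball (\<phi> p) (2 * R / 3)" "q = inv_into U \<phi> z"
            unfolding K_def by blast
          then have "z \<in> \<phi> ` U" using sub by blast
          then show False using z(2) False inv_into_into by metis
        qed
        ultimately show ?thesis using T q by blast
      qed
    qed
    moreover have "f q = g (\<phi> q)" if "q \<in> ?N" for q
      using that \<beta>(2)[of "\<phi> q"] by (simp add: f_def)
    moreover have "f q = 0" if "q \<notin> U \<inter> W" for q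
    proof (cases "q \<in> U")
      case True
      then have "\<phi> q \<notin> cball (\<phi> p) (2 * R / 3)" using inW that by blast
      then have "\<beta> (\<phi> q) = 0" by (intro \<beta>(3)) auto
      then show ?thesis by (simp add: f_def)
    qed (simp add: f_def)
    ultimately show "\<exists>f. smooth_fun A f \<and> (\<forall>q\<in>?N. f q = g (\<phi> q)) \<and> (\<forall>q. q \<notin> U \<inter> W \<longrightarrow> f q = 0)"
      by blast
  qed
qed

lemma smooth_fun_bump:
  fixes A :: "('m::t2_space, 'e::euclidean_space) atlas"
  assumes A: "smooth_atlas A" and W: "open W" "p \<in> W"
  obtains f where "smooth_fun A f" "f p = 1" "\<And>q. q \<notin> W \<Longrightarrow> f q = 0"
proof -
  obtain U \<phi> where U: "(U, \<phi>) \<in> A" "p \<in> U"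
    using smooth_atlas_imp_topological[OF A] by (rule topological_atlasE)
  obtain N where "p \<in> N" "\<And>g :: 'e \<Rightarrow> real. smooth_on (\<phi> ` U) g \<Longrightarrow>
       \<exists>f. smooth_fun A f \<and> (\<forall>q\<in>N. f q = g (\<phi> q)) \<and> (\<forall>q. q \<notin> U \<inter> W \<longrightarrow> f q = 0)"
    by (rule smooth_atlas_extension[OF A U(1) W(1), of p]) (use U(2) W(2) in auto)
  from this(2)[OF smooth_on_const[of _ 1]] this(1) that show thesis by blast
qed

text \<open>Global smooth functions replace charts, because tangent vectors act on them only.\<close>

definition smooth_into :: "('m::t2_space, 'e::euclidean_space) atlas \<Rightarrow> 'a::euclidean_space set \<Rightarrow> ('a \<Rightarrow> 'm) \<Rightarrow> bool" where
  "smooth_into A S \<phi> \<longleftrightarrow> (\<forall>f. smooth_fun A f \<longrightarrow> smooth_on S (\<lambda>x. f (\<phi> x)))"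

lemma smooth_intoD: "smooth_into A S \<phi> \<Longrightarrow> smooth_fun A f \<Longrightarrow> smooth_on S (\<lambda>x. f (\<phi> x))"
  by (simp add: smooth_into_def)

lemma smooth_into_subset: "smooth_into A S \<phi> \<Longrightarrow> T \<subseteq> S \<Longrightarrow> smooth_into A T \<phi>"
  by (meson smooth_into_def smooth_on_subset)

lemma smooth_into_const: "smooth_into A S (\<lambda>x. p)"
  by (simp add: smooth_into_def)

lemma smooth_into_compose:
  "smooth_into A T \<phi> \<Longrightarrow> open S \<Longrightarrow> smooth_on S h \<Longrightarrow> h ` S \<subseteq> T \<Longrightarrow> smooth_into A S (\<lambda>x. \<phi> (h x))"
  unfolding smooth_into_def using smooth_on_compose by blast

lemma smooth_into_chart_inverse:
  "topological_atlas A \<Longrightarrow> (U, \<alpha>) \<in> A \<Longrightarrow> smooth_into A (\<alpha> ` U) (inv_into U \<alpha>)"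
  by (fastforce simp: smooth_into_def smooth_fun_iff o_def)

text \<open>Continuity of \<open>\<phi>\<close> comes out of smoothness against functions: a bump
  function turns a neighbourhood in the manifold into an open condition on a real function.\<close>

lemma smooth_into_nhd:
  fixes A :: "('m::t2_space, 'e::euclidean_space) atlas"
  assumes A: "smooth_atlas A" and S: "open S" "smooth_into A S \<phi>" "x \<in> S" and W: "open W" "\<phi> x \<in> W"
  obtains T where "open T" "x \<in> T" "T \<subseteq> S" "\<phi> ` T \<subseteq> W"
proof -
  obtain f where f: "smooth_fun A f" "f (\<phi> x) = 1" "\<And>q. q \<notin> W \<Longrightarrow> f q = 0"
    using smooth_fun_bump[OF A W] by blast
  have "continuous_on S (\<lambda>x. f (\<phi> x))"
    using smooth_intoD[OF S(2) f(1)] by (rule smooth_on_continuous_on)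
  then have "open (S \<inter> (\<lambda>x. f (\<phi> x)) -` {0<..})"
    using S(1) by (intro continuous_open_preimage) auto
  moreover have "\<phi> ` (S \<inter> (\<lambda>x. f (\<phi> x)) -` {0<..}) \<subseteq> W"
    using f(3) by force
  ultimately show thesis
    using S(3) f(2) by (intro that[of "S \<inter> (\<lambda>x. f (\<phi> x)) -` {0<..}"]) auto
qed

lemma smooth_into_continuous_on:
  fixes A :: "('m::t2_space, 'e::euclidean_space) atlas"
  assumes A: "smooth_atlas A" and S: "open S" "smooth_into A S \<phi>"
  shows "continuous_on S \<phi>"
proof -
  have "isCont \<phi> x" if "x \<in> S" for x
    unfolding continuous_at_open using smooth_into_nhd[OF A S that] by (metis image_subset_iff)
  then show ?thesis by (simp add: continuous_at_imp_continuous_on)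
qed

text \<open>The components of the chart, cut off near \<open>\<phi> x\<close>, are globally defined
  smooth functions and may therefore be composed with \<open>\<phi>\<close>.\<close>

lemma smooth_into_chart:
  fixes A :: "('m::t2_space, 'e::euclidean_space) atlas"
  assumes A: "smooth_atlas A" and S: "open S" "smooth_into A S \<phi>" "x \<in> S"
    and U: "(U, \<alpha>) \<in> A" "\<phi> x \<in> U"
  obtains T where "open T" "x \<in> T" "T \<subseteq> S" "\<phi> ` T \<subseteq> U" "smooth_on T (\<lambda>x. \<alpha> (\<phi> x))"
proof -
  obtain N where N: "open N" "\<phi> x \<in> N" "N \<subseteq> U \<inter> UNIV"
    "\<And>g :: 'e \<Rightarrow> real. smooth_on (\<alpha> ` U) g \<Longrightarrow>
       \<exists>f. smooth_fun A f \<and> (\<forall>q\<in>N. f q = g (\<alpha> q)) \<and> (\<forall>q. q \<notin> U \<inter> UNIV \<longrightarrow> f q = 0)"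
    by (rule smooth_atlas_extension[OF A U(1) open_UNIV, of "\<phi> x"]) (use U(2) in auto)
  have "\<exists>f. smooth_fun A f \<and> (\<forall>q\<in>N. f q = \<alpha> q \<bullet> b)" for b
    using N(4)[OF smooth_on_linear[OF bounded_linear_inner_left, of _ b]] by blast
  then obtain f where f: "\<And>b. smooth_fun A (f b)" "\<And>b q. q \<in> N \<Longrightarrow> f b q = \<alpha> q \<bullet> b"
    by metis
  obtain T where T: "open T" "x \<in> T" "T \<subseteq> S" "\<phi> ` T \<subseteq> N"
    using smooth_into_nhd[OF A S N(1,2)] by blast
  have "smooth_on T (\<lambda>x. \<Sum>b\<in>Basis. f b (\<phi> x) *\<^sub>R b)"
    using smooth_intoD[OF smooth_into_subset[OF S(2) T(3)] f(1)] T(1)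
    by (intro smooth_on_sum smooth_on_scaleR) auto
  then have "smooth_on T (\<lambda>x. \<alpha> (\<phi> x))"
    by (rule smooth_on_cong[OF T(1), THEN iffD1, rotated])
      (use T(4) f(2) in \<open>auto simp: image_subset_iff euclidean_representation\<close>)
  then show thesis using T N(3) that by blast
qed

text \<open>The group multiplication is smooth with respect to the product atlas; this lemma
  converts that into smoothness of products of two maps in the sense of
  \<open>smooth_into\<close>.\<close>

lemma smooth_on_prod_atlas:
  fixes A :: "('m::t2_space, 'e::euclidean_space) atlas"
  assumes A: "smooth_atlas A" and S: "open S" "smooth_into A S \<phi>" "smooth_into A S \<psi>"
    and H: "smooth_fun (prod_atlas A A) H"
  shows "smooth_on S (\<lambda>x. H (\<phi> x, \<psi> x))"
proof (rule smooth_on_local)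
  fix x assume x: "x \<in> S"
  have A': "topological_atlas A" using A by (rule smooth_atlas_imp_topological)
  obtain U \<alpha> where U: "(U, \<alpha>) \<in> A" "\<phi> x \<in> U" using A' by (rule topological_atlasE)
  obtain V \<beta> where V: "(V, \<beta>) \<in> A" "\<psi> x \<in> V" using A' by (rule topological_atlasE)
  obtain T1 where T1: "open T1" "x \<in> T1" "T1 \<subseteq> S" "\<phi> ` T1 \<subseteq> U" "smooth_on T1 (\<lambda>x. \<alpha> (\<phi> x))"
    using smooth_into_chart[OF A S(1,2) x U] by blast
  obtain T2 where T2: "open T2" "x \<in> T2" "T2 \<subseteq> S" "\<psi> ` T2 \<subseteq> V" "smooth_on T2 (\<lambda>x. \<beta> (\<psi> x))"
    using smooth_into_chart[OF A S(1,3) x V] by blast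
  let ?\<theta> = "\<lambda>(p, q). (\<alpha> p, \<beta> q)" and ?W = "U \<times> V" and ?T = "T1 \<inter> T2"
  have W: "(?W, ?\<theta>) \<in> prod_atlas A A" using U V unfolding prod_atlas_def by blast
  note pa = topological_atlas_prod[OF A' A']
  have inj: "inj_on ?\<theta> ?W" using topological_atlas_chart(4)[OF pa W] .
  have s1: "smooth_on (?\<theta> ` ?W) (H \<circ> inv_into ?W ?\<theta>)"
    using H W unfolding smooth_fun_iff[OF pa] by blast
  have oT: "open ?T" using T1 T2 by auto
  have s2: "smooth_on ?T (\<lambda>x. (\<alpha> (\<phi> x), \<beta> (\<psi> x)))"
    using smooth_on_subset[OF T1(5)] smooth_on_subset[OF T2(5)] by (intro smooth_on_Pair oT) auto
  have "smooth_on ?T (\<lambda>x. (H \<circ> inv_into ?W ?\<theta>) (\<alpha> (\<phi> x), \<beta> (\<psi> x)))"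
    by (rule smooth_on_compose[OF oT s2 s1]) (use T1(4) T2(4) in \<open>force simp: image_subset_iff\<close>)
  then have "smooth_on ?T (\<lambda>x. H (\<phi> x, \<psi> x))"
  proof (rule smooth_on_cong[OF oT, THEN iffD1, rotated])
    fix x assume "x \<in> ?T"
    then have "(\<phi> x, \<psi> x) \<in> ?W" using T1(4) T2(4) by auto
    then have "inv_into ?W ?\<theta> (?\<theta> (\<phi> x, \<psi> x)) = (\<phi> x, \<psi> x)"
      using inj by (intro inv_into_f_f)
    then show "(H \<circ> inv_into ?W ?\<theta>) (\<alpha> (\<phi> x), \<beta> (\<psi> x)) = H (\<phi> x, \<psi> x)" by simp
  qed
  then show "\<exists>T. open T \<and> x \<in> T \<and> smooth_on T (\<lambda>x. H (\<phi> x, \<psi> x))"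
    using oT T1(2) T2(2) by blast
qed

text \<open>The value 0 off the smooth functions is the normalisation built into
  \<open>tangent_space\<close>.\<close>

lemma derivative_in_tangent_space:
  assumes "topological_atlas A" "smooth_into A S \<phi>" "x \<in> S"
  shows "(\<lambda>f. if smooth_fun A f then frechet_derivative (\<lambda>x. f (\<phi> x)) (at x) b else 0) \<in> tangent_space A (\<phi> x)"
proof -
  have d: "((\<lambda>x. f (\<phi> x)) has_derivative frechet_derivative (\<lambda>x. f (\<phi> x)) (at x)) (at x)"
    if "smooth_fun A f" for f
    using smooth_on_has_derivative smooth_intoD[OF assms(2) that] assms(3) by blast
  have 1: "frechet_derivative (\<lambda>x. c * f (\<phi> x)) (at x) b = c * frechet_derivative (\<lambda>x. f (\<phi> x)) (at x) b"
    if "smooth_fun A f" for f c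
    by (subst frechet_derivative_eq[OF has_derivative_mult_right[OF d[OF that]]]) simp
  have 2: "frechet_derivative (\<lambda>x. f (\<phi> x) + g (\<phi> x)) (at x) b =
     frechet_derivative (\<lambda>x. f (\<phi> x)) (at x) b + frechet_derivative (\<lambda>x. g (\<phi> x)) (at x) b"
    if "smooth_fun A f" "smooth_fun A g" for f g
    by (subst frechet_derivative_eq[OF has_derivative_add[OF d[OF that(1)] d[OF that(2)]]]) simp
  have 3: "frechet_derivative (\<lambda>x. f (\<phi> x) * g (\<phi> x)) (at x) b =
     frechet_derivative (\<lambda>x. f (\<phi> x)) (at x) b * g (\<phi> x) + f (\<phi> x) * frechet_derivative (\<lambda>x. g (\<phi> x)) (at x) b"
    if "smooth_fun A f" "smooth_fun A g" for f g
    by (subst frechet_derivative_eq[OF has_derivative_mult[OF d[OF that(1)] d[OF that(2)]]]) simp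
  show ?thesis
    unfolding tangent_space_def using 1 2 3
    by (simp add: smooth_fun_cmul[OF assms(1)] smooth_fun_add[OF assms(1)] smooth_fun_mult[OF assms(1)])
qed

lemma sum_fun_apply: "(\<Sum>i\<in>I. f i) x = (\<Sum>i\<in>I. f i x)"
  by (induction I rule: infinite_finite_induct) auto

section \<open>Graded Lie groups\<close>

locale graded_frame =
  fixes mul :: "'g::{t2_space, second_countable_topology} \<Rightarrow> 'g \<Rightarrow> 'g"
    and e :: 'g
    and iv :: "'g \<Rightarrow> 'g"
    and A :: "('g, real^'n::{finite, linorder}) atlas"
    and gr :: "nat \<Rightarrow> 'g tangent set"
    and r :: nat
    and w :: "'n \<Rightarrow> nat"
    and \<xi> :: "'n \<Rightarrow> 'g tangent"
    and X :: "'n \<Rightarrow> 'g vfield"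
  assumes G: "graded_nilpotent_lie_group mul e iv A gr r"
    and w: "w = carnot_weight (carnot_filtration mul gr) e"
    and basis: "graded_basis e A gr w \<xi>"
    and X_smooth: "\<And>j. smooth_vfield A (X j)"
    and X_inv: "\<And>j. left_invariant mul (X j)"
    and X_e: "\<And>j. X j e = \<xi> j"
begin

lemma lie: "lie_group mul e iv A"
  and grading: "lie_grading mul e A gr r"
  and conn: "connected (UNIV :: 'g set)"
  and simply_conn: "simply_connected (UNIV :: 'g set)"
  using G by (auto simp: graded_nilpotent_lie_group_def)

sublocale group mul e iv
  using lie lie_group_def by blast

lemma smooth_A: "smooth_atlas A"
  and mul_smooth: "smooth_map (prod_atlas A A) A (\<lambda>(p, q). mul p q)"
  and iv_smooth: "smooth_map A A iv"
  using lie by (auto simp: lie_group_def lie_group_axioms_def)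

lemma top_A: "topological_atlas A"
  using smooth_A by (rule smooth_atlas_imp_topological)

lemma mul_iv_cancel [simp]: "mul p (mul (iv p) q) = q" "mul (iv p) (mul p q) = q"
  by (simp_all flip: assoc)

lemma iv_mul: "iv (mul p q) = mul (iv q) (iv p)"
  by (rule inverse_distrib_swap)

section \<open>Translations and left-invariant fields\<close>

lemma smooth_fun_mul: "smooth_fun A f \<Longrightarrow> smooth_fun (prod_atlas A A) (\<lambda>(p, q). f (mul p q))"
  using smooth_fun_compose[OF topological_atlas_prod[OF top_A top_A] top_A mul_smooth]
  by (simp add: case_prod_beta')

lemma smooth_into_mul:
  assumes "open S" "smooth_into A S \<phi>" "smooth_into A S \<psi>"
  shows "smooth_into A S (\<lambda>x. mul (\<phi> x) (\<psi> x))"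
  unfolding smooth_into_def
  using smooth_on_prod_atlas[OF smooth_A assms smooth_fun_mul] by auto

lemma smooth_into_iv: "smooth_into A S \<phi> \<Longrightarrow> smooth_into A S (\<lambda>x. iv (\<phi> x))"
  unfolding smooth_into_def using smooth_fun_compose[OF top_A top_A iv_smooth] by blast

lemma smooth_into_chart_inv: "(U, \<alpha>) \<in> A \<Longrightarrow> smooth_into A (\<alpha> ` U) (inv_into U \<alpha>)"
  by (rule smooth_into_chart_inverse[OF top_A])

lemma smooth_fun_left: "smooth_fun A f \<Longrightarrow> smooth_fun A (\<lambda>q. f (mul p q))"
  unfolding smooth_fun_iff[OF top_A, of "\<lambda>q. f (mul p q)"]
  using smooth_into_mul[OF topological_atlas_chart(2)[OF top_A] smooth_into_const smooth_into_chart_inv]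
  by (auto simp: smooth_into_def o_def)

lemma smooth_fun_right: "smooth_fun A f \<Longrightarrow> smooth_fun A (\<lambda>q. f (mul q p))"
  unfolding smooth_fun_iff[OF top_A, of "\<lambda>q. f (mul q p)"]
  using smooth_into_mul[OF topological_atlas_chart(2)[OF top_A] smooth_into_chart_inv smooth_into_const]
  by (auto simp: smooth_into_def o_def)

lemma smooth_fun_left_iff: "smooth_fun A (\<lambda>q. f (mul p q)) \<longleftrightarrow> smooth_fun A f"
  using smooth_fun_left[of f p] smooth_fun_left[of "\<lambda>q. f (mul p q)" "iv p"] by auto

text \<open>The left-invariant field with coordinates \<open>u\<close>, as an operator on functions:
  the point comes last, so that \<open>XX u (XX v f)\<close> is meaningful.\<close>

definition XX :: "(real, 'n) vec \<Rightarrow> ('g \<Rightarrow> real) \<Rightarrow> 'g \<Rightarrow> real" where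
  "XX u f p = (\<Sum>j\<in>UNIV. u $ j * X j p f)"

lemma X_tangent: "X j p \<in> tangent_space A p"
  using X_smooth by (simp add: smooth_vfield_def)

lemma XX_tangent: "(\<lambda>f. XX u f p) \<in> tangent_space A p"
  using X_tangent[of _ p] unfolding tangent_space_def XX_def
  by (simp add: sum_distrib_left sum_distrib_right sum.distrib[symmetric] algebra_simps)

lemma XX_smooth: "smooth_fun A f \<Longrightarrow> smooth_fun A (XX u f)"
  unfolding XX_def[abs_def] using X_smooth
  by (intro smooth_fun_sum[OF top_A] smooth_fun_cmul[OF top_A]) (simp add: smooth_vfield_def)

lemma XX_left: "XX u (\<lambda>q. f (mul p q)) q = XX u f (mul p q)"
proof -
  have "X j (mul p q) f = X j q (\<lambda>r. f (mul p r))" for j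
    using X_inv[of j] by (simp add: left_invariant_def left_translate_def)
  then show ?thesis by (simp add: XX_def)
qed

lemma XX_linear_left:
  "XX (u + v) f p = XX u f p + XX v f p" "XX (c *\<^sub>R u) f p = c * XX u f p" "XX 0 f p = 0"
  "XX (u - v) f p = XX u f p - XX v f p" "XX (- u) f p = - XX u f p"
  by (simp_all add: XX_def algebra_simps sum.distrib sum_distrib_left sum_subtractf sum_negf)

lemma XX_add: "smooth_fun A f \<Longrightarrow> smooth_fun A g \<Longrightarrow> XX u (\<lambda>q. f q + g q) p = XX u f p + XX u g p"
  using XX_tangent[of u p] by (simp add: tangent_space_def)

lemma XX_cmul: "smooth_fun A f \<Longrightarrow> XX u (\<lambda>q. c * f q) p = c * XX u f p"
  using XX_tangent[of u p] by (simp add: tangent_space_def)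

lemma XX_sum:
  "finite I \<Longrightarrow> (\<And>i. i \<in> I \<Longrightarrow> smooth_fun A (f i)) \<Longrightarrow> XX u (\<lambda>q. \<Sum>i\<in>I. f i q) p = (\<Sum>i\<in>I. XX u (f i) p)"
proof (induction I rule: finite_induct)
  case empty
  show ?case using XX_cmul[OF smooth_fun_const[OF top_A, of 1], of u 0 p] by simp
next
  case (insert i I)
  then show ?case
    using XX_add[OF _ smooth_fun_sum[OF top_A], of "f i" I f u p] by auto
qed

text \<open>If the vectors of values of the \<open>\<xi> j\<close> on smooth functions did not fill
  the coordinate space, a vector orthogonal to all of them would give a linear relation between the
  \<open>\<xi> j\<close>. The relation extends to all functions since derivations vanish on the
  non-smooth ones.\<close>

lemma ex_dual: "\<exists>F. (\<forall>i. smooth_fun A (F i)) \<and> (\<forall>i j. \<xi> j (F i) = (if i = j then 1 else 0))"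
proof -
  define ev where "ev f = (\<chi> j. \<xi> j f)" for f
  have tan: "\<xi> j \<in> tangent_space A e" for j
    using X_tangent[of j e] by (simp add: X_e)
  have ev_add: "ev (\<lambda>q. f q + g q) = ev f + ev g" if "smooth_fun A f" "smooth_fun A g" for f g
    using tan that by (simp add: ev_def vec_eq_iff tangent_space_def)
  have ev_mul: "ev (\<lambda>q. c * f q) = c *\<^sub>R ev f" if "smooth_fun A f" for f c
    using tan that by (simp add: ev_def vec_eq_iff tangent_space_def)
  let ?S = "ev ` {f. smooth_fun A f}"
  have sub: "subspace ?S"
    unfolding subspace_def
  proof (intro conjI ballI allI)
    have "ev (\<lambda>q. 0 * 1) = 0 *\<^sub>R ev (\<lambda>q. 1)" by (rule ev_mul[OF smooth_fun_const[OF top_A]])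
    then show "0 \<in> ?S"
      using smooth_fun_const[OF top_A, of 0] by (auto intro!: image_eqI[of _ _ "\<lambda>q. 0"])
  next
    fix x y assume "x \<in> ?S" "y \<in> ?S"
    then show "x + y \<in> ?S" using ev_add smooth_fun_add[OF top_A] by (smt (verit) image_iff mem_Collect_eq)
  next
    fix c x assume "x \<in> ?S"
    then show "c *\<^sub>R x \<in> ?S" using ev_mul smooth_fun_cmul[OF top_A] by (smt (verit) image_iff mem_Collect_eq)
  qed
  have "?S = UNIV"
  proof (rule ccontr)
    assume "?S \<noteq> UNIV"
    then have "span ?S \<noteq> UNIV" by (simp add: span_eq_iff[THEN iffD2, OF sub])
    then obtain a where a: "a \<noteq> 0" "\<forall>x \<in> span ?S. a \<bullet> x = 0"
      using orthogonal_to_subspace_exists_gen[of ?S UNIV] span_UNIV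
      by (metis orthogonal_def psubset_eq subset_UNIV inner_commute)
    have "(\<Sum>j\<in>UNIV. a $ j *\<^sub>R \<xi> j) = 0"
    proof
      fix f
      show "(\<Sum>j\<in>UNIV. a $ j *\<^sub>R \<xi> j) f = 0 f"
      proof (cases "smooth_fun A f")
        case True
        then have "ev f \<in> span ?S" by (simp add: span_base)
        then have "a \<bullet> ev f = 0" using a(2) by blast
        then show ?thesis
          by (simp add: inner_vec_def ev_def scaleR_fun_def sum_fun_apply)
      next
        case False
        then have "\<xi> j f = 0" for j using tan by (simp add: tangent_space_def)
        then show ?thesis by (simp add: scaleR_fun_def sum_fun_apply)
      qed
    qed
    moreover have "(\<Sum>j\<in>UNIV. a $ j *\<^sub>R \<xi> j) = (\<Sum>v\<in>range \<xi>. a $ (inv \<xi> v) *\<^sub>R v)"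
      using basis by (subst sum.reindex) (auto simp: graded_basis_def)
    ultimately have "a $ (inv \<xi> (\<xi> j)) = 0" for j
      using basis independentD[of "range \<xi>" "range \<xi>" "\<lambda>v. a $ inv \<xi> v" "\<xi> j"]
      by (auto simp: graded_basis_def)
    then have "a = 0" using basis by (simp add: graded_basis_def vec_eq_iff)
    with a(1) show False by blast
  qed
  then have "\<exists>f. smooth_fun A f \<and> ev f = axis i 1" for i
    by (metis (mono_tags, lifting) UNIV_I image_iff mem_Collect_eq)
  then obtain F where F: "\<And>i. smooth_fun A (F i)" "\<And>i. ev (F i) = axis i 1" by metis
  then have "\<xi> j (F i) = (if i = j then 1 else 0)" for i j
  proof -
    have "\<xi> j (F i) = ev (F i) $ j" by (simp add: ev_def)
    then show ?thesis by (simp add: F(2) axis_def)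
  qed
  with F(1) show ?thesis by blast
qed

definition dual :: "'n \<Rightarrow> 'g \<Rightarrow> real" where
  "dual = (SOME F. (\<forall>i. smooth_fun A (F i)) \<and> (\<forall>i j. \<xi> j (F i) = (if i = j then 1 else 0)))"

lemma dual_smooth: "smooth_fun A (dual i)"
  and dual_xi: "\<xi> j (dual i) = (if i = j then 1 else 0)"
  using someI_ex[OF ex_dual] by (auto simp: dual_def)

lemma XX_dual: "XX u (dual i) e = u $ i"
  by (simp add: XX_def X_e dual_xi if_distrib cong: if_cong)

lemma XX_dual_left: "XX u (\<lambda>q. dual i (mul (iv p) q)) p = u $ i"
  by (subst XX_left) (simp add: XX_dual)

lemma XX_eqD:
  assumes "\<And>f. smooth_fun A f \<Longrightarrow> XX u f p = XX v f p" shows "u = v"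
  using assms[OF smooth_fun_left[OF dual_smooth, where p = "iv p"]]
  by (simp add: vec_eq_iff XX_dual_left)

lemma span_xi: "v \<in> tangent_space A e \<Longrightarrow> \<exists>u. v = (\<Sum>j\<in>UNIV. u $ j *\<^sub>R \<xi> j)" for v
proof -
  assume v: "v \<in> tangent_space A e"
  let ?S = "{\<Sum>j\<in>UNIV. u $ j *\<^sub>R \<xi> j | u :: (real, 'n) vec. True}"
  have "subspace ?S"
    unfolding subspace_def
  proof (intro conjI ballI allI)
    have "0 = (\<Sum>j\<in>UNIV. (0 :: (real, 'n) vec) $ j *\<^sub>R \<xi> j)" by simp
    then show "0 \<in> ?S" by blast
  next
    fix x y assume "x \<in> ?S" "y \<in> ?S"
    then obtain u u' :: "(real, 'n) vec" where "x = (\<Sum>j\<in>UNIV. u $ j *\<^sub>R \<xi> j)" "y = (\<Sum>j\<in>UNIV. u' $ j *\<^sub>R \<xi> j)"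
      by blast
    then have "x + y = (\<Sum>j\<in>UNIV. (u + u') $ j *\<^sub>R \<xi> j)"
      by (simp add: scaleR_add_left sum.distrib)
    then show "x + y \<in> ?S" by blast
  next
    fix c x assume "x \<in> ?S"
    then obtain u :: "(real, 'n) vec" where "x = (\<Sum>j\<in>UNIV. u $ j *\<^sub>R \<xi> j)" by blast
    then have "c *\<^sub>R x = (\<Sum>j\<in>UNIV. (c *\<^sub>R u) $ j *\<^sub>R \<xi> j)"
      by (simp add: scaleR_sum_right)
    then show "c *\<^sub>R x \<in> ?S" by blast
  qed
  moreover have "range \<xi> \<subseteq> ?S"
  proof clarify
    fix i
    have "\<xi> i = (\<Sum>j\<in>UNIV. (axis i 1 :: (real, 'n) vec) $ j *\<^sub>R \<xi> j)"
      by (simp add: axis_def if_distrib if_distribR cong: if_cong)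
    then show "\<exists>u::(real, 'n) vec. \<xi> i = (\<Sum>j\<in>UNIV. u $ j *\<^sub>R \<xi> j) \<and> True" by blast
  qed
  ultimately have "span (range \<xi>) \<subseteq> ?S" by (rule span_minimal[rotated])
  with v basis show ?thesis by (auto simp: graded_basis_def)
qed

text \<open>Left translation moves the question to \<open>e\<close>, where the basis spans.\<close>

lemma tangent_eq_XX:
  assumes "v \<in> tangent_space A p" shows "\<exists>u. \<forall>f. v f = XX u f p"
proof -
  have "(\<lambda>f. v (\<lambda>q. f (mul (iv p) q))) \<in> tangent_space A e"
    using assms unfolding tangent_space_def by (simp add: smooth_fun_left_iff)
  then obtain u where u: "(\<lambda>f. v (\<lambda>q. f (mul (iv p) q))) = (\<Sum>j\<in>UNIV. u $ j *\<^sub>R \<xi> j)"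
    using span_xi by blast
  have "v f = XX u f p" for f
  proof -
    have "v f = XX u (\<lambda>q. f (mul p q)) e"
      using fun_cong[OF u, of "\<lambda>q. f (mul p q)"] by (simp add: scaleR_fun_def sum_fun_apply XX_def X_e)
    then show ?thesis by (simp add: XX_left)
  qed
  then show ?thesis by blast
qed

section \<open>Logarithmic derivatives\<close>

text \<open>The pullback of the left Maurer-Cartan form along \<open>\<phi>\<close>: the point
  \<open>\<phi> x\<close> is frozen and translated to \<open>e\<close>, where the differentials of
  the functions \<open>dual i\<close> are dual to the basis.\<close>

definition lder :: "('a::euclidean_space \<Rightarrow> 'g) \<Rightarrow> 'a \<Rightarrow> 'a \<Rightarrow> (real, 'n) vec" where
  "lder \<phi> x b = (\<chi> i. frechet_derivative (\<lambda>y. dual i (mul (iv (\<phi> x)) (\<phi> y))) (at x) b)"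

lemma lder_eqI:
  assumes "\<And>f. smooth_fun A f \<Longrightarrow> frechet_derivative (\<lambda>y. f (\<phi> y)) (at x) b = XX u f (\<phi> x)"
  shows "lder \<phi> x b = u"
  using assms[OF smooth_fun_left[OF dual_smooth, where p = "iv (\<phi> x)"]]
  by (simp add: lder_def vec_eq_iff XX_dual_left)

lemma lder:
  assumes "smooth_into A S \<phi>" "x \<in> S" "smooth_fun A f"
  shows "frechet_derivative (\<lambda>y. f (\<phi> y)) (at x) b = XX (lder \<phi> x b) f (\<phi> x)"
proof -
  obtain u where u: "\<And>f. (if smooth_fun A f then frechet_derivative (\<lambda>x. f (\<phi> x)) (at x) b else 0) = XX u f (\<phi> x)"
    using tangent_eq_XX[OF derivative_in_tangent_space[OF top_A assms(1,2), of b]] by blast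
  have *: "frechet_derivative (\<lambda>y. f (\<phi> y)) (at x) b = XX u f (\<phi> x)" if "smooth_fun A f" for f
    using u[of f] that by simp
  then have "lder \<phi> x b = u" by (rule lder_eqI)
  with * assms(3) show ?thesis by simp
qed

lemma has_derivative_lder:
  assumes "smooth_into A S \<phi>" "x \<in> S" "smooth_fun A f"
  shows "((\<lambda>y. f (\<phi> y)) has_derivative (\<lambda>b. XX (lder \<phi> x b) f (\<phi> x))) (at x)"
proof -
  have "((\<lambda>y. f (\<phi> y)) has_derivative frechet_derivative (\<lambda>y. f (\<phi> y)) (at x)) (at x)"
    using smooth_on_has_derivative[OF smooth_intoD[OF assms(1,3)] assms(2)] .
  moreover have "frechet_derivative (\<lambda>y. f (\<phi> y)) (at x) = (\<lambda>b. XX (lder \<phi> x b) f (\<phi> x))"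
    using lder[OF assms] by (rule ext)
  ultimately show ?thesis by simp
qed

lemma lder_linear:
  assumes "smooth_into A S \<phi>" "x \<in> S"
  shows "linear (lder \<phi> x)"
proof -
  have "linear (\<lambda>b. XX (lder \<phi> x b) f (\<phi> x))" if "smooth_fun A f" for f
    using has_derivative_linear[OF has_derivative_lder[OF assms that]] .
  then have *: "XX (lder \<phi> x (a + b)) f (\<phi> x) = XX (lder \<phi> x a + lder \<phi> x b) f (\<phi> x)"
    "XX (lder \<phi> x (c *\<^sub>R a)) f (\<phi> x) = XX (c *\<^sub>R lder \<phi> x a) f (\<phi> x)"
    if "smooth_fun A f" for f a b c
    using that by (simp_all add: linear_iff XX_linear_left)
  show ?thesis by (rule linearI) (blast intro: XX_eqD[where p = "\<phi> x"] *)+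
qed

lemma lder_smooth:
  assumes "open S" "smooth_into A S \<phi>"
  shows "smooth_on S (\<lambda>x. lder \<phi> x b)"
proof (rule smooth_on_vec[OF assms(1)])
  fix k
  let ?F = "\<lambda>z. dual k (mul (iv (\<phi> (fst z))) (\<phi> (snd z)))"
  have o: "open (S \<times> S)" using assms(1) by (simp add: open_Times)
  have sm: "smooth_on (S \<times> S) ?F"
    using assms(2)
    by (intro smooth_intoD[OF smooth_into_mul[OF o smooth_into_iv] dual_smooth]
       smooth_into_compose[OF assms(2) o] smooth_on_linear bounded_linear_fst bounded_linear_snd) auto
  have eq: "frechet_derivative ?F (at (x, x)) (0, b) = lder \<phi> x b $ k" if "x \<in> S" for x
  proof -
    have "(?F has_derivative frechet_derivative ?F (at (x, x))) (at (x, x))"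
      using smooth_on_has_derivative[OF sm] that by simp
    moreover have "((\<lambda>y. (x, y)) has_derivative (\<lambda>b. (0, b))) (at x)"
      by (auto intro!: derivative_eq_intros)
    ultimately have "((\<lambda>y. ?F (x, y)) has_derivative (\<lambda>b. frechet_derivative ?F (at (x, x)) (0, b))) (at x)"
      using has_derivative_compose by fastforce
    then show ?thesis by (simp add: lder_def frechet_derivative_eq)
  qed
  have "smooth_on S (\<lambda>x. frechet_derivative ?F (at (x, x)) (0, b))"
    by (rule smooth_on_compose[OF assms(1) _ smooth_on_frechet_derivative[OF o sm]])
      (auto intro!: smooth_on_Pair assms(1))
  then show "smooth_on S (\<lambda>x. lder \<phi> x b $ k)"
    by (rule smooth_on_cong[OF assms(1) eq, THEN iffD1, rotated]) auto
qed

text \<open>\<open>Adi q\<close> is the adjoint action of \<open>iv q\<close> in the coordinates given by the basis.\<close>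

definition Adi :: "'g \<Rightarrow> (real, 'n) vec \<Rightarrow> (real, 'n) vec" where
  "Adi q v = (\<chi> i. XX v (\<lambda>p. dual i (mul (iv q) (mul p q))) e)"

text \<open>The right translate of a left-invariant field is a derivation at \<open>mul p q\<close>,
  so it has coordinates. Testing these on translates of \<open>dual i\<close> removes
  \<open>p\<close> by left invariance, whence they depend on \<open>q\<close> only.\<close>

lemma XX_right:
  assumes "smooth_fun A f"
  shows "XX v (\<lambda>p'. f (mul p' q)) p = XX (Adi q v) f (mul p q)"
proof -
  let ?d = "\<lambda>f. if smooth_fun A f then XX v (\<lambda>p'. f (mul p' q)) p else 0"
  have "?d \<in> tangent_space A (mul p q)"
    using XX_tangent[of v p] smooth_fun_right[of _ q]
    by (simp add: tangent_space_def smooth_fun_cmul[OF top_A] smooth_fun_add[OF top_A] smooth_fun_mult[OF top_A])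
  then obtain u where u: "\<And>f. ?d f = XX u f (mul p q)"
    using tangent_eq_XX by blast
  have "u $ i = Adi q v $ i" for i
  proof -
    let ?h = "\<lambda>p'. dual i (mul (iv (mul p q)) (mul p' q))"
    have "u $ i = XX v ?h (mul p e)"
      using u[of "\<lambda>r. dual i (mul (iv (mul p q)) r)"] smooth_fun_left[OF dual_smooth]
      by (simp add: XX_dual_left)
    also have "\<dots> = XX v (\<lambda>q'. ?h (mul p q')) e" by (rule XX_left[symmetric])
    finally show ?thesis by (simp add: Adi_def iv_mul assoc)
  qed
  then have "u = Adi q v" by (simp add: vec_eq_iff)
  with u[of f] assms show ?thesis by simp
qed

lemma linear_Adi: "linear (Adi q)"
  by (rule linearI) (simp_all add: Adi_def vec_eq_iff XX_linear_left)

lemma Adi_mul: "Adi (mul p q) v = Adi q (Adi p v)"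
proof (rule XX_eqD[where p = "mul p q"])
  fix f assume f: "smooth_fun A f"
  have "XX (Adi (mul p q) v) f (mul e (mul p q)) = XX v (\<lambda>p'. f (mul p' (mul p q))) e"
    by (rule XX_right[OF f, symmetric])
  also have "\<dots> = XX v (\<lambda>p'. f (mul (mul p' p) q)) e" by (simp add: assoc)
  also have "\<dots> = XX (Adi p v) (\<lambda>p'. f (mul p' q)) (mul e p)"
    by (rule XX_right[OF smooth_fun_right[OF f]])
  also have "\<dots> = XX (Adi q (Adi p v)) f (mul (mul e p) q)" by (rule XX_right[OF f])
  finally show "XX (Adi (mul p q) v) f (mul p q) = XX (Adi q (Adi p v)) f (mul p q)" by simp
qed

lemma Adi_e: "Adi e v = v"
  by (simp add: Adi_def vec_eq_iff XX_dual)

lemma Adi_inverse: "Adi (iv q) (Adi q v) = v"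
  by (simp flip: Adi_mul add: Adi_e)

text \<open>Product rule on the diagonal. The variation of the first factor is followed by a right
  translation by the second, which produces \<open>Adi\<close>.\<close>

lemma lder_mul:
  assumes S: "open S" "x \<in> S" and \<phi>: "smooth_into A S \<phi>" and \<psi>: "smooth_into A S \<psi>"
  shows "lder (\<lambda>x. mul (\<phi> x) (\<psi> x)) x b = Adi (\<psi> x) (lder \<phi> x b) + lder \<psi> x b"
proof (rule lder_eqI)
  fix f assume f: "smooth_fun A f"
  let ?F = "\<lambda>z. f (mul (\<phi> (fst z)) (\<psi> (snd z)))" and ?D = "frechet_derivative (\<lambda>z. f (mul (\<phi> (fst z)) (\<psi> (snd z)))) (at (x, x))"
  have o: "open (S \<times> S)" using S by (simp add: open_Times)
  have "smooth_on (S \<times> S) ?F"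
    by (intro smooth_intoD[OF smooth_into_mul[OF o] f] smooth_into_compose[OF \<phi> o] smooth_into_compose[OF \<psi> o]
      smooth_on_linear bounded_linear_fst bounded_linear_snd) auto
  then have D: "(?F has_derivative ?D) (at (x, x))"
    using smooth_on_has_derivative S(2) by blast
  have "((\<lambda>y. (y, y)) has_derivative (\<lambda>b. (b, b))) (at x)" by (auto intro!: derivative_eq_intros)
  from has_derivative_compose[OF this D]
  have "frechet_derivative (\<lambda>y. f (mul (\<phi> y) (\<psi> y))) (at x) b = ?D (b, b)"
    by (simp add: frechet_derivative_eq)
  also have "\<dots> = ?D (b, 0) + ?D (0, b)"
    using linear_add[OF has_derivative_linear[OF D], of "(b, 0)" "(0, b)"] by simp
  also have "?D (b, 0) = XX (lder \<phi> x b) (\<lambda>p. f (mul p (\<psi> x))) (\<phi> x)"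
  proof -
    have "((\<lambda>y. (y, x)) has_derivative (\<lambda>b. (b, 0))) (at x)" by (auto intro!: derivative_eq_intros)
    from has_derivative_compose[OF this D]
    have "frechet_derivative (\<lambda>y. f (mul (\<phi> y) (\<psi> x))) (at x) b = ?D (b, 0)"
      by (simp add: frechet_derivative_eq)
    then show ?thesis using lder[OF \<phi> S(2) smooth_fun_right[OF f]] by simp
  qed
  also have "?D (0, b) = XX (lder \<psi> x b) (\<lambda>q. f (mul (\<phi> x) q)) (\<psi> x)"
  proof -
    have "((\<lambda>y. (x, y)) has_derivative (\<lambda>b. (0, b))) (at x)" by (auto intro!: derivative_eq_intros)
    from has_derivative_compose[OF this D]
    have "frechet_derivative (\<lambda>y. f (mul (\<phi> x) (\<psi> y))) (at x) b = ?D (0, b)"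
      by (simp add: frechet_derivative_eq)
    then show ?thesis using lder[OF \<psi> S(2) smooth_fun_left[OF f]] by simp
  qed
  finally show "frechet_derivative (\<lambda>y. f (mul (\<phi> y) (\<psi> y))) (at x) b =
      XX (Adi (\<psi> x) (lder \<phi> x b) + lder \<psi> x b) f (mul (\<phi> x) (\<psi> x))"
    by (simp add: XX_right[OF f] XX_left XX_linear_left)
qed

lemma lder_const: "lder (\<lambda>x. p) x b = 0"
  by (rule lder_eqI) (simp add: XX_linear_left)

lemma lder_left:
  assumes "open S" "x \<in> S" "smooth_into A S \<phi>"
  shows "lder (\<lambda>x. mul p (\<phi> x)) x b = lder \<phi> x b"
  using lder_mul[OF assms(1,2) smooth_into_const assms(3)]
  by (simp add: lder_const linear_0[OF linear_Adi])

lemma lder_compose: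
  assumes "smooth_into A T \<phi>" "h x \<in> T" "(h has_derivative h') (at x)"
  shows "lder (\<lambda>x. \<phi> (h x)) x b = lder \<phi> (h x) (h' b)"
proof (rule lder_eqI)
  fix f assume f: "smooth_fun A f"
  from has_derivative_compose[OF assms(3) has_derivative_lder[OF assms(1,2) f]]
  show "frechet_derivative (\<lambda>y. f (\<phi> (h y))) (at x) b = XX (lder \<phi> (h x) (h' b)) f (\<phi> (h x))"
    by (simp add: frechet_derivative_eq)
qed

lemma smooth_fun_separates:
  assumes "\<And>f. smooth_fun A f \<Longrightarrow> f p = f q" shows "p = q"
proof (rule ccontr)
  assume "p \<noteq> q"
  then have "p \<in> - {q}" by simp
  then obtain f where "smooth_fun A f" "f p = 1" "\<And>q'. q' \<notin> - {q} \<Longrightarrow> f q' = 0"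
    using smooth_fun_bump[OF smooth_A, of "- {q}" p] by auto
  with assms[of f] show False by simp
qed

text \<open>The quotient of \<open>\<phi>\<close> and \<open>\<psi>\<close> has zero logarithmic
  derivative, so every smooth function is constant along it. Inside the group this takes the place
  of uniqueness for differential equations.\<close>

lemma eq_if_lder_eq:
  assumes S: "open S" "connected S" "x0 \<in> S" "x \<in> S"
    and \<phi>: "smooth_into A S \<phi>" and \<psi>: "smooth_into A S \<psi>"
    and eq: "\<And>x b. x \<in> S \<Longrightarrow> lder \<phi> x b = lder \<psi> x b" and "\<phi> x0 = \<psi> x0"
  shows "\<phi> x = \<psi> x"
proof -
  let ?c = "\<lambda>x. mul (\<phi> x) (iv (\<psi> x))"
  have c: "smooth_into A S ?c"
    by (intro smooth_into_mul smooth_into_iv S \<phi> \<psi>)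
  have zero: "lder ?c x b = 0" if "x \<in> S" for x b
  proof -
    have "lder \<phi> x b = lder (\<lambda>x. mul (?c x) (\<psi> x)) x b"
      by (simp add: assoc)
    also have "\<dots> = Adi (\<psi> x) (lder ?c x b) + lder \<psi> x b"
      by (rule lder_mul[OF S(1) that c \<psi>])
    finally have "Adi (\<psi> x) (lder ?c x b) = 0" using eq[OF that] by simp
    then have "Adi (iv (\<psi> x)) (Adi (\<psi> x) (lder ?c x b)) = 0" by (simp add: linear_0[OF linear_Adi])
    then show ?thesis by (simp add: Adi_inverse)
  qed
  have "?c x = ?c x0"
  proof (rule smooth_fun_separates)
    fix f assume f: "smooth_fun A f"
    have d: "((\<lambda>y. f (?c y)) has_derivative (\<lambda>b. 0)) (at y within S)" if "y \<in> S" for y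
    proof -
      have "((\<lambda>y. f (?c y)) has_derivative (\<lambda>b. XX (lder ?c y b) f (?c y))) (at y)"
        by (rule has_derivative_lder[OF c that f])
      then have "((\<lambda>y. f (?c y)) has_derivative (\<lambda>b. 0)) (at y)"
        by (simp only: zero[OF that] XX_linear_left)
      then show ?thesis by (rule has_derivative_at_withinI)
    qed
    have "continuous_on S (\<lambda>y. f (?c y))"
      using smooth_on_continuous_on smooth_intoD[OF c f] by blast
    then show "f (?c x) = f (?c x0)"
      using has_derivative_zero_unique_strong_connected[of S "{}" "\<lambda>y. f (?c y)" x0 "f (?c x0)" x] S d
      by auto
  qed
  then have "mul (?c x) (\<psi> x) = mul (?c x0) (\<psi> x)" by simp
  then show ?thesis using assms(8) by (simp add: assoc)
qed

section \<open>The bracket\<close>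

abbreviation br :: "(real, 'n) vec \<Rightarrow> (real, 'n) vec \<Rightarrow> (real, 'n) vec" where
  "br \<equiv> graded_bracket w (struct_const mul e \<xi>)"

lemma carnot_filtration_e: "carnot_filtration mul gr v e = span (\<Union>v\<in>{1..v}. gr v)"
proof -
  have "left_translate mul e = id"
    by (simp add: left_translate_def fun_eq_iff)
  then show ?thesis by (simp add: carnot_filtration_def)
qed

lemma gr_subspace: "d \<in> {1..r} \<Longrightarrow> subspace (gr d) \<and> gr d \<subseteq> tangent_space A e"
  using grading unfolding lie_grading_def by (elim conjE) (erule bspec)

lemma gr_decompose:
  "v \<in> tangent_space A e \<Longrightarrow> \<exists>c. (\<forall>w\<in>{1..r}. c w \<in> gr w) \<and> v = (\<Sum>w\<in>{1..r}. c w)"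
  using grading unfolding lie_grading_def by (elim conjE) (erule bspec)

lemma gr_independent:
  "(\<And>d. d \<in> {1..r} \<Longrightarrow> c d \<in> gr d) \<Longrightarrow> (\<Sum>d\<in>{1..r}. c d) = 0 \<Longrightarrow> d \<in> {1..r} \<Longrightarrow> c d = 0"
proof -
  assume c: "\<And>d. d \<in> {1..r} \<Longrightarrow> c d \<in> gr d" "(\<Sum>d\<in>{1..r}. c d) = 0" "d \<in> {1..r}"
  have "\<forall>c. (\<forall>w\<in>{1..r}. c w \<in> gr w) \<and> (\<Sum>w\<in>{1..r}. c w) = 0 \<longrightarrow> (\<forall>w\<in>{1..r}. c w = 0)"
    using grading unfolding lie_grading_def by (elim conjE)
  from this[THEN spec, of c] show "c d = 0" using c by blast
qed

lemma gr_bracket: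
  "i \<in> {1..r} \<Longrightarrow> j \<in> {1..r} \<Longrightarrow> \<eta> \<in> gr i \<Longrightarrow> \<zeta> \<in> gr j \<Longrightarrow>
    (if i + j \<le> r then lie_bracket mul e \<eta> \<zeta> \<in> gr (i + j) else lie_bracket mul e \<eta> \<zeta> = 0)"
proof -
  assume *: "i \<in> {1..r}" "j \<in> {1..r}" "\<eta> \<in> gr i" "\<zeta> \<in> gr j"
  have "\<forall>w\<in>{1..r}. \<forall>w'\<in>{1..r}. \<forall>\<xi>\<in>gr w. \<forall>\<eta>\<in>gr w'.
      (if w + w' \<le> r then lie_bracket mul e \<xi> \<eta> \<in> gr (w + w') else lie_bracket mul e \<xi> \<eta> = 0)"
    using grading unfolding lie_grading_def by (elim conjE)
  from this[rule_format, OF *(1,2,3,4)] show ?thesis .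
qed

lemma xi_gr: "\<xi> j \<in> gr (w j)"
  and xi_inj: "inj \<xi>" and xi_independent: "independent (range \<xi>)"
  and xi_span: "span (range \<xi>) = tangent_space A e"
  using basis by (simp_all add: graded_basis_def)

text \<open>Ensures that the \<open>LEAST\<close> in \<open>carnot_weight\<close> exists and is at
  most \<open>r\<close>: all layers together span the Lie algebra, whose dimension is the number of
  indices.\<close>

lemma card_le_dim_filtration: "card {..j :: 'n} \<le> dim (carnot_filtration mul gr r e)"
proof -
  have "tangent_space A e \<subseteq> span (\<Union>v\<in>{1..r}. gr v)"
  proof
    fix v assume "v \<in> tangent_space A e"
    from gr_decompose[OF this] obtain c where c: "\<forall>w\<in>{1..r}. c w \<in> gr w" "v = (\<Sum>w\<in>{1..r}. c w)"
      by blast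
    show "v \<in> span (\<Union>v\<in>{1..r}. gr v)"
      unfolding c(2)
    proof (rule real_vector.span_sum)
      fix d assume "d \<in> {1..r}"
      then show "c d \<in> span (\<Union>v\<in>{1..r}. gr v)"
        using c(1) by (intro real_vector.span_base) blast
    qed
  qed
  moreover have "span (\<Union>v\<in>{1..r}. gr v) \<subseteq> span (range \<xi>)"
    using gr_subspace unfolding xi_span[symmetric]
    by (intro real_vector.span_minimal real_vector.subspace_span) blast
  ultimately have "span (range \<xi>) = span (\<Union>v\<in>{1..r}. gr v)"
    unfolding xi_span by (intro antisym)
  then have "dim (\<Union>v\<in>{1..r}. gr v) = card (range \<xi>)"
    using xi_independent by (intro real_vector.dim_eq_card)
  also have "\<dots> = CARD('n)" using xi_inj by (simp add: card_image)
  finally show ?thesis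
    using card_mono[of "UNIV :: 'n set" "{..j}"] by (simp only: carnot_filtration_e real_vector.dim_span) simp
qed

lemma w_le: "w j \<le> r"
  unfolding w carnot_weight_def by (rule Least_le) (rule card_le_dim_filtration)

lemma w_pos: "w j \<ge> 1"
proof (rule ccontr)
  assume "\<not> w j \<ge> 1"
  then have 0: "w j = 0" by simp
  have "card {..j} \<le> dim (carnot_filtration mul gr (w j) e)"
    unfolding w carnot_weight_def by (rule LeastI) (rule card_le_dim_filtration)
  moreover have "dim (carnot_filtration mul gr 0 e) = 0"
    using real_vector.dim_eq_card[of "{}" "carnot_filtration mul gr 0 e"]
    by (simp add: carnot_filtration_e real_vector.independent_empty)
  ultimately show False using 0 by (simp add: card_eq_0_iff)
qed

abbreviation L :: "'n \<Rightarrow> 'n \<Rightarrow> 'n \<Rightarrow> real" where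
  "L \<equiv> struct_const mul e \<xi>"

lemma left_translate_xi: "left_translate mul p (\<xi> j) = X j p"
  using X_inv[of j] X_e[of j] by (metis left_invariant_def right_neutral)

lemma lie_bracket_xi: "lie_bracket mul e (\<xi> i) (\<xi> j) f = X i e (\<lambda>q. X j q f) - X j e (\<lambda>q. X i q f)"
  by (simp add: lie_bracket_def vfield_bracket_def left_translate_xi)

lemma lie_bracket_gr:
  "if w i + w j \<le> r then lie_bracket mul e (\<xi> i) (\<xi> j) \<in> gr (w i + w j) else lie_bracket mul e (\<xi> i) (\<xi> j) = 0"
  using w_pos w_le by (intro gr_bracket xi_gr) auto

lemma representation_xi: "v \<in> tangent_space A e \<Longrightarrow> representation (range \<xi>) v (\<xi> k) = v (dual k)"
proof -
  assume v: "v \<in> tangent_space A e"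
  have "(\<Sum>b\<in>range \<xi>. representation (range \<xi>) v b *\<^sub>R b) = v"
    using v xi_span by (intro real_vector.sum_representation_eq xi_independent) auto
  moreover have "(\<Sum>b\<in>range \<xi>. representation (range \<xi>) v b *\<^sub>R b) (dual k) =
      (\<Sum>j\<in>UNIV. representation (range \<xi>) v (\<xi> j) * \<xi> j (dual k))"
    by (subst sum.reindex[OF xi_inj]) (simp add: sum_fun_apply scaleR_fun_def)
  ultimately show ?thesis
    by (simp add: dual_xi if_distrib cong: if_cong)
qed

lemma lie_bracket_tangent: "lie_bracket mul e (\<xi> i) (\<xi> j) \<in> tangent_space A e"
proof (cases "w i + w j \<le> r")
  case True
  then show ?thesis
    using lie_bracket_gr[of i j] gr_subspace[of "w i + w j"] w_pos[of i] by auto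
next
  case False
  then show ?thesis using lie_bracket_gr[of i j] by (simp add: tangent_space_def)
qed

lemma L_eq: "L i j k = lie_bracket mul e (\<xi> i) (\<xi> j) (dual k)"
  by (simp add: struct_const_def representation_xi[OF lie_bracket_tangent])

lemma L_commute: "L j i k = - L i j k"
  by (simp add: L_eq lie_bracket_xi)

lemma lie_bracket_sum: "lie_bracket mul e (\<xi> i) (\<xi> j) = (\<Sum>k\<in>UNIV. L i j k *\<^sub>R \<xi> k)"
proof -
  obtain u :: "(real, 'n) vec" where u: "lie_bracket mul e (\<xi> i) (\<xi> j) = (\<Sum>k\<in>UNIV. u $ k *\<^sub>R \<xi> k)"
    using span_xi[OF lie_bracket_tangent] by blast
  have "L i j k = u $ k" for k
    by (simp add: L_eq u sum_fun_apply scaleR_fun_def dual_xi if_distrib cong: if_cong)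
  then show ?thesis using u by simp
qed

text \<open>This makes the restricted sum over \<open>w k = w i + w j\<close> in
  \<open>graded_bracket\<close> the whole bracket. The bracket of two basis vectors lies in one
  layer or is zero, and decompositions into layers are unique.\<close>

lemma L_zero: "w k \<noteq> w i + w j \<Longrightarrow> L i j k = 0"
proof (cases "w i + w j \<le> r")
  case False
  then show ?thesis using lie_bracket_gr[of i j] by (simp add: L_eq)
next
  case True
  assume ne: "w k \<noteq> w i + w j"
  let ?B = "lie_bracket mul e (\<xi> i) (\<xi> j)"
  define c where "c d = (\<Sum>k | w k = d. L i j k *\<^sub>R \<xi> k)" for d
  \<comment> \<open>The layers of the bracket, with the bracket itself subtracted in the layer where
    it lies: members of the layers with sum zero, hence all zero.\<close>
  define c' where "c' d = c d - (if d = w i + w j then ?B else 0)" for d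
  have sub: "subspace (gr d)" if "d \<in> {1..r}" for d
    using gr_subspace[OF that] by blast
  have "c d \<in> gr d" if "d \<in> {1..r}" for d
    unfolding c_def using xi_gr
    by (intro real_vector.subspace_sum[OF sub[OF that]] real_vector.subspace_scale[OF sub[OF that]]) auto
  then have mem: "c' d \<in> gr d" if "d \<in> {1..r}" for d
    using lie_bracket_gr[of i j] True that unfolding c'_def
    by (auto intro!: real_vector.subspace_diff[OF sub])
  have "(\<Sum>d\<in>{1..r}. c d) = (\<Sum>k\<in>UNIV. L i j k *\<^sub>R \<xi> k)"
  proof -
    have "w ` UNIV \<subseteq> {1..r}" using w_pos w_le by auto
    from sum.group[OF _ _ this, of "\<lambda>k. L i j k *\<^sub>R \<xi> k"] show ?thesis
      by (simp add: c_def)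
  qed
  then have "(\<Sum>d\<in>{1..r}. c' d) = ?B - ?B"
    unfolding c'_def sum_subtractf using True w_pos[of i] lie_bracket_sum[of i j]
    by (simp add: sum.delta)
  then have "c' (w k) = 0"
    using w_pos[of k] w_le[of k] by (intro gr_independent[of c'] mem) auto
  then have "c (w k) (dual k) = 0" using ne by (simp add: c'_def)
  then show ?thesis
    by (simp add: c_def sum_fun_apply scaleR_fun_def dual_xi if_distrib cong: if_cong)
qed

lemma br_nth: "br x y $ k = (\<Sum>i\<in>UNIV. \<Sum>j\<in>UNIV. x $ i * y $ j * L i j k)"
proof -
  have "(\<Sum>k' | w k' = w i + w j. L i j k' *\<^sub>R (axis k' 1 :: (real, 'n) vec)) $ k = L i j k" for i j
    using L_zero[of k i j] by (auto simp: axis_def if_distrib cong: if_cong)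
  then show ?thesis by (simp add: graded_bracket_def)
qed

lemma bounded_bilinear_br: "bounded_bilinear br"
  by (rule bilinear_conv_bounded_bilinear[THEN iffD1])
    (auto simp: bilinear_def linear_iff vec_eq_iff br_nth algebra_simps sum.distrib sum_distrib_left)

lemma linear_br: "linear (br x)"
  using bounded_bilinear.bounded_linear_right[OF bounded_bilinear_br] bounded_linear.linear by blast

lemma br_commute: "br y x = - br x y"
proof -
  have "br y x $ k = - (br x y $ k)" for k
    unfolding br_nth sum_negf[symmetric]
    by (subst sum.swap) (intro sum.cong refl, subst L_commute, simp)
  then show ?thesis by (simp add: vec_eq_iff)
qed

lemma br_self [simp]: "br x x = 0"
proof -
  have "br x x $ k = - br x x $ k" for k
    using arg_cong[OF br_commute[of x x], of "\<lambda>v. v $ k"] by simp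
  then show ?thesis by (simp add: vec_eq_iff)
qed

lemma XX_axis: "XX (axis i 1) f p = X i p f"
  by (simp add: XX_def axis_def if_distrib if_distribR cong: if_cong)

lemma XX_cmul_sum:
  assumes "\<And>j. smooth_fun A (h j)"
  shows "XX u (\<lambda>q. \<Sum>j\<in>UNIV. (c :: 'n \<Rightarrow> real) j * h j q) p = (\<Sum>j\<in>UNIV. c j * XX u (h j) p)"
proof -
  have "XX u (\<lambda>q. \<Sum>j\<in>UNIV. c j * h j q) p = (\<Sum>j\<in>UNIV. XX u (\<lambda>q. c j * h j q) p)"
    by (intro XX_sum finite smooth_fun_cmul[OF top_A] assms)
  then show ?thesis by (simp only: XX_cmul[OF assms])
qed

lemma X_smooth_fun: "smooth_fun A f \<Longrightarrow> smooth_fun A (\<lambda>p. X j p f)"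
  using X_smooth by (simp add: smooth_vfield_def)

text \<open>The structure constants are read off at \<open>e\<close>; left invariance carries the
  commutator relation to every point.\<close>

lemma XX_br:
  assumes f: "smooth_fun A f"
  shows "XX (br u v) f p = XX u (XX v f) p - XX v (XX u f) p"
proof -
  have comm: "X i p (\<lambda>q. X j q f) - X j p (\<lambda>q. X i q f) = (\<Sum>k\<in>UNIV. L i j k * X k p f)" for i j
  proof -
    have X_left: "X i p h = X i e (\<lambda>q. h (mul p q))" for i h
      using XX_left[of "axis i 1" h p e] by (simp add: XX_axis)
    have X_left': "X j (mul p q) f = X j q (\<lambda>q. f (mul p q))" for j q
      using XX_left[of "axis j 1" f p q] by (simp add: XX_axis)
    have "X i p (\<lambda>q. X j q f) - X j p (\<lambda>q. X i q f) = lie_bracket mul e (\<xi> i) (\<xi> j) (\<lambda>q. f (mul p q))"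
      by (simp add: X_left[of _ "\<lambda>q. X _ q f"] X_left' lie_bracket_xi)
    also have "\<dots> = (\<Sum>k\<in>UNIV. L i j k * X k p f)"
      by (simp add: lie_bracket_sum sum_fun_apply scaleR_fun_def X_left[of _ f] X_e)
    finally show ?thesis .
  qed
  have 2: "XX u (XX v f) p = (\<Sum>i\<in>UNIV. \<Sum>j\<in>UNIV. u $ i * v $ j * X i p (\<lambda>q. X j q f))" for u v
  proof -
    have "X i p (XX v f) = (\<Sum>j\<in>UNIV. v $ j * X i p (\<lambda>q. X j q f))" for i
      using XX_cmul_sum[OF X_smooth_fun[OF f], where u = "axis i 1" and c = "\<lambda>j. v $ j" and p = p]
      unfolding XX_axis XX_def[of v, abs_def] .
    then show ?thesis
      by (simp add: XX_def[of u] sum_distrib_left mult.assoc)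
  qed
  have "XX v (XX u f) p = (\<Sum>i\<in>UNIV. \<Sum>j\<in>UNIV. u $ i * v $ j * X j p (\<lambda>q. X i q f))"
    unfolding 2 by (subst sum.swap) (simp add: mult.commute)
  then have "XX u (XX v f) p - XX v (XX u f) p =
      (\<Sum>i\<in>UNIV. \<Sum>j\<in>UNIV. u $ i * v $ j * (X i p (\<lambda>q. X j q f) - X j p (\<lambda>q. X i q f)))"
    unfolding 2[of u v] by (simp add: sum_subtractf right_diff_distrib)
  also have "\<dots> = (\<Sum>i\<in>UNIV. \<Sum>j\<in>UNIV. \<Sum>k\<in>UNIV. u $ i * v $ j * L i j k * X k p f)"
    unfolding comm by (simp add: sum_distrib_left mult.assoc)
  also have "\<dots> = (\<Sum>k\<in>UNIV. \<Sum>i\<in>UNIV. \<Sum>j\<in>UNIV. u $ i * v $ j * L i j k * X k p f)"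
  proof -
    have "(\<Sum>j\<in>UNIV. \<Sum>k\<in>UNIV. u $ i * v $ j * L i j k * X k p f) =
        (\<Sum>k\<in>UNIV. \<Sum>j\<in>UNIV. u $ i * v $ j * L i j k * X k p f)" for i
      by (rule sum.swap)
    then show ?thesis by (simp only:) (rule sum.swap)
  qed
  also have "\<dots> = XX (br u v) f p"
    by (simp add: XX_def br_nth sum_distrib_right)
  finally show ?thesis by simp
qed

lemma XX_XX: "smooth_fun A f \<Longrightarrow> XX u (XX v f) p = (\<Sum>j\<in>UNIV. v $ j * XX u (\<lambda>q. X j q f) p)"
  unfolding XX_def[of v, abs_def] by (rule XX_cmul_sum) (rule X_smooth_fun)

text \<open>From the symmetry of second derivatives.\<close>

lemma maurer_cartan:
  fixes \<phi> :: "'a::euclidean_space \<Rightarrow> 'g"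
  assumes S: "open S" "x \<in> S" and \<phi>: "smooth_into A S \<phi>"
  shows "frechet_derivative (\<lambda>x. lder \<phi> x c) (at x) b - frechet_derivative (\<lambda>x. lder \<phi> x b) (at x) c =
    br (lder \<phi> x c) (lder \<phi> x b)"
proof (rule XX_eqD[where p = "\<phi> x"])
  fix f assume f: "smooth_fun A f"
  \<comment> \<open>A second derivative of \<open>f\<close> along \<open>\<phi>\<close> is the
    derivative of the form plus a product of two invariant fields; antisymmetrising the latter gives
    the bracket.\<close>
  have second: "frechet_derivative (\<lambda>y. frechet_derivative (\<lambda>z. f (\<phi> z)) (at y) c) (at x) b =
      XX (frechet_derivative (\<lambda>x. lder \<phi> x c) (at x) b) f (\<phi> x) + XX (lder \<phi> x b) (XX (lder \<phi> x c) f) (\<phi> x)" for b c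
  proof -
    let ?\<omega> = "\<lambda>y. lder \<phi> y c"
    have d: "(?\<omega> has_derivative frechet_derivative ?\<omega> (at x)) (at x)"
      using smooth_on_has_derivative[OF lder_smooth[OF S(1) \<phi>] S(2)] .
    have "((\<lambda>y. \<Sum>j\<in>UNIV. ?\<omega> y $ j * X j (\<phi> y) f) has_derivative
        (\<lambda>b. \<Sum>j\<in>UNIV. ?\<omega> x $ j * XX (lder \<phi> x b) (\<lambda>q. X j q f) (\<phi> x) +
          frechet_derivative ?\<omega> (at x) b $ j * X j (\<phi> x) f)) (at x)"
      by (intro has_derivative_sum has_derivative_mult has_derivative_lder[OF \<phi> S(2) X_smooth_fun[OF f]]
          bounded_linear.has_derivative[OF bounded_linear_vec_nth d])
    then have "((\<lambda>y. frechet_derivative (\<lambda>z. f (\<phi> z)) (at y) c) has_derivative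
        (\<lambda>b. \<Sum>j\<in>UNIV. ?\<omega> x $ j * XX (lder \<phi> x b) (\<lambda>q. X j q f) (\<phi> x) +
          frechet_derivative ?\<omega> (at x) b $ j * X j (\<phi> x) f)) (at x)"
      by (rule has_derivative_transform_within_open[OF _ S]) (simp add: lder[OF \<phi> _ f] XX_def)
    then show ?thesis
      by (simp add: frechet_derivative_eq sum.distrib XX_XX[OF f] XX_def[of "frechet_derivative _ _ _"])
  qed
  have "smooth_on S (\<lambda>z. f (\<phi> z))" using \<phi> f by (rule smooth_intoD)
  from frechet_derivative_commute[OF S(1) this S(2), of c b]
  show "XX (frechet_derivative (\<lambda>x. lder \<phi> x c) (at x) b - frechet_derivative (\<lambda>x. lder \<phi> x b) (at x) c) f (\<phi> x) =
      XX (br (lder \<phi> x c) (lder \<phi> x b)) f (\<phi> x)"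
    unfolding second by (simp add: XX_br[OF f] XX_linear_left)
qed

section \<open>Weights\<close>

definition vanish :: "nat \<Rightarrow> (real, 'n) vec \<Rightarrow> bool" where
  "vanish N v \<longleftrightarrow> (\<forall>k. w k \<le> N \<longrightarrow> v $ k = 0)"

lemma vanish_0: "vanish 0 v"
  unfolding vanish_def using w_pos by (metis le_zero_eq not_one_le_zero)

lemma vanish_r: "vanish N v \<Longrightarrow> r \<le> N \<Longrightarrow> v = 0"
  using w_le by (auto simp: vanish_def vec_eq_iff intro: order_trans)

text \<open>Every weight is at least 1, so bracketing raises weights by at least 1. As weights are
  at most \<open>r\<close>, this yields nilpotency of \<open>br u\<close> and the vanishing of
  brackets of more than \<open>r\<close> vectors.\<close>

lemma vanish_br: "vanish N v \<Longrightarrow> vanish (Suc N) (br u v)"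
  unfolding vanish_def
proof (intro allI impI)
  fix k assume v: "\<forall>k. w k \<le> N \<longrightarrow> v $ k = 0" and k: "w k \<le> Suc N"
  have "u $ i * v $ j * L i j k = 0" for i j
  proof (cases "w k = w i + w j")
    case True
    then have "w j \<le> N" using k w_pos[of i] by simp
    then show ?thesis using v by simp
  qed (simp add: L_zero)
  then show "br u v $ k = 0" unfolding br_nth by (intro sum.neutral ballI)
qed

lemma dilation_br: "dilation w t (br u v) = br (dilation w t u) (dilation w t v)"
proof -
  have "t ^ w k * (u $ i * v $ j * L i j k) = t ^ w i * u $ i * (t ^ w j * v $ j) * L i j k" for i j k
    using L_zero[of k i j] by (cases "w k = w i + w j") (simp_all add: power_add)
  then show ?thesis
    unfolding vec_eq_iff br_nth by (simp only: dilation_def vec_lambda_beta br_nth sum_distrib_left)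
      simp
qed

lemma linear_dilation: "linear (dilation w t)"
  by (rule linearI) (simp_all add: dilation_def vec_eq_iff algebra_simps)

lemma lder_cong:
  assumes "open T" "x \<in> T" "\<And>y. y \<in> T \<Longrightarrow> \<phi> y = \<psi> y"
  shows "lder \<phi> x b = lder \<psi> x b"
proof -
  have eq: "frechet_derivative (\<lambda>y. f (\<phi> y)) (at x) = frechet_derivative (\<lambda>y. f (\<psi> y)) (at x)" for f :: "'g \<Rightarrow> real"
  proof -
    have "((\<lambda>y. f (\<phi> y)) has_derivative D) (at x) \<longleftrightarrow> ((\<lambda>y. f (\<psi> y)) has_derivative D) (at x)" for D
      using assms has_derivative_transform_within_open[of "\<lambda>y. f (\<phi> y)" D x UNIV T "\<lambda>y. f (\<psi> y)"]
        has_derivative_transform_within_open[of "\<lambda>y. f (\<psi> y)" D x UNIV T "\<lambda>y. f (\<phi> y)"] by auto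
    then show ?thesis by (simp add: frechet_derivative_def)
  qed
  show ?thesis
    using eq[of "\<lambda>q. dual _ (mul (iv (\<phi> x)) q)"] assms(3)[OF assms(2)]
    unfolding lder_def by simp
qed

lemma lder_real:
  assumes "smooth_into A S \<phi>" "t \<in> S"
  shows "lder \<phi> t b = b *\<^sub>R lder \<phi> t 1"
proof -
  have "lder \<phi> t (b *\<^sub>R 1) = b *\<^sub>R lder \<phi> t 1"
    by (rule linear_scale[OF lder_linear[OF assms]])
  then show ?thesis by simp
qed

text \<open>Global functions that separate tangent vectors near \<open>e\<close>. The logarithmic
  derivative of the inverse chart is injective between spaces of equal dimension, so every
  \<open>u\<close> is the image of some chart direction, and the chart components detect that
  direction.\<close>

lemma chart_coordinates:
  assumes U: "(U, \<alpha>) \<in> A" "e \<in> U"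
  obtains N f where "open N" "e \<in> N" "N \<subseteq> U" "\<And>k. smooth_fun A (f k)"
    "\<And>k q. q \<in> N \<Longrightarrow> f k q = \<alpha> q $ k"
    "\<And>p u. p \<in> N \<Longrightarrow> (\<And>k. XX u (f k) p = 0) \<Longrightarrow> u = 0"
proof -
  obtain N where N: "open N" "e \<in> N" "N \<subseteq> U \<inter> UNIV"
    "\<And>g :: (real, 'n) vec \<Rightarrow> real. smooth_on (\<alpha> ` U) g \<Longrightarrow>
       \<exists>f. smooth_fun A f \<and> (\<forall>q\<in>N. f q = g (\<alpha> q)) \<and> (\<forall>q. q \<notin> U \<inter> UNIV \<longrightarrow> f q = 0)"
    by (rule smooth_atlas_extension[OF smooth_A U(1) open_UNIV, of e]) (use U(2) in auto)
  have "\<exists>f. smooth_fun A f \<and> (\<forall>q\<in>N. f q = \<alpha> q $ k)" for k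
    using N(4)[OF smooth_on_linear[OF bounded_linear_vec_nth[of k]]] by blast
  then obtain f where f: "\<And>k. smooth_fun A (f k)" "\<And>k q. q \<in> N \<Longrightarrow> f k q = \<alpha> q $ k"
    by metis
  have inj: "u = 0" if p: "p \<in> N" and u: "\<And>k. XX u (f k) p = 0" for p u
  proof -
    let ?\<theta> = "inv_into U \<alpha>"
    note c = topological_atlas_chart[OF top_A U(1)]
    have \<theta>: "smooth_into A (\<alpha> ` U) ?\<theta>" by (rule smooth_into_chart_inv[OF U(1)])
    have pU: "p \<in> U" using p N(3) by blast
    then have y: "\<alpha> p \<in> \<alpha> ` U" "?\<theta> (\<alpha> p) = p" using c(4) by auto
    have D: "XX (lder ?\<theta> (\<alpha> p) b) (f k) p = b $ k" for b k
    proof -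
      have o: "open (\<alpha> ` (U \<inter> N))" by (rule chart_image_open[OF top_A U(1) N(1)])
      have "((\<lambda>y. y $ k) has_derivative (\<lambda>b. b $ k)) (at (\<alpha> p))"
        by (rule bounded_linear_imp_has_derivative[OF bounded_linear_vec_nth])
      then have "((\<lambda>y. f k (?\<theta> y)) has_derivative (\<lambda>b. b $ k)) (at (\<alpha> p))"
        by (rule has_derivative_transform_within_open[OF _ o]) (use p pU f(2) c(4) in auto)
      from frechet_derivative_eq[OF this] show ?thesis
        using lder[OF \<theta> y(1) f(1)[of k], of b] y(2) by simp
    qed
    have lin: "linear (lder ?\<theta> (\<alpha> p))" by (rule lder_linear[OF \<theta> y(1)])
    have "inj (lder ?\<theta> (\<alpha> p))"
    proof (rule injI)
      fix a b assume "lder ?\<theta> (\<alpha> p) a = lder ?\<theta> (\<alpha> p) b"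
      then have "a $ k = b $ k" for k using D[of a k] D[of b k] by simp
      then show "a = b" by (simp add: vec_eq_iff)
    qed
    then have "surj (lder ?\<theta> (\<alpha> p))" using lin linear_injective_imp_surjective by blast
    then obtain b where b: "u = lder ?\<theta> (\<alpha> p) b" by (metis surjD)
    then have "b $ k = 0" for k using u[of k] D[of b k] by simp
    then have "b = 0" by (simp add: vec_eq_iff)
    then show ?thesis using b lin by (simp add: linear_0)
  qed
  show thesis by (rule that[of N f]) (use N f inj in auto)
qed

section \<open>One-parameter subgroups\<close>

definition one_param_on :: "(real, 'n) vec \<Rightarrow> real \<Rightarrow> (real \<Rightarrow> 'g) \<Rightarrow> bool" where
  "one_param_on u T c \<longleftrightarrow> smooth_into A {-T<..<T} c \<and> c 0 = e \<and> (\<forall>t\<in>{-T<..<T}. lder c t 1 = u)"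

lemma one_param_local: "\<exists>T>0. \<exists>c. one_param_on u T c"
proof -
  obtain U \<alpha> where U: "(U, \<alpha>) \<in> A" "e \<in> U" using top_A by (rule topological_atlasE)
  obtain N f where N: "open N" "e \<in> N" "N \<subseteq> U" and f: "\<And>k. smooth_fun A (f k)"
    "\<And>k q. q \<in> N \<Longrightarrow> f k q = \<alpha> q $ k"
    and inj: "\<And>p u. p \<in> N \<Longrightarrow> (\<And>k. XX u (f k) p = 0) \<Longrightarrow> u = 0"
    using chart_coordinates[OF U] by blast
  let ?\<theta> = "inv_into U \<alpha>"
  note c = topological_atlas_chart[OF top_A U(1)]
  have \<theta>: "smooth_into A (\<alpha> ` U) ?\<theta>" by (rule smooth_into_chart_inv[OF U(1)])
  \<comment> \<open>The left-invariant field written in the chart.\<close>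
  define V where "V y = (\<chi> k. XX u (f k) (?\<theta> y))" for y
  let ?\<Omega> = "\<alpha> ` (U \<inter> N)"
  have \<Omega>: "open ?\<Omega>" by (rule chart_image_open[OF top_A U(1) N(1)])
  have V: "smooth_on ?\<Omega> V"
  proof (rule smooth_on_vec[OF \<Omega>])
    fix k
    have "smooth_on (\<alpha> ` U) (\<lambda>y. XX u (f k) (?\<theta> y))"
      by (rule smooth_intoD[OF \<theta> XX_smooth[OF f(1)]])
    then show "smooth_on ?\<Omega> (\<lambda>y. V y $ k)"
      unfolding V_def vec_lambda_beta by (rule smooth_on_subset) blast
  qed
  have "\<alpha> e \<in> ?\<Omega>" using U(2) N(2) by blast
  then obtain \<epsilon> y where \<epsilon>: "\<epsilon> > 0" and y0: "y 0 = \<alpha> e"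
    and y: "\<And>t::real. t \<in> {-\<epsilon><..<\<epsilon>} \<Longrightarrow> y t \<in> ?\<Omega> \<and> (y has_vector_derivative V (y t)) (at t)"
    by (rule ode_exists[OF \<Omega> V]) blast
  let ?I = "{-\<epsilon><..<\<epsilon>}"
  have ys: "smooth_on ?I y"
  proof (rule smooth_on_bootstrap[of _ _ "\<lambda>t h. h *\<^sub>R V (y t)"])
    show "open ?I" by simp
    show "(y has_derivative (\<lambda>h. h *\<^sub>R V (y t))) (at t)" if "t \<in> ?I" for t
      using y[OF that] by (simp add: has_vector_derivative_def)
    fix k and b :: real assume k: "Ck_on k ?I y"
    have "Ck_on k ?I (\<lambda>t. V (y t))"
      by (rule Ck_on_compose[OF _ k, where T = ?\<Omega>]) (use V y in \<open>auto simp: smooth_on_def\<close>)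
    then show "Ck_on k ?I (\<lambda>t. b *\<^sub>R V (y t))"
      by (intro Ck_on_scaleR Ck_on_const) auto
  qed
  let ?c = "\<lambda>t. ?\<theta> (y t)"
  have sub: "y ` ?I \<subseteq> \<alpha> ` U" using y by blast
  have cs: "smooth_into A ?I ?c"
    by (rule smooth_into_compose[OF \<theta> _ ys sub]) simp
  have "lder ?c t 1 = u" if t: "t \<in> ?I" for t
  proof -
    have inN: "?c t \<in> N" "\<alpha> (?c t) = y t" if "t \<in> ?I" for t
      using y[OF that] c(4) by (auto simp: f_inv_into_f)
    have "XX (lder ?c t 1 - u) (f k) (?c t) = 0" for k
    proof -
      have "((\<lambda>t. y t $ k) has_derivative (\<lambda>h. (h *\<^sub>R V (y t)) $ k)) (at t)"
        using y[OF t] unfolding has_vector_derivative_def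
        by (intro bounded_linear.has_derivative[OF bounded_linear_vec_nth]) auto
      then have "((\<lambda>t. f k (?c t)) has_derivative (\<lambda>h. (h *\<^sub>R V (y t)) $ k)) (at t)"
        by (rule has_derivative_transform_within_open[of _ _ _ _ ?I]) (use t inN f(2) in auto)
      from frechet_derivative_eq[OF this]
      have "frechet_derivative (\<lambda>t. f k (?c t)) (at t) 1 = XX u (f k) (?c t)"
        by (simp add: V_def)
      then show ?thesis
        using lder[OF cs t f(1)[of k], of 1] by (simp add: XX_linear_left)
    qed
    then have "lder ?c t 1 - u = 0" by (rule inj[OF inN(1)[OF t]])
    then show ?thesis by simp
  qed
  moreover have "?c 0 = e" using y0 c(4) U(2) by simp
  ultimately have "one_param_on u \<epsilon> ?c" using cs by (simp add: one_param_on_def)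
  with \<epsilon> show ?thesis by blast
qed

lemma one_param_unique:
  assumes "one_param_on u T c" "one_param_on u T' c'" "\<bar>t\<bar> < T" "\<bar>t\<bar> < T'"
  shows "c t = c' t"
proof -
  let ?T = "min T T'"
  have s: "smooth_into A {-?T<..<?T} c" "smooth_into A {-?T<..<?T} c'"
    using assms(1,2) by (auto simp: one_param_on_def elim!: smooth_into_subset)
  show ?thesis
  proof (rule eq_if_lder_eq[OF _ _ _ _ s, of 0])
    show "lder c x b = lder c' x b" if "x \<in> {-?T<..<?T}" for x b
      using that assms(1,2) lder_real[OF s(1) that, of b] lder_real[OF s(2) that, of b] by (auto simp: one_param_on_def)
  qed (use assms in \<open>auto simp: one_param_on_def\<close>)
qed

text \<open>As functions of \<open>t\<close> both sides start at \<open>c s\<close> and have the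
  same logarithmic derivative. The interval \<open>?S\<close> consists of the times for which
  \<open>t\<close> and \<open>s + t\<close> are both admissible.\<close>

lemma one_param_add:
  assumes c: "one_param_on u T c" and st: "\<bar>s\<bar> < T" "\<bar>t\<bar> < T" "\<bar>s + t\<bar> < T"
  shows "c (s + t) = mul (c s) (c t)"
proof -
  let ?S = "{max (-T) (-T - s)<..<min T (T - s)}"
  have cs: "smooth_into A {-T<..<T} c" "c 0 = e" and cl: "\<And>t. \<bar>t\<bar> < T \<Longrightarrow> lder c t 1 = u"
    using c by (auto simp: one_param_on_def abs_less_iff)
  have s1: "smooth_into A ?S c" by (rule smooth_into_subset[OF cs(1)]) auto
  have s2: "smooth_into A ?S (\<lambda>x. c (s + x))"
    by (rule smooth_into_compose[OF cs(1)]) (auto intro!: smooth_on_add)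
  show ?thesis
  proof (rule eq_if_lder_eq[of ?S 0 t "\<lambda>x. c (s + x)" "\<lambda>x. mul (c s) (c x)"])
    show "smooth_into A ?S (\<lambda>x. mul (c s) (c x))"
      by (intro smooth_into_mul smooth_into_const s1) simp
    fix x and b :: real assume x: "x \<in> ?S"
    have "lder (\<lambda>x. c (s + x)) x b = lder c (s + x) b"
      using x by (intro lder_compose[OF cs(1)]) (auto intro!: derivative_eq_intros)
    also have "\<dots> = b *\<^sub>R u"
      using x lder_real[OF cs(1), of "s + x" b] cl[of "s + x"] by auto
    also have "\<dots> = lder c x b"
      using x lder_real[OF cs(1), of x b] cl[of x] by auto
    also have "\<dots> = lder (\<lambda>x. mul (c s) (c x)) x b"
      by (rule lder_left[OF _ x s1, symmetric]) simp
    finally show "lder (\<lambda>x. c (s + x)) x b = lder (\<lambda>x. mul (c s) (c x)) x b" .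
  qed (use st s2 cs in auto)
qed

text \<open>Differentiate \<open>c (x + a) = mul (c x) (c a)\<close> at \<open>x = 0\<close>: the
  logarithmic derivative is \<open>u\<close> on the left and \<open>Adi (c a) u\<close> on the
  right.\<close>

lemma one_param_Adi:
  assumes c: "one_param_on u T c" and a: "\<bar>a\<bar> < T"
  shows "Adi (c a) u = u"
proof -
  let ?d = "T - \<bar>a\<bar>" let ?S = "{-?d<..<?d}"
  have cs: "smooth_into A {-T<..<T} c" "c 0 = e" and cl: "\<And>t. \<bar>t\<bar> < T \<Longrightarrow> lder c t 1 = u"
    using c by (auto simp: one_param_on_def abs_less_iff)
  have s1: "smooth_into A ?S c" by (rule smooth_into_subset[OF cs(1)]) auto
  have "((\<lambda>x. x + a) has_derivative (\<lambda>h. h)) (at 0)"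
    by (auto intro!: derivative_eq_intros)
  then have "u = lder (\<lambda>x. c (x + a)) 0 1"
    using a cl[of a] lder_compose[OF cs(1), of "\<lambda>x. x + a" 0 "\<lambda>h. h" 1] by (auto simp: abs_less_iff)
  also have "\<dots> = lder (\<lambda>x. mul (c x) (c a)) 0 1"
    using a by (intro lder_cong[of ?S] one_param_add[OF c]) auto
  also have "\<dots> = Adi (c a) (lder c 0 1) + lder (\<lambda>x :: real. c a) 0 1"
    by (rule lder_mul[OF _ _ s1 smooth_into_const]) (use a in auto)
  also have "\<dots> = Adi (c a) u"
    using a cl[of 0] by (simp add: lder_const)
  finally show ?thesis ..
qed

text \<open>Squaring \<open>c (t / 2)\<close> doubles the interval of definition; because
  \<open>Adi (c (t / 2))\<close> fixes \<open>u\<close>, each factor contributes half of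
  \<open>u\<close>.\<close>

lemma one_param_double:
  assumes c: "one_param_on u T c"
  shows "one_param_on u (2 * T) (\<lambda>t. mul (c (t / 2)) (c (t / 2)))"
  unfolding one_param_on_def
proof (intro conjI ballI)
  let ?S = "{- (2 * T)<..<2 * T}"
  have cs: "smooth_into A {-T<..<T} c" "c 0 = e" and cl: "\<And>t. \<bar>t\<bar> < T \<Longrightarrow> lder c t 1 = u"
    using c by (auto simp: one_param_on_def abs_less_iff)
  have s2: "smooth_into A ?S (\<lambda>t. c (t / 2))"
    by (rule smooth_into_compose[OF cs(1)]) (auto intro!: smooth_on_linear bounded_linear_divide)
  then show "smooth_into A ?S (\<lambda>t. mul (c (t / 2)) (c (t / 2)))"
    by (intro smooth_into_mul) auto
  show "mul (c (0 / 2)) (c (0 / 2)) = e" using cs(2) by simp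
  fix t assume t: "t \<in> ?S"
  have half: "lder (\<lambda>t. c (t / 2)) t 1 = (1 / 2) *\<^sub>R u"
  proof -
    have "lder (\<lambda>t. c (t / 2)) t 1 = lder c (t / 2) (1 / 2)"
      using t by (intro lder_compose[OF cs(1)]) (auto intro!: derivative_eq_intros)
    then show ?thesis using lder_real[OF cs(1), of "t / 2" "1 / 2"] cl[of "t / 2"] t by auto
  qed
  have "lder (\<lambda>t. mul (c (t / 2)) (c (t / 2))) t 1 = Adi (c (t / 2)) ((1 / 2) *\<^sub>R u) + (1 / 2) *\<^sub>R u"
    using lder_mul[OF _ t s2 s2, of 1] half by simp
  also have "Adi (c (t / 2)) ((1 / 2) *\<^sub>R u) = (1 / 2) *\<^sub>R u"
    using one_param_Adi[OF c, of "t / 2"] t linear_scale[OF linear_Adi] by auto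
  finally show "lder (\<lambda>t. mul (c (t / 2)) (c (t / 2))) t 1 = u"
    by (simp flip: scaleR_add_left)
qed

lemma one_param_on_all: "\<exists>c. one_param_on u T c"
proof -
  obtain T0 c0 where T0: "T0 > 0" "one_param_on u T0 c0" using one_param_local by blast
  have pow: "\<exists>c. one_param_on u (2 ^ n * T0) c" for n
  proof (induction n)
    case 0
    then show ?case using T0 by auto
  next
    case (Suc n)
    then obtain c where "one_param_on u (2 ^ n * T0) c" by blast
    from one_param_double[OF this] show ?case by (auto simp: mult.assoc)
  qed
  obtain n where "T / T0 < 2 ^ n" using real_arch_pow[of 2 "T / T0"] by auto
  then have "T \<le> 2 ^ n * T0" using T0 by (simp add: field_simps)
  moreover obtain c where "one_param_on u (2 ^ n * T0) c" using pow by blast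
  ultimately have "one_param_on u T c"
    unfolding one_param_on_def by (auto elim!: smooth_into_subset)
  then show ?thesis by blast
qed

lemma ex_one_param: "\<exists>c. smooth_into A UNIV c \<and> c 0 = e \<and> (\<forall>t b. lder c t b = b *\<^sub>R u)"
proof -
  obtain C where C: "\<And>T. one_param_on u T (C T)" using one_param_on_all by metis
  \<comment> \<open>Glued from solutions on bounded intervals; by \<open>one_param_unique\<close>
    the choice of the interval is immaterial.\<close>
  define c where "c t = C (\<bar>t\<bar> + 1) t" for t
  have c: "c t = C T t" if "\<bar>t\<bar> < T" for t T
    unfolding c_def by (rule one_param_unique[OF C C]) (use that in auto)
  have sm: "smooth_into A UNIV c"
    unfolding smooth_into_def
  proof (intro allI impI smooth_on_local)
    fix f and t :: real assume f: "smooth_fun A f"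
    let ?T = "\<bar>t\<bar> + 1"
    have "smooth_on {-?T<..<?T} (\<lambda>x. f (C ?T x))"
      using C[of ?T] f by (simp add: one_param_on_def smooth_into_def)
    then have "smooth_on {-?T<..<?T} (\<lambda>x. f (c x))"
      by (rule smooth_on_cong[THEN iffD1, rotated 2]) (auto simp: c[of _ ?T])
    then show "\<exists>S. open S \<and> t \<in> S \<and> smooth_on S (\<lambda>x. f (c x))"
      by (intro exI[of _ "{-?T<..<?T}"]) auto
  qed
  moreover have "lder c t b = b *\<^sub>R u" for t b :: real
  proof -
    let ?T = "\<bar>t\<bar> + 1"
    have "lder c t 1 = lder (C ?T) t 1"
      by (rule lder_cong[of "{-?T<..<?T}"]) (auto simp: c)
    also have "\<dots> = u"
    proof -
      have "t \<in> {-?T<..<?T}" by auto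
      then show ?thesis using C[of ?T] unfolding one_param_on_def by blast
    qed
    finally show ?thesis using lder_real[OF sm, of t b] by simp
  qed
  moreover have "c 0 = e" using C[of 1] by (simp add: c_def one_param_on_def)
  ultimately show ?thesis by blast
qed

definition one_param :: "(real, 'n) vec \<Rightarrow> real \<Rightarrow> 'g" where
  "one_param u = (SOME c. smooth_into A UNIV c \<and> c 0 = e \<and> (\<forall>t b. lder c t b = b *\<^sub>R u))"

lemma one_param_smooth: "smooth_into A UNIV (one_param u)"
  and one_param_0: "one_param u 0 = e"
  and lder_one_param: "lder (one_param u) t b = b *\<^sub>R u"
  using someI_ex[OF ex_one_param[of u]] by (auto simp: one_param_def)

end

section \<open>Power series of nilpotent operators\<close>

text \<open>Substitution of an operator into a formal power series, cut off at the order of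
  nilpotency, so that identities between series turn into identities between operators.\<close>

definition ev :: "nat \<Rightarrow> real fps \<Rightarrow> ('v::real_vector \<Rightarrow> 'v) \<Rightarrow> 'v \<Rightarrow> 'v" where
  "ev m p N v = (\<Sum>k<m. fps_nth p k *\<^sub>R (N ^^ k) v)"

locale nilpotent_op =
  fixes m :: nat and N :: "'v::real_vector \<Rightarrow> 'v"
  assumes lin: "linear N" and nil: "(N ^^ m) v = 0"
begin

lemma linear_pow: "linear (N ^^ k)"
proof (induction k)
  case 0
  then show ?case by (simp add: linear_iff)
next
  case (Suc k)
  then show ?case by (simp only: funpow.simps linear_compose[OF _ lin])
qed

lemma pow_eq_0: "m \<le> k \<Longrightarrow> (N ^^ k) v = 0"
  using funpow_add[of "k - m" m N] linear_0[OF linear_pow] by (simp add: nil)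

lemma linear_ev: "linear (ev m p N)"
  unfolding ev_def
  by (intro linear_compose_sum ballI linear_compose_scale_right linear_pow)

lemma ev_extend: "m \<le> M \<Longrightarrow> ev m p N v = (\<Sum>k<M. fps_nth p k *\<^sub>R (N ^^ k) v)"
  unfolding ev_def by (rule sum.mono_neutral_left) (auto simp: pow_eq_0)

lemma ev_add: "ev m (p + q) N v = ev m p N v + ev m q N v"
  by (simp add: ev_def scaleR_add_left sum.distrib)

lemma ev_diff: "ev m (p - q) N v = ev m p N v - ev m q N v"
  by (simp add: ev_def scaleR_diff_left sum_subtractf)

lemma ev_cmul: "ev m (fps_const c * p) N v = c *\<^sub>R ev m p N v"
  by (simp add: ev_def scaleR_sum_right)

lemma ev_1: "ev m 1 N v = v"
proof -
  have "ev m 1 N v = (\<Sum>k<Suc m. fps_nth 1 k *\<^sub>R (N ^^ k) v)"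
    by (rule ev_extend) simp
  also have "\<dots> = (\<Sum>k<Suc m. if k = 0 then v else 0)"
    by (rule sum.cong) auto
  finally show ?thesis by simp
qed

lemma ev_mult: "ev m (p * q) N v = ev m p N (ev m q N v)"
proof -
  let ?g = "\<lambda>i j. (fps_nth p i * fps_nth q j) *\<^sub>R (N ^^ (i + j)) v"
  have "ev m p N (ev m q N v) = (\<Sum>i<m. \<Sum>j<m. ?g i j)"
    unfolding ev_def
    by (simp add: linear_sum[OF linear_pow] linear_scale[OF linear_pow] scaleR_sum_right funpow_add)
  also have "\<dots> = (\<Sum>(i, j)\<in>{..<m} \<times> {..<m}. ?g i j)"
    by (rule sum.cartesian_product)
  \<comment> \<open>Only the triangle survives, since powers from \<open>m\<close> on vanish. This
    is why truncated sums multiply like power series.\<close>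
  also have "\<dots> = (\<Sum>(i, j)\<in>{(i, j). i + j < m}. ?g i j)"
    by (rule sum.mono_neutral_right) (auto, meson not_le pow_eq_0)
  also have "\<dots> = (\<Sum>k<m. \<Sum>i\<le>k. ?g i (k - i))"
    by (rule sum.triangle_reindex)
  also have "\<dots> = ev m (p * q) N v"
    unfolding ev_def by (simp add: fps_mult_nth scaleR_sum_left atLeast0AtMost)
  finally show ?thesis ..
qed

lemma ev_power: "ev m (p ^ k) N v = (ev m p N ^^ k) v"
  by (induction k) (simp_all add: ev_1 ev_mult)

lemma ev_sum: "ev m (\<Sum>i\<in>I. p i) N v = (\<Sum>i\<in>I. ev m (p i) N v)"
  by (induction I rule: infinite_finite_induct) (simp_all add: ev_add, simp_all add: ev_def)

lemma ev_compose:
  assumes "fps_nth b 0 = 0" shows "ev m a (ev m b N) v = ev m (a oo b) N v"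
proof -
  have "ev m a (ev m b N) v = ev m (\<Sum>k<m. fps_const (fps_nth a k) * b ^ k) N v"
    unfolding ev_sum ev_cmul ev_power by (simp add: ev_def[of m a])
  \<comment> \<open>Powers of \<open>b\<close> with exponent above \<open>n\<close> do not reach the
    coefficient \<open>n\<close>, because \<open>b\<close> has no constant term.\<close>
  moreover have "fps_nth (\<Sum>k<m. fps_const (fps_nth a k) * b ^ k) n = fps_nth (a oo b) n" if "n < m" for n
  proof -
    have "(\<Sum>k<m. fps_nth a k * fps_nth (b ^ k) n) = (\<Sum>k\<in>{0..n}. fps_nth a k * fps_nth (b ^ k) n)"
      using startsby_zero_power_prefix[OF assms] that by (intro sum.mono_neutral_right) auto
    then show ?thesis by (simp add: fps_sum_nth fps_compose_nth)
  qed
  ultimately show ?thesis by (simp add: ev_def[of m _ N])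
qed

lemma ev_exp_minus: "ev m (fps_exp (- c)) N (ev m (fps_exp c) N v) = v"
  using fps_exp_add_mult[of "- c" c] by (simp flip: ev_mult add: ev_1)

end

text \<open>The exponential as an integrating factor: along a solution of B' = v - N B the
  derivative reduces to the exponential applied to v.\<close>

lemma has_vector_derivative_ev_exp:
  fixes N :: "'v::euclidean_space \<Rightarrow> 'v"
  assumes "nilpotent_op m N" "(B has_vector_derivative B') (at t within S)"
  shows "((\<lambda>t. ev m (fps_exp t) N (B t)) has_vector_derivative ev m (fps_exp t) N (B' + N (B t))) (at t within S)"
proof -
  interpret nilpotent_op m N by fact
  have bl: "bounded_linear (N ^^ k)" for k
    using linear_pow linear_conv_bounded_linear by blast
  have "((\<lambda>t. \<Sum>k<m. (t ^ k / fact k) *\<^sub>R (N ^^ k) (B t)) has_vector_derivative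
     (\<Sum>k<m. (t ^ k / fact k) *\<^sub>R (N ^^ k) B' + (real k * t ^ (k - 1) / fact k) *\<^sub>R (N ^^ k) (B t))) (at t within S)"
    by (intro has_vector_derivative_sum has_vector_derivative_scaleR bounded_linear.has_vector_derivative[OF bl assms(2)])
      (auto intro!: derivative_eq_intros)
  moreover have "(\<Sum>k<m. (real k * t ^ (k - 1) / fact k) *\<^sub>R (N ^^ k) v) = (\<Sum>k<m. (t ^ k / fact k) *\<^sub>R (N ^^ k) (N v))" for v
  proof (cases m)
    case (Suc m')
    have "(\<Sum>k<m. (real k * t ^ (k - 1) / fact k) *\<^sub>R (N ^^ k) v) =
        (\<Sum>k<m'. (real (Suc k) * t ^ k / fact (Suc k)) *\<^sub>R (N ^^ Suc k) v)"
      unfolding Suc sum.lessThan_Suc_shift by simp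
    also have "\<dots> = (\<Sum>k<m'. (t ^ k / fact k) *\<^sub>R (N ^^ k) (N v))"
      by (intro sum.cong refl arg_cong2[where f = scaleR]) (auto simp: funpow_swap1 simp del: of_nat_Suc)
    \<comment> \<open>The added term with index \<open>m'\<close> contains the \<open>m\<close>-th
      power of \<open>N\<close>, which is zero.\<close>
    also have "\<dots> = (\<Sum>k<m. (t ^ k / fact k) *\<^sub>R (N ^^ k) (N v))"
      unfolding Suc using nil[of v] Suc by (simp add: funpow_swap1)
    finally show ?thesis .
  qed simp
  ultimately show ?thesis
    unfolding ev_def by (simp add: sum.distrib scaleR_add_right linear_add[OF linear_pow])
qed

lemma has_vector_derivative_ev_exp_integral:
  fixes N :: "'v::real_normed_vector \<Rightarrow> 'v"
  shows "((\<lambda>t. \<Sum>k<m. (t ^ Suc k / fact (Suc k)) *\<^sub>R (N ^^ k) v) has_vector_derivative ev m (fps_exp t) N v) (at t within S)"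
proof -
  have "((\<lambda>t. (t ^ Suc k / fact (Suc k)) *\<^sub>R (N ^^ k) v) has_vector_derivative (t ^ k / fact k) *\<^sub>R (N ^^ k) v) (at t within S)" for k
  proof -
    have "((\<lambda>t. t ^ Suc k / fact (Suc k)) has_real_derivative (t ^ k / fact k)) (at t within S)"
      by (auto intro!: derivative_eq_intros simp del: of_nat_Suc power_Suc)
    from has_vector_derivative_scaleR[OF this has_vector_derivative_const] show ?thesis by simp
  qed
  then show ?thesis
    by (simp add: ev_def has_vector_derivative_sum del: fact_Suc power_Suc)
qed

section \<open>The series (exp X - 1) / X and ln (1 + X) / X\<close>

definition exp_quot :: "real fps" where
  "exp_quot = Abs_fps (\<lambda>k. 1 / fact (Suc k))"

definition ln_quot :: "real fps" where
  "ln_quot = Abs_fps (\<lambda>k. (- 1) ^ k / real (Suc k))"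

lemma exp_quot_X: "exp_quot * fps_X = fps_exp 1 - 1"
  by (auto simp: fps_eq_iff exp_quot_def fact_reduce)

lemma ln_quot_X: "ln_quot * fps_X = fps_ln 1"
  by (auto simp: fps_eq_iff ln_quot_def fps_ln_nth)

text \<open>Substituting exp X - 1 for X in X \<open>ln_quot\<close> = ln (1 + X) gives X. Since exp
  X - 1 = X \<open>exp_quot\<close>, cancelling X shows that the two factors are inverse to each
  other.\<close>

lemma ln_quot_exp_quot: "(ln_quot oo (fps_exp 1 - 1)) * exp_quot = 1"
proof -
  have e0: "fps_nth (fps_exp (1::real) - 1) 0 = 0" by simp
  have "((ln_quot oo (fps_exp 1 - 1)) * exp_quot) * fps_X = (ln_quot oo (fps_exp 1 - 1)) * (fps_exp 1 - 1)"
    by (simp add: exp_quot_X mult.assoc)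
  also have "\<dots> = (ln_quot * fps_X) oo (fps_exp 1 - 1)"
    by (simp add: fps_compose_mult_distrib[OF e0])
  also have "\<dots> = fps_X"
    unfolding ln_quot_X by (simp add: fps_ln_fps_exp_inv fps_inv)
  finally show ?thesis by (metis mult_cancel_right fps_X_neq_zero mult_1)
qed

section \<open>Polynomials in time with parameters\<close>

lemma real_polynomial_function_sum_list_powers:
  fixes p :: "real \<times> 'a::real_normed_vector \<Rightarrow> real"
  assumes "real_polynomial_function p"
  shows "\<exists>xs. (\<forall>(d, c)\<in>set xs. real_polynomial_function c) \<and> (\<forall>t y. p (t, y) = (\<Sum>(d, c)\<leftarrow>xs. t ^ d * c y))"
  using assms
proof (induction rule: real_polynomial_function.induct)
  case (linear f)
  then have bl: "bounded_linear f" .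
  then interpret bounded_linear f .
  have eq: "f (t, y) = t * f (1, 0) + f (0, y)" for t y
    using add[of "t *\<^sub>R (1, 0)" "(0, y)"] by (simp only: scale) simp
  let ?xs = "[(1, \<lambda>y. f (1, 0)), (0, \<lambda>y. f (0, y))] :: (nat \<times> ('a \<Rightarrow> real)) list"
  have "bounded_linear (\<lambda>y. f (0, y))"
    by (intro bounded_linear_compose[OF bl]) (auto intro: bounded_linear_intros)
  then have 1: "\<forall>(d, c)\<in>set ?xs. real_polynomial_function c"
    by (simp add: real_polynomial_function.intros(1,2))
  have "f (t, y) = (\<Sum>(d, c)\<leftarrow>?xs. t ^ d * c y)" for t y
    by (subst eq) simp
  with 1 show ?case by blast
next
  case (const c)
  show ?case by (intro exI[of _ "[(0, \<lambda>y. c)]"]) (simp add: real_polynomial_function.intros(2))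
next
  case (add f g)
  then obtain xs ys where "\<forall>(d, c)\<in>set xs. real_polynomial_function c" "\<forall>t y. f (t, y) = (\<Sum>(d, c)\<leftarrow>xs. t ^ d * c y)"
    "\<forall>(d, c)\<in>set ys. real_polynomial_function c" "\<forall>t y. g (t, y) = (\<Sum>(d, c)\<leftarrow>ys. t ^ d * c y)"
    by blast
  then show ?case by (intro exI[of _ "xs @ ys"]) (simp add: ball_Un)
next
  case (mult f g)
  then obtain xs ys where *: "\<forall>(d, c)\<in>set xs. real_polynomial_function c" "\<forall>t y. f (t, y) = (\<Sum>(d, c)\<leftarrow>xs. t ^ d * c y)"
    "\<forall>(d, c)\<in>set ys. real_polynomial_function c" "\<forall>t y. g (t, y) = (\<Sum>(d, c)\<leftarrow>ys. t ^ d * c y)"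
    by blast
  let ?z = "map (\<lambda>((d, c), (d', c')). (d + d', \<lambda>y. c y * c' y)) (List.product xs ys)"
  have sm: "(\<Sum>(d, c)\<leftarrow>map (\<lambda>((d, c), (d', c')). (d + d', \<lambda>y. c y * c' y)) (List.product xs ys). t ^ d * c y) =
     (\<Sum>(d, c)\<leftarrow>xs. t ^ d * c y) * (\<Sum>(d, c)\<leftarrow>ys. t ^ d * c y)" for t :: real and y
  proof (induction xs)
    case (Cons x xs)
    have "(\<Sum>(d, c)\<leftarrow>map ((\<lambda>((d, c), (d', c')). (d + d', \<lambda>y. c y * c' y)) \<circ> Pair x) ys. t ^ d * c y) =
       (case x of (d, c) \<Rightarrow> t ^ d * c y) * (\<Sum>(d, c)\<leftarrow>ys. t ^ d * c y)"
      by (induction ys) (auto simp: algebra_simps power_add split: prod.splits)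
    then show ?case using Cons.IH by (simp add: algebra_simps)
  qed simp
  have "\<forall>(d, c)\<in>set ?z. real_polynomial_function c"
    using *(1,3) by (auto intro!: real_polynomial_function.intros(4))
  then show ?case using sm *(2,4) by (intro exI[of _ ?z]) simp
qed

text \<open>Expanded in powers of \<open>t\<close>, the polynomial can be integrated term by term,
  and the result is a polynomial in time and parameters jointly.\<close>

lemma real_polynomial_function_antiderivative:
  fixes p :: "real \<times> 'a::real_normed_vector \<Rightarrow> real"
  assumes "real_polynomial_function p"
  obtains q where "real_polynomial_function q" "\<And>y. q (0, y) = 0"
    "\<And>t y. ((\<lambda>t. q (t, y)) has_real_derivative p (t, y)) (at t)"
proof -
  obtain xs where xs: "\<forall>(d, c)\<in>set xs. real_polynomial_function c" "\<And>t y. p (t, y) = (\<Sum>(d, c)\<leftarrow>xs. t ^ d * c y)"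
    using real_polynomial_function_sum_list_powers[OF assms] by blast
  define q where "q z = (\<Sum>(d, c)\<leftarrow>xs. fst z ^ Suc d / real (Suc d) * c (snd z))" for z :: "real \<times> 'a"
  have "real_polynomial_function (\<lambda>z::real \<times> 'a. \<Sum>(d, c)\<leftarrow>xs. fst z ^ Suc d / real (Suc d) * c (snd z))"
    using xs(1)
  proof (induction xs)
    case (Cons x xs)
    obtain d c where x: "x = (d, c)" by fastforce
    have "real_polynomial_function (\<lambda>z::real \<times> 'a. c (snd z))"
      using real_polynomial_function_compose[of snd c] Cons.prems x
      by (auto simp: o_def polynomial_function_bounded_linear bounded_linear_snd)
    moreover have "real_polynomial_function (\<lambda>z::real \<times> 'a. fst z ^ Suc d / real (Suc d))"
      by (intro real_polynomial_function_divide real_polynomial_function_power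
          real_polynomial_function.intros(1) bounded_linear_fst)
    ultimately have "real_polynomial_function (\<lambda>z::real \<times> 'a. fst z ^ Suc d / real (Suc d) * c (snd z))"
      by (rule real_polynomial_function.intros(4)[rotated])
    moreover have "real_polynomial_function (\<lambda>z::real \<times> 'a. \<Sum>(d, c)\<leftarrow>xs. fst z ^ Suc d / real (Suc d) * c (snd z))"
      using Cons by simp
    ultimately show ?case
      unfolding x list.map sum_list.Cons prod.case by (rule real_polynomial_function.intros(3))
  qed auto
  moreover have "q (0, y) = 0" for y
    unfolding q_def by (induction xs) auto
  moreover have "((\<lambda>t. q (t, y)) has_real_derivative p (t, y)) (at t)" for t y
    unfolding q_def xs(2)
  proof (induction xs)
    case (Cons x xs)
    obtain d c where x: "x = (d, c)" by fastforce
    have "((\<lambda>t. t ^ Suc d / real (Suc d) * c y) has_real_derivative t ^ d * c y) (at t)"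
      by (auto intro!: derivative_eq_intros simp del: power_Suc of_nat_Suc)
    from DERIV_add[OF this Cons.IH] show ?case by (simp add: x)
  qed auto
  ultimately show thesis using that unfolding q_def[abs_def] by blast
qed

section \<open>The adjoint action as an exponential\<close>

context graded_frame
begin

lemma nilpotent_br: "nilpotent_op r (br u)"
proof (rule nilpotent_op.intro)
  fix v
  have "vanish k ((br u ^^ k) v)" for k
    by (induction k) (auto simp: vanish_0 vanish_br)
  then show "(br u ^^ r) v = 0" using vanish_r by blast
qed (rule linear_br)

sublocale nilpotent_op r "br u" for u by (rule nilpotent_br)

text \<open>The Maurer-Cartan equation for the product of \<open>one_param v s\<close> and
  \<open>one_param u t\<close>, taken at s = 0, says that B(t) =
  \<open>Adi (one_param u t) v\<close> satisfies B' = - [u, B]. The exponential is the integrating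
  factor.\<close>

lemma one_param_commutator:
  "ev r (fps_exp t) (br u) (Adi (one_param u t) v) = v"
proof -
  let ?\<phi> = "\<lambda>x. mul (one_param v (fst x)) (one_param u (snd x))"
  have s1: "smooth_into A UNIV (\<lambda>x :: real \<times> real. one_param v (fst x))"
    by (rule smooth_into_compose[OF one_param_smooth]) (auto intro: smooth_on_linear bounded_linear_fst)
  have s2: "smooth_into A UNIV (\<lambda>x :: real \<times> real. one_param u (snd x))"
    by (rule smooth_into_compose[OF one_param_smooth]) (auto intro: smooth_on_linear bounded_linear_snd)
  have s: "smooth_into A UNIV ?\<phi>" by (intro smooth_into_mul s1 s2) simp
  have l: "lder ?\<phi> x b = Adi (one_param u (snd x)) (fst b *\<^sub>R v) + snd b *\<^sub>R u" for x b
  proof -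
    have "lder (\<lambda>x :: real \<times> real. one_param v (fst x)) x b = fst b *\<^sub>R v"
      using lder_compose[OF one_param_smooth _ bounded_linear_imp_has_derivative[OF bounded_linear_fst]]
      by (simp add: lder_one_param)
    moreover have "lder (\<lambda>x :: real \<times> real. one_param u (snd x)) x b = snd b *\<^sub>R u"
      using lder_compose[OF one_param_smooth _ bounded_linear_imp_has_derivative[OF bounded_linear_snd]]
      by (simp add: lder_one_param)
    ultimately show ?thesis
      using lder_mul[OF _ _ s1 s2, of x b] by simp
  qed
  let ?B = "\<lambda>t. Adi (one_param u t) v"
  have dB: "(?B has_vector_derivative - br u (?B t)) (at t)" for t
  proof -
    have sm: "smooth_on UNIV (\<lambda>x. lder ?\<phi> x (1, 0))"
      by (rule lder_smooth[OF open_UNIV s])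
    let ?D = "frechet_derivative (\<lambda>x. lder ?\<phi> x (1, 0)) (at (0, t))"
    have 1: "?D (0, 1) = br (?B t) u"
      using maurer_cartan[OF open_UNIV _ s, of "(0, t)" "(1, 0)" "(0, 1)"] unfolding l
      by (simp add: linear_0[OF linear_Adi])
    have "((\<lambda>t. (0, t)) has_derivative (\<lambda>h. (0, h))) (at t)"
      by (auto intro!: derivative_eq_intros)
    from has_derivative_compose[OF this smooth_on_has_derivative[OF sm]]
    have 2: "((\<lambda>t. lder ?\<phi> (0, t) (1, 0)) has_derivative (\<lambda>h. ?D (0, h))) (at t)" by simp
    have "?D (0, h) = h *\<^sub>R br (?B t) u" for h
      using linear_scale[OF linear_frechet_derivative[OF smooth_on_differentiable[OF sm]], of "(0, t)" h "(0, 1)"]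
      unfolding 1[symmetric] by simp
    then have "((\<lambda>t. lder ?\<phi> (0, t) (1, 0)) has_vector_derivative br (?B t) u) (at t)"
      unfolding has_vector_derivative_def by (rule has_derivative_eq_rhs[OF 2, OF ext])
    then show ?thesis by (simp add: l br_commute[of "?B t" u])
  qed
  have "((\<lambda>t. ev r (fps_exp t) (br u) (?B t)) has_vector_derivative 0) (at t)" for t
    using has_vector_derivative_ev_exp[OF nilpotent_br[of u] dB[of t]]
    by (simp add: linear_0[OF linear_ev])
  then have "ev r (fps_exp t) (br u) (?B t) = ev r (fps_exp 0) (br u) (?B 0)"
    by (intro has_derivative_zero_unique_connected[of UNIV])
      (auto simp: has_vector_derivative_def)
  then show ?thesis by (simp add: one_param_0 Adi_e ev_1)
qed

lemma Adi_one_param: "Adi (one_param u t) v = ev r (fps_exp (- t)) (br u) v"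
  using arg_cong[OF one_param_commutator[of t u v], of "ev r (fps_exp (- t)) (br u)"]
  by (simp add: ev_exp_minus)

lemma polynomial_function_vec_nth: "polynomial_function F \<Longrightarrow> real_polynomial_function (\<lambda>z. F z $ k)"
  unfolding polynomial_function_def using bounded_linear_vec_nth[of k] by (auto simp: o_def)

lemma polynomial_function_vecI:
  fixes F :: "'a::real_normed_vector \<Rightarrow> (real, 'n) vec"
  assumes "\<And>k. real_polynomial_function (\<lambda>z. F z $ k)" shows "polynomial_function F"
proof -
  have "polynomial_function (\<lambda>z. \<Sum>k\<in>UNIV. F z $ k *\<^sub>R axis k (1::real))"
    using assms by (intro polynomial_function_sum polynomial_function_mult) (auto simp: real_polynomial_function_eq)
  moreover have "(\<lambda>z. \<Sum>k\<in>UNIV. F z $ k *\<^sub>R axis k (1::real)) = F"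
    by (simp add: fun_eq_iff vec_eq_iff axis_def if_distrib cong: if_cong)
  ultimately show ?thesis by metis
qed

lemma polynomial_function_br:
  "polynomial_function F \<Longrightarrow> polynomial_function H \<Longrightarrow> polynomial_function (\<lambda>z. br (F z) (H z))"
  by (rule polynomial_function_vecI, unfold br_nth)
    (intro real_polynomial_function_sum finite real_polynomial_function.intros(4) polynomial_function_vec_nth
      real_polynomial_function.intros(2); assumption)

lemma polynomial_function_ev:
  assumes "polynomial_function F" "polynomial_function H" "\<And>k. real_polynomial_function (\<lambda>z. fps_nth (p z) k)"
  shows "polynomial_function (\<lambda>z. ev r (p z) (br (F z)) (H z))"
proof -
  have "polynomial_function (\<lambda>z. (br (F z) ^^ k) (H z))" for k
    by (induction k) (auto intro: polynomial_function_br assms)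
  then show ?thesis
    unfolding ev_def using assms(3)
    by (intro polynomial_function_sum polynomial_function_mult) (auto simp: real_polynomial_function_eq)
qed

lemma smooth_on_polynomial_function:
  fixes F :: "'a::euclidean_space \<Rightarrow> (real, 'n) vec"
  shows "polynomial_function F \<Longrightarrow> smooth_on UNIV F"
  by (intro smooth_on_vec smooth_on_real_polynomial polynomial_function_vec_nth) auto

text \<open>Induction on \<open>K\<close>: split off a basis vector of least weight, the others spanning an ideal.
This yields smoothness in the parameters without a theorem on the dependence of flows on parameters.\<close>

lemma integrate_polynomial_family:
  fixes F :: "real \<times> 'a::euclidean_space \<Rightarrow> (real, 'n) vec"
  assumes "\<And>i l. i \<in> K \<Longrightarrow> w i < w l \<Longrightarrow> l \<in> K"
    and "polynomial_function F" "\<And>z k. k \<notin> K \<Longrightarrow> F z $ k = 0"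
  shows "\<exists>\<phi>. smooth_into A UNIV \<phi> \<and> (\<forall>y. \<phi> (0, y) = e) \<and> (\<forall>z. lder \<phi> z (1, 0) = F z)"
  using assms
proof (induction "card K" arbitrary: K F)
  case 0
  then have "F z = 0" for z by (simp add: vec_eq_iff)
  then show ?case by (intro exI[of _ "\<lambda>z. e"]) (auto simp: smooth_into_const lder_const)
next
  case (Suc n)
  then have "K \<noteq> {}" by auto
  then obtain k where k: "k \<in> K" "\<And>l. l \<in> K \<Longrightarrow> w k \<le> w l"
    using ex_min_if_finite[of "w ` K"] by (metis (no_types, lifting) arg_min_if_finite(1) arg_min_least finite)
  let ?a = "\<lambda>z. F z $ k"
  obtain \<sigma> where \<sigma>: "real_polynomial_function \<sigma>" "\<And>y. \<sigma> (0, y) = 0"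
    "\<And>t y. ((\<lambda>t. \<sigma> (t, y)) has_real_derivative ?a (t, y)) (at t)"
    using real_polynomial_function_antiderivative[OF polynomial_function_vec_nth[OF Suc.prems(2)], of k] by blast
  let ?E = "axis k 1 :: (real, 'n) vec"
  let ?F1 = "\<lambda>z. F z - ?a z *\<^sub>R ?E"
  \<comment> \<open>Multiplication on the right by the one-parameter factor will apply its
    \<open>Adi\<close>, which is the inverse of this exponential; the exponential compensates for it
    in advance.\<close>
  let ?F2 = "\<lambda>z. ev r (fps_exp (\<sigma> z)) (br ?E) (?F1 z)"
  have F1: "?F1 z $ l = 0" if "l \<notin> K - {k}" for z l
    using that Suc.prems(3)[of l z] by (cases "l = k") (auto simp: axis_def)
  have supp: "br ?E v $ l = 0" if v: "\<And>l. l \<notin> K - {k} \<Longrightarrow> v $ l = 0" and l: "l \<notin> K - {k}" for v l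
  proof -
    have "?E $ i * v $ j * L i j l = 0" for i j
    proof (cases "j \<in> K - {k} \<and> w l = w i + w j")
      case True
      then have "w j < w l" using w_pos[of i] by simp
      moreover have "w k \<le> w j" using k(2) True by blast
      ultimately have "l \<in> K - {k}" using Suc.prems(1)[of j l] True by auto
      then show ?thesis using l by blast
    next
      case False
      then show ?thesis using v[of j] L_zero[of l i j] by auto
    qed
    then show ?thesis unfolding br_nth by (intro sum.neutral ballI)
  qed
  have pow: "(br ?E ^^ n) v $ l = 0" if "\<And>l. l \<notin> K - {k} \<Longrightarrow> v $ l = 0" "l \<notin> K - {k}" for v l n
    using that by (induction n arbitrary: l) (auto intro: supp)
  have F2: "?F2 z $ l = 0" if "l \<notin> K - {k}" for z l
    using pow[OF F1 that] by (simp add: ev_def)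
  have "polynomial_function ?F2"
    using \<sigma>(1) Suc.prems(2)
    by (intro polynomial_function_ev polynomial_function_diff polynomial_function_mult polynomial_function_const)
      (auto simp: polynomial_function_vec_nth simp flip: real_polynomial_function_eq)
  moreover have "l \<in> K - {k}" if "i \<in> K - {k}" "w i < w l" for i l
    using that Suc.prems(1)[of i l] k(2)[of i] by auto
  moreover have "n = card (K - {k})" using Suc.hyps(2) k(1) by simp
  ultimately obtain \<phi> where \<phi>: "smooth_into A UNIV \<phi>" "\<forall>y. \<phi> (0, y) = e" "\<forall>z. lder \<phi> z (1, 0) = ?F2 z"
    using Suc.hyps(1)[of "K - {k}" ?F2] F2 by blast
  let ?\<psi> = "\<lambda>z. one_param ?E (\<sigma> z)"
  have s\<sigma>: "smooth_on UNIV \<sigma>" by (rule smooth_on_real_polynomial[OF \<sigma>(1) open_UNIV])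
  have \<psi>: "smooth_into A UNIV ?\<psi>"
    by (rule smooth_into_compose[OF one_param_smooth _ s\<sigma>]) auto
  have l\<psi>: "lder ?\<psi> z (1, 0) = ?a z *\<^sub>R ?E" for z
  proof -
    obtain t y where z: "z = (t, y)" by fastforce
    have D: "(\<sigma> has_derivative frechet_derivative \<sigma> (at z)) (at z)"
      using smooth_on_has_derivative[OF s\<sigma>] by simp
    have "((\<lambda>t. (t, y)) has_derivative (\<lambda>h. (h, 0))) (at t)"
      by (auto intro!: derivative_eq_intros)
    from has_derivative_compose[OF this D[unfolded z]]
    have "((\<lambda>t. \<sigma> (t, y)) has_derivative (\<lambda>h. frechet_derivative \<sigma> (at z) (h, 0))) (at t)"
      by (simp add: z)
    from has_derivative_unique[OF this \<sigma>(3)[of y t, unfolded has_field_derivative_def]]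
    have "frechet_derivative \<sigma> (at z) (1, 0) = ?a z" by (simp add: z fun_eq_iff)
    then show ?thesis
      using lder_compose[OF one_param_smooth _ D, of ?E "(1, 0)"] by (simp add: lder_one_param)
  qed
  have "lder (\<lambda>z. mul (\<phi> z) (?\<psi> z)) z (1, 0) = F z" for z
  proof -
    have "lder (\<lambda>z. mul (\<phi> z) (?\<psi> z)) z (1, 0) = Adi (?\<psi> z) (?F2 z) + ?a z *\<^sub>R ?E"
      using lder_mul[OF open_UNIV _ \<phi>(1) \<psi>, of z "(1, 0)"] \<phi>(3) l\<psi> by simp
    also have "Adi (?\<psi> z) (?F2 z) = ?F1 z"
      unfolding Adi_one_param by (rule ev_exp_minus)
    finally show ?thesis by simp
  qed
  moreover have "mul (\<phi> (0, y)) (?\<psi> (0, y)) = e" for y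
    using \<phi>(2) \<sigma>(2) by (simp add: one_param_0)
  moreover have "smooth_into A UNIV (\<lambda>z. mul (\<phi> z) (?\<psi> z))"
    by (intro smooth_into_mul \<phi> \<psi>) simp
  ultimately show ?case by blast
qed

section \<open>The exponential map\<close>

definition EE :: "(real, 'n) vec \<Rightarrow> 'g" where
  "EE u = one_param u 1"

lemma one_param_eq_EE: "one_param u t = EE (t *\<^sub>R u)"
proof -
  have s: "smooth_into A UNIV (\<lambda>s. one_param u (s * t))"
    by (rule smooth_into_compose[OF one_param_smooth])
      (auto intro: smooth_on_linear bounded_linear_mult_left)
  have "((\<lambda>s. s * t) has_derivative (\<lambda>h. h * t)) (at s)" for s
    by (auto intro!: derivative_eq_intros)
  from lder_compose[OF one_param_smooth _ this]
  have "lder (\<lambda>s. one_param u (s * t)) s b = lder (one_param (t *\<^sub>R u)) s b" for s b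
    by (simp add: lder_one_param)
  from eq_if_lder_eq[OF _ _ _ _ s one_param_smooth this, of 0 1]
  show ?thesis by (simp add: one_param_0 EE_def)
qed

text \<open>For \<open>snd\<close>, the family whose velocity is constantly the parameter,
  \<open>integrate_polynomial_family\<close> gives a map smooth in time and parameter jointly;
  \<open>EE\<close> is its value at time 1.\<close>

lemma EE_smooth: "smooth_into A UNIV EE"
proof -
  have "polynomial_function (snd :: real \<times> (real, 'n) vec \<Rightarrow> _)"
    by (intro polynomial_function_bounded_linear bounded_linear_snd)
  then obtain \<phi> :: "real \<times> (real, 'n) vec \<Rightarrow> 'g" where \<phi>: "smooth_into A UNIV \<phi>" "\<And>y. \<phi> (0, y) = e" "\<And>z. lder \<phi> z (1, 0) = snd z"
    using integrate_polynomial_family[of UNIV snd] by auto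
  have "\<phi> (t, y) = one_param y t" for t y
  proof -
    have s: "smooth_into A UNIV (\<lambda>t. \<phi> (t, y))"
      by (rule smooth_into_compose[OF \<phi>(1)]) (auto intro!: smooth_on_Pair)
    have "((\<lambda>t. (t, y)) has_derivative (\<lambda>h. (h, 0))) (at t)" for t
      by (auto intro!: derivative_eq_intros)
    from lder_compose[OF \<phi>(1) _ this]
    have "lder (\<lambda>t. \<phi> (t, y)) t b = lder \<phi> (t, y) (b, 0)" for t b by simp
    moreover have "lder \<phi> (t, y) (b, 0) = b *\<^sub>R y" for t b
      using linear_scale[OF lder_linear[OF \<phi>(1)], of "(t, y)" b "(1, 0)"] \<phi>(3) by simp
    ultimately have "lder (\<lambda>t. \<phi> (t, y)) t b = lder (one_param y) t b" for t b
      by (simp add: lder_one_param)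
    from eq_if_lder_eq[OF _ _ _ _ s one_param_smooth this, of 0 t]
    show ?thesis by (simp add: one_param_0 \<phi>(2))
  qed
  then have "EE = (\<lambda>u. \<phi> (1, u))" by (simp add: EE_def fun_eq_iff)
  moreover have "smooth_into A UNIV (\<lambda>u. \<phi> (1, u))"
    by (rule smooth_into_compose[OF \<phi>(1)]) (auto intro!: smooth_on_Pair)
  ultimately show ?thesis by simp
qed

lemma EE_0: "EE 0 = e"
  using one_param_eq_EE[of 0 0] by (simp add: one_param_0)

lemma lder_EE_line: "lder (\<lambda>t. EE (t *\<^sub>R u)) t b = b *\<^sub>R u"
  using lder_one_param[of u t b] by (simp add: one_param_eq_EE[abs_def])

lemma Adi_EE_scale: "Adi (EE (t *\<^sub>R u)) v = ev r (fps_exp (- t)) (br u) v"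
  using Adi_one_param[of u t v] by (simp add: one_param_eq_EE)

lemma ev_exp_Adi_EE: "ev r (fps_exp 1) (br u) (Adi (EE u) v) = v"
  using one_param_commutator[of 1 u v] by (simp add: EE_def)

lemma lder_EE_compose:
  assumes "(Z has_vector_derivative Z') (at t)"
  shows "lder (\<lambda>t. EE (Z t)) t b = b *\<^sub>R lder EE (Z t) Z'"
  using lder_compose[OF EE_smooth _ assms[unfolded has_vector_derivative_def], of b]
    linear_scale[OF lder_linear[OF EE_smooth]] by simp

text \<open>The Maurer--Cartan equation for \<open>(s, t) \<mapsto> EE (t (z + s v))\<close> is a linear differential
  equation in \<open>t\<close> for the left-hand side.\<close>

lemma lder_EE: "ev r (fps_exp 1) (br z) (lder EE z v) = ev r exp_quot (br z) v"
proof -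
  let ?h = "\<lambda>x :: real \<times> real. snd x *\<^sub>R (z + fst x *\<^sub>R v)"
  let ?\<phi> = "\<lambda>x. EE (?h x)"
  have sh: "smooth_on UNIV ?h"
    by (intro smooth_on_scaleR smooth_on_add smooth_on_linear bounded_linear_fst bounded_linear_snd smooth_on_const open_UNIV)
  have s: "smooth_into A UNIV ?\<phi>"
    by (rule smooth_into_compose[OF EE_smooth _ sh]) auto
  have dh: "(?h has_derivative (\<lambda>b. snd x *\<^sub>R (fst b *\<^sub>R v) + snd b *\<^sub>R (z + fst x *\<^sub>R v))) (at x)" for x
    by (auto intro!: derivative_eq_intros simp: algebra_simps)
  have l: "lder ?\<phi> x b = lder EE (?h x) (snd x *\<^sub>R (fst b *\<^sub>R v) + snd b *\<^sub>R (z + fst x *\<^sub>R v))" for x b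
    by (rule lder_compose[OF EE_smooth _ dh]) simp
  have lE: "lder EE (t *\<^sub>R y) y = y" for t y
  proof -
    have "((\<lambda>t. t *\<^sub>R y) has_vector_derivative y) (at t)"
      by (auto intro!: derivative_eq_intros)
    from lder_EE_compose[OF this, of 1] lder_EE_line[of y t 1] show ?thesis by simp
  qed
  have l1: "lder ?\<phi> x (0, 1) = z + fst x *\<^sub>R v" for x
    by (simp add: l lE)
  let ?B = "\<lambda>t. lder ?\<phi> (0, t) (1, 0)"
  have dB: "(?B has_vector_derivative v - br z (?B t)) (at t)" for t
  proof -
    have sm: "smooth_on UNIV (\<lambda>x. lder ?\<phi> x (1, 0))"
      by (rule lder_smooth[OF open_UNIV s])
    let ?D = "frechet_derivative (\<lambda>x. lder ?\<phi> x (1, 0)) (at (0, t))"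
    have "((\<lambda>x :: real \<times> real. z + fst x *\<^sub>R v) has_derivative (\<lambda>b. fst b *\<^sub>R v)) (at (0, t))"
      by (auto intro!: derivative_eq_intros)
    then have "frechet_derivative (\<lambda>x. lder ?\<phi> x (0, 1)) (at (0, t)) (1, 0) = v"
      unfolding l1 by (simp add: frechet_derivative_eq)
    then have 1: "?D (0, 1) = v - br z (?B t)"
      using maurer_cartan[OF open_UNIV _ s, of "(0, t)" "(1, 0)" "(0, 1)"] l1[of "(0, t)"] br_commute[of "?B t" z]
      by (simp add: algebra_simps)
    have "((\<lambda>t. (0, t)) has_derivative (\<lambda>h. (0, h))) (at t)"
      by (auto intro!: derivative_eq_intros)
    from has_derivative_compose[OF this smooth_on_has_derivative[OF sm]]
    have 2: "(?B has_derivative (\<lambda>h. ?D (0, h))) (at t)" by simp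
    have "?D (0, h) = h *\<^sub>R (v - br z (?B t))" for h
      using linear_scale[OF linear_frechet_derivative[OF smooth_on_differentiable[OF sm]], of "(0, t)" h "(0, 1)"]
      unfolding 1[symmetric] by simp
    then show ?thesis
      unfolding has_vector_derivative_def by (rule has_derivative_eq_rhs[OF 2, OF ext])
  qed
  \<comment> \<open>The antiderivative, vanishing at 0, of the exponential applied to
    \<open>v\<close>. At \<open>t = 1\<close> its coefficients are those of
    \<open>exp_quot\<close>.\<close>
  let ?I = "\<lambda>t. \<Sum>k<r. (t ^ Suc k / fact (Suc k)) *\<^sub>R (br z ^^ k) v"
  let ?F = "\<lambda>t. ev r (fps_exp t) (br z) (?B t) - ?I t"
  have "(?F has_vector_derivative 0) (at t)" for t
    using has_vector_derivative_diff[OF has_vector_derivative_ev_exp[OF nilpotent_br[of z] dB[of t]]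
        has_vector_derivative_ev_exp_integral[where m = r and N = "br z" and v = v and t = t and S = UNIV]] by simp
  then have "?F 1 = ?F 0"
    by (intro has_derivative_zero_unique_connected[of UNIV ?F])
      (auto simp: has_vector_derivative_def)
  also have "?F 0 = 0"
    by (simp add: l linear_0[OF lder_linear[OF EE_smooth]] linear_0[OF linear_ev])
  finally have "ev r (fps_exp 1) (br z) (?B 1) = ?I 1" by simp
  moreover have "?B 1 = lder EE z v" by (simp add: l)
  moreover have "?I 1 = ev r exp_quot (br z) v"
    by (simp add: ev_def exp_quot_def)
  ultimately show ?thesis by simp
qed

text \<open>The inverse of \<open>lder EE x\<close>, found by solving \<open>lder_EE\<close> for its
  argument. It will give the coefficients of left-invariant fields in exponential coordinates, and
  it is polynomial in \<open>x\<close>.\<close>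

definition Om :: "(real, 'n) vec \<Rightarrow> (real, 'n) vec \<Rightarrow> (real, 'n) vec" where
  "Om x = ev r (inverse exp_quot * fps_exp 1) (br x)"

lemma Om_lder: "Om x (lder EE x v) = v"
proof -
  have "inverse exp_quot * exp_quot = 1"
    by (rule inverse_mult_eq_1) (simp add: exp_quot_def)
  then show ?thesis
    unfolding Om_def ev_mult lder_EE by (simp flip: ev_mult add: ev_1)
qed

lemma linear_lder_EE: "linear (lder EE x)"
  by (rule lder_linear[OF EE_smooth]) simp

lemma linear_Om: "linear (Om x)"
  unfolding Om_def by (rule linear_ev)

lemma lder_Om: "lder EE x (Om x u) = u"
proof -
  have "inj (lder EE x)" by (metis Om_lder injI)
  then have "surj (lder EE x)"
    using linear_injective_imp_surjective[OF linear_lder_EE] by blast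
  then obtain v where "u = lder EE x v" by (metis surjD)
  then show ?thesis by (simp add: Om_lder)
qed

end

section \<open>Dynkin's formula\<close>

lemma nested_bracket_Cons: "vs \<noteq> [] \<Longrightarrow> nested_bracket b (v # vs) = b v (nested_bracket b vs)"
  by (cases vs) auto

lemma nested_bracket_replicate:
  "vs \<noteq> [] \<Longrightarrow> nested_bracket b (replicate p x @ vs) = (b x ^^ p) (nested_bracket b vs)"
  by (induction p) (auto simp: nested_bracket_Cons)

definition dynkin_word :: "'v \<Rightarrow> 'v \<Rightarrow> (nat \<times> nat) list \<Rightarrow> 'v list" where
  "dynkin_word x y ps = concat (map (\<lambda>(p, q). replicate p x @ replicate q y) ps)"

lemma length_dynkin_word: "length (dynkin_word x y ps) = (\<Sum>(p, q)\<leftarrow>ps. p + q)"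
  unfolding dynkin_word_def by (induction ps) auto

lemma sum_lists_length_Suc:
  "(\<Sum>ps | set ps \<subseteq> S \<and> length ps = Suc k. f ps) = (\<Sum>a\<in>S. \<Sum>ps | set ps \<subseteq> S \<and> length ps = k. f (a # ps))"
proof -
  have "{ps. set ps \<subseteq> S \<and> length ps = Suc k} = (\<lambda>(a, ps). a # ps) ` (S \<times> {ps. set ps \<subseteq> S \<and> length ps = k})"
    by (auto simp: length_Suc_conv image_iff)
  then show ?thesis
    by (simp add: sum.reindex inj_on_def sum.cartesian_product case_prod_beta)
qed

context graded_frame
begin

lemma vanish_nested: "vs \<noteq> [] \<Longrightarrow> vanish (length vs - 1) (nested_bracket br vs)"
proof (induction vs)
  case (Cons v vs)
  then show ?case
    using vanish_br[of "length vs - 1" "nested_bracket br vs" v]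
    by (cases "vs = []") (auto simp: nested_bracket_Cons vanish_0)
qed simp

lemma nested_bracket_eq_0: "r < length vs \<Longrightarrow> nested_bracket br vs = 0"
  using vanish_nested[of vs] vanish_r[of "length vs - 1" "nested_bracket br vs"] by fastforce

lemma nested_bracket_scale:
  "nested_bracket br (map (\<lambda>v. t *\<^sub>R v) vs) = t ^ length vs *\<^sub>R nested_bracket br vs"
proof (induction vs)
  case (Cons v vs)
  interpret bounded_bilinear br by (rule bounded_bilinear_br)
  show ?case
    using Cons by (cases "vs = []") (auto simp: nested_bracket_Cons scaleR_left scaleR_right)
qed simp

text \<open>The operator exp (t ad x) exp (t ad y) - 1. Expanding its powers in the series of the
  logarithm produces Dynkin's sum.\<close>

definition dW :: "(real, 'n) vec \<Rightarrow> (real, 'n) vec \<Rightarrow> real \<Rightarrow> (real, 'n) vec \<Rightarrow> (real, 'n) vec" where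
  "dW x y t v = ev r (fps_exp t) (br x) (ev r (fps_exp t) (br y) v) - v"

abbreviation dS :: "(nat \<times> nat) set" where
  "dS \<equiv> {(p, q). p \<le> r \<and> q \<le> r \<and> p + q > 0}"

lemma finite_dS: "finite dS"
  by (rule finite_subset[of _ "{..r} \<times> {..r}"]) auto

lemma r_pos: "r \<ge> 1"
  using w_pos w_le order_trans by blast

lemma dW_eq:
  "dW x y t v = (\<Sum>(p, q)\<in>dS. (t ^ (p + q) / (fact p * fact q)) *\<^sub>R (br x ^^ p) ((br y ^^ q) v))"
proof -
  have "ev r (fps_exp t) (br x) (ev r (fps_exp t) (br y) v) =
      (\<Sum>p<Suc r. \<Sum>q<Suc r. (t ^ (p + q) / (fact p * fact q)) *\<^sub>R (br x ^^ p) ((br y ^^ q) v))"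
    unfolding ev_extend[of "Suc r", OF le_SucI[OF order_refl]]
    by (simp add: linear_sum[OF linear_pow] linear_scale[OF linear_pow] scaleR_sum_right power_add del: sum.lessThan_Suc)
  also have "\<dots> = (\<Sum>(p, q)\<in>{..r} \<times> {..r}. (t ^ (p + q) / (fact p * fact q)) *\<^sub>R (br x ^^ p) ((br y ^^ q) v))"
    unfolding lessThan_Suc_atMost by (rule sum.cartesian_product)
  \<comment> \<open>Removing the pair of exponents (0, 0) amounts to subtracting the
    identity.\<close>
  also have "{..r} \<times> {..r} = insert (0, 0) dS" by auto
  also have "(\<Sum>(p, q)\<in>insert (0, 0) dS. (t ^ (p + q) / (fact p * fact q)) *\<^sub>R (br x ^^ p) ((br y ^^ q) v)) =
      v + (\<Sum>(p, q)\<in>dS. (t ^ (p + q) / (fact p * fact q)) *\<^sub>R (br x ^^ p) ((br y ^^ q) v))"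
    using finite_dS by (subst sum.insert) auto
  finally show ?thesis by (simp add: dW_def)
qed

abbreviation dlen :: "(nat \<times> nat) list \<Rightarrow> nat" where
  "dlen ps \<equiv> (\<Sum>(p, q)\<leftarrow>ps. p + q)"

abbreviation dfact :: "(nat \<times> nat) list \<Rightarrow> real" where
  "dfact ps \<equiv> (\<Prod>(p, q)\<leftarrow>ps. fact p * fact q)"

abbreviation dnb :: "(real, 'n) vec \<Rightarrow> (real, 'n) vec \<Rightarrow> (nat \<times> nat) list \<Rightarrow> (real, 'n) vec" where
  "dnb x y ps \<equiv> nested_bracket br (dynkin_word x y ps)"

lemma dlen_pos: "set ps \<subseteq> dS \<Longrightarrow> ps \<noteq> [] \<Longrightarrow> dlen ps > 0"
  by (cases ps) auto

text \<open>Two equal innermost letters bracket to zero, so only \<open>x\<close> alone and words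
  with a single final \<open>y\<close> survive.\<close>

lemma nested_two: "nested_bracket br (replicate p x @ replicate q y) =
  (if q = 0 then if p = 1 then x else 0 else if q = 1 then (br x ^^ p) y else 0)"
proof (cases q)
  case 0
  have "nested_bracket br (replicate (Suc (Suc n)) x) = 0" for n
  proof (induction n)
    case (Suc n)
    then show ?case
      using linear_0[OF linear_br] by (simp add: nested_bracket_Cons)
  qed simp
  then show ?thesis using 0 by (cases p; cases "p - 1") auto
next
  case (Suc q')
  have z: "nested_bracket br (replicate (Suc (Suc n)) y) = 0" for n
  proof (induction n)
    case (Suc n)
    then show ?case
      using linear_0[OF linear_br] by (simp add: nested_bracket_Cons)
  qed simp
  have "nested_bracket br (replicate p x @ replicate q y) = (br x ^^ p) (nested_bracket br (replicate q y))"
    using Suc by (intro nested_bracket_replicate) auto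
  also have "nested_bracket br (replicate q y) = (if q = 1 then y else 0)"
    using Suc z by (cases q') auto
  finally show ?thesis using Suc by (auto simp: linear_0[OF linear_pow])
qed

text \<open>Each application of \<open>dW\<close> prepends a pair of exponents to the word, and the
  start vector collects the innermost pairs that survive in \<open>nested_two\<close>. The power of
  \<open>t\<close> is one below the length of the word because the sum is to be a derivative in
  \<open>t\<close>.\<close>

lemma dW_pow_eq:
  "(dW x y t ^^ k) (x + ev r (fps_exp t) (br x) y) =
    (\<Sum>ps | set ps \<subseteq> dS \<and> length ps = Suc k. (t ^ (dlen ps - 1) / dfact ps) *\<^sub>R dnb x y ps)"
proof (induction k)
  case 0
  have "(\<Sum>ps | set ps \<subseteq> dS \<and> length ps = Suc 0. (t ^ (dlen ps - 1) / dfact ps) *\<^sub>R dnb x y ps) =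
      (\<Sum>(p, q)\<in>dS. (t ^ (p + q - 1) / (fact p * fact q)) *\<^sub>R nested_bracket br (replicate p x @ replicate q y))"
    unfolding sum_lists_length_Suc by (intro sum.cong refl) (auto simp: dynkin_word_def cong: conj_cong)
  also have "\<dots> = (\<Sum>(p, q)\<in>insert (1, 0) ((\<lambda>p. (p, 1)) ` {..r}).
      (t ^ (p + q - 1) / (fact p * fact q)) *\<^sub>R nested_bracket br (replicate p x @ replicate q y))"
    by (rule sum.mono_neutral_right) (use finite_dS r_pos in \<open>auto simp: nested_two image_iff split: if_splits\<close>)
  also have "\<dots> = x + (\<Sum>(p, q)\<in>(\<lambda>p. (p, 1)) ` {..r}.
      (t ^ (p + q - 1) / (fact p * fact q)) *\<^sub>R nested_bracket br (replicate p x @ replicate q y))"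
    by (subst sum.insert) (auto simp: nested_two)
  also have "\<dots> = x + (\<Sum>p\<le>r. (t ^ p / fact p) *\<^sub>R (br x ^^ p) y)"
    by (subst sum.reindex) (auto simp: inj_on_def nested_two)
  also have "\<dots> = x + ev r (fps_exp t) (br x) y"
    unfolding ev_extend[of "Suc r", OF le_SucI[OF order_refl]] lessThan_Suc_atMost by simp
  finally show ?case by simp
next
  case (Suc k)
  have lin: "linear (dW x y t)"
    unfolding dW_def[abs_def]
    by (intro linear_compose_sub linear_compose[OF linear_ev linear_ev, unfolded o_def] linear_ident)
  have "(dW x y t ^^ Suc k) (x + ev r (fps_exp t) (br x) y) =
      (\<Sum>ps | set ps \<subseteq> dS \<and> length ps = Suc k. (t ^ (dlen ps - 1) / dfact ps) *\<^sub>R dW x y t (dnb x y ps))"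
    by (simp only: funpow.simps o_apply Suc.IH linear_sum[OF lin] linear_scale[OF lin])
  also have "\<dots> = (\<Sum>ps | set ps \<subseteq> dS \<and> length ps = Suc k. \<Sum>a\<in>dS. (t ^ (dlen (a # ps) - 1) / dfact (a # ps)) *\<^sub>R dnb x y (a # ps))"
  proof (rule sum.cong[OF refl])
    fix ps assume "ps \<in> {ps. set ps \<subseteq> dS \<and> length ps = Suc k}"
    then have ps: "set ps \<subseteq> dS" "ps \<noteq> []" by auto
    then have pos: "dlen ps > 0" by (rule dlen_pos)
    then have ne: "dynkin_word x y ps \<noteq> []"
      by (metis length_dynkin_word length_0_conv less_numeral_extra(3))
    have "(t ^ (dlen ps - 1) / dfact ps) *\<^sub>R dW x y t (dnb x y ps) =
        (\<Sum>(p, q)\<in>dS. (t ^ (dlen ps - 1) / dfact ps) *\<^sub>R (t ^ (p + q) / (fact p * fact q)) *\<^sub>R (br x ^^ p) ((br y ^^ q) (dnb x y ps)))"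
      unfolding dW_eq scaleR_sum_right by (simp add: case_prod_beta)
    also have "\<dots> = (\<Sum>a\<in>dS. (t ^ (dlen (a # ps) - 1) / dfact (a # ps)) *\<^sub>R dnb x y (a # ps))"
    proof (rule sum.cong[OF refl], clarify)
      fix p q
      have "dynkin_word x y ((p, q) # ps) = replicate p x @ replicate q y @ dynkin_word x y ps"
        by (simp add: dynkin_word_def)
      then have "dnb x y ((p, q) # ps) = (br x ^^ p) ((br y ^^ q) (dnb x y ps))"
        using ne by (simp add: nested_bracket_replicate)
      moreover have "t ^ (dlen ((p, q) # ps) - 1) = t ^ (dlen ps - 1) * t ^ (p + q)"
        using pos by (simp flip: power_add) (metis Nat.add_diff_assoc Suc_leI add.commute)
      ultimately show "(t ^ (dlen ps - 1) / dfact ps) *\<^sub>R (t ^ (p + q) / (fact p * fact q)) *\<^sub>R (br x ^^ p) ((br y ^^ q) (dnb x y ps)) =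
          (t ^ (dlen ((p, q) # ps) - 1) / dfact ((p, q) # ps)) *\<^sub>R dnb x y ((p, q) # ps)"
        by (simp add: mult.commute)
    qed
    finally show "(t ^ (dlen ps - 1) / dfact ps) *\<^sub>R dW x y t (dnb x y ps) =
        (\<Sum>a\<in>dS. (t ^ (dlen (a # ps) - 1) / dfact (a # ps)) *\<^sub>R dnb x y (a # ps))" .
  qed
  also have "\<dots> = (\<Sum>ps | set ps \<subseteq> dS \<and> length ps = Suc (Suc k). (t ^ (dlen ps - 1) / dfact ps) *\<^sub>R dnb x y ps)"
    unfolding sum_lists_length_Suc[where S = dS and k = "Suc k"] by (rule sum.swap)
  finally show ?case .
qed

abbreviation dyn :: "(real, 'n) vec \<Rightarrow> (real, 'n) vec \<Rightarrow> (real, 'n) vec" where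
  "dyn \<equiv> dynkin_product r br"

lemma dyn_scale:
  "dyn (t *\<^sub>R x) (t *\<^sub>R y) = (\<Sum>ps\<in>dynkin_indices r.
     (t ^ dlen ps * (- 1) ^ (length ps - 1) / (real (length ps) * real (dlen ps) * dfact ps)) *\<^sub>R dnb x y ps)"
proof -
  have "dynkin_word (t *\<^sub>R x) (t *\<^sub>R y) ps = map (\<lambda>v. t *\<^sub>R v) (dynkin_word x y ps)" for ps
    unfolding dynkin_word_def by (induction ps) auto
  then have "dnb (t *\<^sub>R x) (t *\<^sub>R y) ps = t ^ dlen ps *\<^sub>R dnb x y ps" for ps
    by (simp only: nested_bracket_scale length_dynkin_word)
  then show ?thesis
    unfolding dynkin_product_def dynkin_word_def[symmetric] by (simp add: mult.commute)
qed

lemma dynkin_indices_eq: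
  "dynkin_indices r = {ps. set ps \<subseteq> dS \<and> length ps \<in> {1..r} \<and> dlen ps \<le> r}"
proof -
  have "set ps \<subseteq> dS" "length ps \<le> r" if "\<forall>(p, q)\<in>set ps. p + q > 0" "dlen ps \<le> r" for ps
  proof -
    have "p + q \<le> dlen ps" if "(p, q) \<in> set ps" for p q
      using that by (induction ps) auto
    then show "set ps \<subseteq> dS" using that by fastforce
    have "length ps \<le> dlen ps" using that(1) by (induction ps) auto
    then show "length ps \<le> r" using that(2) by simp
  qed
  then show ?thesis
    unfolding dynkin_indices_def by (fastforce simp: Suc_le_eq)
qed

text \<open>Differentiation cancels the factor \<open>dlen ps\<close> in Dynkin's denominators; the
  rest, sorted by the number of pairs, is \<open>ln_quot\<close> evaluated at
  \<open>dW\<close>.\<close>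

lemma has_vector_derivative_dyn:
  "((\<lambda>t. dyn (t *\<^sub>R x) (t *\<^sub>R y)) has_vector_derivative
     ev r ln_quot (dW x y t) (x + ev r (fps_exp t) (br x) y)) (at t)"
proof -
  let ?c = "\<lambda>ps. (t ^ (dlen ps - 1) * (- 1) ^ (length ps - 1) / (real (length ps) * dfact ps)) *\<^sub>R dnb x y ps"
  have pos: "dlen ps > 0" if "ps \<in> dynkin_indices r" for ps
    using that dlen_pos[of ps] unfolding dynkin_indices_eq by (cases ps) auto
  have "((\<lambda>t. dyn (t *\<^sub>R x) (t *\<^sub>R y)) has_vector_derivative (\<Sum>ps\<in>dynkin_indices r. ?c ps)) (at t)"
    unfolding dyn_scale
  proof (rule has_vector_derivative_sum)
    fix ps assume ps: "ps \<in> dynkin_indices r"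
    let ?k = "real (length ps) * real (dlen ps) * dfact ps"
    have "((\<lambda>t. t ^ dlen ps * (- 1) ^ (length ps - 1) / ?k) has_real_derivative
        real (dlen ps) * t ^ (dlen ps - 1) * (- 1) ^ (length ps - 1) / ?k) (at t)"
      unfolding One_nat_def by (intro DERIV_cdivide DERIV_cmult_right DERIV_pow)
    moreover have "real (dlen ps) * t ^ (dlen ps - 1) * (- 1) ^ (length ps - 1) / ?k =
        t ^ (dlen ps - 1) * (- 1) ^ (length ps - 1) / (real (length ps) * dfact ps)"
    proof -
      have gen: "d * a * b / (l * d * f) = a * b / (l * f)" if "d \<noteq> 0" for a b d l f :: real
        using that by simp
      show ?thesis by (rule gen) (use pos[OF ps] in linarith)
    qed
    ultimately have "((\<lambda>t. t ^ dlen ps * (- 1) ^ (length ps - 1) / ?k) has_real_derivative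
        t ^ (dlen ps - 1) * (- 1) ^ (length ps - 1) / (real (length ps) * dfact ps)) (at t)"
      by (simp only:)
    from has_vector_derivative_scaleR[OF this has_vector_derivative_const[of "dnb x y ps"]]
    show "((\<lambda>t. (t ^ dlen ps * (- 1) ^ (length ps - 1) / ?k) *\<^sub>R dnb x y ps) has_vector_derivative ?c ps) (at t)"
      by (simp only: scaleR_zero_right add_0_left)
  qed
  \<comment> \<open>Words of more than \<open>r\<close> letters have zero bracket, so the bound on
    the total length can be traded for one on the number of pairs alone.\<close>
  also have "(\<Sum>ps\<in>dynkin_indices r. ?c ps) = (\<Sum>ps | set ps \<subseteq> dS \<and> length ps \<in> {1..r}. ?c ps)"
  proof (rule sum.mono_neutral_left)
    have "finite {ps. set ps \<subseteq> dS \<and> length ps \<le> r}" by (rule finite_lists_length_le[OF finite_dS])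
    then show "finite {ps. set ps \<subseteq> dS \<and> length ps \<in> {1..r}}" by (rule finite_subset[rotated]) auto
    show "\<forall>ps\<in>{ps. set ps \<subseteq> dS \<and> length ps \<in> {1..r}} - dynkin_indices r. ?c ps = 0"
    proof
      fix ps assume "ps \<in> {ps. set ps \<subseteq> dS \<and> length ps \<in> {1..r}} - dynkin_indices r"
      then have "r < length (dynkin_word x y ps)"
        unfolding dynkin_indices_eq length_dynkin_word by auto
      then show "?c ps = 0" by (simp only: nested_bracket_eq_0 scaleR_zero_right)
    qed
  qed (auto simp: dynkin_indices_eq)
  also have "\<dots> = (\<Sum>k<r. \<Sum>ps | set ps \<subseteq> dS \<and> length ps = Suc k. ?c ps)"
  proof -
    have "length ps \<in> {1..r} \<longleftrightarrow> (\<exists>k<r. length ps = Suc k)" for ps :: "(nat \<times> nat) list"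
      by (cases ps) auto
    then have "{ps. set ps \<subseteq> dS \<and> length ps \<in> {1..r}} = (\<Union>k\<in>{..<r}. {ps. set ps \<subseteq> dS \<and> length ps = Suc k})"
      by blast
    moreover have "finite {ps. set ps \<subseteq> dS \<and> length ps = Suc k}" for k
      by (rule finite_lists_length_eq[OF finite_dS])
    ultimately show ?thesis
      by (simp only:) (intro sum.UNION_disjoint ballI impI; blast?; auto)
  qed
  also have "\<dots> = (\<Sum>k<r. ((- 1) ^ k / real (Suc k)) *\<^sub>R (\<Sum>ps | set ps \<subseteq> dS \<and> length ps = Suc k. (t ^ (dlen ps - 1) / dfact ps) *\<^sub>R dnb x y ps))"
    unfolding scaleR_sum_right by (intro sum.cong refl) (auto simp: field_simps)
  also have "\<dots> = ev r ln_quot (dW x y t) (x + ev r (fps_exp t) (br x) y)"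
    unfolding ev_def[of r ln_quot] dW_pow_eq by (simp add: ln_quot_def)
  finally show ?thesis .
qed

end

section \<open>Local inverses and identity of polynomials\<close>

lemma smooth_local_inverse:
  fixes f :: "'a::euclidean_space \<Rightarrow> 'a"
  assumes U: "open U" "smooth_on U f" "x0 \<in> U"
    and inj: "\<And>b. frechet_derivative f (at x0) b = 0 \<Longrightarrow> b = 0"
  obtains U' V g where "open U'" "U' \<subseteq> U" "x0 \<in> U'" "open V" "f x0 \<in> V" "homeomorphism U' V f g"
    "\<And>y. y \<in> V \<Longrightarrow> g differentiable (at y)"
proof -
  let ?D = "\<lambda>x. Blinfun (frechet_derivative f (at x))"
  have bl: "bounded_linear (frechet_derivative f (at x))" if "x \<in> U" for x
    using smooth_on_has_derivative[OF U(2) that] has_derivative_bounded_linear by blast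
  have D: "blinfun_apply (?D x) = frechet_derivative f (at x)" if "x \<in> U" for x
    using bl[OF that] by (rule bounded_linear_Blinfun_apply)
  have cont: "continuous_on U ?D"
  proof (rule continuous_on_blinfun_componentwise)
    fix i :: 'a
    have "continuous_on U (\<lambda>x. frechet_derivative f (at x) i)"
      using smooth_on_frechet_derivative[OF U(1,2)] by (rule smooth_on_continuous_on)
    then show "continuous_on U (\<lambda>x. blinfun_apply (?D x) i)"
      by (rule continuous_on_eq) (simp add: D)
  qed
  have lin: "linear (frechet_derivative f (at x0))"
    using bl[OF U(3)] bounded_linear.linear by blast
  have "inj (frechet_derivative f (at x0))"
    using inj linear_injective_0[OF lin] by blast
  then obtain h where h: "linear h" "h \<circ> frechet_derivative f (at x0) = id"
    using linear_injective_left_inverse[OF lin] by blast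
  have hb: "bounded_linear h" using h(1) linear_conv_bounded_linear by blast
  have inv: "Blinfun h o\<^sub>L ?D x0 = id_blinfun"
    using h(2) by (intro blinfun_eqI) (simp add: bounded_linear_Blinfun_apply[OF hb] D[OF U(3)] fun_eq_iff)
  show thesis
  proof (rule inverse_function_theorem[OF U(1) _ cont U(3) inv])
    show "(f has_derivative blinfun_apply (?D x)) (at x)" if "x \<in> U" for x
      using smooth_on_has_derivative[OF U(2) that] D[OF that] by simp
    fix U' V g g'
    assume "open U'" "U' \<subseteq> U" "x0 \<in> U'" "open V" "f x0 \<in> V" "homeomorphism U' V f g"
      and "\<And>y. y \<in> V \<Longrightarrow> (g has_derivative g' y) (at y)"
    then show thesis using that unfolding differentiable_def by blast
  qed
qed

text \<open>The difference has infinitely many roots.\<close>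

lemma real_polynomial_function_eq_everywhere:
  fixes p q :: "real \<Rightarrow> real"
  assumes "real_polynomial_function p" "real_polynomial_function q" "\<epsilon> > 0"
    and "\<And>t. \<bar>t\<bar> < \<epsilon> \<Longrightarrow> p t = q t"
  shows "p t = q t"
proof -
  obtain a n where a: "\<And>t. p t - q t = (\<Sum>i\<le>n. a i * t ^ i)"
    using real_polynomial_function_imp_sum[OF real_polynomial_function_diff[OF assms(1,2)]] by metis
  have "infinite {- \<epsilon><..<\<epsilon>}" using assms(3) by simp
  moreover have "{- \<epsilon><..<\<epsilon>} \<subseteq> {t. (\<Sum>i\<le>n. a i * t ^ i) = 0}"
    using assms(4) by (auto simp flip: a)
  ultimately have "infinite {t. (\<Sum>i\<le>n. a i * t ^ i) = 0}"
    using finite_subset by blast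
  then have "\<forall>i\<le>n. a i = 0" using polyfun_finite_roots[of a n] by blast
  then have "(\<Sum>i\<le>n. a i * t ^ i) = 0" by simp
  then show ?thesis by (simp flip: a)
qed

section \<open>The local logarithm\<close>

context graded_frame
begin

text \<open>Defined on all of the group, but a coordinate system only near \<open>e\<close>, where
  the differentials are dual to the basis.\<close>

definition \<kappa> :: "'g \<Rightarrow> (real, 'n) vec" where
  "\<kappa> p = (\<chi> i. dual i p)"

lemma smooth_on_\<kappa>: "open S \<Longrightarrow> smooth_into A S \<phi> \<Longrightarrow> smooth_on S (\<lambda>x. \<kappa> (\<phi> x))"
  by (rule smooth_on_vec) (auto simp: \<kappa>_def intro: smooth_intoD dual_smooth)

lemma frechet_derivative_\<kappa>:
  assumes "open S" "smooth_into A S \<phi>" "x \<in> S" "\<phi> x = e"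
  shows "frechet_derivative (\<lambda>x. \<kappa> (\<phi> x)) (at x) b = lder \<phi> x b"
proof -
  have "((\<lambda>x. \<kappa> (\<phi> x)) has_derivative frechet_derivative (\<lambda>x. \<kappa> (\<phi> x)) (at x)) (at x)"
    by (rule smooth_on_has_derivative[OF smooth_on_\<kappa>[OF assms(1,2)] assms(3)])
  from bounded_linear.has_derivative[OF bounded_linear_vec_nth this]
  have "((\<lambda>x. dual i (\<phi> x)) has_derivative (\<lambda>b. frechet_derivative (\<lambda>x. \<kappa> (\<phi> x)) (at x) b $ i)) (at x)" for i
    by (simp add: \<kappa>_def)
  from frechet_derivative_eq[OF this] lder[OF assms(2,3) dual_smooth] assms(4)
  show ?thesis by (simp add: vec_eq_iff XX_dual)
qed

text \<open>Inverse function theorem in a chart at \<open>e\<close>: by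
  \<open>frechet_derivative_\<kappa>\<close> the differential of \<open>\<kappa>\<close> is there
  the logarithmic derivative of the inverse chart, which is injective.\<close>

lemma \<kappa>_inj: obtains N where "open N" "e \<in> N" "inj_on \<kappa> N"
proof -
  obtain U \<alpha> where U: "(U, \<alpha>) \<in> A" "e \<in> U" using top_A by (rule topological_atlasE)
  let ?\<theta> = "inv_into U \<alpha>"
  note c = topological_atlas_chart[OF top_A U(1)]
  have \<theta>: "smooth_into A (\<alpha> ` U) ?\<theta>" by (rule smooth_into_chart_inv[OF U(1)])
  have y: "\<alpha> e \<in> \<alpha> ` U" "?\<theta> (\<alpha> e) = e" using c(4) U(2) by auto
  have inj: "b = 0" if "lder ?\<theta> (\<alpha> e) b = 0" for b
  proof -
    obtain N f where N: "open N" "e \<in> N" "N \<subseteq> U" and f: "\<And>k. smooth_fun A (f k)"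
      "\<And>k q. q \<in> N \<Longrightarrow> f k q = \<alpha> q $ k"
      using chart_coordinates[OF U] by metis
    have o: "open (\<alpha> ` (U \<inter> N))" by (rule chart_image_open[OF top_A U(1) N(1)])
    have "b $ k = 0" for k
    proof -
      have "((\<lambda>y. y $ k) has_derivative (\<lambda>b. b $ k)) (at (\<alpha> e))"
        by (rule bounded_linear_imp_has_derivative[OF bounded_linear_vec_nth])
      then have "((\<lambda>y. f k (?\<theta> y)) has_derivative (\<lambda>b. b $ k)) (at (\<alpha> e))"
        by (rule has_derivative_transform_within_open[OF _ o]) (use N U f(2) c(4) in auto)
      from frechet_derivative_eq[OF this] show ?thesis
        using lder[OF \<theta> y(1) f(1)[of k], of b] that by (simp add: XX_linear_left)
    qed
    then show ?thesis by (simp add: vec_eq_iff)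
  qed
  obtain U' V g where U': "open U'" "U' \<subseteq> \<alpha> ` U" "\<alpha> e \<in> U'" "homeomorphism U' V (\<lambda>x. \<kappa> (?\<theta> x)) g"
  proof (rule smooth_local_inverse[OF c(2) smooth_on_\<kappa>[OF c(2) \<theta>] y(1)])
    fix b assume "frechet_derivative (\<lambda>x. \<kappa> (?\<theta> x)) (at (\<alpha> e)) b = 0"
    then show "b = 0"
      using inj frechet_derivative_\<kappa>[OF c(2) \<theta> y] by simp
  qed blast
  show thesis
  proof (rule that[of "U \<inter> \<alpha> -` U'"])
    show "open (U \<inter> \<alpha> -` U')" by (rule chart_preimage_open[OF top_A U(1) U'(1)])
    show "e \<in> U \<inter> \<alpha> -` U'" using U U' by simp
    show "inj_on \<kappa> (U \<inter> \<alpha> -` U')"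
    proof (rule inj_onI)
      fix p q assume pq: "p \<in> U \<inter> \<alpha> -` U'" "q \<in> U \<inter> \<alpha> -` U'" "\<kappa> p = \<kappa> q"
      have \<theta>\<alpha>: "?\<theta> (\<alpha> p) = p" "?\<theta> (\<alpha> q) = q" using pq(1,2) inv_into_f_f[OF c(4)] by blast+
      have "g (\<kappa> (?\<theta> z)) = z" if "z \<in> U'" for z
        using U'(4) that by (simp add: homeomorphism_def)
      from this[of "\<alpha> p"] this[of "\<alpha> q"] have "\<alpha> p = \<alpha> q"
        using pq unfolding \<theta>\<alpha> by simp
      then show "p = q" using \<theta>\<alpha> by metis
    qed
  qed
qed

lemma lder_EE_self: "lder EE (t *\<^sub>R y) y = y"
proof -
  have "((\<lambda>t. t *\<^sub>R y) has_vector_derivative y) (at t)"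
    by (auto intro!: derivative_eq_intros)
  from lder_EE_compose[OF this, of 1] lder_EE_line[of y t 1] show ?thesis by simp
qed

lemma EE_continuous: "continuous_on UNIV EE"
  by (rule smooth_into_continuous_on[OF smooth_A open_UNIV EE_smooth])

lemma \<kappa>_continuous: "continuous_on UNIV \<kappa>"
proof -
  have "continuous_on UNIV (dual i)" for i
    using smooth_fun_continuous[OF dual_smooth] .
  then show ?thesis unfolding \<kappa>_def[abs_def] by (intro continuous_on_vec_lambda)
qed

lemma local_log:
  obtains W V g \<rho> where "open W" "e \<in> W" "0 < \<rho>" "inj_on EE (ball 0 \<rho>)" "g (\<kappa> e) = 0"
    "\<And>p. p \<in> W \<Longrightarrow> \<kappa> p \<in> V \<and> EE (g (\<kappa> p)) = p \<and> g (\<kappa> p) \<in> ball 0 \<rho>"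
    "open V" "\<And>y. y \<in> V \<Longrightarrow> g differentiable (at y)"
proof -
  obtain N where N: "open N" "e \<in> N" "inj_on \<kappa> N" by (rule \<kappa>_inj)
  let ?f = "\<lambda>x. \<kappa> (EE x)"
  have sf: "smooth_on UNIV ?f" by (rule smooth_on_\<kappa>[OF open_UNIV EE_smooth])
  obtain U' V g where U': "open U'" "0 \<in> U'" "open V" "?f 0 \<in> V" "homeomorphism U' V ?f g"
    and g: "\<And>y. y \<in> V \<Longrightarrow> g differentiable (at y)"
  proof (rule smooth_local_inverse[OF open_UNIV sf])
    fix b assume "frechet_derivative ?f (at 0) b = 0"
    then show "b = 0"
      using frechet_derivative_\<kappa>[OF open_UNIV EE_smooth, of 0 b] lder_EE_self[of 0 b] by (simp add: EE_0)
  qed auto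
  obtain \<rho> where \<rho>: "\<rho> > 0" "ball 0 \<rho> \<subseteq> U'" using U'(1,2) open_contains_ball by blast
  have gf: "g (?f x) = x" if "x \<in> U'" for x
    using U'(5) that by (simp add: homeomorphism_def)
  have fg: "?f (g y) = y" if "y \<in> V" for y
    using U'(5) that by (simp add: homeomorphism_def)
  have cg: "continuous_on V g" using U'(5) by (simp add: homeomorphism_def)
  have oE: "open (EE -` N)" by (rule open_vimage[OF N(1) EE_continuous])
  then have o: "open (EE -` N \<inter> ball 0 \<rho>)" by blast
  \<comment> \<open>For arguments in \<open>V'\<close> the point \<open>EE (g y)\<close> lies in
    \<open>N\<close>, where \<open>\<kappa>\<close> is injective; so
    \<open>\<kappa> (EE (g (\<kappa> p))) = \<kappa> p\<close> can be cancelled to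
    \<open>EE (g (\<kappa> p)) = p\<close>.\<close>
  define V' where "V' = V \<inter> g -` (EE -` N \<inter> ball 0 \<rho>)"
  have oV': "open V'" unfolding V'_def by (rule continuous_open_preimage[OF cg U'(3) o])
  show thesis
  proof (rule that[of "N \<inter> \<kappa> -` V'" \<rho> g V])
    show "open (N \<inter> \<kappa> -` V')"
      by (intro open_Int N(1) open_vimage[OF oV' \<kappa>_continuous])
    have g0: "g (\<kappa> e) = 0" using gf[OF U'(2)] by (simp add: EE_0)
    then show "g (\<kappa> e) = 0" .
    show "e \<in> N \<inter> \<kappa> -` V'"
      using N(2) U'(4) g0 \<rho> by (simp add: V'_def EE_0)
    show "inj_on EE (ball 0 \<rho>)"
      using gf \<rho>(2) by (metis inj_onI subsetD)
    fix p assume p: "p \<in> N \<inter> \<kappa> -` V'"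
    then have "\<kappa> p \<in> V" "EE (g (\<kappa> p)) \<in> N" "g (\<kappa> p) \<in> ball 0 \<rho>" by (auto simp: V'_def)
    moreover from this have "\<kappa> (EE (g (\<kappa> p))) = \<kappa> p" using fg by simp
    ultimately show "\<kappa> p \<in> V \<and> EE (g (\<kappa> p)) = p \<and> g (\<kappa> p) \<in> ball 0 \<rho>"
      using N(3) p by (auto simp: inj_on_def)
  qed (use \<rho> U' g in auto)
qed

section \<open>The Baker--Campbell--Hausdorff formula\<close>

lemma ev_self: "ev r p (br x) x = fps_nth p 0 *\<^sub>R x"
proof -
  have "(br x ^^ k) x = (if k = 0 then x else 0)" for k
    by (induction k) (auto simp: linear_0[OF linear_br])
  then have "ev r p (br x) x = (\<Sum>k<r. if k = 0 then fps_nth p 0 *\<^sub>R x else 0)"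
    unfolding ev_def by (intro sum.cong) auto
  then show ?thesis using r_pos by simp
qed

lemma ev_exp_exp_minus: "ev r (fps_exp c) (br x) (ev r (fps_exp (- c)) (br x) v) = v"
  using ev_exp_minus[of "- c" x v] by simp

context
  fixes x y Z :: "(real, 'n) vec" and t :: real
  assumes H: "\<And>u. ev r (fps_exp 1) (br Z) u = ev r (fps_exp t) (br x) (ev r (fps_exp t) (br y) u)"
begin

text \<open>Two candidates for the logarithm of the product will satisfy \<open>H\<close>: the local
  logarithm and Dynkin's polynomial. For either one, \<open>ln_quot\<close> at \<open>dW\<close>
  inverts \<open>exp_quot\<close> at \<open>br Z\<close>.\<close>

lemma dW_exp: "dW x y t = ev r (fps_exp 1 - 1) (br Z)"
  by (simp add: fun_eq_iff dW_def ev_diff ev_1 H)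

lemma ln_quot_dW: "ev r ln_quot (dW x y t) (ev r exp_quot (br Z) v) = v"
  unfolding dW_exp by (subst ev_compose) (simp_all flip: ev_mult add: ln_quot_exp_quot ev_1)

lemma exp_quot_dW: "ev r exp_quot (br Z) (ev r ln_quot (dW x y t) v) = v"
  unfolding dW_exp
  by (subst ev_compose) (simp_all flip: ev_mult add: ln_quot_exp_quot mult.commute[of exp_quot] ev_1)

lemma exp_lder_product:
  "ev r (fps_exp 1) (br Z) (ev r (fps_exp (- t)) (br y) x + y) = x + ev r (fps_exp t) (br x) y"
  unfolding H by (simp add: linear_add[OF linear_ev] ev_exp_exp_minus ev_self)

end

lemma lder_product_line:
  "lder (\<lambda>t. mul (EE (t *\<^sub>R x)) (EE (t *\<^sub>R y))) t b = b *\<^sub>R (ev r (fps_exp (- t)) (br y) x + y)"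
proof -
  have s: "smooth_into A UNIV (\<lambda>t. EE (t *\<^sub>R u))" for u
    using one_param_smooth[of u] by (simp add: one_param_eq_EE[abs_def])
  show ?thesis
    using lder_mul[OF open_UNIV _ s s, of t x y b]
    by (simp add: lder_EE_line Adi_EE_scale linear_scale[OF linear_ev] scaleR_add_right)
qed

lemma dyn_0_0: "dyn (0 *\<^sub>R x) (0 *\<^sub>R y) = 0"
  unfolding dyn_scale
proof (intro sum.neutral ballI)
  fix ps assume "ps \<in> dynkin_indices r"
  then have "dlen ps > 0"
    using dlen_pos[of ps] unfolding dynkin_indices_eq by (cases ps) auto
  then show "(0 ^ dlen ps * (- 1) ^ (length ps - 1) / (real (length ps) * real (dlen ps) * dfact ps)) *\<^sub>R dnb x y ps = 0"
    by (simp only: zero_power mult_zero_left div_0 scaleR_zero_left)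
qed

lemma exp_dyn_local:
  "\<exists>\<epsilon>>0. \<forall>t. \<bar>t\<bar> < \<epsilon> \<longrightarrow>
    (\<forall>u. ev r (fps_exp 1) (br (dyn (t *\<^sub>R x) (t *\<^sub>R y))) u = ev r (fps_exp t) (br x) (ev r (fps_exp t) (br y) u))"
proof -
  obtain W V g \<rho> where W: "open W" "e \<in> W" "g (\<kappa> e) = 0"
    "\<And>p. p \<in> W \<Longrightarrow> \<kappa> p \<in> V \<and> EE (g (\<kappa> p)) = p"
    and g: "\<And>y. y \<in> V \<Longrightarrow> g differentiable (at y)"
    using local_log by metis
  let ?q = "\<lambda>t. mul (EE (t *\<^sub>R x)) (EE (t *\<^sub>R y))"
  have s: "smooth_into A UNIV (\<lambda>t. EE (t *\<^sub>R u))" for u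
    using one_param_smooth[of u] by (simp add: one_param_eq_EE[abs_def])
  have q: "smooth_into A UNIV ?q" by (intro smooth_into_mul s) simp
  obtain T where T: "open T" "0 \<in> T" "?q ` T \<subseteq> W"
    using smooth_into_nhd[OF smooth_A open_UNIV q, of 0 W] W(1,2) by (auto simp: EE_0)
  obtain \<epsilon> where \<epsilon>: "\<epsilon> > 0" "ball 0 \<epsilon> \<subseteq> T" using T(1,2) open_contains_ball by blast
  have inW: "?q t \<in> W" if "\<bar>t\<bar> < \<epsilon>" for t
  proof -
    have "t \<in> T" using that \<epsilon>(2) by (auto simp: subset_iff)
    then show ?thesis using T(3) by blast
  qed
  let ?Z = "\<lambda>t. g (\<kappa> (?q t))"
  have EZ: "EE (?Z t) = ?q t" if "\<bar>t\<bar> < \<epsilon>" for t using W(4)[OF inW[OF that]] by blast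
  have H: "ev r (fps_exp 1) (br (?Z t)) u = ev r (fps_exp t) (br x) (ev r (fps_exp t) (br y) u)" if "\<bar>t\<bar> < \<epsilon>" for t u
  proof -
    let ?v = "ev r (fps_exp t) (br x) (ev r (fps_exp t) (br y) u)"
    \<comment> \<open>\<open>Adi\<close> reverses products and is exp (- ad) on exponentials, so it
      undoes the two exponentials in \<open>?v\<close> in the right order.\<close>
    have "Adi (EE (?Z t)) ?v = u"
      unfolding EZ[OF that] Adi_mul Adi_EE_scale by (simp add: ev_exp_minus)
    then show ?thesis using ev_exp_Adi_EE[of "?Z t" ?v] by simp
  qed
  have dZ: "(?Z has_vector_derivative ev r ln_quot (dW x y t) (x + ev r (fps_exp t) (br x) y)) (at t)" if t: "\<bar>t\<bar> < \<epsilon>" for t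
  proof -
    have "(\<lambda>t. \<kappa> (?q t)) differentiable (at t)"
      by (rule smooth_on_differentiable[OF smooth_on_\<kappa>[OF open_UNIV q]]) simp
    then have "?Z differentiable (at t)"
      using g W(4)[OF inW[OF t]] differentiable_chain_at[of "\<lambda>t. \<kappa> (?q t)" t g] by (simp add: o_def)
    then obtain Z' where Z': "(?Z has_vector_derivative Z') (at t)"
      using vector_derivative_works by blast
    \<comment> \<open>Computing the logarithmic derivative of the product in two ways determines the
      derivative of its logarithm.\<close>
    have "lder EE (?Z t) Z' = lder (\<lambda>t. EE (?Z t)) t 1"
      using lder_EE_compose[OF Z', of 1] by simp
    also have "\<dots> = lder ?q t 1"
      by (rule lder_cong[of "{-\<epsilon><..<\<epsilon>}"]) (use t EZ in auto)
    also have "\<dots> = ev r (fps_exp (- t)) (br y) x + y" by (simp add: lder_product_line)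
    finally have "ev r exp_quot (br (?Z t)) Z' = x + ev r (fps_exp t) (br x) y"
      using exp_lder_product[OF H[OF t]] lder_EE[of "?Z t" Z'] by simp
    then have "Z' = ev r ln_quot (dW x y t) (x + ev r (fps_exp t) (br x) y)"
      using ln_quot_dW[OF H[OF t], of Z'] by simp
    with Z' show ?thesis by simp
  qed
  have "?Z t = dyn (t *\<^sub>R x) (t *\<^sub>R y)" if t: "\<bar>t\<bar> < \<epsilon>" for t
  proof -
    let ?d = "\<lambda>t. ?Z t - dyn (t *\<^sub>R x) (t *\<^sub>R y)"
    have "(?d has_derivative (\<lambda>h. 0)) (at s)" if "s \<in> {-\<epsilon><..<\<epsilon>}" for s
    proof -
      have "\<bar>s\<bar> < \<epsilon>" using that by auto
      from has_vector_derivative_diff[OF dZ[OF this] has_vector_derivative_dyn[of x y s]]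
      show ?thesis by (simp add: has_vector_derivative_def)
    qed
    then have "?d t = ?d 0"
      by (intro has_derivative_zero_unique_connected[of "{-\<epsilon><..<\<epsilon>}" ?d]) (use t \<epsilon> in auto)
    then show ?thesis using W(3) dyn_0_0[of x y] by (simp add: EE_0)
  qed
  then show ?thesis using H \<epsilon>(1) by (intro exI[of _ \<epsilon>]) simp
qed

lemma polynomial_function_nested:
  assumes "\<And>v. v \<in> set vs \<Longrightarrow> polynomial_function v"
  shows "polynomial_function (\<lambda>z. nested_bracket br (map (\<lambda>v. v z) vs))"
  using assms
proof (induction vs)
  case (Cons v vs)
  then show ?case
    by (cases "vs = []") (auto simp: nested_bracket_Cons intro!: polynomial_function_br)
qed simp

lemma polynomial_function_dyn:
  assumes "polynomial_function F" "polynomial_function H"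
  shows "polynomial_function (\<lambda>z. dyn (F z) (H z))"
proof -
  have "polynomial_function (\<lambda>z. dnb (F z) (H z) ps)" for ps
  proof -
    have "dynkin_word (F z) (H z) ps = map (\<lambda>v. v z) (dynkin_word F H ps)" for z
      unfolding dynkin_word_def by (induction ps) auto
    moreover have "polynomial_function v" if "v \<in> set (dynkin_word F H ps)" for v
      using that assms unfolding dynkin_word_def by auto
    ultimately show ?thesis using polynomial_function_nested[of "dynkin_word F H ps"] by simp
  qed
  then show ?thesis
    unfolding dynkin_product_def dynkin_word_def[symmetric]
    by (intro polynomial_function_sum polynomial_function_cmul finite_dynkin_indices)
qed

lemma exp_dyn:
  "ev r (fps_exp 1) (br (dyn (t *\<^sub>R x) (t *\<^sub>R y))) u = ev r (fps_exp t) (br x) (ev r (fps_exp t) (br y) u)"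
proof -
  obtain \<epsilon> where \<epsilon>: "\<epsilon> > 0" "\<And>t. \<bar>t\<bar> < \<epsilon> \<Longrightarrow>
      ev r (fps_exp 1) (br (dyn (t *\<^sub>R x) (t *\<^sub>R y))) u = ev r (fps_exp t) (br x) (ev r (fps_exp t) (br y) u)"
    using exp_dyn_local[of x y] by blast
  have ps: "polynomial_function (\<lambda>t::real. t *\<^sub>R v)" for v :: "(real, 'n) vec"
    by (intro polynomial_function_bounded_linear bounded_linear_scaleR_left)
  have pe: "real_polynomial_function (\<lambda>t. fps_nth (fps_exp t) k)" for k
    unfolding fps_exp_nth by (intro real_polynomial_function_divide real_polynomial_function_power real_polynomial_function.intros(1)) simp
  have 1: "polynomial_function (\<lambda>t. ev r (fps_exp 1) (br (dyn (t *\<^sub>R x) (t *\<^sub>R y))) u)"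
    by (intro polynomial_function_ev polynomial_function_dyn ps polynomial_function_const real_polynomial_function.intros(2))
  have 2: "polynomial_function (\<lambda>t. ev r (fps_exp t) (br x) (ev r (fps_exp t) (br y) u))"
    by (intro polynomial_function_ev pe polynomial_function_const)
  have "ev r (fps_exp 1) (br (dyn (t *\<^sub>R x) (t *\<^sub>R y))) u $ k = ev r (fps_exp t) (br x) (ev r (fps_exp t) (br y) u) $ k" for k
    by (rule real_polynomial_function_eq_everywhere[OF polynomial_function_vec_nth[OF 1] polynomial_function_vec_nth[OF 2] \<epsilon>(1)])
      (simp only: \<epsilon>(2))
  then show ?thesis unfolding vec_eq_iff by blast
qed

text \<open>As \<open>exp_dyn\<close> holds for every \<open>t\<close>, the logarithmic derivatives
  of both sides agree along the whole path from 0 to 1, beyond the reach of the local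
  logarithm.\<close>

theorem EE_dyn: "EE (dyn x y) = mul (EE x) (EE y)"
proof -
  let ?D = "\<lambda>t. dyn (t *\<^sub>R x) (t *\<^sub>R y)" and ?q = "\<lambda>t. mul (EE (t *\<^sub>R x)) (EE (t *\<^sub>R y))"
  have s: "smooth_into A UNIV (\<lambda>t. EE (t *\<^sub>R u))" for u
    using one_param_smooth[of u] by (simp add: one_param_eq_EE[abs_def])
  have q: "smooth_into A UNIV ?q" by (intro smooth_into_mul s) simp
  have "polynomial_function (\<lambda>t::real. t *\<^sub>R v)" for v :: "(real, 'n) vec"
    by (intro polynomial_function_bounded_linear bounded_linear_scaleR_left)
  then have "smooth_on UNIV ?D"
    by (intro smooth_on_polynomial_function polynomial_function_dyn)
  then have D: "smooth_into A UNIV (\<lambda>t. EE (?D t))"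
    by (intro smooth_into_compose[OF EE_smooth]) auto
  have "lder (\<lambda>t. EE (?D t)) t b = lder ?q t b" for t b
  proof -
    let ?b = "x + ev r (fps_exp t) (br x) y"
    let ?l = "lder EE (?D t) (ev r ln_quot (dW x y t) ?b)"
    have "ev r (fps_exp 1) (br (?D t)) ?l = ?b"
      unfolding lder_EE by (rule exp_quot_dW[OF exp_dyn])
    also have "\<dots> = ev r (fps_exp 1) (br (?D t)) (ev r (fps_exp (- t)) (br y) x + y)"
      by (rule exp_lder_product[OF exp_dyn, symmetric])
    finally have "ev r (fps_exp (- 1)) (br (?D t)) (ev r (fps_exp 1) (br (?D t)) ?l) =
        ev r (fps_exp (- 1)) (br (?D t)) (ev r (fps_exp 1) (br (?D t)) (ev r (fps_exp (- t)) (br y) x + y))"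
      by simp
    then have "?l = ev r (fps_exp (- t)) (br y) x + y"
      unfolding ev_exp_minus .
    then show ?thesis
      by (simp add: lder_EE_compose[OF has_vector_derivative_dyn] lder_product_line)
  qed
  from eq_if_lder_eq[OF _ _ _ _ D q this, of 0 1] dyn_0_0[of x y] show ?thesis
    by (simp add: EE_0)
qed

end

lemma Ck_on_Pair:
  assumes "open S" "Ck_on k S f" "Ck_on k S g" shows "Ck_on k S (\<lambda>x. (f x, g x))"
proof -
  have "Ck_on k S (\<lambda>x. (f x, 0) + (0, g x))"
    using assms by (intro Ck_on_add Ck_on_linear_compose[of S "\<lambda>v. (v, 0)" k f]
        Ck_on_linear_compose[of S "\<lambda>v. (0, v)" k g]) (auto intro: bounded_linear_intros)
  then show ?thesis by simp
qed

context graded_frame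
begin

section \<open>The group law on \<open>\<real>\<^sup>n\<close>\<close>

lemma nested_bracket_dilation:
  "nested_bracket br (map (dilation w t) vs) = dilation w t (nested_bracket br vs)"
proof (induction vs)
  case Nil
  then show ?case by (simp add: linear_0[OF linear_dilation])
next
  case (Cons v vs)
  then show ?case by (cases "vs = []") (auto simp: nested_bracket_Cons dilation_br)
qed

lemma dilation_dyn: "dilation w t (dyn x y) = dyn (dilation w t x) (dilation w t y)"
proof -
  have "dynkin_word (dilation w t x) (dilation w t y) ps = map (dilation w t) (dynkin_word x y ps)" for ps
    unfolding dynkin_word_def by (induction ps) auto
  then have "dnb (dilation w t x) (dilation w t y) ps = dilation w t (dnb x y ps)" for ps
    by (simp only: nested_bracket_dilation)
  then show ?thesis
    unfolding dynkin_product_def dynkin_word_def[symmetric]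
    by (simp only: linear_sum[OF linear_dilation] linear_scale[OF linear_dilation])
qed

lemma dilation_tendsto_0: "((\<lambda>t. dilation w t x) \<longlongrightarrow> 0) (at 0)"
proof (rule vec_tendstoI)
  fix k
  have "((\<lambda>t. t ^ w k * x $ k) \<longlongrightarrow> 0 ^ w k * x $ k) (at 0)"
    by (intro tendsto_intros)
  then show "((\<lambda>t. dilation w t x $ k) \<longlongrightarrow> 0 $ k) (at 0)"
    using w_pos[of k] by (simp add: dilation_def zero_power)
qed

lemma dilation_eq_iff: "t \<noteq> 0 \<Longrightarrow> dilation w t x = dilation w t y \<longleftrightarrow> x = y"
  by (simp add: dilation_def vec_eq_iff)

text \<open>Since the exponential map is injective near the origin, dilations reduce identities for the
  product on \<open>\<real>\<^sup>n\<close> to identities in the group.\<close>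

lemma eq_if_EE_dilation_eq:
  assumes "\<And>t. EE (dilation w t x) = EE (dilation w t y)" shows "x = y"
proof -
  obtain \<rho> where \<rho>: "0 < \<rho>" "inj_on EE (ball 0 \<rho>)" using local_log by metis
  have "\<forall>\<^sub>F t in at 0. dilation w t z \<in> ball 0 \<rho>" for z
    using tendstoD[OF dilation_tendsto_0 \<rho>(1), of z] by (simp add: dist_commute)
  then have "\<forall>\<^sub>F t in at 0. dilation w t x \<in> ball 0 \<rho> \<and> dilation w t y \<in> ball 0 \<rho>"
    by (intro eventually_conj)
  moreover have "\<forall>\<^sub>F t in at (0::real). t \<noteq> 0" by (simp add: eventually_at_filter)
  ultimately have "\<forall>\<^sub>F t in at (0::real). dilation w t x \<in> ball 0 \<rho> \<and> dilation w t y \<in> ball 0 \<rho> \<and> t \<noteq> 0"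
    by eventually_elim auto
  from eventually_happens[OF this]
  obtain t where "dilation w t x \<in> ball 0 \<rho>" "dilation w t y \<in> ball 0 \<rho>" "t \<noteq> (0::real)"
    by auto
  then show ?thesis
    using \<rho>(2) assms[of t] dilation_eq_iff[of t x y] by (auto simp: inj_on_def)
qed

lemma EE_add_scale: "EE ((s + t) *\<^sub>R u) = mul (EE (s *\<^sub>R u)) (EE (t *\<^sub>R u))"
proof -
  have "one_param_on u (\<bar>s\<bar> + \<bar>t\<bar> + 1) (one_param u)"
    unfolding one_param_on_def
    using one_param_smooth[of u] by (auto simp: one_param_0 lder_one_param elim: smooth_into_subset)
  from one_param_add[OF this, of s t] show ?thesis
    by (simp add: one_param_eq_EE)
qed

lemma dyn_add_scale: "dyn (s *\<^sub>R u) (t *\<^sub>R u) = (s + t) *\<^sub>R u"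
  by (rule eq_if_EE_dilation_eq, unfold dilation_dyn EE_dyn linear_scale[OF linear_dilation])
    (rule EE_add_scale[symmetric])

sublocale N: group dyn 0 uminus
proof
  show "dyn (dyn a b) c = dyn a (dyn b c)" for a b c
    by (rule eq_if_EE_dilation_eq) (simp only: dilation_dyn EE_dyn assoc)
  show "dyn 0 a = a" for a
    using dyn_add_scale[of 0 a 1] by simp
  show "dyn (- a) a = 0" for a
    using dyn_add_scale[of "-1" a 1] by simp
qed

lemma EE_minus: "EE (- x) = iv (EE x)"
  using EE_dyn[of "-x" x] EE_0 by (metis N.left_inverse inverse_unique inverse_inverse)

section \<open>Bijectivity of the exponential map\<close>

lemma mul_continuous: "continuous_on UNIV (\<lambda>(p, q). mul p q)"
  using mul_smooth by (simp add: smooth_map_def)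

lemma iv_continuous: "continuous_on UNIV iv"
  using iv_smooth by (simp add: smooth_map_def)

lemma continuous_on_mul:
  "continuous_on S f \<Longrightarrow> continuous_on S g \<Longrightarrow> continuous_on S (\<lambda>x. mul (f x) (g x))"
  using continuous_on_compose2[OF mul_continuous continuous_on_Pair, of S f g] by simp

lemma continuous_on_iv: "continuous_on S f \<Longrightarrow> continuous_on S (\<lambda>x. iv (f x))"
  using continuous_on_compose2[OF iv_continuous, of S f] by simp

lemma open_translate: "open W \<Longrightarrow> open {q. mul p q \<in> W}"
  using open_vimage[of W "\<lambda>q. mul p q"] continuous_on_mul[of UNIV "\<lambda>q. p" "\<lambda>q. q"]
  by (simp add: vimage_def continuous_on_id)

text \<open>Logarithms in a prescribed ball. Differentiability is stated for compositions with
  smooth maps, as there is no derivative on the group itself.\<close>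

lemma small_log:
  assumes "\<sigma> > 0"
  obtains W l where "open W" "e \<in> W" "l e = 0" "\<And>p. p \<in> W \<Longrightarrow> EE (l p) = p \<and> l p \<in> ball 0 \<sigma>"
    "\<And>S x \<phi>. open S \<Longrightarrow> x \<in> S \<Longrightarrow> smooth_into A S \<phi> \<Longrightarrow> \<phi> x \<in> W \<Longrightarrow> (\<lambda>x :: (real, 'n) vec. l (\<phi> x)) differentiable (at x)"
proof -
  obtain W V g \<rho> where W: "open W" "e \<in> W" "g (\<kappa> e) = 0"
    "\<And>p. p \<in> W \<Longrightarrow> \<kappa> p \<in> V \<and> EE (g (\<kappa> p)) = p" "open V"
    and g: "\<And>y. y \<in> V \<Longrightarrow> g differentiable (at y)"
    using local_log by metis
  have "continuous_on V g"
    using g by (intro continuous_at_imp_continuous_on ballI differentiable_imp_continuous_within)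
  then have "open (V \<inter> g -` ball 0 \<sigma>)"
    by (intro continuous_open_preimage W(5) open_ball)
  then have o: "open (W \<inter> \<kappa> -` (V \<inter> g -` ball 0 \<sigma>))"
    by (rule open_Int[OF W(1) open_vimage[OF _ \<kappa>_continuous]])
  show thesis
  proof (rule that[OF o, of "\<lambda>p. g (\<kappa> p)"])
    show "e \<in> W \<inter> \<kappa> -` (V \<inter> g -` ball 0 \<sigma>)"
      using W(2,3) W(4)[OF W(2)] assms by simp
    show "g (\<kappa> e) = 0" by (rule W(3))
    show "EE (g (\<kappa> p)) = p \<and> g (\<kappa> p) \<in> ball 0 \<sigma>" if "p \<in> W \<inter> \<kappa> -` (V \<inter> g -` ball 0 \<sigma>)" for p
      using that W(4)[of p] by simp
    fix S and x :: "(real, 'n) vec" and \<phi>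
    assume S: "open S" "x \<in> S" "smooth_into A S \<phi>" "\<phi> x \<in> W \<inter> \<kappa> -` (V \<inter> g -` ball 0 \<sigma>)"
    have "(\<lambda>x. \<kappa> (\<phi> x)) differentiable (at x)"
      by (rule smooth_on_differentiable[OF smooth_on_\<kappa>[OF S(1,3)] S(2)])
    then show "(\<lambda>x. g (\<kappa> (\<phi> x))) differentiable (at x)"
      using g S(4) differentiable_chain_at[of "\<lambda>x. \<kappa> (\<phi> x)" x g] by (simp add: o_def)
  qed
qed

text \<open>Points that differ by a right factor in \<open>W\<close> lie in the range of
  \<open>EE\<close> together or not at all, by \<open>EE_dyn\<close>; so the range and its
  complement are both open.\<close>

lemma surj_EE: "surj EE"
proof -
  obtain W l where W: "open W" "e \<in> W" "\<And>p. p \<in> W \<Longrightarrow> EE (l p) = p"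
    using small_log[OF zero_less_one] by metis
  have o: "open {q. mul (iv p) q \<in> W}" for p by (rule open_translate[OF W(1)])
  have mem: "p \<in> range EE \<longleftrightarrow> q \<in> range EE" if "mul (iv p) q \<in> W" for p q
  proof -
    let ?l = "l (mul (iv p) q)"
    have q: "q = mul p (EE ?l)" using W(3)[OF that] by simp
    show ?thesis
    proof
      assume "p \<in> range EE"
      then obtain x where "p = EE x" by blast
      then have "q = EE (dyn x ?l)" using q by (simp add: EE_dyn)
      then show "q \<in> range EE" by blast
    next
      assume "q \<in> range EE"
      then obtain x where x: "q = EE x" by blast
      have "p = mul q (iv (EE ?l))" by (subst q) (simp add: assoc)
      then have "p = EE (dyn x (- ?l))" by (simp add: EE_dyn EE_minus x)
      then show "p \<in> range EE" by blast
    qed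
  qed
  have "open (range EE)"
  proof (subst open_subopen, rule ballI)
    fix p assume "p \<in> range EE"
    then show "\<exists>T. open T \<and> p \<in> T \<and> T \<subseteq> range EE"
      using o[of p] W(2) mem[of p] by (intro exI[of _ "{q. mul (iv p) q \<in> W}"]) auto
  qed
  moreover have "open (- range EE)"
  proof (subst open_subopen, rule ballI)
    fix p assume "p \<in> - range EE"
    then show "\<exists>T. open T \<and> p \<in> T \<and> T \<subseteq> - range EE"
      using o[of p] W(2) mem[of p] by (intro exI[of _ "{q. mul (iv p) q \<in> W}"]) auto
  qed
  ultimately have "range EE = {} \<or> range EE = UNIV"
    using conn connected_clopen[of UNIV] by (auto simp: closed_def)
  then show ?thesis by auto
qed

text \<open>Uniform continuity in the sense of the group: close to each point of the compact square
  the increments lie in \<open>W\<close>, and a Lebesgue number makes this uniform.\<close>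

lemma loop_subdivision:
  assumes h: "continuous_on ({0..1} \<times> {0..1}) (h :: real \<times> real \<Rightarrow> 'g)" and W: "open W" "e \<in> W"
  obtains \<delta> where "\<delta> > 0" "\<And>a b. a \<in> {0..1} \<times> {0..1} \<Longrightarrow> b \<in> {0..1} \<times> {0..1} \<Longrightarrow> dist a b < \<delta> \<Longrightarrow> mul (iv (h a)) (h b) \<in> W"
proof -
  let ?K = "{0..1} \<times> {0..1} :: (real \<times> real) set"
  let ?m = "\<lambda>z. mul (iv (h (fst z))) (h (snd z))"
  have cm: "continuous_on (?K \<times> ?K) ?m"
    by (intro continuous_on_mul continuous_on_iv continuous_on_compose2[OF h] continuous_intros) auto
  obtain O' where O': "open O'" "O' \<inter> (?K \<times> ?K) = ?m -` W \<inter> (?K \<times> ?K)"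
    using cm[unfolded continuous_on_open_invariant, rule_format, OF W(1)] by blast
  have "\<exists>\<epsilon>>0. \<forall>b\<in>?K \<inter> ball a \<epsilon>. \<forall>c\<in>?K \<inter> ball a \<epsilon>. mul (iv (h b)) (h c) \<in> W" if a: "a \<in> ?K" for a
  proof -
    have "(a, a) \<in> O'" using a O'(2) W(2) by auto
    then obtain B C where BC: "open B" "open C" "a \<in> B" "a \<in> C" "B \<times> C \<subseteq> O'"
      by (rule open_prod_elim[OF O'(1)]) auto
    then obtain \<epsilon> where \<epsilon>: "\<epsilon> > 0" "ball a \<epsilon> \<subseteq> B \<inter> C"
      using open_contains_ball[of "B \<inter> C"] by (meson IntI open_Int)
    have "mul (iv (h b)) (h c) \<in> W" if "b \<in> ?K \<inter> ball a \<epsilon>" "c \<in> ?K \<inter> ball a \<epsilon>" for b c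
    proof -
      have "(b, c) \<in> O' \<inter> (?K \<times> ?K)" using BC(5) \<epsilon>(2) that by blast
      then show ?thesis unfolding O'(2) by simp
    qed
    with \<epsilon>(1) show ?thesis by blast
  qed
  then obtain \<epsilon> where \<epsilon>: "\<And>a. a \<in> ?K \<Longrightarrow> \<epsilon> a > 0"
    "\<And>a b c. a \<in> ?K \<Longrightarrow> b \<in> ?K \<inter> ball a (\<epsilon> a) \<Longrightarrow> c \<in> ?K \<inter> ball a (\<epsilon> a) \<Longrightarrow> mul (iv (h b)) (h c) \<in> W"
    by metis
  have "compact ?K" by (intro compact_Times compact_Icc)
  moreover have "?K \<subseteq> \<Union> ((\<lambda>a. ball a (\<epsilon> a)) ` ?K)"
    using \<epsilon>(1) centre_in_ball by blast
  ultimately obtain \<delta> where \<delta>: "\<delta> > 0" "\<And>x. x \<in> ?K \<Longrightarrow> \<exists>G\<in>(\<lambda>a. ball a (\<epsilon> a)) ` ?K. ball x \<delta> \<subseteq> G"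
    by (rule Heine_Borel_lemma) auto
  show thesis
  proof (rule that[OF \<delta>(1)])
    fix a b assume ab: "a \<in> ?K" "b \<in> ?K" "dist a b < \<delta>"
    obtain c where "c \<in> ?K" "ball a \<delta> \<subseteq> ball c (\<epsilon> c)" using \<delta>(2)[OF ab(1)] by blast
    then show "mul (iv (h a)) (h b) \<in> W"
      using ab \<delta>(1) by (intro \<epsilon>(2)[of c]) (auto simp: subset_iff)
  qed
qed

text \<open>A loop \<open>t \<mapsto> EE (t z)\<close> is freely homotopic to a constant.  On a fine grid in the parameter
  square, the increments of the homotopy have small logarithms, which compose like the increments
  themselves; so the products of the logarithms along consecutive rows are conjugate.\<close>

lemma EE_kernel:
  assumes z: "EE z = e" shows "z = 0"
proof -
  obtain \<rho> where \<rho>: "0 < \<rho>" "inj_on EE (ball 0 \<rho>)" using local_log by metis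
  have "polynomial_function (\<lambda>x :: (real, 'n) vec \<times> (real, 'n) vec. dyn (fst x) (snd x))"
    by (intro polynomial_function_dyn polynomial_function_bounded_linear bounded_linear_fst bounded_linear_snd)
  then have "isCont (\<lambda>x :: (real, 'n) vec \<times> (real, 'n) vec. dyn (fst x) (snd x)) 0"
    by (rule continuous_polymonial_function)
  then obtain d where d: "d > 0" "\<And>x. dist x 0 < d \<Longrightarrow> dyn (fst x) (snd x) \<in> ball 0 \<rho>"
    using \<rho>(1) unfolding continuous_at_eps_delta by (force simp: dist_commute)
  \<comment> \<open>Products of two logarithms of norm below \<open>\<sigma>\<close> stay in the
    ball on which \<open>EE\<close> is injective, so identities between such products can be checked
    in the group.\<close>
  define \<sigma> where "\<sigma> = min (d / 2) \<rho>"
  have \<sigma>: "\<sigma> > 0" using d(1) \<rho>(1) by (simp add: \<sigma>_def)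
  have small: "dyn x y \<in> ball 0 \<rho>" if "x \<in> ball 0 \<sigma>" "y \<in> ball 0 \<sigma>" for x y
  proof -
    have "norm (x, y) \<le> norm x + norm y" by (rule norm_Pair_le)
    then have "dist (x, y) 0 < d" using that by (simp add: \<sigma>_def)
    then show ?thesis using d(2)[of "(x, y)"] by simp
  qed
  obtain W l where W: "open W" "e \<in> W" "l e = 0" "\<And>p. p \<in> W \<Longrightarrow> EE (l p) = p \<and> l p \<in> ball 0 \<sigma>"
    using small_log[OF \<sigma>] by metis
  let ?\<gamma> = "\<lambda>t :: real. EE (t *\<^sub>R z)"
  have "path ?\<gamma>"
    unfolding path_def by (intro continuous_on_compose2[OF EE_continuous] continuous_intros) auto
  then have "homotopic_loops UNIV ?\<gamma> (\<lambda>t. e)"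
    using simply_conn z unfolding simply_connected_def
    by (auto simp: pathfinish_def pathstart_def path_def EE_0)
  then obtain h :: "real \<times> real \<Rightarrow> 'g" where "continuous_on ({0..1} \<times> {0..1}) h"
    "\<forall>t\<in>{0..1}. h (0, t) = ?\<gamma> t" "\<forall>t\<in>{0..1}. h (1, t) = e"
    "\<forall>s\<in>{0..1}. pathfinish (h \<circ> Pair s) = pathstart (h \<circ> Pair s)"
    unfolding homotopic_loops by blast
  then have h: "continuous_on ({0..1} \<times> {0..1}) h"
    "\<And>t. t \<in> {0..1} \<Longrightarrow> h (0, t) = ?\<gamma> t" "\<And>t. t \<in> {0..1} \<Longrightarrow> h (1, t) = e"
    "\<And>s. s \<in> {0..1} \<Longrightarrow> h (s, 1) = h (s, 0)"
    by (simp_all add: pathfinish_def pathstart_def)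
  obtain \<delta> where \<delta>: "\<delta> > 0" "\<And>a b. a \<in> {0..1} \<times> {0..1} \<Longrightarrow> b \<in> {0..1} \<times> {0..1} \<Longrightarrow> dist a b < \<delta> \<Longrightarrow> mul (iv (h a)) (h b) \<in> W"
    using loop_subdivision[OF h(1) W(1,2)] by metis
  \<comment> \<open>The mesh of the grid is below \<open>\<delta>\<close>, and the increment z / n
    of the loop has norm below \<open>\<rho>\<close>.\<close>
  obtain n :: nat where n: "n > 0" "1 / real n < \<delta>" "norm z / real n < \<rho>"
  proof -
    obtain n :: nat where n: "max (1 / \<delta>) (norm z / \<rho>) < real n" using reals_Archimedean2 by blast
    then have "real n > 0" using \<delta>(1) by (smt (verit) divide_pos_pos max_def zero_less_one)
    with n \<delta>(1) \<rho>(1) show thesis by (intro that[of n]) (auto simp: field_simps)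
  qed
  define P where "P j i = h (real j / real n, real i / real n)" for j i
  have step: "mul (iv (P j i)) (P j' i') \<in> W" if "j \<le> n" "i \<le> n" "j' \<le> n" "i' \<le> n"
    "(j' = Suc j \<and> i' = i) \<or> (j' = j \<and> i' = Suc i)" for i j i' j'
  proof -
    have "dist (real j / real n, real i / real n) (real j' / real n, real i' / real n) = 1 / real n"
      using that(5) n(1) by (auto simp: dist_Pair_Pair dist_real_def field_simps diff_divide_distrib[symmetric] real_sqrt_divide)
    then show ?thesis
      unfolding P_def using that n by (intro \<delta>(2)) (auto simp: divide_le_eq_1)
  qed
  define u where "u j i = l (mul (iv (P j i)) (P j (Suc i)))" for j i
  define v where "v j i = l (mul (iv (P j i)) (P (Suc j) i))" for j i
  have u: "EE (u j i) = mul (iv (P j i)) (P j (Suc i))" "u j i \<in> ball 0 \<sigma>" if "j \<le> n" "i < n" for j i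
    using W(4)[OF step[of j i j "Suc i"]] that by (auto simp: u_def)
  have v: "EE (v j i) = mul (iv (P j i)) (P (Suc j) i)" "v j i \<in> ball 0 \<sigma>" if "j < n" "i \<le> n" for j i
    using W(4)[OF step[of j i "Suc j" i]] that by (auto simp: v_def)
  \<comment> \<open>Both ways around a cell lead from one corner to the opposite one.\<close>
  have square: "dyn (u j i) (v j (Suc i)) = dyn (v j i) (u (Suc j) i)" if "j < n" "i < n" for j i
  proof (rule inj_onD[OF \<rho>(2)])
    show "EE (dyn (u j i) (v j (Suc i))) = EE (dyn (v j i) (u (Suc j) i))"
      using that by (simp add: EE_dyn u v assoc)
    show "dyn (u j i) (v j (Suc i)) \<in> ball 0 \<rho>" "dyn (v j i) (u (Suc j) i) \<in> ball 0 \<rho>"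
      using that by (intro small u v; simp)+
  qed
  define b where "b j i = rec_nat 0 (\<lambda>i c. dyn c (u j i)) i" for j i
  have b_0: "b j 0 = 0" and b_Suc: "b j (Suc i) = dyn (b j i) (u j i)" for j i
    by (simp_all add: b_def)
  have row: "dyn (b j i) (v j i) = dyn (v j 0) (b (Suc j) i)" if "j < n" "i \<le> n" for j i
    using that(2)
  proof (induction i)
    case (Suc i)
    then have "dyn (b j (Suc i)) (v j (Suc i)) = dyn (b j i) (dyn (v j i) (u (Suc j) i))"
      using that(1) square[of j i] by (simp add: b_Suc N.assoc)
    also have "\<dots> = dyn (v j 0) (b (Suc j) (Suc i))"
      using Suc by (simp add: b_Suc flip: N.assoc)
    finally show ?case .
  qed (simp add: b_0)
  have last_row: "b n i = 0" if "i \<le> n" for i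
    using that
  proof (induction i)
    case (Suc i)
    have "P n k = e" if "k \<le> n" for k
      unfolding P_def using that n(1) h(3)[of "real k / real n"] by simp
    then have "u n i = 0" using Suc.prems W(3) by (simp add: u_def)
    then show ?case using Suc by (simp add: b_Suc)
  qed (simp add: b_0)
  \<comment> \<open>From the last row back to the first: the homotopy runs through loops, so its two
    sides agree, and by \<open>row\<close> the products of consecutive rows are conjugate by
    \<open>v j 0\<close>.\<close>
  have "b (n - k) n = 0" if "k \<le> n" for k
    using that
  proof (induction k)
    case (Suc k)
    let ?j = "n - Suc k"
    have j: "Suc ?j = n - k" "?j < n" using Suc.prems by auto
    have "P i n = P i 0" if "i \<le> n" for i
      unfolding P_def using h(4)[of "real i / real n"] that n(1) by simp
    then have "v ?j n = v ?j 0" using j by (simp add: v_def)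
    then have "dyn (b ?j n) (v ?j 0) = dyn 0 (v ?j 0)"
      using row[OF j(2), of n] j(1) Suc by simp
    then show ?case by (simp only: N.right_cancel)
  qed (use last_row in simp)
  from this[of n] have b0: "b 0 n = 0" by simp
  \<comment> \<open>On the first row both \<open>u 0 i\<close> and z / n are logarithms of the
    increment of the loop, and both lie in the ball of injectivity.\<close>
  have u0: "u 0 i = (1 / real n) *\<^sub>R z" if "i < n" for i
  proof (rule inj_onD[OF \<rho>(2)])
    have "EE ((real i / real n) *\<^sub>R z + (1 / real n) *\<^sub>R z) = mul (EE ((real i / real n) *\<^sub>R z)) (EE ((1 / real n) *\<^sub>R z))"
      using EE_add_scale[of "real i / real n" "1 / real n" z] by (simp add: scaleR_add_left)
    moreover have "1 / real n + real i / real n \<le> 1" using that n(1) by (simp add: field_simps)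
    then have "P 0 i = EE ((real i / real n) *\<^sub>R z)" "P 0 (Suc i) = EE ((real i / real n) *\<^sub>R z + (1 / real n) *\<^sub>R z)"
      using that n(1) h(2)[of "real i / real n"] h(2)[of "real (Suc i) / real n"]
      by (simp_all add: P_def add_divide_distrib scaleR_add_left add.commute)
    ultimately show "EE (u 0 i) = EE ((1 / real n) *\<^sub>R z)"
      using that u(1)[of 0 i] by simp
    show "u 0 i \<in> ball 0 \<rho>" using u(2)[of 0 i] that by (simp add: \<sigma>_def)
    show "(1 / real n) *\<^sub>R z \<in> ball 0 \<rho>" using n by simp
  qed
  have "b 0 i = (real i / real n) *\<^sub>R z" if "i \<le> n" for i
    using that
  proof (induction i)
    case (Suc i)
    then have "b 0 (Suc i) = dyn ((real i / real n) *\<^sub>R z) ((1 / real n) *\<^sub>R z)"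
      using u0[of i] by (simp add: b_Suc)
    then show ?case by (simp add: dyn_add_scale add_divide_distrib add.commute)
  qed (simp add: b_0)
  from this[of n] b0 n(1) show ?thesis by simp
qed

lemma bij_EE: "bij EE"
proof -
  have "x = y" if "EE x = EE y" for x y
  proof -
    have "EE (dyn (- x) y) = e" using that by (simp add: EE_dyn EE_minus)
    then have "dyn (- x) y = 0" by (rule EE_kernel)
    then have "dyn x (dyn (- x) y) = x" by simp
    then show ?thesis by (simp flip: N.assoc)
  qed
  then show ?thesis using surj_EE by (simp add: bij_def inj_def)
qed

section \<open>The global logarithm and its smoothness\<close>

abbreviation LL :: "'g \<Rightarrow> (real, 'n) vec" where
  "LL \<equiv> inv EE"

lemma EE_LL [simp]: "EE (LL p) = p"
  using bij_EE by (simp add: bij_def surj_f_inv_f)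

lemma LL_EE [simp]: "LL (EE x) = x"
  using bij_EE by (simp add: bij_def)

lemma polynomial_function_Om:
  fixes F H :: "'a::real_normed_vector \<Rightarrow> (real, 'n) vec"
  shows "polynomial_function F \<Longrightarrow> polynomial_function H \<Longrightarrow> polynomial_function (\<lambda>z. Om (F z) (H z))"
  unfolding Om_def by (intro polynomial_function_ev real_polynomial_function.intros(2))

text \<open>Near \<open>x0\<close> the global logarithm is the Dynkin product of a constant and a
  local logarithm, hence differentiable; its derivative is then forced by
  \<open>lder_compose\<close> and \<open>Om_lder\<close>.\<close>

lemma has_derivative_LL:
  fixes \<phi> :: "(real, 'n) vec \<Rightarrow> 'g"
  assumes S: "open S" "x0 \<in> S" and \<phi>: "smooth_into A S \<phi>"
  shows "((\<lambda>x. LL (\<phi> x)) has_derivative (\<lambda>b. Om (LL (\<phi> x0)) (lder \<phi> x0 b))) (at x0)"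
proof -
  obtain W l where W: "open W" "e \<in> W" "\<And>p. p \<in> W \<Longrightarrow> EE (l p) = p"
    and dl: "\<And>S x \<phi>. open S \<Longrightarrow> x \<in> S \<Longrightarrow> smooth_into A S \<phi> \<Longrightarrow> \<phi> x \<in> W \<Longrightarrow> (\<lambda>x :: (real, 'n) vec. l (\<phi> x)) differentiable (at x)"
    using small_log[OF zero_less_one] by metis
  let ?\<psi> = "\<lambda>x. mul (iv (\<phi> x0)) (\<phi> x)"
  have \<psi>: "smooth_into A S ?\<psi>" by (intro smooth_into_mul smooth_into_const S \<phi>)
  obtain T where T: "open T" "x0 \<in> T" "T \<subseteq> S" "?\<psi> ` T \<subseteq> W"
    using smooth_into_nhd[OF smooth_A S(1) \<psi> S(2) W(1)] W(2) by auto
  have near: "LL (\<phi> x) = dyn (LL (\<phi> x0)) (l (?\<psi> x))" if "x \<in> T" for x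
  proof -
    have "?\<psi> x \<in> W" using T(4) that by blast
    then have "EE (dyn (LL (\<phi> x0)) (l (?\<psi> x))) = \<phi> x"
      by (simp add: EE_dyn W(3))
    then show ?thesis by (metis LL_EE)
  qed
  have "polynomial_function (\<lambda>y. dyn (LL (\<phi> x0)) y)"
    by (intro polynomial_function_dyn) auto
  then have "(\<lambda>y. dyn (LL (\<phi> x0)) y) differentiable (at y)" for y
    by (rule differentiable_at_polynomial_function)
  moreover have "(\<lambda>x. l (?\<psi> x)) differentiable (at x0)"
    using W(2) by (intro dl[OF S \<psi>]) simp
  ultimately have "(\<lambda>x. dyn (LL (\<phi> x0)) (l (?\<psi> x))) differentiable (at x0)"
    using differentiable_chain_at[of "\<lambda>x. l (?\<psi> x)" x0 "\<lambda>y. dyn (LL (\<phi> x0)) y"] by (simp add: o_def)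
  then obtain D where D: "((\<lambda>x. dyn (LL (\<phi> x0)) (l (?\<psi> x))) has_derivative D) (at x0)"
    unfolding differentiable_def by blast
  have D: "((\<lambda>x. LL (\<phi> x)) has_derivative D) (at x0)"
    by (rule has_derivative_transform_within_open[OF D T(1,2)]) (simp add: near)
  have "D b = Om (LL (\<phi> x0)) (lder \<phi> x0 b)" for b
  proof -
    have "lder \<phi> x0 b = lder (\<lambda>x. EE (LL (\<phi> x))) x0 b" by simp
    also have "\<dots> = lder EE (LL (\<phi> x0)) (D b)"
      by (rule lder_compose[OF EE_smooth _ D]) simp
    finally show ?thesis by (simp add: Om_lder)
  qed
  then have "D = (\<lambda>b. Om (LL (\<phi> x0)) (lder \<phi> x0 b))" by blast
  with D show ?thesis by simp
qed

text \<open>Bootstrap: the derivative is a polynomial in the logarithm itself and the smooth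
  function \<open>lder \<phi> x b\<close>.\<close>

lemma smooth_on_LL:
  fixes \<phi> :: "(real, 'n) vec \<Rightarrow> 'g"
  assumes S: "open S" and \<phi>: "smooth_into A S \<phi>"
  shows "smooth_on S (\<lambda>x. LL (\<phi> x))"
proof (rule smooth_on_bootstrap[OF S has_derivative_LL[OF S _ \<phi>]])
  fix k and b :: "(real, 'n) vec" assume k: "Ck_on k S (\<lambda>x. LL (\<phi> x))"
  have "polynomial_function (\<lambda>z :: (real, 'n) vec \<times> (real, 'n) vec. Om (fst z) (snd z))"
    by (intro polynomial_function_Om polynomial_function_bounded_linear bounded_linear_fst bounded_linear_snd)
  then have "smooth_on UNIV (\<lambda>z :: (real, 'n) vec \<times> (real, 'n) vec. Om (fst z) (snd z))"
    by (rule smooth_on_polynomial_function)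
  then have "Ck_on k UNIV (\<lambda>z :: (real, 'n) vec \<times> (real, 'n) vec. Om (fst z) (snd z))"
    by (simp add: smooth_on_def)
  moreover have "Ck_on k S (\<lambda>x. lder \<phi> x b)"
    using lder_smooth[OF S \<phi>] by (simp add: smooth_on_def)
  ultimately show "Ck_on k S (\<lambda>x. Om (LL (\<phi> x)) (lder \<phi> x b))"
    using Ck_on_compose[OF S Ck_on_Pair[OF S k], of "\<lambda>x. lder \<phi> x b" UNIV "\<lambda>z. Om (fst z) (snd z)"] by simp
qed

lemma smooth_fun_LL: "smooth_fun A (\<lambda>p. LL p $ k)"
  unfolding smooth_fun_iff[OF top_A]
  using smooth_on_vec_nth[OF topological_atlas_chart(2)[OF top_A] smooth_on_LL[OF topological_atlas_chart(2)[OF top_A] smooth_into_chart_inv]]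
  by (auto simp: o_def)

lemma diffeomorphism_EE: "diffeomorphism euclid_atlas A EE"
proof -
  have inv_id: "inv_into UNIV (\<lambda>x. x) = (\<lambda>x::(real, 'n) vec. x)"
    by (simp add: fun_eq_iff inv_f_eq)
  have "smooth_map euclid_atlas A EE"
    unfolding smooth_map_def
  proof (intro conjI EE_continuous)
    have "smooth_on (EE -` V) (\<lambda>x. \<psi> (EE x))" if V: "(V, \<psi>) \<in> A" for V \<psi>
    proof (rule smooth_on_local)
      fix x assume "x \<in> EE -` V"
      then have x: "EE x \<in> V" by simp
      obtain T where "open T" "x \<in> T" "smooth_on T (\<lambda>x. \<psi> (EE x))"
        by (rule smooth_into_chart[OF smooth_A open_UNIV EE_smooth UNIV_I V x])
      then show "\<exists>T. open T \<and> x \<in> T \<and> smooth_on T (\<lambda>x. \<psi> (EE x))" by blast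
    qed
    then show "\<forall>(U, \<phi>)\<in>euclid_atlas. \<forall>(V, \<psi>)\<in>A. smooth_on (\<phi> ` (U \<inter> EE -` V)) (\<psi> \<circ> EE \<circ> inv_into U \<phi>)"
      by (auto simp: euclid_atlas_def inv_id o_def)
  qed
  moreover have "smooth_map A euclid_atlas LL"
    unfolding smooth_map_def
  proof (intro conjI)
    have "continuous_on UNIV (\<lambda>p. \<chi> k. LL p $ k)"
      using smooth_fun_continuous[OF smooth_fun_LL] by (intro continuous_on_vec_lambda)
    then show "continuous_on UNIV LL" by simp
    show "\<forall>(U, \<phi>)\<in>A. \<forall>(V, \<psi>)\<in>euclid_atlas. smooth_on (\<phi> ` (U \<inter> LL -` V)) (\<psi> \<circ> LL \<circ> inv_into U \<phi>)"
      using smooth_on_LL[OF topological_atlas_chart(2)[OF top_A] smooth_into_chart_inv]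
      by (auto simp: euclid_atlas_def o_def)
  qed
  ultimately show ?thesis using bij_EE by (simp add: diffeomorphism_def)
qed

section \<open>Canonical coordinates\<close>

text \<open>Differentiate \<open>LL (EE y) = y\<close> and invert \<open>lder EE\<close>.\<close>

lemma XX_LL: "XX u (\<lambda>p. LL p $ k) p = Om (LL p) u $ k"
proof -
  let ?x = "LL p"
  have "((\<lambda>y. y $ k) has_derivative (\<lambda>b. b $ k)) (at ?x)"
    by (rule bounded_linear_imp_has_derivative[OF bounded_linear_vec_nth])
  moreover have "((\<lambda>y. LL (EE y) $ k) has_derivative (\<lambda>b. XX (lder EE ?x b) (\<lambda>p. LL p $ k) (EE ?x))) (at ?x)"
    by (rule has_derivative_lder[OF EE_smooth UNIV_I smooth_fun_LL])
  ultimately have "(\<lambda>b. XX (lder EE ?x b) (\<lambda>p. LL p $ k) p) = (\<lambda>b. b $ k)"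
    using has_derivative_unique by (simp only: LL_EE EE_LL) blast
  from fun_cong[OF this, of "Om ?x u"] show ?thesis by (simp add: lder_Om)
qed

lemma Om_self: "Om (t *\<^sub>R u) u = u"
  using Om_lder[of "t *\<^sub>R u" u] by (simp add: lder_EE_self)

lemma Om_0: "Om 0 u = u"
  using Om_self[of 0 u] by simp

lemma Om_smooth: "smooth_on UNIV (\<lambda>x. Om x u)"
  by (intro smooth_on_polynomial_function polynomial_function_Om polynomial_function_id polynomial_function_const)

text \<open>The straight line from 0 to \<open>u\<close> is an integral curve because
  \<open>Om (t *\<^sub>R u) u = u\<close>.\<close>

lemma Om_flow_unique:
  assumes "\<And>t. t \<in> {0..1} \<Longrightarrow> (\<eta> has_vector_derivative Om (\<eta> t) u) (at t within {0..1})" "\<eta> 0 = 0"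
  shows "\<eta> 1 = u"
proof -
  have "((\<lambda>t. t *\<^sub>R u) has_vector_derivative Om (t *\<^sub>R u) u) (at t within {0..1})" for t :: real
    unfolding Om_self by (auto intro!: derivative_eq_intros)
  from ode_unique[OF Om_smooth assms(1) this, of 1] assms(2) show ?thesis by simp
qed

text \<open>The definite description in \<open>flow_one\<close> ranges over all integral curves in
  the manifold; \<open>LL\<close> carries them to Euclidean space, where uniqueness is
  available.\<close>

lemma flow_one_frame: "flow_one A (\<Sum>j\<in>UNIV. u $ j *\<^sub>R X j) e = EE u"
proof -
  let ?V = "\<Sum>j\<in>UNIV. u $ j *\<^sub>R X j"
  have V: "?V p f = XX u f p" for p f
    by (simp add: XX_def sum_fun_apply scaleR_fun_def)
  let ?c = "\<lambda>t :: real. EE (t *\<^sub>R u)"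
  have s: "smooth_into A UNIV ?c"
    using one_param_smooth[of u] by (simp add: one_param_eq_EE[abs_def])
  have c: "integral_curve A ?V ?c"
    unfolding integral_curve_def
  proof (intro conjI ballI allI impI)
    show "continuous_on {0..1} ?c"
      using smooth_into_continuous_on[OF smooth_A open_UNIV s] continuous_on_subset by blast
    fix t f assume f: "smooth_fun A f"
    have "((\<lambda>s. f (?c s)) has_derivative (\<lambda>b. XX (lder ?c t b) f (?c t))) (at t)"
      by (rule has_derivative_lder[OF s UNIV_I f])
    then have "((\<lambda>s. f (?c s)) has_real_derivative ?V (?c t) f) (at t)"
      unfolding has_field_derivative_def V
      by (rule has_derivative_eq_rhs) (simp add: fun_eq_iff lder_EE_line XX_linear_left)
    then show "((\<lambda>s. f (?c s)) has_real_derivative ?V (?c t) f) (at t within {0..1})"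
      by (rule has_field_derivative_at_within)
  qed
  have unique: "\<gamma> 1 = EE u" if \<gamma>: "integral_curve A ?V \<gamma>" "\<gamma> 0 = e" for \<gamma>
  proof -
    have "LL (\<gamma> 1) = u"
    proof (rule Om_flow_unique)
      show "LL (\<gamma> 0) = 0" using \<gamma>(2) LL_EE[of 0] by (simp add: EE_0)
      fix t :: real assume t: "t \<in> {0..1}"
      have "((\<lambda>s. LL (\<gamma> s) $ k) has_real_derivative Om (LL (\<gamma> t)) u $ k) (at t within {0..1})" for k
      proof -
        have "((\<lambda>s. LL (\<gamma> s) $ k) has_real_derivative XX u (\<lambda>p. LL p $ k) (\<gamma> t)) (at t within {0..1})"
          using \<gamma>(1) t smooth_fun_LL[of k] unfolding integral_curve_def V by blast
        then show ?thesis by (simp only: XX_LL)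
      qed
      then have "((\<lambda>s. LL (\<gamma> s) $ k) has_derivative (\<lambda>h. (h *\<^sub>R Om (LL (\<gamma> t)) u) $ k)) (at t within {0..1})" for k
        unfolding has_field_derivative_def by (rule has_derivative_eq_rhs) (simp add: fun_eq_iff)
      then have "((\<lambda>s. \<Sum>k\<in>UNIV. LL (\<gamma> s) $ k *\<^sub>R axis k (1::real)) has_derivative
          (\<lambda>h. \<Sum>k\<in>UNIV. (h *\<^sub>R Om (LL (\<gamma> t)) u) $ k *\<^sub>R axis k (1::real))) (at t within {0..1})"
        by (intro has_derivative_sum has_derivative_scaleR_left)
      moreover have "(\<Sum>k\<in>UNIV. v $ k *\<^sub>R axis k 1) = v" for v :: "(real, 'n) vec"
        by (simp add: vec_eq_iff axis_def if_distrib cong: if_cong)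
      ultimately show "((\<lambda>s. LL (\<gamma> s)) has_vector_derivative Om (LL (\<gamma> t)) u) (at t within {0..1})"
        by (simp only: has_vector_derivative_def)
    qed
    then show ?thesis by (metis EE_LL)
  qed
  show ?thesis
    unfolding flow_one_def
  proof (rule the_equality)
    show "\<exists>\<gamma>. integral_curve A ?V \<gamma> \<and> \<gamma> 0 = e \<and> \<gamma> 1 = EE u"
      using c by (intro exI[of _ ?c]) (simp add: EE_0)
  qed (use unique in blast)
qed

lemma exp_frame_eq: "exp_frame A e X = EE"
  by (simp add: fun_eq_iff exp_frame_def flow_one_frame)

definition YY :: "'n \<Rightarrow> (real, 'n) vec \<Rightarrow> (real, 'n) vec" where
  "YY j x = Om x (axis j 1)"

lemma in_coords_eq: "in_coords LL (X j) = YY j"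
proof
  fix x
  have "inv LL = EE" using bij_EE by (rule inv_inv_eq)
  then show "in_coords LL (X j) x = YY j x"
    by (simp add: in_coords_def vec_eq_iff YY_def XX_axis[symmetric] XX_LL)
qed

lemma sum_axis: "(\<Sum>k\<in>UNIV. v $ k *\<^sub>R axis k 1) = (v :: (real, 'n) vec)"
  by (simp add: vec_eq_iff axis_def if_distrib cong: if_cong)

lemma Om_eq_sum_YY: "Om x u = (\<Sum>j\<in>UNIV. u $ j *\<^sub>R YY j x)"
proof -
  have "Om x u = Om x (\<Sum>j\<in>UNIV. u $ j *\<^sub>R axis j 1)" by (simp add: sum_axis)
  then show ?thesis
    by (simp only: linear_sum[OF linear_Om] linear_scale[OF linear_Om] YY_def)
qed

lemma YY_smooth: "smooth_on UNIV (YY j)"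
  unfolding YY_def[abs_def] by (rule Om_smooth)

lemma YY_0: "YY j 0 = axis j 1"
  by (simp add: YY_def Om_0)

lemma dyn_left_smooth: "smooth_on UNIV (dyn a)"
  by (intro smooth_on_polynomial_function polynomial_function_dyn) auto

lemma dyn_left_derivative:
  "(dyn a has_derivative frechet_derivative (dyn a) (at x)) (at x)"
  by (rule smooth_on_has_derivative[OF dyn_left_smooth UNIV_I])

text \<open>Left multiplication in the group preserves logarithmic derivatives, and
  \<open>EE\<close> turns \<open>dyn a\<close> into a left multiplication.\<close>

lemma frechet_derivative_dyn_left: "frechet_derivative (dyn a) (at x) (Om x u) = Om (dyn a x) u"
proof -
  have "lder (\<lambda>x. EE (dyn a x)) x v = lder EE (dyn a x) (frechet_derivative (dyn a) (at x) v)" for v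
    by (rule lder_compose[OF EE_smooth UNIV_I dyn_left_derivative])
  moreover have "lder (\<lambda>x. EE (dyn a x)) x v = lder EE x v" for v
    unfolding EE_dyn by (rule lder_left[OF open_UNIV UNIV_I EE_smooth])
  ultimately have "lder EE (dyn a x) (frechet_derivative (dyn a) (at x) (Om x u)) = lder EE x (Om x u)"
    by metis
  also have "\<dots> = u" by (rule lder_Om)
  finally have "lder EE (dyn a x) (frechet_derivative (dyn a) (at x) (Om x u)) = u" .
  then show ?thesis by (metis Om_lder)
qed

lemma Om_dilation: "Om (dilation w t x) (dilation w t u) = dilation w t (Om x u)"
proof -
  have "(br (dilation w t x) ^^ k) (dilation w t u) = dilation w t ((br x ^^ k) u)" for k
    by (induction k) (simp_all add: dilation_br)
  then show ?thesis
    unfolding Om_def ev_def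
    by (simp only: linear_sum[OF linear_dilation] linear_scale[OF linear_dilation])
qed

lemma dilation_axis: "dilation w t (axis j 1) = t ^ w j *\<^sub>R axis j 1"
  by (auto simp: dilation_def vec_eq_iff axis_def)

lemma YY_dilation: "t ^ w j *\<^sub>R YY j (dilation w t x) = dilation w t (YY j x)"
  unfolding YY_def Om_dilation[symmetric] dilation_axis by (simp add: linear_scale[OF linear_Om])

section \<open>Words in the frame\<close>

lemma vf_apply_smooth:
  fixes V :: "(real, 'n) vec \<Rightarrow> (real, 'n) vec"
  assumes "smooth_on UNIV V" "smooth_on UNIV f" shows "smooth_on UNIV (vf_apply V f)"
proof -
  have "vf_apply V f = (\<lambda>x. \<Sum>b\<in>Basis. (V x \<bullet> b) *\<^sub>R frechet_derivative f (at x) b)"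
    unfolding vf_apply_def[abs_def]
    using frechet_derivative_expand[OF smooth_on_differentiable[OF assms(2)]] by blast
  moreover have "smooth_on UNIV (\<lambda>x. \<Sum>b\<in>Basis. (V x \<bullet> b) *\<^sub>R frechet_derivative f (at x) b)"
    using assms
    by (intro smooth_on_sum smooth_on_scaleR smooth_on_frechet_derivative smooth_on_linear_compose[of _ "\<lambda>v. v \<bullet> _"]
        bounded_linear_inner_left open_UNIV)
  ultimately show ?thesis by simp
qed

lemma frame_word_Nil: "frame_word YY [] f = f"
  and frame_word_Cons: "frame_word YY (i # I) f = vf_apply (YY i) (frame_word YY I f)"
  and frame_word_snoc: "frame_word YY (I @ [i]) f = frame_word YY I (vf_apply (YY i) f)"
  by (simp_all add: frame_word_def)

lemma frame_word_smooth: "smooth_on UNIV f \<Longrightarrow> smooth_on UNIV (frame_word YY I f)"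
  by (induction I) (simp_all add: frame_word_Nil frame_word_Cons vf_apply_smooth YY_smooth)

lemma frame_word_translate:
  assumes "smooth_on UNIV f"
  shows "frame_word YY I (\<lambda>x. f (dyn a x)) x = frame_word YY I f (dyn a x)"
proof (induction I arbitrary: x)
  case (Cons i I)
  let ?g = "frame_word YY I f"
  have eq: "frame_word YY I (\<lambda>x. f (dyn a x)) = (\<lambda>x. ?g (dyn a x))"
    using Cons by blast
  have "(?g has_derivative frechet_derivative ?g (at (dyn a x))) (at (dyn a x))"
    by (rule smooth_on_has_derivative[OF frame_word_smooth[OF assms] UNIV_I])
  from frechet_derivative_eq[OF has_derivative_compose[OF dyn_left_derivative this]]
  have "vf_apply (YY i) (\<lambda>x. ?g (dyn a x)) x = vf_apply (YY i) ?g (dyn a x)"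
    by (simp add: vf_apply_def YY_def[of i] frechet_derivative_dyn_left)
  then show ?case
    by (simp only: frame_word_Cons eq)
qed (simp add: frame_word_Nil)

text \<open>A word lowers the degree of homogeneity by its weight. The powers of \<open>t\<close>
  stay on both sides because the difference of degrees may be negative.\<close>

lemma frame_word_dilation:
  assumes "smooth_on UNIV f" "\<And>x. f (dilation w t x) = t ^ d * f x"
  shows "t ^ word_weight w I * frame_word YY I f (dilation w t x) = t ^ d * frame_word YY I f x"
proof (induction I arbitrary: x)
  case (Cons i I)
  let ?g = "frame_word YY I f" and ?N = "word_weight w I"
  have D: "(?g has_derivative frechet_derivative ?g (at x)) (at x)" for x
    by (rule smooth_on_has_derivative[OF frame_word_smooth[OF assms(1)] UNIV_I])
  have "(dilation w t has_derivative dilation w t) (at x)"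
    using linear_dilation linear_conv_bounded_linear by (intro bounded_linear_imp_has_derivative) blast
  from has_derivative_mult_right[OF has_derivative_compose[OF this D], of "t ^ ?N"]
  have "((\<lambda>x. t ^ d * ?g x) has_derivative
      (\<lambda>v. t ^ ?N * frechet_derivative ?g (at (dilation w t x)) (dilation w t v))) (at x)"
    by (simp only: Cons.IH)
  from has_derivative_unique[OF this has_derivative_mult_right[OF D]]
  have "t ^ ?N * frechet_derivative ?g (at (dilation w t x)) (dilation w t (YY i x)) =
      t ^ d * frechet_derivative ?g (at x) (YY i x)"
    by meson
  moreover have "frechet_derivative ?g (at (dilation w t x)) (dilation w t (YY i x)) =
      t ^ w i * frechet_derivative ?g (at (dilation w t x)) (YY i (dilation w t x))"
    unfolding YY_dilation[symmetric] using linear_scale[OF has_derivative_linear[OF D]] by simp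
  ultimately show ?case
    by (simp add: frame_word_Cons vf_apply_def word_weight_def power_add mult.assoc mult.left_commute)
qed (simp add: frame_word_Nil word_weight_def assms)

text \<open>The origin is fixed by dilations, so a nonzero value would force the two homogeneity
  factors to agree; \<open>t = 2\<close> tells the exponents apart.\<close>

lemma frame_word_coordinate_0:
  assumes "word_weight w I \<noteq> w k" shows "frame_word YY I (\<lambda>x. x $ k) 0 = 0"
proof -
  let ?c = "frame_word YY I (\<lambda>x. x $ k) 0"
  have "smooth_on UNIV (\<lambda>x :: (real, 'n) vec. x $ k)"
    by (rule smooth_on_linear[OF bounded_linear_vec_nth])
  from frame_word_dilation[OF this, of 2 "w k" I 0]
  have "2 ^ word_weight w I * ?c = 2 ^ w k * ?c"
    by (simp add: linear_0[OF linear_dilation]) (simp add: dilation_def)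
  then show ?thesis using assms by (simp add: power_inject_exp)
qed

text \<open>The translation moves \<open>a\<close> to the origin without changing the frame. There
  homogeneity leaves only words of weight \<open>w k\<close>, and the one-letter word
  \<open>[k]\<close> gives 1.\<close>

lemma privileged_translation: "privileged w YY a (dyn (- a))"
  unfolding privileged_def
proof (intro conjI allI)
  let ?\<tau> = "dyn (- a)"
  have \<tau>: "frechet_derivative ?\<tau> (at a) (YY j a) = axis j 1" for j
    by (simp add: YY_def frechet_derivative_dyn_left Om_0)
  then show "linearly_adapted YY a ?\<tau>"
    by (simp add: linearly_adapted_def)
  fix k
  have s: "smooth_on UNIV (\<lambda>x :: (real, 'n) vec. x $ k)"
    by (rule smooth_on_linear[OF bounded_linear_vec_nth])
  have eq: "frame_word YY I (\<lambda>x. ?\<tau> x $ k) a = frame_word YY I (\<lambda>x. x $ k) 0" for I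
    using frame_word_translate[OF s, of I "- a" a] by simp
  have "((\<lambda>x. x $ k) has_derivative (\<lambda>v. v $ k)) (at (0 :: (real, 'n) vec))"
    by (rule bounded_linear_imp_has_derivative[OF bounded_linear_vec_nth])
  then have "frame_word YY [k] (\<lambda>x. x $ k) 0 = 1"
    by (simp add: frame_word_Cons frame_word_Nil vf_apply_def frechet_derivative_eq YY_0)
  then show "has_order w YY a (\<lambda>x. ?\<tau> x $ k) (w k)"
    unfolding has_order_def eq
    by (auto intro!: frame_word_coordinate_0 exI[of _ "[k]"] simp: word_weight_def)
qed

section \<open>The affine map\<close>

text \<open>\<open>Om a\<close> maps the unit vectors to the frame at \<open>a\<close>, so its
  inverse \<open>lder EE a\<close> is the linear part of \<open>T_map\<close>.\<close>

definition TT :: "(real, 'n) vec \<Rightarrow> (real, 'n) vec \<Rightarrow> (real, 'n) vec" where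
  "TT a x = lder EE a (x - a)"

lemma TT_derivative: "(TT a has_derivative lder EE a) (at x)"
proof -
  have "bounded_linear (lder EE a)" using linear_lder_EE linear_conv_bounded_linear by blast
  moreover have "((\<lambda>x. x - a) has_derivative (\<lambda>b. b)) (at x)" by (auto intro!: derivative_eq_intros)
  ultimately show ?thesis
    unfolding TT_def[abs_def] by (rule bounded_linear.has_derivative)
qed

lemma T_map_eq: "T_map YY a = TT a"
  unfolding T_map_def
proof (rule the_equality)
  have "TT a = (\<lambda>x. matrix (lder EE a) *v x + (- lder EE a a))"
    by (simp add: fun_eq_iff TT_def matrix_works[OF linear_matrix_vector_mul_eq[THEN iffD2, OF linear_lder_EE]]
        linear_diff[OF linear_lder_EE])
  moreover have "linearly_adapted YY a (TT a)"
    by (simp add: linearly_adapted_def frechet_derivative_eq[OF TT_derivative] YY_def lder_Om)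
      (simp add: TT_def linear_0[OF linear_lder_EE])
  ultimately show "(\<exists>M b. TT a = (\<lambda>x. M *v x + b)) \<and> linearly_adapted YY a (TT a)" by blast
next
  fix T assume T: "(\<exists>M b. T = (\<lambda>x. M *v x + b)) \<and> linearly_adapted YY a T"
  then obtain M b where M: "T = (\<lambda>x. M *v x + b)" by blast
  have "(T has_derivative (\<lambda>v. M *v v)) (at a)"
    unfolding M by (auto intro!: derivative_eq_intros bounded_linear_imp_has_derivative matrix_vector_mul_bounded_linear)
  then have "M *v YY j a = axis j 1" for j
    using T by (simp add: linearly_adapted_def frechet_derivative_eq)
  then have "M *v (Om a u) = u" for u
    unfolding Om_eq_sum_YY
    by (simp only: linear_sum[OF matrix_vector_mul_linear] linear_scale[OF matrix_vector_mul_linear]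
        \<open>\<And>j. M *v YY j a = axis j 1\<close> sum_axis)
  then have Mv: "M *v v = lder EE a v" for v by (metis Om_lder)
  have "T a = 0" using T by (simp add: linearly_adapted_def)
  then have "b = - lder EE a a" by (simp add: M Mv add_eq_0_iff2)
  then show "T = TT a"
    by (simp add: M Mv fun_eq_iff TT_def linear_diff[OF linear_lder_EE])
qed

section \<open>Uniqueness of the polynomial correction\<close>

text \<open>Although the coordinates have weights, unweighted orders are what is needed here: up to terms
  of higher unweighted order, the frame acts on monomials in the coordinates \<open>T\<^sub>a\<close> like the partial
  derivatives.\<close>

definition ord_ge :: "(real, 'n) vec \<Rightarrow> nat \<Rightarrow> ((real, 'n) vec \<Rightarrow> real) \<Rightarrow> bool" where
  "ord_ge a N f \<longleftrightarrow> smooth_on UNIV f \<and> (\<forall>I. length I < N \<longrightarrow> frame_word YY I f a = 0)"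

lemma vf_apply_YY_smooth: "smooth_on UNIV f \<Longrightarrow> smooth_on UNIV (vf_apply (YY j) f)"
  by (rule vf_apply_smooth[OF YY_smooth])

lemma ord_ge_0: "ord_ge a 0 f \<longleftrightarrow> smooth_on UNIV f"
  by (simp add: ord_ge_def)

lemma ord_ge_Suc: "ord_ge a (Suc N) f \<longleftrightarrow> smooth_on UNIV f \<and> f a = 0 \<and> (\<forall>j. ord_ge a N (vf_apply (YY j) f))"
proof
  assume f: "ord_ge a (Suc N) f"
  have "frame_word YY [] f a = 0" using f unfolding ord_ge_def by (metis list.size(3) zero_less_Suc)
  moreover have "frame_word YY I (vf_apply (YY j) f) a = 0" if "length I < N" for I j
    using f that unfolding ord_ge_def frame_word_snoc[symmetric] by simp
  ultimately show "smooth_on UNIV f \<and> f a = 0 \<and> (\<forall>j. ord_ge a N (vf_apply (YY j) f))"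
    using f by (simp add: ord_ge_def vf_apply_YY_smooth frame_word_Nil)
next
  assume f: "smooth_on UNIV f \<and> f a = 0 \<and> (\<forall>j. ord_ge a N (vf_apply (YY j) f))"
  have "frame_word YY I f a = 0" if "length I < Suc N" for I
  proof (cases I rule: rev_cases)
    case Nil
    then show ?thesis using f by (simp add: frame_word_Nil)
  next
    case (snoc I' j)
    then show ?thesis using f that by (simp add: frame_word_snoc ord_ge_def)
  qed
  then show "ord_ge a (Suc N) f" using f by (simp add: ord_ge_def)
qed

lemma ord_ge_smooth: "ord_ge a N f \<Longrightarrow> smooth_on UNIV f"
  by (simp add: ord_ge_def)

lemma vf_apply_add:
  assumes "smooth_on UNIV f" "smooth_on UNIV g"
  shows "vf_apply V (\<lambda>x. f x + g x) = (\<lambda>x. vf_apply V f x + vf_apply V g x)"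
  unfolding vf_apply_def
  using frechet_derivative_eq[OF has_derivative_add[OF smooth_on_has_derivative[OF assms(1) UNIV_I] smooth_on_has_derivative[OF assms(2) UNIV_I]]]
  by (simp add: fun_eq_iff)

lemma vf_apply_mult:
  assumes "smooth_on UNIV f" "smooth_on UNIV g"
  shows "vf_apply V (\<lambda>x. f x * g x) = (\<lambda>x. f x * vf_apply V g x + vf_apply V f x * g x)"
  unfolding vf_apply_def
  using frechet_derivative_eq[OF has_derivative_mult[OF smooth_on_has_derivative[OF assms(1) UNIV_I] smooth_on_has_derivative[OF assms(2) UNIV_I]]]
  by (simp add: fun_eq_iff)

lemma vf_apply_cmul:
  assumes "smooth_on UNIV f"
  shows "vf_apply V (\<lambda>x. c * f x) = (\<lambda>x. c * vf_apply V f x)"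
  using vf_apply_mult[OF smooth_on_const assms, of V c] by (simp add: vf_apply_def fun_eq_iff)

lemma frame_word_add:
  assumes "smooth_on UNIV f" "smooth_on UNIV g"
  shows "frame_word YY I (\<lambda>x. f x + g x) = (\<lambda>x. frame_word YY I f x + frame_word YY I g x)"
  by (induction I) (simp_all add: frame_word_Nil frame_word_Cons vf_apply_add frame_word_smooth assms)

lemma frame_word_cmul:
  assumes "smooth_on UNIV f"
  shows "frame_word YY I (\<lambda>x. c * f x) = (\<lambda>x. c * frame_word YY I f x)"
  by (induction I) (simp_all add: frame_word_Nil frame_word_Cons vf_apply_cmul frame_word_smooth assms)

lemma frame_word_sum:
  assumes "finite S" "\<And>i. i \<in> S \<Longrightarrow> smooth_on UNIV (f i)"
  shows "frame_word YY I (\<lambda>x. \<Sum>i\<in>S. c i * f i x) a = (\<Sum>i\<in>S. c i * frame_word YY I (f i) a)"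
  using assms
proof (induction S rule: finite_induct)
  case empty
  have "frame_word YY I (\<lambda>x. 0 * 0) = (\<lambda>x. 0 * frame_word YY I (\<lambda>x. 0) x)"
    by (rule frame_word_cmul) simp
  then show ?case by simp
next
  case (insert i S)
  have "frame_word YY I (\<lambda>x. c i * f i x + (\<Sum>i\<in>S. c i * f i x)) =
      (\<lambda>x. frame_word YY I (\<lambda>x. c i * f i x) x + frame_word YY I (\<lambda>x. \<Sum>i\<in>S. c i * f i x) x)"
    using insert.prems by (intro frame_word_add smooth_on_mult smooth_on_sum) auto
  then show ?case using insert by (simp add: frame_word_cmul)
qed

lemma ord_ge_add: "ord_ge a N f \<Longrightarrow> ord_ge a N g \<Longrightarrow> ord_ge a N (\<lambda>x. f x + g x)"
  by (simp add: ord_ge_def smooth_on_add frame_word_add)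

text \<open>Leibniz rule. The slack in \<open>N \<le> m + n\<close> absorbs the case in which a
  factor of order 0 is differentiated and its order cannot drop.\<close>

lemma ord_ge_mult:
  "N \<le> m + n \<Longrightarrow> ord_ge a m f \<Longrightarrow> ord_ge a n g \<Longrightarrow> ord_ge a N (\<lambda>x. f x * g x)"
proof (induction N arbitrary: m n f g)
  case 0
  then show ?case by (simp add: ord_ge_0 ord_ge_smooth smooth_on_mult)
next
  case (Suc N)
  note s = ord_ge_smooth[OF Suc.prems(2)] ord_ge_smooth[OF Suc.prems(3)]
  have dec: "ord_ge a (k - 1) (vf_apply (YY j) h)" if "ord_ge a k h" for k h j
    using that by (cases k) (auto simp: ord_ge_Suc ord_ge_0 vf_apply_YY_smooth)
  have "f a * g a = 0"
  proof (cases m)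
    case 0
    then obtain n' where "n = Suc n'" using Suc.prems(1) by (cases n) auto
    then show ?thesis using Suc.prems(3) by (simp add: ord_ge_Suc)
  next
    case (Suc m')
    then show ?thesis using Suc.prems(2) by (simp add: ord_ge_Suc)
  qed
  moreover have "ord_ge a N (vf_apply (YY j) (\<lambda>x. f x * g x))" for j
    unfolding vf_apply_mult[OF s]
    using Suc.IH[OF _ Suc.prems(2) dec[OF Suc.prems(3)]] Suc.IH[OF _ dec[OF Suc.prems(2)] Suc.prems(3)] Suc.prems(1)
    by (intro ord_ge_add) auto
  ultimately show ?case using s by (simp add: ord_ge_Suc smooth_on_mult)
qed

definition mono :: "('n \<Rightarrow> nat) \<Rightarrow> (real, 'n) vec \<Rightarrow> real" where
  "mono \<alpha> y = (\<Prod>j\<in>UNIV. y $ j ^ \<alpha> j)"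

definition mdeg :: "('n \<Rightarrow> nat) \<Rightarrow> nat" where
  "mdeg \<alpha> = (\<Sum>j\<in>UNIV. \<alpha> j)"

definition mweight :: "('n \<Rightarrow> nat) \<Rightarrow> nat" where
  "mweight \<alpha> = (\<Sum>j\<in>UNIV. w j * \<alpha> j)"

definition minc :: "'n \<Rightarrow> ('n \<Rightarrow> nat) \<Rightarrow> ('n \<Rightarrow> nat)" where
  "minc i \<alpha> = \<alpha>(i := Suc (\<alpha> i))"

definition mdec :: "'n \<Rightarrow> ('n \<Rightarrow> nat) \<Rightarrow> ('n \<Rightarrow> nat)" where
  "mdec i \<alpha> = \<alpha>(i := \<alpha> i - 1)"

lemma mono_minc: "mono (minc i \<alpha>) y = y $ i * mono \<alpha> y"
proof -
  have "mono (minc i \<alpha>) y = (\<Prod>j\<in>UNIV. (if j = i then y $ i else 1) * y $ j ^ \<alpha> j)"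
    unfolding mono_def minc_def by (intro prod.cong) auto
  then show ?thesis by (simp add: prod.distrib mono_def)
qed

lemma mdeg_minc: "mdeg (minc i \<alpha>) = Suc (mdeg \<alpha>)"
proof -
  have "mdeg (minc i \<alpha>) = (\<Sum>j\<in>UNIV. (if j = i then 1 else 0) + \<alpha> j)"
    unfolding mdeg_def minc_def by (intro sum.cong) auto
  then show ?thesis by (simp add: sum.distrib mdeg_def)
qed

lemma mweight_minc: "mweight (minc i \<alpha>) = w i + mweight \<alpha>"
proof -
  have "mweight (minc i \<alpha>) = (\<Sum>j\<in>UNIV. (if j = i then w j else 0) + w j * \<alpha> j)"
    unfolding mweight_def minc_def by (intro sum.cong) auto
  then show ?thesis by (simp add: sum.distrib mweight_def)
qed

lemma minc_mdec: "\<alpha> i > 0 \<Longrightarrow> minc i (mdec i \<alpha>) = \<alpha>"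
  by (auto simp: minc_def mdec_def)

lemma mdeg_eq_0: "mdeg \<alpha> = 0 \<longleftrightarrow> \<alpha> = (\<lambda>j. 0)"
  by (auto simp: mdeg_def)

lemma mdeg_Suc: "mdeg \<alpha> = Suc m \<Longrightarrow> \<exists>i. \<alpha> i > 0"
  using mdeg_eq_0[of \<alpha>] by (metis neq0_conv old.nat.distinct(2))

lemma smooth_mono: "smooth_on UNIV (mono \<alpha>)"
  unfolding mono_def[abs_def]
  by (intro smooth_on_real_polynomial real_polynomial_function_prod real_polynomial_function_power
      real_polynomial_function.intros(1) bounded_linear_vec_nth open_UNIV) simp

definition tmono :: "(real, 'n) vec \<Rightarrow> ('n \<Rightarrow> nat) \<Rightarrow> (real, 'n) vec \<Rightarrow> real" where
  "tmono a \<alpha> x = mono \<alpha> (TT a x)"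

lemma TT_smooth: "smooth_on UNIV (TT a)"
proof -
  have "bounded_linear (lder EE a)" using linear_lder_EE linear_conv_bounded_linear by blast
  then show ?thesis
    unfolding TT_def[abs_def] by (intro smooth_on_linear_compose[of _ "lder EE a"] smooth_on_diff) auto
qed

lemma tmono_smooth: "smooth_on UNIV (tmono a \<alpha>)"
  unfolding tmono_def[abs_def] by (rule smooth_on_compose[OF _ TT_smooth smooth_mono]) auto

abbreviation tcoord :: "(real, 'n) vec \<Rightarrow> 'n \<Rightarrow> (real, 'n) vec \<Rightarrow> real" where
  "tcoord a i \<equiv> \<lambda>x. TT a x $ i"

lemma tcoord_smooth: "smooth_on UNIV (tcoord a i)"
  by (rule smooth_on_vec_nth[OF open_UNIV TT_smooth])

lemma tmono_minc: "tmono a (minc i \<alpha>) = (\<lambda>x. tcoord a i x * tmono a \<alpha> x)"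
  by (simp add: tmono_def mono_minc fun_eq_iff)

lemma ord_ge_tcoord: "ord_ge a 1 (tcoord a i)"
  by (simp add: ord_ge_Suc ord_ge_0 tcoord_smooth vf_apply_YY_smooth)
    (simp add: TT_def linear_0[OF linear_lder_EE])

lemma ord_ge_tmono: "mdeg \<alpha> = m \<Longrightarrow> ord_ge a m (tmono a \<alpha>)"
proof (induction m arbitrary: \<alpha>)
  case 0
  then show ?case by (simp add: ord_ge_0 tmono_smooth)
next
  case (Suc m)
  then obtain i where i: "\<alpha> i > 0" using mdeg_Suc by blast
  have "mdeg (mdec i \<alpha>) = m"
    using mdeg_minc[of i "mdec i \<alpha>"] Suc.prems by (simp add: minc_mdec i)
  then have "ord_ge a (Suc m) (\<lambda>x. tcoord a i x * tmono a (mdec i \<alpha>) x)"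
    using Suc.IH ord_ge_tcoord by (intro ord_ge_mult[of "Suc m" 1 m]) auto
  then show ?case by (simp add: minc_mdec i flip: tmono_minc)
qed

lemma vf_apply_tcoord: "ord_ge a 1 (\<lambda>x. vf_apply (YY j) (tcoord a i) x - (if i = j then 1 else 0))"
proof -
  have "(tcoord a i has_derivative (\<lambda>b. lder EE a b $ i)) (at a)"
    by (rule bounded_linear.has_derivative[OF bounded_linear_vec_nth TT_derivative])
  then have "vf_apply (YY j) (tcoord a i) a = (if i = j then 1 else 0)"
    by (simp add: vf_apply_def frechet_derivative_eq YY_def lder_Om axis_def)
  moreover have "smooth_on UNIV (\<lambda>x. vf_apply (YY j) (tcoord a i) x - (if i = j then 1 else 0))"
    by (intro smooth_on_diff vf_apply_YY_smooth tcoord_smooth smooth_on_const open_UNIV)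
  ultimately show ?thesis
    by (simp add: ord_ge_Suc ord_ge_0 vf_apply_YY_smooth)
qed

text \<open>To leading order the frame differentiates monomials like the partial derivatives. If
  \<open>\<alpha> j\<close> is 0, then \<open>mdec j \<alpha>\<close> is \<open>\<alpha>\<close>
  again, but with coefficient 0.\<close>

lemma vf_apply_tmono:
  "mdeg \<alpha> = m \<Longrightarrow> ord_ge a m (\<lambda>x. vf_apply (YY j) (tmono a \<alpha>) x - real (\<alpha> j) * tmono a (mdec j \<alpha>) x)"
proof (induction m arbitrary: \<alpha>)
  case 0
  then show ?case
    by (simp add: ord_ge_0 smooth_on_diff smooth_on_mult vf_apply_YY_smooth tmono_smooth)
next
  case (Suc m)
  then obtain i where i: "\<alpha> i > 0" using mdeg_Suc by blast
  let ?\<beta> = "mdec i \<alpha>"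
  have \<alpha>: "\<alpha> = minc i ?\<beta>" by (simp add: minc_mdec i)
  have deg: "mdeg ?\<beta> = m" using mdeg_minc[of i ?\<beta>] Suc.prems \<alpha> by simp
  let ?e = "\<lambda>x. vf_apply (YY j) (tmono a ?\<beta>) x - real (?\<beta> j) * tmono a (mdec j ?\<beta>) x"
  let ?d = "\<lambda>x. vf_apply (YY j) (tcoord a i) x - (if i = j then 1 else 0)"
  \<comment> \<open>By the product rule the error for \<open>\<alpha>\<close> comes from the errors
    for the smaller monomial and for one coordinate, each times a factor whose order makes up the
    total.\<close>
  have "ord_ge a (Suc m) (\<lambda>x. tcoord a i x * ?e x + ?d x * tmono a ?\<beta> x)"
    by (intro ord_ge_add ord_ge_mult[OF _ ord_ge_tcoord Suc.IH[OF deg]] ord_ge_mult[OF _ vf_apply_tcoord ord_ge_tmono[OF deg]]) auto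
  moreover have "tcoord a i x * ?e x + ?d x * tmono a ?\<beta> x = vf_apply (YY j) (tmono a \<alpha>) x - real (\<alpha> j) * tmono a (mdec j \<alpha>) x" for x
  proof -
    have v: "vf_apply (YY j) (tmono a \<alpha>) x = tcoord a i x * vf_apply (YY j) (tmono a ?\<beta>) x + vf_apply (YY j) (tcoord a i) x * tmono a ?\<beta> x"
      by (subst \<alpha>) (simp add: tmono_minc vf_apply_mult tcoord_smooth tmono_smooth)
    have "tcoord a i x * (real (?\<beta> j) * tmono a (mdec j ?\<beta>) x) + (if i = j then 1 else 0) * tmono a ?\<beta> x =
        real (\<alpha> j) * tmono a (mdec j \<alpha>) x"
    proof (cases "i = j")
      case True
      have "tcoord a i x * (real (?\<beta> j) * tmono a (mdec j ?\<beta>) x) = real (?\<beta> j) * tmono a ?\<beta> x"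
      proof (cases "?\<beta> j = 0")
        case False
        then have "?\<beta> = minc j (mdec j ?\<beta>)" using minc_mdec[of ?\<beta> j] by simp
        then have "tmono a ?\<beta> x = tcoord a j x * tmono a (mdec j ?\<beta>) x" by (metis tmono_minc)
        then show ?thesis using True by simp
      qed simp
      moreover have "real (\<alpha> j) = real (?\<beta> j) + 1" using i True by (simp add: mdec_def)
      ultimately show ?thesis using True by (simp add: algebra_simps)
    next
      case False
      have bj: "?\<beta> j = \<alpha> j" using False by (simp add: mdec_def)
      have "mdec j \<alpha> = minc i (mdec j ?\<beta>)" using False i by (auto simp: mdec_def minc_def)
      then have "tmono a (mdec j \<alpha>) x = tcoord a i x * tmono a (mdec j ?\<beta>) x" by (simp add: tmono_minc)
      then show ?thesis using False bj by simp
    qed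
    then show ?thesis unfolding v by (simp add: algebra_simps)
  qed
  ultimately show ?case by simp
qed

text \<open>The word lists each index \<open>j\<close> with multiplicity \<open>\<alpha> j\<close>:
  to leading order it is the partial derivative of multi-index \<open>\<alpha>\<close>, which kills
  the other monomials of the same degree at \<open>a\<close>. Its weight is recorded because
  privileged coordinates control only words of small weight.\<close>

lemma separating_word:
  "mdeg \<alpha> = m \<Longrightarrow> \<exists>I. length I = m \<and> word_weight w I = mweight \<alpha> \<and> frame_word YY I (tmono a \<alpha>) a \<noteq> 0 \<and>
    (\<forall>\<beta>. mdeg \<beta> = m \<and> \<beta> \<noteq> \<alpha> \<longrightarrow> frame_word YY I (tmono a \<beta>) a = 0)"
proof (induction m arbitrary: \<alpha>)
  case 0
  then have \<alpha>: "\<alpha> = (\<lambda>j. 0)" by (simp only: mdeg_eq_0)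
  show ?case
  proof (intro exI[of _ "[]"] conjI allI impI)
    show "word_weight w [] = mweight \<alpha>" by (simp add: \<alpha> word_weight_def mweight_def)
    show "frame_word YY [] (tmono a \<alpha>) a \<noteq> 0" by (simp add: \<alpha> frame_word_Nil tmono_def mono_def)
    fix \<beta> assume "mdeg \<beta> = 0 \<and> \<beta> \<noteq> \<alpha>"
    then show "frame_word YY [] (tmono a \<beta>) a = 0" unfolding \<alpha> mdeg_eq_0 by blast
  qed simp
next
  case (Suc m)
  obtain j where j: "\<alpha> j > 0" using mdeg_Suc[OF Suc.prems] by blast
  let ?\<alpha> = "mdec j \<alpha>"
  have \<alpha>: "\<alpha> = minc j ?\<alpha>" by (simp add: minc_mdec j)
  have deg: "mdeg ?\<alpha> = m" using mdeg_minc[of j ?\<alpha>] Suc.prems \<alpha> by simp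
  obtain I where I: "length I = m" "word_weight w I = mweight ?\<alpha>" "frame_word YY I (tmono a ?\<alpha>) a \<noteq> 0"
    "\<And>\<beta>. mdeg \<beta> = m \<Longrightarrow> \<beta> \<noteq> ?\<alpha> \<Longrightarrow> frame_word YY I (tmono a \<beta>) a = 0"
    using Suc.IH[OF deg] by blast
  have step: "frame_word YY (I @ [j]) (tmono a \<beta>) a = real (\<beta> j) * frame_word YY I (tmono a (mdec j \<beta>)) a"
    if "mdeg \<beta> = Suc m" for \<beta>
  proof -
    let ?e = "\<lambda>x. vf_apply (YY j) (tmono a \<beta>) x - real (\<beta> j) * tmono a (mdec j \<beta>) x"
    have e: "ord_ge a (Suc m) ?e" by (rule vf_apply_tmono[OF that])
    have "vf_apply (YY j) (tmono a \<beta>) = (\<lambda>x. ?e x + real (\<beta> j) * tmono a (mdec j \<beta>) x)" by simp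
    then have "frame_word YY I (vf_apply (YY j) (tmono a \<beta>)) a =
        frame_word YY I (\<lambda>x. ?e x + real (\<beta> j) * tmono a (mdec j \<beta>) x) a" by (rule arg_cong)
    also have "\<dots> = frame_word YY I ?e a + frame_word YY I (\<lambda>x. real (\<beta> j) * tmono a (mdec j \<beta>) x) a"
      using frame_word_add[OF ord_ge_smooth[OF e], of "\<lambda>x. real (\<beta> j) * tmono a (mdec j \<beta>) x" I]
      by (simp add: smooth_on_mult tmono_smooth)
    also have "frame_word YY I ?e a = 0" using e I(1) unfolding ord_ge_def by blast
    finally show ?thesis by (simp add: frame_word_snoc frame_word_cmul tmono_smooth)
  qed
  show ?case
  proof (intro exI[of _ "I @ [j]"] conjI allI impI)
    show "length (I @ [j]) = Suc m" using I(1) by simp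
    show "word_weight w (I @ [j]) = mweight \<alpha>"
      using I(2) mweight_minc[of j ?\<alpha>] \<alpha> by (simp add: word_weight_def)
    show "frame_word YY (I @ [j]) (tmono a \<alpha>) a \<noteq> 0"
      using step[OF Suc.prems] I(3) j by simp
    fix \<beta> assume \<beta>: "mdeg \<beta> = Suc m \<and> \<beta> \<noteq> \<alpha>"
    show "frame_word YY (I @ [j]) (tmono a \<beta>) a = 0"
    proof (cases "\<beta> j = 0")
      case True
      then show ?thesis using step \<beta> by simp
    next
      case False
      then have b: "minc j (mdec j \<beta>) = \<beta>" by (simp add: minc_mdec)
      then have "mdec j \<beta> \<noteq> ?\<alpha>" using \<beta> \<alpha> by metis
      moreover have "mdeg (mdec j \<beta>) = m" using mdeg_minc[of j "mdec j \<beta>"] b \<beta> by simp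
      ultimately show ?thesis using step \<beta> I(4) by simp
    qed
  qed
qed

text \<open>Induction on the degree: the word that separates \<open>\<alpha>\<close> sees only
  \<open>d \<alpha>\<close>, since coefficients of lower degree are already zero and monomials of
  higher degree have too high an order. The weight bound on \<open>B\<close> makes this word
  admissible in \<open>zero\<close>.\<close>

lemma coefficients_eq_0:
  assumes B: "finite B" "\<And>\<alpha>. \<alpha> \<in> B \<Longrightarrow> mweight \<alpha> < N"
    and zero: "\<And>I. word_weight w I < N \<Longrightarrow> frame_word YY I (\<lambda>x. \<Sum>\<alpha>\<in>B. d \<alpha> * tmono a \<alpha> x) a = 0"
  shows "\<alpha> \<in> B \<Longrightarrow> d \<alpha> = 0"
proof (induction "mdeg \<alpha>" arbitrary: \<alpha> rule: less_induct)
  case less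
  obtain I where I: "length I = mdeg \<alpha>" "word_weight w I = mweight \<alpha>" "frame_word YY I (tmono a \<alpha>) a \<noteq> 0"
    "\<And>\<beta>. mdeg \<beta> = mdeg \<alpha> \<Longrightarrow> \<beta> \<noteq> \<alpha> \<Longrightarrow> frame_word YY I (tmono a \<beta>) a = 0"
    using separating_word[OF refl] by metis
  have "d \<beta> * frame_word YY I (tmono a \<beta>) a = 0" if "\<beta> \<in> B" "\<beta> \<noteq> \<alpha>" for \<beta>
  proof (cases "mdeg \<beta>" "mdeg \<alpha>" rule: linorder_cases)
    case less
    then show ?thesis using less.hyps[of \<beta>] that by simp
  next
    case equal
    then show ?thesis using I(4) that by simp
  next
    case greater
    then show ?thesis using ord_ge_tmono[OF refl, of a \<beta>] I(1) unfolding ord_ge_def by simp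
  qed
  then have "(\<Sum>\<beta>\<in>B - {\<alpha>}. d \<beta> * frame_word YY I (tmono a \<beta>) a) = 0"
    by (intro sum.neutral ballI) blast
  then have "(\<Sum>\<beta>\<in>B. d \<beta> * frame_word YY I (tmono a \<beta>) a) = d \<alpha> * frame_word YY I (tmono a \<alpha>) a"
    by (simp only: sum.remove[OF B(1) less.prems] add_0_right)
  moreover have "(\<Sum>\<beta>\<in>B. d \<beta> * frame_word YY I (tmono a \<beta>) a) = 0"
    using zero[of I] B less.prems I(2) by (simp add: frame_word_sum tmono_smooth)
  ultimately show ?case using I(3) by simp
qed

end

lemma power_sum_coefficients:
  fixes c :: "'a \<Rightarrow> real" and c' :: "'b \<Rightarrow> real"
  assumes "finite S" "finite T" "\<And>t. (\<Sum>i\<in>S. c i * t ^ d i) = (\<Sum>j\<in>T. c' j * t ^ d' j)"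
  shows "(\<Sum>i | i \<in> S \<and> d i = N. c i) = (\<Sum>j | j \<in> T \<and> d' j = N. c' j)"
proof -
  have "poly (\<Sum>i\<in>S. monom (c i) (d i)) = poly (\<Sum>j\<in>T. monom (c' j) (d' j))"
    using assms(3) by (simp add: fun_eq_iff poly_sum poly_monom)
  then have "coeff (\<Sum>i\<in>S. monom (c i) (d i)) N = coeff (\<Sum>j\<in>T. monom (c' j) (d' j)) N"
    by (simp only: poly_eq_poly_eq_iff)
  then show ?thesis
    using assms(1,2) by (simp add: coeff_sum sum.inter_filter)
qed

context graded_frame
begin

section \<open>The shape of the polynomial correction\<close>

lemma mono_add: "mono (\<lambda>j. \<alpha> j + \<beta> j) y = mono \<alpha> y * mono \<beta> y"
  by (simp add: mono_def power_add prod.distrib)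

lemma mono_0: "mono (\<lambda>j. 0) y = 1"
  by (simp add: mono_def)

lemma mono_dilation: "mono \<alpha> (dilation w t y) = t ^ mweight \<alpha> * mono \<alpha> y"
  by (simp add: mono_def dilation_def mweight_def power_mult_distrib prod.distrib power_sum power_mult)

lemma mono_scaleR: "mono \<alpha> (t *\<^sub>R y) = t ^ mdeg \<alpha> * mono \<alpha> y"
  by (simp add: mono_def mdeg_def power_mult_distrib prod.distrib power_sum)

definition mono_sum :: "((real, 'n) vec \<Rightarrow> real) \<Rightarrow> bool" where
  "mono_sum f \<longleftrightarrow> (\<exists>S c. finite S \<and> f = (\<lambda>y. \<Sum>\<alpha>\<in>S. c \<alpha> * mono \<alpha> y))"

lemma mono_sum_cmono: "mono_sum (\<lambda>y. c * mono \<alpha> y)"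
  unfolding mono_sum_def by (intro exI[of _ "{\<alpha>}"] exI[of _ "\<lambda>_. c"]) simp

lemma mono_sum_add:
  assumes "mono_sum f" "mono_sum g" shows "mono_sum (\<lambda>y. f y + g y)"
proof -
  obtain S c where S: "finite S" "f = (\<lambda>y. \<Sum>\<alpha>\<in>S. c \<alpha> * mono \<alpha> y)"
    using assms(1) unfolding mono_sum_def by blast
  obtain T d where T: "finite T" "g = (\<lambda>y. \<Sum>\<alpha>\<in>T. d \<alpha> * mono \<alpha> y)"
    using assms(2) unfolding mono_sum_def by blast
  have "(\<Sum>\<alpha>\<in>S. c \<alpha> * mono \<alpha> y) = (\<Sum>\<alpha>\<in>S \<union> T. (if \<alpha> \<in> S then c \<alpha> else 0) * mono \<alpha> y)" for y
    using S(1) T(1) by (intro sum.mono_neutral_cong_left) auto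
  moreover have "(\<Sum>\<alpha>\<in>T. d \<alpha> * mono \<alpha> y) = (\<Sum>\<alpha>\<in>S \<union> T. (if \<alpha> \<in> T then d \<alpha> else 0) * mono \<alpha> y)" for y
    using S(1) T(1) by (intro sum.mono_neutral_cong_left) auto
  ultimately have "f y + g y =
      (\<Sum>\<alpha>\<in>S \<union> T. ((if \<alpha> \<in> S then c \<alpha> else 0) + (if \<alpha> \<in> T then d \<alpha> else 0)) * mono \<alpha> y)" for y
    by (simp only: S(2) T(2) distrib_right sum.distrib)
  then show ?thesis
    unfolding mono_sum_def using S(1) T(1)
    by (intro exI[of _ "S \<union> T"] exI[of _ "\<lambda>\<alpha>. (if \<alpha> \<in> S then c \<alpha> else 0) + (if \<alpha> \<in> T then d \<alpha> else 0)"]) auto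
qed

lemma mono_sum_sum:
  assumes "finite S" "\<And>i. i \<in> S \<Longrightarrow> mono_sum (f i)" shows "mono_sum (\<lambda>y. \<Sum>i\<in>S. f i y)"
  using assms
proof (induction S rule: finite_induct)
  case empty
  show ?case unfolding mono_sum_def by (intro exI[of _ "{}"]) simp
qed (simp add: mono_sum_add)

lemma mono_sum_real_polynomial:
  "real_polynomial_function f \<Longrightarrow> mono_sum f"
proof (induction f rule: real_polynomial_function.induct)
  case (linear f)
  have "f = (\<lambda>y. \<Sum>k\<in>UNIV. f (axis k 1) * mono (minc k (\<lambda>j. 0)) y)"
  proof
    fix y
    have "f y = f (\<Sum>k\<in>UNIV. y $ k *\<^sub>R axis k 1)" by (simp only: sum_axis)
    also have "\<dots> = (\<Sum>k\<in>UNIV. f (axis k 1) * mono (minc k (\<lambda>j. 0)) y)"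
      using bounded_linear.linear[OF linear] by (simp add: linear_sum linear_scale mono_minc mono_0 mult.commute)
    finally show "f y = (\<Sum>k\<in>UNIV. f (axis k 1) * mono (minc k (\<lambda>j. 0)) y)" .
  qed
  moreover have "mono_sum (\<lambda>y. \<Sum>k\<in>UNIV. f (axis k 1) * mono (minc k (\<lambda>j. 0)) y)"
    by (intro mono_sum_sum mono_sum_cmono) simp
  ultimately show ?case by simp
next
  case (const c)
  then show ?case using mono_sum_cmono[of c "\<lambda>j. 0"] by (simp add: mono_0)
next
  case (add f g)
  then show ?case by (simp add: mono_sum_add)
next
  case (mult f g)
  obtain S c where S: "finite S" "f = (\<lambda>y. \<Sum>\<alpha>\<in>S. c \<alpha> * mono \<alpha> y)"
    using mult.IH(1) unfolding mono_sum_def by blast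
  obtain T d where T: "finite T" "g = (\<lambda>y. \<Sum>\<beta>\<in>T. d \<beta> * mono \<beta> y)"
    using mult.IH(2) unfolding mono_sum_def by blast
  have "f y * g y = (\<Sum>\<alpha>\<in>S. \<Sum>\<beta>\<in>T. (c \<alpha> * d \<beta>) * mono (\<lambda>j. \<alpha> j + \<beta> j) y)" for y
    by (simp add: S(2) T(2) sum_product mono_add mult_ac)
  then show ?case
    using S(1) T(1) by (simp only:) (intro mono_sum_sum mono_sum_cmono)
qed

text \<open>\<open>PP a\<close> turns out to be \<open>psi_hat w YY a\<close>; it is determined by \<open>PP_TT\<close>.\<close>

definition PP :: "(real, 'n) vec \<Rightarrow> (real, 'n) vec \<Rightarrow> (real, 'n) vec" where
  "PP a y = dyn (- a) (a + Om a y)"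

lemma PP_TT: "PP a (TT a x) = dyn (- a) x"
  by (simp add: PP_def TT_def Om_lder)

lemma PP_dilation: "PP (dilation w t a) (dilation w t y) = dilation w t (PP a y)"
  by (simp add: PP_def Om_dilation dilation_dyn linear_add[OF linear_dilation] linear_neg[OF linear_dilation])

lemma polynomial_function_PP:
  fixes F H :: "'a::real_normed_vector \<Rightarrow> (real, 'n) vec"
  assumes "polynomial_function F" "polynomial_function H"
  shows "polynomial_function (\<lambda>z. PP (F z) (H z))"
  unfolding PP_def using assms
  by (intro polynomial_function_dyn polynomial_function_minus polynomial_function_add polynomial_function_Om)

lemma PP_0_left: "PP 0 y = y"
  by (simp add: PP_def Om_0)

lemma PP_0: "PP a 0 = 0"
  by (simp add: PP_def linear_0[OF linear_Om])

lemma PP_derivative: "((\<lambda>t. PP a (t *\<^sub>R y)) has_vector_derivative y) (at 0)"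
proof -
  have "((\<lambda>t. a + Om a (t *\<^sub>R y)) has_derivative (\<lambda>h. h *\<^sub>R Om a y)) (at 0)"
    unfolding linear_scale[OF linear_Om] by (auto intro!: derivative_eq_intros)
  from has_derivative_compose[OF this dyn_left_derivative[of "- a"]]
  have "((\<lambda>t. PP a (t *\<^sub>R y)) has_derivative (\<lambda>h. frechet_derivative (dyn (- a)) (at a) (h *\<^sub>R Om a y))) (at 0)"
    by (simp add: PP_def linear_0[OF linear_Om])
  moreover have "frechet_derivative (dyn (- a)) (at a) (h *\<^sub>R Om a y) = h *\<^sub>R y" for h
    by (simp add: linear_scale[OF has_derivative_linear[OF dyn_left_derivative]] frechet_derivative_dyn_left Om_0)
  ultimately show ?thesis by (simp add: has_vector_derivative_def)
qed

lemma polynomial_dilation: "polynomial_function (\<lambda>s. dilation w s a)"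
proof (rule polynomial_function_vecI)
  fix k
  have "real_polynomial_function (\<lambda>s :: real. s)" by (intro real_polynomial_function.intros(1)) simp
  then show "real_polynomial_function (\<lambda>s. dilation w s a $ k)"
    by (simp add: dilation_def) (intro real_polynomial_function.intros(2,4) real_polynomial_function_power)
qed

lemma dilation_0: "dilation w 0 a = 0"
proof -
  have "(0::real) ^ w j = 0" for j using w_pos[of j] by (simp add: zero_power)
  then show ?thesis by (simp add: dilation_def vec_eq_iff)
qed

text \<open>\<open>PP\<close> is jointly homogeneous and \<open>PP 0 = id\<close>, so the part of \<open>PP a\<close> of weight at least \<open>w k\<close>
  is found by dilating \<open>a\<close> to \<open>0\<close>.\<close>

lemma weight_components:
  assumes "finite S" "\<And>y. PP a y $ k = (\<Sum>\<alpha>\<in>S. c \<alpha> * mono \<alpha> y)" "N \<ge> w k"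
  shows "(\<Sum>\<alpha> | \<alpha> \<in> S \<and> mweight \<alpha> = N. c \<alpha> * mono \<alpha> y) = (if N = w k then y $ k else 0)"
proof -
  have "real_polynomial_function (\<lambda>s. PP (dilation w s a) y $ k)"
    by (intro polynomial_function_vec_nth polynomial_function_PP polynomial_dilation) simp
  then obtain b n where "(\<lambda>s. PP (dilation w s a) y $ k) = (\<lambda>s. \<Sum>i\<le>n. b i * s ^ i)"
    using real_polynomial_function_imp_sum by blast
  then have b: "PP (dilation w s a) y $ k = (\<Sum>i\<le>n. b i * s ^ i)" for s by meson
  have "(\<Sum>i\<le>n. b i * 0 ^ i) = (\<Sum>i\<in>{0}. b i)"
    by (intro sum.mono_neutral_cong_right) auto
  then have b0: "b 0 = y $ k" using b[of 0] by (simp add: dilation_0 PP_0_left)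
  \<comment> \<open>The factor \<open>t ^ Suc n\<close> clears the negative powers that come from
    dilating \<open>a\<close> by \<open>1 / t\<close>; with \<open>Suc n\<close> in place of
    \<open>n\<close>, both sides vanish at \<open>t = 0\<close> and the identity holds for all
    \<open>t\<close>.\<close>
  have "(\<Sum>\<alpha>\<in>S. (c \<alpha> * mono \<alpha> y) * t ^ (mweight \<alpha> + Suc n)) = (\<Sum>i\<le>n. b i * t ^ (Suc (w k) + (n - i)))" for t
  proof (cases "t = 0")
    case False
    have "dilation w t (dilation w (1 / t) a) = a"
      using False by (simp add: dilation_def vec_eq_iff power_one_over)
    then have "PP a (dilation w t y) = dilation w t (PP (dilation w (1 / t) a) y)"
      using PP_dilation[of t "dilation w (1 / t) a" y] by simp
    then have "PP a (dilation w t y) $ k = t ^ w k * (\<Sum>i\<le>n. b i * (1 / t) ^ i)"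
      by (simp add: dilation_def[of w t] b)
    then have "(\<Sum>\<alpha>\<in>S. c \<alpha> * (t ^ mweight \<alpha> * mono \<alpha> y)) * t ^ Suc n = t ^ w k * (\<Sum>i\<le>n. b i * (1 / t) ^ i) * t ^ Suc n"
      by (simp only: assms(2) mono_dilation)
    also have "\<dots> = (\<Sum>i\<le>n. t ^ w k * (b i * (1 / t) ^ i) * t ^ Suc n)"
      by (simp only: sum_distrib_left sum_distrib_right)
    also have "\<dots> = (\<Sum>i\<le>n. b i * t ^ (Suc (w k) + (n - i)))"
    proof (intro sum.cong refl)
      fix i assume "i \<in> {..n}"
      then have "i \<le> n" by simp
      then show "t ^ w k * (b i * (1 / t) ^ i) * t ^ Suc n = b i * t ^ (Suc (w k) + (n - i))"
        using False by (simp add: power_add power_diff power_one_over)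
    qed
    also have "(\<Sum>\<alpha>\<in>S. c \<alpha> * (t ^ mweight \<alpha> * mono \<alpha> y)) * t ^ Suc n =
        (\<Sum>\<alpha>\<in>S. (c \<alpha> * mono \<alpha> y) * t ^ (mweight \<alpha> + Suc n))"
      by (simp add: sum_distrib_left sum_distrib_right power_add mult_ac)
    finally show ?thesis .
  qed simp
  from power_sum_coefficients[OF assms(1) _ this, of "N + Suc n"]
  have "(\<Sum>\<alpha> | \<alpha> \<in> S \<and> mweight \<alpha> = N. c \<alpha> * mono \<alpha> y) = (\<Sum>i | i \<le> n \<and> Suc (w k) + (n - i) = N + Suc n. b i)"
    by simp
  \<comment> \<open>For \<open>N \<ge> w k\<close> only the constant coefficient \<open>b 0\<close>
    can contribute, and only when \<open>N = w k\<close>.\<close>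
  also have "{i. i \<le> n \<and> Suc (w k) + (n - i) = N + Suc n} = (if N = w k then {0} else {})"
    using assms(3) by auto
  finally show ?thesis by (simp add: b0)
qed

text \<open>Degree 0 is read off from \<open>PP a 0 = 0\<close>, degree 1 from the derivative of
  \<open>PP a\<close> at the origin, which is the identity and is already accounted for by
  \<open>y $ k\<close>.\<close>

lemma degree_components:
  assumes "finite S" "\<And>y. PP a y $ k = y $ k + (\<Sum>\<alpha>\<in>S. c \<alpha> * mono \<alpha> y)"
  shows "N < 2 \<Longrightarrow> (\<Sum>\<alpha> | \<alpha> \<in> S \<and> mdeg \<alpha> = N. c \<alpha> * mono \<alpha> y) = 0"
proof -
  assume "N < 2"
  then consider "N = 0" | "N = 1" by linarith
  then show ?thesis
  proof cases
    case 1
    have "(\<Sum>\<alpha>\<in>S. c \<alpha> * mono \<alpha> (0 *\<^sub>R y)) = 0" using assms(2)[of 0] by (simp add: PP_0)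
    moreover have "c \<alpha> * mono \<alpha> (0 *\<^sub>R y) = (if mdeg \<alpha> = 0 then c \<alpha> * mono \<alpha> y else 0)" for \<alpha>
      unfolding mono_scaleR by (simp add: power_0_left)
    ultimately have "(\<Sum>\<alpha>\<in>S. if mdeg \<alpha> = 0 then c \<alpha> * mono \<alpha> y else 0) = 0"
      by simp
    then show ?thesis using assms(1) 1 by (simp add: sum.inter_filter)
  next
    case 2
    have "((\<lambda>t. PP a (t *\<^sub>R y) $ k) has_derivative (\<lambda>h. (h *\<^sub>R y) $ k)) (at 0)"
      using bounded_linear.has_derivative[OF bounded_linear_vec_nth PP_derivative[unfolded has_vector_derivative_def]] .
    then have "((\<lambda>t. t * y $ k + (\<Sum>\<alpha>\<in>S. c \<alpha> * (t ^ mdeg \<alpha> * mono \<alpha> y))) has_real_derivative y $ k) (at 0)"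
      unfolding assms(2) mono_scaleR has_field_derivative_def by (simp add: mult_commute_abs)
    moreover have "((\<lambda>t. t * y $ k + (\<Sum>\<alpha>\<in>S. c \<alpha> * (t ^ mdeg \<alpha> * mono \<alpha> y))) has_real_derivative
        y $ k + (\<Sum>\<alpha>\<in>S. c \<alpha> * (real (mdeg \<alpha>) * 0 ^ (mdeg \<alpha> - 1) * mono \<alpha> y))) (at 0)"
      by (auto intro!: derivative_eq_intros simp: mult_ac)
    ultimately have "(\<Sum>\<alpha>\<in>S. c \<alpha> * (real (mdeg \<alpha>) * 0 ^ (mdeg \<alpha> - 1) * mono \<alpha> y)) = 0"
      using DERIV_unique by fastforce
    moreover have "c \<alpha> * (real (mdeg \<alpha>) * 0 ^ (mdeg \<alpha> - 1) * mono \<alpha> y) = (if mdeg \<alpha> = 1 then c \<alpha> * mono \<alpha> y else 0)" for \<alpha>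
      by (auto simp: power_0_left)
    ultimately show ?thesis using assms(1) 2 by (simp add: sum.inter_filter)
  qed
qed

abbreviation indices :: "'n \<Rightarrow> ('n \<Rightarrow> nat) set" where
  "indices k \<equiv> {\<alpha>. mweight \<alpha> < w k \<and> mdeg \<alpha> \<ge> 2}"

text \<open>Positive weights bound all exponents. Finiteness matters because a sum over an infinite
  index set would be 0 by convention.\<close>

lemma finite_indices: "finite (indices k)"
proof (rule finite_subset)
  have "\<alpha> j \<le> w k" if "mweight \<alpha> < w k" for \<alpha> j
  proof -
    have "\<alpha> j \<le> w j * \<alpha> j" using w_pos[of j] by simp
    also have "\<dots> \<le> mweight \<alpha>" unfolding mweight_def by (rule member_le_sum) auto
    finally show ?thesis using that by simp
  qed
  then show "indices k \<subseteq> PiE UNIV (\<lambda>_. {..w k})" by (auto simp: PiE_def)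
qed (simp add: finite_PiE)

lemma psi_hat_shape_iff:
  "psi_hat_shape w P \<longleftrightarrow> (\<exists>c. \<forall>y k. P y $ k = y $ k + (\<Sum>\<alpha>\<in>indices k. c k \<alpha> * mono \<alpha> y))"
  by (simp add: psi_hat_shape_def mono_def mdeg_def mweight_def)

text \<open>The expansion into monomials is cut down twice: the terms of weight at least
  \<open>w k\<close> add up to \<open>y $ k\<close>, and among the remaining ones those of degree
  below 2 add up to zero.\<close>

lemma psi_hat_shape_PP: "psi_hat_shape w (PP a)"
proof -
  have "\<exists>d. \<forall>y. PP a y $ k = y $ k + (\<Sum>\<alpha>\<in>indices k. d \<alpha> * mono \<alpha> y)" for k
  proof -
    have "mono_sum (\<lambda>y. PP a y $ k)"
      by (intro mono_sum_real_polynomial polynomial_function_vec_nth polynomial_function_PP) auto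
    then obtain S c where "finite S" and c: "(\<lambda>y. PP a y $ k) = (\<lambda>y. \<Sum>\<alpha>\<in>S. c \<alpha> * mono \<alpha> y)"
      unfolding mono_sum_def by blast
    from fun_cong[OF c] have c: "PP a y $ k = (\<Sum>\<alpha>\<in>S. c \<alpha> * mono \<alpha> y)" for y .
    let ?S = "{\<alpha> \<in> S. mweight \<alpha> < w k}" and ?S' = "{\<alpha> \<in> S. \<alpha> \<in> indices k}"
    have 1: "PP a y $ k = y $ k + (\<Sum>\<alpha>\<in>?S. c \<alpha> * mono \<alpha> y)" for y
    proof -
      let ?f = "\<lambda>\<alpha>. c \<alpha> * mono \<alpha> y"
      have "(\<Sum>\<alpha> | \<alpha> \<in> S \<and> \<not> mweight \<alpha> < w k. ?f \<alpha>) =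
          (\<Sum>N\<in>{w k..Max (insert (w k) (mweight ` S))}. \<Sum>\<alpha> | \<alpha> \<in> {\<alpha>. \<alpha> \<in> S \<and> \<not> mweight \<alpha> < w k} \<and> mweight \<alpha> = N. ?f \<alpha>)"
        using \<open>finite S\<close> by (intro sum.group[symmetric]) auto
      also have "\<dots> = (\<Sum>N\<in>{w k..Max (insert (w k) (mweight ` S))}. \<Sum>\<alpha> | \<alpha> \<in> S \<and> mweight \<alpha> = N. ?f \<alpha>)"
        by (intro sum.cong) auto
      also have "\<dots> = (\<Sum>N\<in>{w k..Max (insert (w k) (mweight ` S))}. if N = w k then y $ k else 0)"
        using weight_components[OF \<open>finite S\<close> c] by (intro sum.cong) auto
      also have "\<dots> = y $ k" using \<open>finite S\<close> by simp
      finally show ?thesis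
        unfolding c using sum.inter_filter[OF \<open>finite S\<close>] sum.Int_Diff[OF \<open>finite S\<close>, of ?f "{\<alpha>. mweight \<alpha> < w k}"]
        by (simp add: Int_def set_diff_eq)
    qed
    have 2: "(\<Sum>\<alpha>\<in>?S. c \<alpha> * mono \<alpha> y) = (\<Sum>\<alpha>\<in>?S'. c \<alpha> * mono \<alpha> y)" for y
    proof -
      let ?f = "\<lambda>\<alpha>. c \<alpha> * mono \<alpha> y"
      have fin: "finite ?S" using \<open>finite S\<close> by simp
      have "(\<Sum>\<alpha>\<in>?S - indices k. ?f \<alpha>) =
          (\<Sum>N\<in>{..<2}. \<Sum>\<alpha> | \<alpha> \<in> ?S - indices k \<and> mdeg \<alpha> = N. ?f \<alpha>)"
        using \<open>finite S\<close> by (intro sum.group[symmetric]) auto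
      also have "\<dots> = (\<Sum>N\<in>{..<2}. \<Sum>\<alpha> | \<alpha> \<in> ?S \<and> mdeg \<alpha> = N. ?f \<alpha>)"
        by (intro sum.cong) auto
      also have "\<dots> = 0"
        using degree_components[OF fin 1] by (intro sum.neutral) auto
      finally have "(\<Sum>\<alpha>\<in>?S. ?f \<alpha>) = (\<Sum>\<alpha>\<in>?S \<inter> indices k. ?f \<alpha>)"
        using sum.Int_Diff[OF fin, of ?f "indices k"] by simp
      also have "?S \<inter> indices k = ?S'" by auto
      finally show ?thesis .
    qed
    have "(\<Sum>\<alpha>\<in>?S'. c \<alpha> * mono \<alpha> y) = (\<Sum>\<alpha>\<in>indices k. (if \<alpha> \<in> S then c \<alpha> else 0) * mono \<alpha> y)" for y
      by (intro sum.mono_neutral_cong_left finite_indices) auto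
    then have "PP a y $ k = y $ k + (\<Sum>\<alpha>\<in>indices k. (if \<alpha> \<in> S then c \<alpha> else 0) * mono \<alpha> y)" for y
      by (simp only: 1 2)
    then show ?thesis by (intro exI[of _ "\<lambda>\<alpha>. if \<alpha> \<in> S then c \<alpha> else 0"] allI)
  qed
  then have "\<forall>k. \<exists>d. \<forall>y. PP a y $ k = y $ k + (\<Sum>\<alpha>\<in>indices k. d \<alpha> * mono \<alpha> y)" ..
  from choice[OF this] show ?thesis unfolding psi_hat_shape_iff by blast
qed

text \<open>Words of weight below \<open>w k\<close> annihilate the \<open>k\<close>-th components
  of both maps at \<open>a\<close>, hence their difference, a combination of monomials of weight
  below \<open>w k\<close>; so \<open>coefficients_eq_0\<close> applies.\<close>

lemma psi_hat_unique:
  assumes "psi_hat_shape w P" "privileged w YY a (P \<circ> TT a)" "psi_hat_shape w Q" "privileged w YY a (Q \<circ> TT a)"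
  shows "P = Q"
proof -
  obtain c where c: "\<And>y k. P y $ k = y $ k + (\<Sum>\<alpha>\<in>indices k. c k \<alpha> * mono \<alpha> y)"
    using assms(1) unfolding psi_hat_shape_iff by blast
  obtain d where d: "\<And>y k. Q y $ k = y $ k + (\<Sum>\<alpha>\<in>indices k. d k \<alpha> * mono \<alpha> y)"
    using assms(3) unfolding psi_hat_shape_iff by blast
  have word: "frame_word YY I (tcoord a k) a + (\<Sum>\<alpha>\<in>indices k. c \<alpha> * frame_word YY I (tmono a \<alpha>) a) = 0"
    if "privileged w YY a (P \<circ> TT a)" "\<And>y k. P y $ k = y $ k + (\<Sum>\<alpha>\<in>indices k. c' k \<alpha> * mono \<alpha> y)"
      "c' k = c" "word_weight w I < w k" for P I k c c'
  proof -
    have "frame_word YY I (\<lambda>x. (P \<circ> TT a) x $ k) a = 0"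
      using that(1,4) unfolding privileged_def has_order_def by blast
    then have "frame_word YY I (\<lambda>x. tcoord a k x + (\<Sum>\<alpha>\<in>indices k. c \<alpha> * tmono a \<alpha> x)) a = 0"
      by (simp add: that(2,3) tmono_def)
    moreover have "smooth_on UNIV (\<lambda>x. \<Sum>\<alpha>\<in>indices k. c \<alpha> * tmono a \<alpha> x)"
      by (intro smooth_on_sum smooth_on_mult smooth_on_const tmono_smooth open_UNIV)
    ultimately show ?thesis
      by (simp add: frame_word_add[OF tcoord_smooth] frame_word_sum[OF finite_indices tmono_smooth])
  qed
  have "c k \<alpha> - d k \<alpha> = 0" if "\<alpha> \<in> indices k" for k \<alpha>
  proof (rule coefficients_eq_0[OF finite_indices _ _ that])
    fix I assume I: "word_weight w I < w k"
    have "(\<Sum>\<alpha>\<in>indices k. c k \<alpha> * frame_word YY I (tmono a \<alpha>) a) = (\<Sum>\<alpha>\<in>indices k. d k \<alpha> * frame_word YY I (tmono a \<alpha>) a)"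
      using word[OF assms(2) c refl I] word[OF assms(4) d refl I] by simp
    then show "frame_word YY I (\<lambda>x. \<Sum>\<alpha>\<in>indices k. (c k \<alpha> - d k \<alpha>) * tmono a \<alpha> x) a = 0"
      by (subst frame_word_sum[OF finite_indices tmono_smooth]) (simp_all add: left_diff_distrib sum_subtractf)
  qed simp
  then have "c k \<alpha> * mono \<alpha> y = d k \<alpha> * mono \<alpha> y" if "\<alpha> \<in> indices k" for k \<alpha> y
    using that by simp
  then have "P y $ k = Q y $ k" for y k
    unfolding c d by (intro arg_cong[of _ _ "(+) _"] sum.cong refl)
  then show ?thesis by (simp add: fun_eq_iff vec_eq_iff)
qed

section \<open>Privileged coordinates, model fields and the epsilon map\<close>

lemma psi_map_eq: "psi_map w YY a = dyn (- a)"
proof -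
  have PP: "PP a \<circ> TT a = dyn (- a)" by (simp add: fun_eq_iff PP_TT)
  have "psi_hat w YY a = PP a"
    unfolding psi_hat_def T_map_eq
  proof (rule the_equality)
    show *: "psi_hat_shape w (PP a) \<and> privileged w YY a (PP a \<circ> TT a)"
      unfolding PP using psi_hat_shape_PP privileged_translation by blast
    show "P = PP a" if "psi_hat_shape w P \<and> privileged w YY a (P \<circ> TT a)" for P
      using psi_hat_unique that * by blast
  qed
  then show ?thesis by (simp add: psi_map_def T_map_eq PP)
qed

lemma dyn_uminus_cancel: "dyn (- a) (dyn a x) = x" "dyn a (dyn (- a) x) = x"
  using N.assoc[symmetric] by simp_all

lemma model_field_eq: "model_field w YY a j = YY j"
proof
  fix x
  have "inv (dyn (- a)) = dyn a"
    by (rule inv_equality) (simp_all add: dyn_uminus_cancel)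
  then have p: "pushforward (dyn (- a)) (YY j) = YY j"
    by (simp add: fun_eq_iff pushforward_def YY_def frechet_derivative_dyn_left dyn_uminus_cancel)
  \<comment> \<open>Homogeneity makes the expression under the limit independent of
    \<open>t\<close>.\<close>
  have "t ^ w j *\<^sub>R dilation_pullback w t (YY j) x = YY j x" if "t \<noteq> 0" for t
  proof -
    have "t ^ w j * YY j (dilation w t x) $ k = t ^ w k * YY j x $ k" for k
      using arg_cong[OF YY_dilation, of "\<lambda>v. v $ k" t j x] by (simp add: dilation_def[of w t "YY j x"])
    then have "t ^ w j * (inverse (t ^ w k) * YY j (dilation w t x) $ k) = YY j x $ k" for k
      using that by (simp add: mult.left_commute[of "t ^ w j"])
    then show ?thesis by (simp add: dilation_pullback_def vec_eq_iff)
  qed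
  then have "((\<lambda>t. t ^ w j *\<^sub>R dilation_pullback w t (YY j) x) \<longlongrightarrow> YY j x) (at 0)"
    by (intro tendsto_eventually) (auto simp: eventually_at_filter)
  from tendsto_Lim[OF _ this] show "model_field w YY a j x = YY j x"
    by (simp add: model_field_def psi_map_eq p)
qed

lemma exp_model_eq: "exp_model w YY a u = u"
  unfolding exp_model_def euclid_flow_one_def model_field_eq Om_eq_sum_YY[symmetric]
proof (rule the_equality)
  have "((\<lambda>t. t *\<^sub>R u) has_vector_derivative Om (t *\<^sub>R u) u) (at t within {0..1})" for t :: real
    unfolding Om_self by (auto intro!: derivative_eq_intros)
  then show "\<exists>\<gamma>. \<gamma> 0 = 0 \<and> \<gamma> 1 = u \<and> (\<forall>t\<in>{0..1::real}. (\<gamma> has_vector_derivative Om (\<gamma> t) u) (at t within {0..1}))"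
    by (intro exI[of _ "\<lambda>t. t *\<^sub>R u"]) simp
qed (use Om_flow_unique in blast)

lemma eps_map_eq: "eps_map w YY a = dyn (- a)"
proof -
  have "exp_model w YY a = id" by (simp add: fun_eq_iff exp_model_eq)
  then show ?thesis by (simp add: eps_map_def psi_map_eq)
qed

end

theorem proposition7p12:
  fixes mul :: "'g::{t2_space, second_countable_topology} \<Rightarrow> 'g \<Rightarrow> 'g"
    and e :: 'g
    and iv :: "'g \<Rightarrow> 'g"
    and A :: "('g, real^'n::{finite, linorder}) atlas"
    and gr :: "nat \<Rightarrow> 'g tangent set"
    and r :: nat
    and w :: "'n \<Rightarrow> nat"
    and \<xi> :: "'n \<Rightarrow> 'g tangent"
    and X :: "'n \<Rightarrow> 'g vfield"
  assumes G: "graded_nilpotent_lie_group mul e iv A gr r"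
    and w: "w = carnot_weight (carnot_filtration mul gr) e"
    and basis: "graded_basis e A gr w \<xi>"
    and X_smooth: "\<And>j. smooth_vfield A (X j)"
    and X_inv: "\<And>j. left_invariant mul (X j)"
    and X_e: "\<And>j. X j e = \<xi> j"
  shows "diffeomorphism euclid_atlas A (exp_frame A e X) \<and>
    (\<forall>a x. eps_map w (\<lambda>j. in_coords (inv (exp_frame A e X)) (X j)) a x =
       dynkin_product r (graded_bracket w (struct_const mul e \<xi>)) (- a) x)"
proof -
  interpret graded_frame mul e iv A gr r w \<xi> X
    using assms by (rule graded_frame.intro)
  show ?thesis
    using diffeomorphism_EE by (simp add: exp_frame_eq in_coords_eq eps_map_eq)
qed

end
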